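(* Let $Y: y^n=f(x)$ over $K$, $L/K$, $v\in V(\Delta)$, $\bar{X}_v$, $\bar{Y}_v$, $I_v$, $P_v$ be as described in the context, and let $\sigma\in I_v$ be an element of order prime to $p$ whose image generates the cyclic group $I_v/P_v$. Let $\psi_\sigma$ denote the induced automorphism of $\bar{Y}_v$ and of $\bar{X}_v$, let $\mu$ be the order of $\psi_\sigma$ as an automorphism of $\bar{Y}_v$ and $m$ the order of $\psi_\sigma$ as an automorphism of $\bar{X}_v$, and let $\bar{P}_v$ be the image of $P_v$ in $\mathrm{Aut}_{\mathbb{F}_L}(\bar{Y}_v)$. Put $\bar{Z}_{v,\mathbb{F}_L}:=\bar{Y}_v/I_v$ and $\bar{W}_{v,\mathbb{F}_L}:=\bar{X}_v/I_v$. (1) The chart $\lambda_v$ (chosen so that $I_v$ acts on $\bar{x}_v$ by affine linear transformations over $\mathbb{F}_L$) may be chosen such that $$\psi_\sigma(\bar{x}_v,\bar{y}_v)=(c\,\bar{x}_v,\gamma\,\bar{y}_v)$$ for suitable constants $c,\gamma\in\mathbb{F}_L^\times$. (2) With such a choice, the cover $\bar{Z}_{v,\mathbb{F}_L}\to\bar{W}_{v,\mathbb{F}_L}$ is given by a Kummer equation $$\bar{z}_v^{\,\bar{n}}=\bar{h}_v(\bar{w}_v),\qquad \bar{h}_v\in\mathbb{F}_L(\bar{w}_v),$$ where $$\bar{u}_v:=\prod_{\rho\in\bar{P}_v}\rho(\bar{x}_v),\qquad \bar{w}_v:=\bar{u}_v^{\,m},\qquad \bar{z}_v:=\bar{y}_v^{\,\mu/m}\,\bar{u}_v^{\,-s}.$$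 Moreover, $m=\mathrm{ord}(c)$, $\mu=\mathrm{lcm}(m,\mathrm{ord}(\gamma))$, $c^s=\gamma^{\mu/m}$ (which defines the integer $s$ modulo $m$; such an $s$ exists), and $\bar{n}=n/(\mu/m)$.
   Context: Setting: $K/\mathbb{Q}_p$ is finite; $Y$ is the smooth projective curve with function field $K(x,y\mid y^n=f(x))$, where $f\in K[x]$ is a nonconstant polynomial without nontrivial factors that are $n$th powers in $K[x]$, $f=c_0\prod_{\alpha\in S}(x-\alpha)^{a_\alpha}$ over its splitting field $L_0$, $\gcd(n,a_\alpha\mid\alpha\in S)=1$, $n\ge 2$ is prime to $p$ and $g(Y)\ge 2$. $L/K$ is a finite Galois extension containing $L_0$, a primitive $n$th root of unity and an $n$th root of $p$, and such that the ramification index of $L/L_0$ is divisible by $n$. $\Gamma=\mathrm{Gal}(L/K)$, $I\lhd\Gamma$ is the inertia subgroup, $\mathbb{F}_L$ the residue field, $\pi$ a prime element of $L$. Models: $X=\mathbb{P}^1_K$ with coordinate $x$; $D_L\subset X_L$ is the set of branch points of $Y_L\to X_L$ ($S$, together with $\infty$ if $n\nmid\sum a_\alpha$). $\mathcal{X}$ is the stable model of the marked curve $(X_L,D_L)$ (the minimal semistable $\mathcal{O}_L$-model in which the points of $D_L$ extend to disjoint sections in the smooth locus); its special fiber $\bar{X}$ is a tree of projective lines over $\mathbb{F}_L$ with dual tree $\Delta$ and components $\bar{X}_v$, $v\in V(\Delta)$. $\mathcal{Y}$ is the normalization of $\mathcal{X}$ in the function field of $Y_L$; it is semistable, with special fiber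 $\bar{Y}$, and $\bar{Y}_v:=\bar{Y}|_{\bar{X}_v}$. The group $\Gamma$ acts on $L(x)$ and $L(x,y)$ through coefficients, fixing $x,y$; this induces actions on $\bar{X},\bar{Y}$. $I_v\subset I$ is the stabilizer of $\bar{X}_v$ and $P_v$ its Sylow $p$-subgroup; $I_v/P_v$ is cyclic of order prime to $p$. For $\sigma\in I_v$, $\psi_\sigma$ denotes the induced $\mathbb{F}_L$-automorphism of $\bar X_v$, $\bar Y_v$ and their function rings. Coordinates: a chart $\lambda_v$ for $\bar{X}_v$ is an isomorphism $X_L\to\mathbb{P}^1_L$ extending to $\mathcal{X}\to\mathbb{P}^1_{\mathcal{O}_L}$ whose reduction maps $\bar{X}_v$ isomorphically to $\mathbb{P}^1_{\mathbb{F}_L}$ and contracts all other components; it is unique up to composition with $\mathrm{PGL}_2(\mathcal{O}_L)$. Put $x_v=\lambda_v^*(x)$ and let $\bar{x}_v$ be its image in the function field $\mathbb{F}_L(\bar{x}_v)$ of $\bar{X}_v$. There exists a chart for which every $\psi_\sigma$, $\sigma\in I_v$, acts as $\bar{x}_v\mapsto a_\sigma\bar{x}_v+b_\sigma$ with $a_\sigma,b_\sigma\in\mathbb{F}_L$. Let $\eta_v$ be the Gauss valuation on $L(x)$ with respect to $x_v$, $N_v=\eta_v(f)/\eta_v(\pi)$ (divisible by $n$), $\bar{f}_v$ the reduction of $\pi^{-N_v}f$ and $y_v=\pi^{-N_v/n}y$. The (possibly reducible) curve $\bar{Y}_v$ is given by $\bar{y}_v^{\,n}=\bar{f}_v(\bar{x}_v)$,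 with function ring $\mathbb{F}_L(\bar{x}_v)[\bar{y}_v]/(\bar{y}_v^{\,n}-\bar{f}_v)$. That a (possibly reducible) cover is given by a Kummer equation means that its ring of rational functions is obtained from the function field of the base by adjoining the indicated variable with the indicated equation. *)

theory Defs
  imports
    "HOL-Computational_Algebra.Computational_Algebra"
    "HOL-Number_Theory.Cong"
    "HOL-Algebra.Multiplicative_Group"
    "HOL-Algebra.Generated_Groups"
    "HOL-Algebra.Bij"
begin

text \<open>
  All fields that occur are subfields of one type \<open>'a\<close>, namely of the function field
  \<open>L(x,y)\<close> of \<open>Y\<^sub>L\<close>. Curves over a field are represented by their function fields, and models of
  curves in the language of Zariski and Chevalley: an integral separated scheme is identified with
  the set of its local rings, regarded as subrings of its function field.
\<close>


section \<open>Subrings and subfields of a field\<close>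

definition is_subring :: "'a::comm_ring_1 set \<Rightarrow> bool" where
  "is_subring A \<longleftrightarrow> 0 \<in> A \<and> 1 \<in> A \<and> (\<forall>a\<in>A. \<forall>b\<in>A. a - b \<in> A \<and> a * b \<in> A)"

definition is_subfield :: "'a::field set \<Rightarrow> bool" where
  "is_subfield k \<longleftrightarrow> is_subring k \<and> (\<forall>a\<in>k. inverse a \<in> k)"

definition ring_gen :: "'a::comm_ring_1 set \<Rightarrow> 'a set" where
  "ring_gen T = \<Inter>{A. is_subring A \<and> T \<subseteq> A}"

definition field_gen :: "'a::field set \<Rightarrow> 'a set" where
  "field_gen T = \<Inter>{k. is_subfield k \<and> T \<subseteq> k}"

definition poly_over :: "'a::zero set \<Rightarrow> 'a poly \<Rightarrow> bool" where
  "poly_over A P \<longleftrightarrow> set (Polynomial.coeffs P) \<subseteq> A"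

definition transcendental_over :: "'a::comm_ring_1 set \<Rightarrow> 'a \<Rightarrow> bool" where
  "transcendental_over k t \<longleftrightarrow> (\<forall>P. poly_over k P \<and> poly P t = 0 \<longrightarrow> P = 0)"

definition ideal_gen :: "'a::comm_ring_1 set \<Rightarrow> 'a set \<Rightarrow> 'a set" where
  "ideal_gen R T = {\<Sum>t\<in>T. c t * t |c. \<forall>t\<in>T. c t \<in> R}"

definition prime_ideal :: "'a::comm_ring_1 set \<Rightarrow> 'a set \<Rightarrow> bool" where
  "prime_ideal A P \<longleftrightarrow> P \<subseteq> A \<and> 0 \<in> P \<and> 1 \<notin> P \<and> (\<forall>a\<in>P. \<forall>b\<in>P. a + b \<in> P) \<and>
     (\<forall>a\<in>A. \<forall>b\<in>P. a * b \<in> P) \<and> (\<forall>a\<in>A. \<forall>b\<in>A. a * b \<in> P \<longrightarrow> a \<in> P \<or> b \<in> P)"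

definition integral_closure :: "'a::comm_ring_1 set \<Rightarrow> 'a set" where
  "integral_closure A = {b. \<exists>P. poly_over A P \<and> lead_coeff P = 1 \<and> poly P b = 0}"

text \<open>The quotient \<open>V/W\<close> of \<open>k\<close>-vector spaces has finite dimension \<open>d\<close>.\<close>

definition has_dim :: "'a::field set \<Rightarrow> 'a set \<Rightarrow> 'a set \<Rightarrow> nat \<Rightarrow> bool" where
  "has_dim k V W d \<longleftrightarrow> (\<exists>B. finite B \<and> card B = d \<and> B \<subseteq> V \<and>
     (\<forall>v\<in>V. \<exists>!c. c \<in> B \<rightarrow>\<^sub>E k \<and> v - (\<Sum>b\<in>B. c b * b) \<in> W))"

definition dim_over :: "'a::field set \<Rightarrow> 'a set \<Rightarrow> 'a set \<Rightarrow> nat" where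
  "dim_over k V W = (THE d. has_dim k V W d)"


section \<open>Valuation rings and the genus of a function field\<close>

text \<open>The non-units of \<open>R\<close>; this is the maximal ideal if \<open>R\<close> is a local ring.\<close>

definition max_ideal :: "'a::field set \<Rightarrow> 'a set" where
  "max_ideal R = {a \<in> R. a = 0 \<or> inverse a \<notin> R}"

definition valuation_ring :: "'a::field set \<Rightarrow> 'a set \<Rightarrow> bool" where
  "valuation_ring E V \<longleftrightarrow> is_subring V \<and> V \<subseteq> E \<and> (\<forall>a\<in>E. a \<in> V \<or> inverse a \<in> V)"

text \<open>Local rings of the closed points of the smooth projective curve with function field \<open>E/k\<close>.\<close>

definition places :: "'a::field set \<Rightarrow> 'a set \<Rightarrow> 'a set set" where
  "places k E = {V. valuation_ring E V \<and> k \<subseteq> V \<and> V \<noteq> E}"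

definition ord_at :: "'a::field set \<Rightarrow> 'a \<Rightarrow> int" where
  "ord_at V g = (THE e. \<exists>t u. max_ideal V = (\<lambda>a. t * a) ` V \<and> u \<in> V \<and> inverse u \<in> V \<and>
     g = u * t powi e)"

definition divisors :: "'a::field set \<Rightarrow> 'a set \<Rightarrow> ('a set \<Rightarrow> int) set" where
  "divisors k E = {D. finite {V. D V \<noteq> 0} \<and> {V. D V \<noteq> 0} \<subseteq> places k E}"

definition divisor_degree :: "'a::field set \<Rightarrow> ('a set \<Rightarrow> int) \<Rightarrow> int" where
  "divisor_degree k D = (\<Sum>V | D V \<noteq> 0. D V * int (dim_over k V (max_ideal V)))"

definition riemann_roch_space :: "'a::field set \<Rightarrow> 'a set \<Rightarrow> ('a set \<Rightarrow> int) \<Rightarrow> 'a set" where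
  "riemann_roch_space k E D = {g \<in> E. g = 0 \<or> (\<forall>V\<in>places k E. ord_at V g + D V \<ge> 0)}"

definition genus :: "'a::field set \<Rightarrow> 'a set \<Rightarrow> int" where
  "genus k E = Sup {divisor_degree k D - int (dim_over k (riemann_roch_space k E D) {0}) + 1 |D.
     D \<in> divisors k E}"


section \<open>Local fields and Galois groups\<close>

text \<open>
  Valuations are additive and real valued; their value at \<open>0\<close> (morally \<open>\<infinity>\<close>) is irrelevant.
\<close>

definition is_valuation :: "'a::field set \<Rightarrow> ('a \<Rightarrow> real) \<Rightarrow> bool" where
  "is_valuation L val \<longleftrightarrow> (\<forall>a\<in>L - {0}. \<forall>b\<in>L - {0}. val (a * b) = val a + val b \<and>
     (a + b \<noteq> 0 \<longrightarrow> val (a + b) \<ge> min (val a) (val b)))"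

definition padic_val :: "nat \<Rightarrow> rat \<Rightarrow> int" where
  "padic_val p r = (case quotient_of r of (a, b) \<Rightarrow>
     int (multiplicity (int p) a) - int (multiplicity (int p) b))"

text \<open>\<open>Q\<close> with the valuation \<open>val\<close> is a completion of the rationals at \<open>p\<close>.\<close>

definition is_Qp :: "nat \<Rightarrow> 'a::field_char_0 set \<Rightarrow> ('a \<Rightarrow> real) \<Rightarrow> bool" where
  "is_Qp p Q val \<longleftrightarrow> is_subfield Q \<and> is_valuation Q val \<and>
     (\<forall>r. r \<noteq> 0 \<longrightarrow> val (of_rat r) = of_int (padic_val p r)) \<and>
     (\<forall>a\<in>Q. \<forall>C. \<exists>r. a = of_rat r \<or> val (a - of_rat r) \<ge> C) \<and>
     (\<forall>s::nat \<Rightarrow> 'a. range s \<subseteq> Q \<and>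
        (\<forall>C. \<exists>M. \<forall>i\<ge>M. \<forall>j\<ge>M. s i = s j \<or> val (s i - s j) \<ge> C) \<longrightarrow>
        (\<exists>a\<in>Q. \<forall>C. \<exists>M. \<forall>i\<ge>M. s i = a \<or> val (s i - a) \<ge> C))"

definition val_ring :: "'a::field set \<Rightarrow> ('a \<Rightarrow> real) \<Rightarrow> 'a set" where
  "val_ring L val = {a \<in> L. a = 0 \<or> val a \<ge> 0}"

definition prime_element :: "'a::field set \<Rightarrow> ('a \<Rightarrow> real) \<Rightarrow> 'a \<Rightarrow> bool" where
  "prime_element L val t \<longleftrightarrow> t \<in> L \<and> t \<noteq> 0 \<and> val t > 0 \<and> (\<forall>a\<in>L. a \<noteq> 0 \<and> val a > 0 \<longrightarrow> val a \<ge> val t)"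

definition ramification_index :: "('a::field \<Rightarrow> real) \<Rightarrow> 'a set \<Rightarrow> 'a set \<Rightarrow> nat" where
  "ramification_index val L M =
     (THE e. \<exists>s t. prime_element L val s \<and> prime_element M val t \<and> val t = real e * val s)"

definition ring_hom_on :: "'a::comm_ring_1 set \<Rightarrow> ('a \<Rightarrow> 'b::comm_ring_1) \<Rightarrow> bool" where
  "ring_hom_on A h \<longleftrightarrow> h 1 = 1 \<and> (\<forall>a\<in>A. \<forall>b\<in>A. h (a + b) = h a + h b \<and> h (a * b) = h a * h b)"

text \<open>\<open>Gal(L/K)\<close>, as a group of permutations of \<open>L\<close> (extended by \<open>undefined\<close> outside \<open>L\<close>).\<close>

definition Gal :: "'a::field set \<Rightarrow> 'a set \<Rightarrow> ('a \<Rightarrow> 'a) set" where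
  "Gal L K = {\<sigma> \<in> Bij L. ring_hom_on L \<sigma> \<and> (\<forall>a\<in>K. \<sigma> a = a)}"

definition finite_galois :: "'a::field set \<Rightarrow> 'a set \<Rightarrow> bool" where
  "finite_galois L K \<longleftrightarrow> K \<subseteq> L \<and> (\<exists>d. has_dim K L {0} d) \<and>
     {a \<in> L. \<forall>\<sigma>\<in>Gal L K. \<sigma> a = a} = K"

definition inertia :: "'a::field set \<Rightarrow> 'a set \<Rightarrow> ('a \<Rightarrow> real) \<Rightarrow> ('a \<Rightarrow> 'a) set" where
  "inertia L K val = {\<sigma> \<in> Gal L K. \<forall>a\<in>val_ring L val. \<sigma> a - a \<in> max_ideal (val_ring L val)}"

text \<open>The action of \<open>\<sigma>\<close> on \<open>L(x,y)\<close> through coefficients, fixing \<open>x\<close> and \<open>y\<close>.\<close>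

definition coeff_act :: "'a::field set \<Rightarrow> 'a \<Rightarrow> 'a \<Rightarrow> ('a \<Rightarrow> 'a) \<Rightarrow> 'a \<Rightarrow> 'a" where
  "coeff_act L x y \<sigma> = (THE \<tau>. bij \<tau> \<and> ring_hom_on UNIV \<tau> \<and> (\<forall>a\<in>L. \<tau> a = \<sigma> a) \<and> \<tau> x = x \<and> \<tau> y = y)"


section \<open>Models of curves over a valuation ring\<close>

text \<open>
  Here \<open>\<O>\<close> is a complete discrete valuation ring with field of fractions \<open>L\<close> and perfect residue
  field, \<open>\<pi>\<close> a prime element and \<open>E/L\<close> the function field of a smooth projective curve.
\<close>

definition dominates :: "'a::field set \<Rightarrow> 'a set \<Rightarrow> bool" where
  "dominates S R \<longleftrightarrow> R \<subseteq> S \<and> max_ideal R \<subseteq> max_ideal S"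

definition spec_model :: "'a::field set \<Rightarrow> 'a set set" where
  "spec_model A = {{a / b |a b. a \<in> A \<and> b \<in> A - P} |P. prime_ideal A P}"

text \<open>
  A finite union of spectra of finitely generated \<open>\<O>\<close>-algebras with field of fractions \<open>E\<close>, such
  that each valuation ring of \<open>E\<close> containing \<open>\<O>\<close> has exactly one centre (valuative criterion of
  properness), and whose generic fibre is the smooth projective curve with function field \<open>E/L\<close>.
  Being integral and dominant over \<open>\<O>\<close>, it is flat.
\<close>

definition is_model :: "'a::field set \<Rightarrow> 'a set \<Rightarrow> 'a set \<Rightarrow> 'a set set \<Rightarrow> bool" where
  "is_model \<O> L E M \<longleftrightarrow>
     (\<exists>\<A>. finite \<A> \<and> M = (\<Union>A\<in>\<A>. spec_model A) \<and>
        (\<forall>A\<in>\<A>. field_gen A = E \<and> (\<exists>T. finite T \<and> A = ring_gen (\<O> \<union> T)))) \<and>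
     (\<forall>V. valuation_ring E V \<and> \<O> \<subseteq> V \<longrightarrow> (\<exists>!R. R \<in> M \<and> dominates V R)) \<and>
     {R \<in> M. L \<subseteq> R} = insert E (places L E)"

definition special_points :: "'a::field set \<Rightarrow> 'a set set \<Rightarrow> 'a set set" where
  "special_points L M = {R \<in> M. \<not> L \<subseteq> R}"

text \<open>
  An irreducible component of the special fibre is represented by its generic point, that is, by
  the local ring of the model there. (\<open>R \<subseteq> R'\<close> means that \<open>R\<close> is a specialization of \<open>R'\<close>.)
\<close>

definition components :: "'a::field set \<Rightarrow> 'a set set \<Rightarrow> 'a set set" where
  "components L M = {R \<in> special_points L M. \<forall>R'\<in>special_points L M. R \<subseteq> R' \<longrightarrow> R' = R}"

text \<open>\<open>R/\<pi>R\<close> is a regular local ring of dimension at most one: a domain whose maximal ideal is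
  principal.\<close>

definition smooth_at :: "'a::field \<Rightarrow> 'a set \<Rightarrow> bool" where
  "smooth_at \<pi> R \<longleftrightarrow> prime_ideal R (ideal_gen R {\<pi>}) \<and> (\<exists>t. max_ideal R = ideal_gen R {\<pi>, t})"

text \<open>
  Ordinary double point of the special fibre, possibly non-split: \<open>R/\<pi>R\<close> is reduced and not
  regular, its maximal ideal is generated by two elements \<open>u, v\<close>, and its tangent cone is given by a
  binary quadratic form with two distinct zeros over an algebraic closure. Since a nondegenerate
  form has a nonzero value, the coefficient of \<open>u\<^sup>2\<close> can be taken to be \<open>1\<close>; the discriminant
  criterion is then also valid in residue characteristic \<open>2\<close>.
\<close>

definition node_at :: "'a::field \<Rightarrow> 'a set \<Rightarrow> bool" where
  "node_at \<pi> R \<longleftrightarrow>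
     (\<forall>a\<in>R. \<forall>k. a ^ k \<in> ideal_gen R {\<pi>} \<longrightarrow> a \<in> ideal_gen R {\<pi>}) \<and>
     \<not> (\<exists>t. max_ideal R = ideal_gen R {\<pi>, t}) \<and>
     (\<exists>u v. \<exists>a\<in>R. \<exists>b\<in>R. max_ideal R = ideal_gen R {\<pi>, u, v} \<and>
        u^2 + a * u * v + b * v^2 \<in> ideal_gen R {\<pi>, u^3, u^2 * v, u * v^2, v^3} \<and>
        a^2 - 4 * b \<notin> max_ideal R)"

definition semistable :: "'a::field set \<Rightarrow> 'a \<Rightarrow> 'a set set \<Rightarrow> bool" where
  "semistable L \<pi> M \<longleftrightarrow> (\<forall>R\<in>special_points L M. smooth_at \<pi> R \<or> node_at \<pi> R)"

text \<open>
  The closure of a rational point \<open>d\<close> of the generic fibre is a section of the model; it meets the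
  special fibre in the special point \<open>R\<close> of which \<open>d\<close> is a generization, \<open>R \<subseteq> d\<close>.
\<close>

definition marked_semistable_model ::
  "'a::field set \<Rightarrow> 'a set \<Rightarrow> 'a \<Rightarrow> 'a set \<Rightarrow> 'a set set \<Rightarrow> 'a set set \<Rightarrow> bool" where
  "marked_semistable_model \<O> L \<pi> E D M \<longleftrightarrow> is_model \<O> L E M \<and> semistable L \<pi> M \<and>
     (\<forall>d\<in>D. \<forall>R\<in>special_points L M. R \<subseteq> d \<longrightarrow> smooth_at \<pi> R) \<and>
     (\<forall>d\<in>D. \<forall>d'\<in>D. d \<noteq> d' \<longrightarrow> \<not> (\<exists>R\<in>special_points L M. R \<subseteq> d \<and> R \<subseteq> d'))"

text \<open>There is a morphism from \<open>M'\<close> to \<open>M\<close> that is the identity on function fields.\<close>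

definition model_dominates :: "'a::field set set \<Rightarrow> 'a set set \<Rightarrow> bool" where
  "model_dominates M' M \<longleftrightarrow> (\<forall>R'\<in>M'. \<exists>R\<in>M. dominates R' R)"

definition stable_marked_model ::
  "'a::field set \<Rightarrow> 'a set \<Rightarrow> 'a \<Rightarrow> 'a set \<Rightarrow> 'a set set \<Rightarrow> 'a set set \<Rightarrow> bool" where
  "stable_marked_model \<O> L \<pi> E D M \<longleftrightarrow> marked_semistable_model \<O> L \<pi> E D M \<and>
     (\<forall>M'. marked_semistable_model \<O> L \<pi> E D M' \<longrightarrow> model_dominates M' M)"


section \<open>The projective line, its marked points and charts\<close>

definition finite_point :: "'a::field set \<Rightarrow> 'a \<Rightarrow> 'a \<Rightarrow> 'a set" where
  "finite_point L x \<alpha> = {poly P x / poly Q x |P Q. poly_over L P \<and> poly_over L Q \<and> poly Q \<alpha> \<noteq> 0}"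

definition infinite_point :: "'a::field set \<Rightarrow> 'a \<Rightarrow> 'a set" where
  "infinite_point L x = {poly P x / poly Q x |P Q. poly_over L P \<and> poly_over L Q \<and> Q \<noteq> 0 \<and>
     degree P \<le> degree Q}"

text \<open>Branch points of \<open>y\<^sup>n = f(x)\<close> over \<open>L\<close>, where \<open>f\<close> splits over \<open>L\<close> and has no zeros of order
  divisible by \<open>n\<close>.\<close>

definition branch_points :: "'a::field set \<Rightarrow> 'a \<Rightarrow> nat \<Rightarrow> 'a poly \<Rightarrow> 'a set set" where
  "branch_points L x n f = finite_point L x ` {\<alpha>. poly f \<alpha> = 0} \<union>
     (if n dvd (\<Sum>\<alpha> | poly f \<alpha> = 0. Polynomial.order \<alpha> f) then {} else {infinite_point L x})"

definition P1_model :: "'a::field set \<Rightarrow> 'a \<Rightarrow> 'a set set" where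
  "P1_model \<O> t = spec_model (ring_gen (insert t \<O>)) \<union> spec_model (ring_gen (insert (inverse t) \<O>))"

text \<open>
  A chart is represented by the coordinate \<open>t\<close>, the pullback of the standard coordinate. The map from
  the component \<open>v\<close> to the special fibre of the target is an isomorphism as soon as it is birational,
  because its target is a normal curve; this means that \<open>v\<close> itself is the local ring of \<open>P1_model \<O> t\<close>
  at the generic point of the special fibre. The other components are contracted, that is, their
  generic points are mapped to closed points.
\<close>

definition is_chart :: "'a::field set \<Rightarrow> 'a set \<Rightarrow> 'a \<Rightarrow> 'a set set \<Rightarrow> 'a set \<Rightarrow> 'a \<Rightarrow> bool" where
  "is_chart \<O> L x M v t \<longleftrightarrow>
     (\<exists>a\<in>L. \<exists>b\<in>L. \<exists>c\<in>L. \<exists>d\<in>L. a * d - b * c \<noteq> 0 \<and> t = (a * x + b) / (c * x + d)) \<and>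
     model_dominates M (P1_model \<O> t) \<and> v \<in> components L (P1_model \<O> t) \<and>
     (\<forall>w\<in>components L M. w \<noteq> v \<longrightarrow> \<not> (\<exists>R\<in>components L (P1_model \<O> t). dominates w R))"

text \<open>The Gauss valuation on \<open>L(t)\<close> with respect to \<open>t\<close>.\<close>

definition gauss_val :: "'a::field set \<Rightarrow> ('a \<Rightarrow> real) \<Rightarrow> 'a \<Rightarrow> 'a \<Rightarrow> real" where
  "gauss_val L val t g = (THE r. \<exists>P Q. poly_over L P \<and> poly_over L Q \<and> P \<noteq> 0 \<and> Q \<noteq> 0 \<and>
     g = poly P t / poly Q t \<and>
     r = Min (val ` (set (Polynomial.coeffs P) - {0})) - Min (val ` (set (Polynomial.coeffs Q) - {0})))"


section \<open>Reductions, induced actions and Kummer equations\<close>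

text \<open>\<open>red\<close> exhibits the ring \<open>'e\<close> as the quotient \<open>B/J\<close>.\<close>

definition quotient_map :: "'a::comm_ring_1 set \<Rightarrow> 'a set \<Rightarrow> ('a \<Rightarrow> 'e::comm_ring_1) \<Rightarrow> bool" where
  "quotient_map B J red \<longleftrightarrow> ring_hom_on B red \<and> red ` B = UNIV \<and> (\<forall>b\<in>B. red b = 0 \<longleftrightarrow> b \<in> J)"

definition induced :: "'a set \<Rightarrow> ('a \<Rightarrow> 'e) \<Rightarrow> ('a \<Rightarrow> 'a) \<Rightarrow> 'e \<Rightarrow> 'e" where
  "induced B red \<tau> = (THE \<psi>. \<forall>b\<in>B. \<psi> (red b) = red (\<tau> b))"

text \<open>Order of an automorphism of the ring \<open>A\<close>.\<close>

definition aut_order :: "'e set \<Rightarrow> ('e \<Rightarrow> 'e) \<Rightarrow> nat" where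
  "aut_order A \<psi> = group.ord (BijGroup A) (restrict \<psi> A)"

definition mult_order :: "'e::comm_ring_1 \<Rightarrow> nat" where
  "mult_order c = (LEAST k. 0 < k \<and> c ^ k = 1)"

text \<open>Integral powers of units of a commutative ring.\<close>

definition unit_power :: "'e::comm_ring_1 \<Rightarrow> int \<Rightarrow> 'e" where
  "unit_power a k = (if k \<ge> 0 then a ^ nat k else (THE b. a * b = 1) ^ nat (- k))"

text \<open>\<open>k(w)\<close> inside a ring in which the nonzero elements of \<open>k[w]\<close> are units.\<close>

definition rational_functions :: "'e::comm_ring_1 set \<Rightarrow> 'e \<Rightarrow> 'e set" where
  "rational_functions k w = {g. \<exists>P Q. poly_over k P \<and> poly_over k Q \<and> poly Q w dvd 1 \<and>
     g * poly Q w = poly P w}"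

text \<open>\<open>R\<close> is obtained from \<open>F\<close> by adjoining \<open>z\<close> with the equation \<open>z\<^sup>n = h\<close>: evaluation at \<open>z\<close> induces
  an isomorphism of \<open>F[T]/(T\<^sup>n - h)\<close> with \<open>R\<close>.\<close>

definition kummer_extension :: "'e::comm_ring_1 set \<Rightarrow> 'e set \<Rightarrow> 'e \<Rightarrow> nat \<Rightarrow> 'e \<Rightarrow> bool" where
  "kummer_extension F R z n h \<longleftrightarrow> h \<in> F \<and> R = {poly G z |G. poly_over F G} \<and>
     (\<forall>G. poly_over F G \<longrightarrow> (poly G z = 0 \<longleftrightarrow>
        (\<exists>H. poly_over F H \<and> G = (Polynomial.monom 1 n - [:h:]) * H)))"

end

theory Submission
  imports Defs
begin

text \<open>
  Why the theorem is true. A chart \<open>t\<close> for the component \<open>v\<close> identifies the local ring \<open>v\<close> with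
  the Gauss extension of \<open>\<O>\<close> to \<open>L(t)\<close>, a discrete valuation ring with uniformizer \<open>\<pi>\<close>
  (\<open>component_P1_model\<close>). If \<open>N\<close> is the Gauss valuation of \<open>f\<close>, then \<open>Y = \<pi>\<^sup>-\<^sup>N\<^sup>/\<^sup>n y\<close> satisfies
  an equation \<open>Y\<^sup>n = unit of v\<close>. As \<open>n\<close> is a unit, the Kummer extension obtained by adjoining \<open>Y\<close>
  is unramified, and the integral closure of \<open>v\<close> is \<open>v[Y]\<close> (\<open>integral_closure_eq\<close>). Its reduction
  modulo \<open>\<pi>\<close> is therefore \<open>k(x)[y]/(y\<^sup>n - h)\<close>, where \<open>k\<close> is the residue field, \<open>k(x)\<close> the function
  field of the component, \<open>h \<in> k(x)\<close>, and \<open>x\<close> and \<open>y\<close> denote the reductions of \<open>t\<close> and \<open>Y\<close>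
  (\<open>kummer_cover_red\<close>).

  The action on coefficients. Inertia acts trivially on \<open>k\<close>, so it acts by \<open>k\<close>-automorphisms, and
  it multiplies \<open>y\<close> by constants, because it fixes the generator of the function field of the
  curve from which \<open>Y\<close> is obtained and multiplies \<open>\<pi>\<close> by units. The coordinate of \<open>X\<close> is fixed as
  well; hence a chart that is affine linear in it, which exists by the Iwasawa decomposition
  (\<open>affine_chart_exists\<close>), is transformed by affine linear substitutions. After a translation to a
  fixed point the generator \<open>\<sigma>\<close> acts on \<open>x\<close> by multiplication: if it acted by a nontrivial
  translation, its order would be divisible by \<open>p\<close>.

  The quotient. The group is \<open>P\<langle>\<sigma>\<rangle>\<close>, with \<open>\<sigma>\<close> normalizing \<open>P\<close> (\<open>cyclic_coset_structure\<close>). Since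
  \<open>k\<close> contains no nontrivial roots of unity of \<open>p\<close>-power order, \<open>P\<close> fixes \<open>y\<close> and acts on \<open>x\<close> by
  translations \<open>x \<mapsto> x + b\<close> by the elements of a finite group \<open>B\<close>, and \<open>c B = B\<close> if \<open>\<sigma>(x) = c x\<close>.
  The product \<open>u\<close> of the translates of \<open>x\<close> satisfies \<open>\<sigma>(u) = c\<^sup>|\<^sup>B\<^sup>| u = c u\<close>, so that \<open>w = u\<^sup>m\<close>
  is invariant, and the invariants of \<open>k(x)\<close> are \<open>k(w)\<close> (\<open>W_eq\<close>). Let \<open>\<sigma>(y) = \<gamma> y\<close>. An eigenvalue
  of \<open>\<sigma>\<close> on \<open>k(x)\<close> is a power of \<open>c\<close>, and \<open>\<gamma>\<^sup>i\<close> is a power of \<open>c\<close> if and only if \<open>\<mu>/m\<close> divides \<open>i\<close>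
  (\<open>semi_invariant_dvd\<close>). Applied to \<open>h = y\<^sup>n\<close> this gives that \<open>\<mu>/m\<close> divides \<open>n\<close>. Applied to the
  coefficients of an invariant polynomial in \<open>y\<close>, it shows that such a polynomial involves only
  powers of \<open>y\<^sup>\<mu>\<^sup>/\<^sup>m\<close>. As \<open>c\<^sup>s = \<gamma>\<^sup>\<mu>\<^sup>/\<^sup>m\<close>, the element \<open>z = y\<^sup>\<mu>\<^sup>/\<^sup>m u\<^sup>-\<^sup>s\<close> is invariant, and hence
  generates the ring of invariants over \<open>k(w)\<close> with an equation of degree \<open>n/(\<mu>/m)\<close>
  (\<open>kummer_quotient\<close>).
\<close>

section \<open>Polynomials over subrings and ring homomorphisms\<close>

(* The algebra library has constants of the same names; below they are those of univariate polynomials. *)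
hide_const (open) UnivPoly.coeff UnivPoly.monom Module.smult Coset.order

lemma subring_0: "is_subring A \<Longrightarrow> 0 \<in> A"
  and subring_1: "is_subring A \<Longrightarrow> 1 \<in> A"
  and subring_diff: "is_subring A \<Longrightarrow> a \<in> A \<Longrightarrow> b \<in> A \<Longrightarrow> a - b \<in> A"
  and subring_mult: "is_subring A \<Longrightarrow> a \<in> A \<Longrightarrow> b \<in> A \<Longrightarrow> a * b \<in> A"
  by (auto simp: is_subring_def)

lemma subring_uminus: "is_subring A \<Longrightarrow> a \<in> A \<Longrightarrow> - a \<in> A"
  using subring_diff[of A 0 a] by (simp add: subring_0)

lemma subring_add: "is_subring A \<Longrightarrow> a \<in> A \<Longrightarrow> b \<in> A \<Longrightarrow> a + b \<in> A"
  using subring_diff[of A a "- b"] by (simp add: subring_uminus)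

lemma subring_sum: "is_subring A \<Longrightarrow> (\<And>i. i \<in> I \<Longrightarrow> g i \<in> A) \<Longrightarrow> sum g I \<in> A"
  by (induction I rule: infinite_finite_induct) (auto intro: subring_0 subring_add)

lemma subring_prod: "is_subring A \<Longrightarrow> (\<And>i. i \<in> I \<Longrightarrow> g i \<in> A) \<Longrightarrow> prod g I \<in> A"
  by (induction I rule: infinite_finite_induct) (auto intro: subring_1 subring_mult)

lemma subring_power: "is_subring A \<Longrightarrow> a \<in> A \<Longrightarrow> a ^ k \<in> A"
  by (induction k) (auto intro: subring_1 subring_mult)

lemma subring_of_nat: "is_subring A \<Longrightarrow> of_nat k \<in> A"
  by (induction k) (auto intro: subring_0 subring_1 subring_add)

lemmas subring_closed = subring_0 subring_1 subring_diff subring_mult subring_uminus subring_add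
  subring_sum subring_prod subring_power subring_of_nat

lemma poly_over_iff: "0 \<in> A \<Longrightarrow> poly_over A P \<longleftrightarrow> (\<forall>i. coeff P i \<in> A)"
  unfolding poly_over_def using range_coeff[of P] by (metis UNIV_I image_subset_iff insert_subset)

lemma poly_over_coeff: "is_subring A \<Longrightarrow> poly_over A P \<Longrightarrow> coeff P i \<in> A"
  by (simp add: poly_over_iff subring_0)

lemma poly_over_mono: "poly_over A P \<Longrightarrow> A \<subseteq> B \<Longrightarrow> poly_over B P"
  by (auto simp: poly_over_def)

context
  fixes A :: "'a::comm_ring_1 set"
  assumes A: "is_subring A"
begin

lemma poly_over_0: "poly_over A 0"
  by (simp add: poly_over_def)

lemma poly_over_pCons: "a \<in> A \<Longrightarrow> poly_over A P \<Longrightarrow> poly_over A (pCons a P)"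
  using A by (auto simp: poly_over_iff subring_0 coeff_pCons split: nat.splits)

lemma poly_over_const: "a \<in> A \<Longrightarrow> poly_over A [:a:]"
  by (simp add: poly_over_pCons poly_over_0)

lemma poly_over_1: "poly_over A 1"
  using poly_over_const[of 1] A by (simp add: one_pCons subring_1)

lemma poly_over_linear: "a \<in> A \<Longrightarrow> b \<in> A \<Longrightarrow> poly_over A [:a, b:]"
  by (simp add: poly_over_pCons poly_over_0)

lemma poly_over_add: "poly_over A P \<Longrightarrow> poly_over A Q \<Longrightarrow> poly_over A (P + Q)"
  using A by (auto simp: poly_over_iff subring_closed)

lemma poly_over_diff: "poly_over A P \<Longrightarrow> poly_over A Q \<Longrightarrow> poly_over A (P - Q)"
  using A by (auto simp: poly_over_iff subring_closed)

lemma poly_over_uminus: "poly_over A P \<Longrightarrow> poly_over A (- P)"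
  using A by (auto simp: poly_over_iff subring_closed)

lemma poly_over_smult: "a \<in> A \<Longrightarrow> poly_over A P \<Longrightarrow> poly_over A (smult a P)"
  using A by (auto simp: poly_over_iff subring_closed)

lemma poly_over_mult: "poly_over A P \<Longrightarrow> poly_over A Q \<Longrightarrow> poly_over A (P * Q)"
  using A by (auto simp: poly_over_iff subring_closed coeff_mult)

lemma poly_over_monom: "a \<in> A \<Longrightarrow> poly_over A (monom a k)"
  using A by (auto simp: poly_over_iff subring_closed)

lemma poly_over_sum: "(\<And>i. i \<in> I \<Longrightarrow> poly_over A (g i)) \<Longrightarrow> poly_over A (sum g I)"
  by (induction I rule: infinite_finite_induct) (auto intro: poly_over_0 poly_over_add)

lemma poly_over_prod: "(\<And>i. i \<in> I \<Longrightarrow> poly_over A (g i)) \<Longrightarrow> poly_over A (prod g I)"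
  by (induction I rule: infinite_finite_induct) (auto intro: poly_over_1 poly_over_mult)

lemma poly_over_power: "poly_over A P \<Longrightarrow> poly_over A (P ^ k)"
  by (induction k) (auto intro: poly_over_1 poly_over_mult)

lemma poly_over_induct [consumes 1, case_names zero pCons]:
  assumes "poly_over A P" and "Pr 0"
    and "\<And>a P. a \<in> A \<Longrightarrow> poly_over A P \<Longrightarrow> Pr P \<Longrightarrow> Pr (pCons a P)"
  shows "Pr P"
  using assms(1)
proof (induction P)
  case (pCons a P)
  then have *: "\<forall>i. coeff (pCons a P) i \<in> A"
    using poly_over_iff[of A] A by (simp add: subring_0)
  have "a \<in> A" using *[rule_format, of 0] by simp
  moreover have "poly_over A P"
    using *[rule_format, of "Suc _"] poly_over_iff[of A] A by (simp add: subring_0)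
  ultimately show ?case using assms(3) pCons by blast
qed (rule assms(2))

lemma poly_over_pcompose: "poly_over A P \<Longrightarrow> poly_over A Q \<Longrightarrow> poly_over A (pcompose P Q)"
  by (induction P rule: poly_over_induct)
     (auto simp: pcompose_pCons intro: poly_over_0 poly_over_add poly_over_mult poly_over_const)

lemma poly_in_subring: "poly_over A P \<Longrightarrow> a \<in> A \<Longrightarrow> poly P a \<in> A"
  by (induction P rule: poly_over_induct) (auto intro: subring_closed A)

lemmas poly_over_closed = poly_over_0 poly_over_pCons poly_over_const poly_over_1 poly_over_linear
  poly_over_add poly_over_diff poly_over_uminus poly_over_smult poly_over_mult poly_over_monom
  poly_over_sum poly_over_prod poly_over_power poly_over_pcompose

lemma monic_division:
  assumes "poly_over A P" "poly_over A D" "lead_coeff D = 1" "degree D > 0"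
  shows "\<exists>H R. poly_over A H \<and> poly_over A R \<and> P = D * H + R \<and> degree R < degree D"
  using assms(1)
proof (induction "degree P" arbitrary: P rule: less_induct)
  case less
  show ?case
  proof (cases "degree P < degree D")
    case True
    then show ?thesis using less.prems poly_over_0 by (intro exI[of _ 0] exI[of _ P]) auto
  next
    case False
    define M where "M = monom (lead_coeff P) (degree P - degree D)"
    define P1 where "P1 = P - D * M"
    have M: "poly_over A M"
      unfolding M_def using less.prems A by (auto intro!: poly_over_monom poly_over_coeff)
    have P1: "poly_over A P1" unfolding P1_def by (intro poly_over_diff poly_over_mult less.prems assms M)
    have "degree M \<le> degree P - degree D" by (simp add: M_def degree_monom_le)
    then have le: "degree (D * M) \<le> degree P"
      using degree_mult_le[of D M] False by linarith
    have "coeff (D * M) (degree P) = lead_coeff P"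
      using assms(3) False by (simp add: M_def mult.commute[of D] coeff_monom_mult)
    then have "coeff P1 (degree P) = 0" by (simp add: P1_def)
    moreover have "degree P1 \<le> degree P" unfolding P1_def using le by (simp add: degree_diff_le)
    moreover have "degree P > 0" using False assms(4) by linarith
    ultimately have "degree P1 < degree P" 
      by (metis degree_0 le_neq_implies_less leading_coeff_0_iff)
    from less.hyps[OF this P1] obtain H R where HR: "poly_over A H" "poly_over A R" "P1 = D * H + R"
      "degree R < degree D" by blast
    have "P = D * (H + M) + R" using HR(3) by (simp add: P1_def algebra_simps)
    then show ?thesis using HR M by (blast intro: poly_over_add)
  qed
qed

end

lemma ring_hom_on_add: "ring_hom_on A h \<Longrightarrow> a \<in> A \<Longrightarrow> b \<in> A \<Longrightarrow> h (a + b) = h a + h b"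
  and ring_hom_on_mult: "ring_hom_on A h \<Longrightarrow> a \<in> A \<Longrightarrow> b \<in> A \<Longrightarrow> h (a * b) = h a * h b"
  and ring_hom_on_1: "ring_hom_on A h \<Longrightarrow> h 1 = 1"
  by (auto simp: ring_hom_on_def)

lemma ring_hom_on_cong: "(\<And>a. a \<in> A \<Longrightarrow> h a = h' a) \<Longrightarrow> is_subring A \<Longrightarrow> ring_hom_on A h \<Longrightarrow> ring_hom_on A h'"
  by (simp add: ring_hom_on_def) (metis subring_1 subring_add subring_mult)

context
  fixes A :: "'a::comm_ring_1 set" and h :: "'a \<Rightarrow> 'b::comm_ring_1"
  assumes A: "is_subring A" and h: "ring_hom_on A h"
begin

lemma ring_hom_on_0: "h 0 = 0"
  using ring_hom_on_add[OF h, of 0 0] A by (simp add: subring_0)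

lemma ring_hom_on_uminus: "a \<in> A \<Longrightarrow> h (- a) = - h a"
  using ring_hom_on_add[OF h, of a "- a"] A
  by (simp add: subring_uminus ring_hom_on_0 eq_neg_iff_add_eq_0 add.commute)

lemma ring_hom_on_diff: "a \<in> A \<Longrightarrow> b \<in> A \<Longrightarrow> h (a - b) = h a - h b"
  using ring_hom_on_add[OF h, of a "- b"] A by (simp add: subring_uminus ring_hom_on_uminus)

lemma ring_hom_on_sum: "(\<And>i. i \<in> I \<Longrightarrow> g i \<in> A) \<Longrightarrow> h (sum g I) = (\<Sum>i\<in>I. h (g i))"
  using A by (induction I rule: infinite_finite_induct)
    (auto simp: ring_hom_on_0 ring_hom_on_add[OF h] subring_closed)

lemma ring_hom_on_power: "a \<in> A \<Longrightarrow> h (a ^ k) = h a ^ k"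
  using A by (induction k) (auto simp: ring_hom_on_1[OF h] ring_hom_on_mult[OF h] subring_closed)

lemma ring_hom_on_of_nat: "h (of_nat k) = of_nat k"
  using A by (induction k) (auto simp: ring_hom_on_0 ring_hom_on_1[OF h] ring_hom_on_add[OF h] subring_closed)

lemma coeff_map_hom: "coeff (map_poly h P) i = h (coeff P i)"
  by (simp add: coeff_map_poly ring_hom_on_0)

lemma map_hom_mult: "poly_over A P \<Longrightarrow> poly_over A Q \<Longrightarrow> map_poly h (P * Q) = map_poly h P * map_poly h Q"
  by (rule poly_eqI)
    (auto simp: coeff_map_hom coeff_mult ring_hom_on_sum ring_hom_on_mult[OF h] poly_over_coeff[OF A] subring_mult[OF A]
      intro!: sum.cong)

lemma map_hom_add: "poly_over A P \<Longrightarrow> poly_over A Q \<Longrightarrow> map_poly h (P + Q) = map_poly h P + map_poly h Q"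
  by (rule poly_eqI) (auto simp: coeff_map_hom ring_hom_on_add[OF h] poly_over_coeff[OF A])

lemma map_hom_diff: "poly_over A P \<Longrightarrow> poly_over A Q \<Longrightarrow> map_poly h (P - Q) = map_poly h P - map_poly h Q"
  by (rule poly_eqI) (auto simp: coeff_map_hom ring_hom_on_diff poly_over_coeff[OF A])

lemma map_hom_pCons: "map_poly h (pCons a P) = pCons (h a) (map_poly h P)"
  by (rule poly_eqI) (simp add: coeff_map_hom coeff_pCons split: nat.splits)

lemma poly_map_hom: "poly_over A P \<Longrightarrow> a \<in> A \<Longrightarrow> poly (map_poly h P) (h a) = h (poly P a)"
  by (induction P rule: poly_over_induct[OF A, consumes 1, case_names zero pCons])
    (auto simp: map_hom_pCons ring_hom_on_0 ring_hom_on_add[OF h] ring_hom_on_mult[OF h]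
      poly_in_subring[OF A] subring_mult[OF A])

end

lemma ring_hom_on_poly_fixed:
  assumes "is_subring B" "ring_hom_on B h" "is_subring A" "A \<subseteq> B" "\<And>a. a \<in> A \<Longrightarrow> h a = a" "poly_over A P" "b \<in> B"
  shows "h (poly P b) = poly P (h b)"
proof -
  have "map_poly h P = P"
    by (rule poly_eqI) (simp add: coeff_map_hom[OF assms(1,2)] assms(5) poly_over_coeff[OF assms(3,6)])
  then show ?thesis
    using poly_map_hom[OF assms(1,2) poly_over_mono[OF assms(6,4)] assms(7)] by simp
qed

section \<open>Units and orders\<close>

lemma unit_power_diff:
  assumes "a * b = 1"
  shows "unit_power a (int i - int j) = a ^ i * b ^ j"
proof -
  have the: "(THE b. a * b = 1) = b"
    using assms by (intro the_equality) (auto, metis mult.assoc mult.commute mult_1)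
  have eq: "a ^ l * b ^ l = 1" for l
    using assms by (simp flip: power_mult_distrib)
  show ?thesis
  proof (cases "i \<ge> j")
    case True
    then obtain l where "i = j + l" using le_Suc_ex by blast
    moreover have "a ^ (j + l) * b ^ j = (a ^ j * b ^ j) * a ^ l" by (simp add: power_add mult_ac)
    ultimately show ?thesis using eq[of j] by (simp add: unit_power_def)
  next
    case False
    then obtain l where "j = i + l" "l > 0" using less_imp_add_positive[of i j] by auto
    then show ?thesis using eq[of i] by (simp add: unit_power_def power_add the flip: mult.assoc)
  qed
qed

lemma unit_power_add:
  assumes "a dvd 1"
  shows "unit_power a (k + l) = unit_power a k * unit_power a l"
proof -
  obtain b where b: "a * b = 1" using assms by (metis dvdE)
  obtain i j where k: "k = int i - int j" by (rule int_diff_cases)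
  obtain i' j' where l: "l = int i' - int j'" by (rule int_diff_cases)
  have "k + l = int (i + i') - int (j + j')" by (simp add: k l)
  then show ?thesis unfolding k l by (simp only: unit_power_diff[OF b]) (simp add: power_add mult_ac)
qed

lemma unit_power_int: "unit_power a (int i) = a ^ i"
  by (simp add: unit_power_def)

lemma unit_power_0: "unit_power a 0 = 1"
  using unit_power_int[of a 0] by simp

lemma unit_power_mult_distrib:
  assumes "a dvd 1" "b dvd 1"
  shows "unit_power (a * b) k = unit_power a k * unit_power b k"
proof -
  obtain a' b' where *: "a * a' = 1" "b * b' = 1" using assms by (metis dvdE)
  then have **: "(a * b) * (a' * b') = 1" by (metis mult.assoc mult.commute mult_1)
  obtain i j where k: "k = int i - int j" by (rule int_diff_cases)
  show ?thesis unfolding k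
    by (simp only: unit_power_diff[OF *(1)] unit_power_diff[OF *(2)] unit_power_diff[OF **])
       (simp add: power_mult_distrib mult_ac)
qed

lemma unit_power_mult:
  assumes "a dvd 1"
  shows "unit_power a (k * int l) = unit_power a k ^ l"
proof -
  obtain b where b: "a * b = 1" using assms by (metis dvdE)
  obtain i j where k: "k = int i - int j" by (rule int_diff_cases)
  have "k * int l = int (i * l) - int (j * l)" by (simp add: k algebra_simps)
  then show ?thesis unfolding k
    by (simp only: unit_power_diff[OF b]) (simp add: power_mult power_mult_distrib)
qed

lemma unit_power_minus:
  assumes "a dvd 1"
  shows "unit_power a k * unit_power a (- k) = 1"
  using unit_power_add[OF assms, of k "- k"] by (simp add: unit_power_0)

lemma unit_power_hom:
  assumes "ring_hom_on UNIV h" "a dvd 1"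
  shows "h (unit_power a k) = unit_power (h a) k"
proof -
  have U: "is_subring (UNIV :: 'a set)" by (simp add: is_subring_def)
  obtain b where b: "a * b = 1" using assms by (metis dvdE)
  then have hb: "h a * h b = 1"
    using assms(1) by (metis UNIV_I ring_hom_on_1 ring_hom_on_mult)
  obtain i j where k: "k = int i - int j" by (rule int_diff_cases)
  show ?thesis unfolding k unit_power_diff[OF b] unit_power_diff[OF hb]
    by (simp add: ring_hom_on_mult[OF assms(1)] ring_hom_on_power[OF U assms(1)])
qed

lemma mult_order_dvd:
  assumes "c ^ r = 1" "r > 0"
  shows "mult_order c > 0" "c ^ k = 1 \<longleftrightarrow> mult_order c dvd k"
proof -
  have *: "0 < mult_order c \<and> c ^ mult_order c = 1"
    unfolding mult_order_def using assms LeastI[of "\<lambda>k. 0 < k \<and> c ^ k = 1" r] by simp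
  then show "mult_order c > 0" ..
  show "c ^ k = 1 \<longleftrightarrow> mult_order c dvd k"
  proof
    assume "mult_order c dvd k"
    then show "c ^ k = 1" using * by (auto simp: dvd_def power_mult)
  next
    assume k: "c ^ k = 1"
    have "c ^ k = (c ^ mult_order c) ^ (k div mult_order c) * c ^ (k mod mult_order c)"
      by (simp flip: power_mult power_add)
    with k * have "c ^ (k mod mult_order c) = 1" by simp
    moreover have "k mod mult_order c < mult_order c" using * by simp
    ultimately have "k mod mult_order c = 0"
      using not_less_Least[of "k mod mult_order c" "\<lambda>k. 0 < k \<and> c ^ k = 1"]
      unfolding mult_order_def[symmetric] by auto
    then show "mult_order c dvd k" by auto
  qed
qed

lemma unit_power_eq_1_iff:
  assumes "c ^ r = 1" "r > 0"
  shows "unit_power c k = 1 \<longleftrightarrow> int (mult_order c) dvd k"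
proof -
  have "c dvd 1" using assms by (metis dvd_power)
  note minus = unit_power_minus[OF this]
  show ?thesis
  proof (cases "k \<ge> 0")
    case True
    then obtain i where "k = int i" using nonneg_int_cases by blast
    then show ?thesis using mult_order_dvd[OF assms] by (simp add: unit_power_int)
  next
    case False
    then obtain i where i: "- k = int i" using nonneg_int_cases[of "- k"] by auto
    have "unit_power c k = 1 \<longleftrightarrow> unit_power c (- k) = 1"
      using minus[of k] by (metis mult.right_neutral mult_1)
    then show ?thesis using mult_order_dvd[OF assms] by (simp add: i unit_power_int) (metis dvd_minus_iff i int_dvd_int_iff)
  qed
qed

lemma aut_order_dvd:
  assumes "bij_betw S A A"
  shows "aut_order A S dvd k \<longleftrightarrow> (\<forall>a\<in>A. (S ^^ k) a = a)"
proof -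
  have pow_in: "(S ^^ k) a \<in> A" if "a \<in> A" for a k
    using that assms by (induction k) (auto simp: bij_betw_def)
  have S: "restrict S A \<in> Bij A" using assms by (simp add: Bij_def)
  have bij: "bij_betw (S ^^ k) A A" for k
  proof (induction k)
    case (Suc k)
    then show ?case using bij_betw_trans[OF Suc assms] by (simp add: comp_def)
  qed (auto simp: bij_betw_def)
  have Sk: "restrict (S ^^ k) A \<in> Bij A" for k using bij by (simp add: Bij_def)
  have pow: "restrict S A [^]\<^bsub>BijGroup A\<^esub> k = restrict (S ^^ k) A" for k :: nat
  proof (induction k)
    case 0
    then show ?case by (auto simp: BijGroup_def nat_pow_def)
  next
    case (Suc k)
    have "restrict S A [^]\<^bsub>BijGroup A\<^esub> Suc k = restrict S A [^]\<^bsub>BijGroup A\<^esub> k \<otimes>\<^bsub>BijGroup A\<^esub> restrict S A"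
      by (simp add: nat_pow_def)
    also have "\<dots> = compose A (restrict (S ^^ k) A) (restrict S A)"
      unfolding Suc using S Sk[of k] by (simp add: BijGroup_def del: funpow.simps)
    also have "\<dots> = restrict (S ^^ Suc k) A"
    proof
      fix a
      have "(S ^^ k) (S a) = (S ^^ Suc k) a" by (simp only: funpow_Suc_right comp_apply)
      moreover have "S a \<in> A" if "a \<in> A" using assms that by (auto simp: bij_betw_def)
      ultimately show "compose A (restrict (S ^^ k) A) (restrict S A) a = restrict (S ^^ Suc k) A a"
        by (cases "a \<in> A") (simp_all add: compose_def del: funpow.simps)
    qed
    finally show ?case .
  qed
  have "aut_order A S dvd k \<longleftrightarrow> restrict S A [^]\<^bsub>BijGroup A\<^esub> k = \<one>\<^bsub>BijGroup A\<^esub>"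
    unfolding aut_order_def using group.pow_eq_id[OF group_BijGroup, of "restrict S A" A k] S
    by (simp add: BijGroup_def)
  also have "\<dots> \<longleftrightarrow> (\<forall>a\<in>A. (S ^^ k) a = a)"
    unfolding pow by (auto simp: BijGroup_def fun_eq_iff restrict_def)
  finally show ?thesis .
qed

section \<open>Polynomials over fields that are embedded in a ring\<close>

text \<open>
  A ring of functions on a reducible curve has zero divisors; fields occur only as subrings of it,
  and an inverse of an element of such a subring has to be found in the subring itself.
\<close>

definition embedded_field :: "'e::comm_ring_1 set \<Rightarrow> bool" where
  "embedded_field A \<longleftrightarrow> is_subring A \<and> (\<forall>a\<in>A. a \<noteq> 0 \<longrightarrow> (\<exists>b\<in>A. a * b = 1))"

lemma embedded_field_subring: "embedded_field A \<Longrightarrow> is_subring A"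
  by (simp add: embedded_field_def)

lemma embedded_field_unit: "embedded_field A \<Longrightarrow> a \<in> A \<Longrightarrow> a \<noteq> 0 \<Longrightarrow> a dvd 1"
  unfolding embedded_field_def by (metis dvdI)

lemma unit_mult_eq_0:
  fixes a :: "'e::comm_ring_1"
  assumes "a dvd 1" "a * b = 0 \<or> b * a = 0"
  shows "b = 0"
proof -
  obtain a' where "a * a' = 1" using assms(1) by (metis dvdE)
  then have "b = a' * (a * b)" by (metis mult.assoc mult.commute mult_1)
  then show ?thesis using assms(2) by (auto simp: mult.commute)
qed

lemma embedded_field_mult_eq_0:
  "embedded_field A \<Longrightarrow> a \<in> A \<Longrightarrow> a * b = 0 \<Longrightarrow> a = 0 \<or> b = 0"
  using unit_mult_eq_0 embedded_field_unit by blast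

lemma embedded_field_power_neq_0: "embedded_field A \<Longrightarrow> a \<in> A \<Longrightarrow> a \<noteq> 0 \<Longrightarrow> a ^ k \<noteq> 0"
  by (induction k) (auto dest: embedded_field_mult_eq_0)

lemma embedded_field_unit_power:
  assumes "embedded_field A" "a \<in> A" "a \<noteq> 0"
  shows "unit_power a k \<in> A"
proof -
  obtain b where b: "b \<in> A" "a * b = 1" using assms by (auto simp: embedded_field_def)
  obtain i j where k: "k = int i - int j" by (rule int_diff_cases)
  show ?thesis unfolding k unit_power_diff[OF b(2)]
    using assms b by (simp add: embedded_field_def subring_closed)
qed

lemma degree_mult_monic:
  fixes D H :: "'e::comm_ring_1 poly"
  assumes "lead_coeff D = 1" "H \<noteq> 0"
  shows "degree (D * H) = degree D + degree H"
proof -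
  have "coeff (D * H) (degree D + degree H) = lead_coeff H"
    using assms by (simp add: coeff_mult_degree_sum)
  then show ?thesis using assms by (intro antisym degree_mult_le le_degree) auto
qed

lemma lead_coeff_mult_monic:
  fixes D H :: "'e::comm_ring_1 poly"
  assumes "lead_coeff D = 1"
  shows "lead_coeff (D * H) = lead_coeff H"
  using assms by (cases "H = 0") (auto simp: degree_mult_monic coeff_mult_degree_sum)

lemma monic_division_unique:
  fixes D H :: "'e::comm_ring_1 poly"
  assumes "lead_coeff D = 1" "D * H + R = D * H' + R'" "degree R < degree D" "degree R' < degree D"
  shows "H = H' \<and> R = R'"
proof -
  have eq: "D * (H - H') = R' - R" using assms(2) by (simp add: algebra_simps)
  have "degree (R' - R) < degree D" using assms(3,4) by (rule degree_diff_less[rotated])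
  then have "H - H' = 0"
    using degree_mult_monic[OF assms(1), of "H - H'"] unfolding eq by fastforce
  then show ?thesis using eq by simp
qed

text \<open>
  The expansion \<open>P(D) = a\<^sub>0 + D (a\<^sub>1 + D (\<dots>))\<close> is the base-\<open>D\<close> expansion with constant digits, so
  uniqueness of division by \<open>D\<close> kills the digits one after the other.
\<close>

lemma pcompose_monic_eq_0:
  fixes D P :: "'e::comm_ring_1 poly"
  assumes "lead_coeff D = 1" "degree D > 0" "pcompose P D = 0"
  shows "P = 0"
  using assms(3)
proof (induction P)
  case (pCons a P)
  have "D * pcompose P D + [:a:] = D * 0 + 0"
    using pCons.prems by (simp add: pcompose_pCons add.commute)
  then have "pcompose P D = 0 \<and> [:a:] = 0"
    using assms by (intro monic_division_unique) auto
  then show ?case using pCons by simp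
qed simp

lemma prod_linear_monic:
  fixes g :: "'i \<Rightarrow> 'e::comm_ring_1"
  assumes "finite I"
  shows "lead_coeff (\<Prod>i\<in>I. [:g i, 1:]) = 1 \<and> degree (\<Prod>i\<in>I. [:g i, 1:]) = card I"
  using assms
proof (induction I)
  case (insert j I)
  define M where "M = (\<Prod>i\<in>I. [:g i, 1:])"
  have M: "lead_coeff M = 1" "degree M = card I" using insert.IH by (auto simp: M_def)
  then have "M \<noteq> 0" by auto
  moreover have "(\<Prod>i\<in>insert j I. [:g i, 1:]) = [:g j, 1:] * M"
    unfolding M_def by (rule prod.insert[OF insert.hyps])
  ultimately show ?case
    using degree_mult_monic[of "[:g j, 1:]" M] lead_coeff_mult_monic[of "[:g j, 1:]" M] M insert.hyps
    by (simp del: mult_pCons_left)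
qed simp

lemma poly_over_synthetic_div:
  assumes "is_subring A" "poly_over A P" "c \<in> A"
  shows "poly_over A (synthetic_div P c)"
  using assms(2)
  by (induction P rule: poly_over_induct[OF assms(1), consumes 1])
    (auto intro!: poly_over_0 poly_over_pCons poly_in_subring assms)

text \<open>
  The roots have to lie in the field \<open>F\<close>: in a ring with zero divisors a polynomial may have more
  roots than its degree.
\<close>

lemma card_roots_le_degree:
  assumes F: "embedded_field F" and "poly_over F P" "P \<noteq> 0" "finite B" "B \<subseteq> F" "\<And>b. b \<in> B \<Longrightarrow> poly P b = 0"
  shows "card B \<le> degree P"
  using assms(2-)
proof (induction "degree P" arbitrary: P B rule: less_induct)
  case less
  note sub = embedded_field_subring[OF F]
  show ?case
  proof (cases "B = {}")
    case False
    then obtain b where b: "b \<in> B" by auto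
    define Q where "Q = synthetic_div P b"
    have P: "P = [:- b, 1:] * Q"
      using synthetic_div_correct'[of b P] less.prems(5)[OF b] by (simp add: Q_def)
    have Q: "poly_over F Q" unfolding Q_def using less.prems b by (intro poly_over_synthetic_div sub) auto
    have "Q \<noteq> 0" using P less.prems by auto
    then have deg: "degree P = Suc (degree Q)"
      using degree_mult_monic[of "[:- b, 1:]" Q] P by simp
    have "poly Q b' = 0" if "b' \<in> B - {b}" for b'
    proof -
      have "(b' - b) * poly Q b' = 0" using less.prems(5)[of b'] that by (simp add: P algebra_simps)
      moreover have "b' - b \<in> F" using that less.prems b by (intro subring_diff sub) auto
      ultimately show ?thesis using embedded_field_mult_eq_0[OF F, of "b' - b"] that by auto
    qed
    then have "card (B - {b}) \<le> degree Q"
      using less.prems deg Q \<open>Q \<noteq> 0\<close> by (intro less.hyps) auto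
    then show ?thesis using deg b less.prems by (simp add: card_Diff_singleton)
  qed simp
qed

text \<open>
  Otherwise \<open>d\<close> and the powers of \<open>c\<close> would be \<open>m + 1\<close> roots of \<open>T\<^sup>m - 1\<close>, where \<open>m\<close> is the order
  of \<open>c\<close>.
\<close>

lemma root_of_unity_power:
  assumes F: "embedded_field F" "c \<in> F" "d \<in> F" and c: "c ^ r = 1" "r > 0" and d: "d ^ mult_order c = 1"
  shows "\<exists>i. d = c ^ i"
proof (rule ccontr)
  assume *: "\<not> ?thesis"
  define m where "m = mult_order c"
  have m: "m > 0" and cm: "c ^ m = 1" using mult_order_dvd[OF c] by (auto simp: m_def)
  note sub = embedded_field_subring[OF F(1)]
  have inj: "inj_on (\<lambda>i. c ^ i) {..<m}"
  proof -
    have "i = j" if "c ^ i = c ^ j" "i \<le> j" "j < m" for i j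
    proof -
      have "i + (m - i) = m" "j = (j - i) + i" using that by auto
      then have "c ^ i * c ^ (m - i) = 1" "c ^ j = c ^ (j - i) * c ^ i" by (metis cm power_add)+
      then have "c ^ (j - i) = 1" by (metis that(1) mult.assoc mult.right_neutral)
      then have "m dvd j - i" using mult_order_dvd(2)[OF c, of "j - i"] unfolding m_def by blast
      then show ?thesis using that by (auto dest: dvd_imp_le)
    qed
    then show ?thesis by (intro inj_onI) (metis lessThan_iff nle_le)
  qed
  let ?B = "insert d ((\<lambda>i. c ^ i) ` {..<m})"
  define P where "P = monom 1 m - (1 :: 'a poly)"
  have "coeff P m = 1" using m by (simp add: P_def)
  then have "P \<noteq> 0" by auto
  have "degree P \<le> m" unfolding P_def by (intro degree_diff_le degree_monom_le) simp
  have pow1: "(c ^ i) ^ m = 1" for i using cm by (metis mult.commute power_mult power_one)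
  have "card ?B \<le> degree P"
    using F d pow1 \<open>P \<noteq> 0\<close> by (intro card_roots_le_degree[OF F(1)])
      (auto simp: P_def poly_monom m_def intro!: poly_over_diff poly_over_monom poly_over_1 subring_closed sub)
  moreover have "card ?B = Suc m" using * inj by (subst card_insert_disjoint) (auto simp: card_image)
  ultimately show False using \<open>degree P \<le> m\<close> by simp
qed

text \<open>
  In characteristic \<open>p\<close> the equation \<open>a\<^sup>q = 1\<close> with a power \<open>q\<close> of \<open>p\<close> reads \<open>(a - 1)\<^sup>q = 0\<close>.
\<close>

lemma freshman_power_eq_1:
  fixes a :: "'e::comm_ring_1"
  assumes F: "embedded_field F" "a \<in> F" and p: "prime p" "of_nat p = (0 :: 'e)" and a: "a ^ (p ^ k) = 1"
  shows "a = 1"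
proof -
  have "CHAR('e) dvd p" using p(2) by (simp add: of_nat_eq_0_iff_char_dvd)
  then have char: "CHAR('e) = p" using p(1) CHAR_not_1[where ?'a = 'e] by (metis One_nat_def prime_nat_iff)
  have "((a - 1) + 1) ^ (p ^ k) = (a - 1) ^ (p ^ k) + 1 ^ (p ^ k)"
    using freshmans_dream'[of "p ^ k" k "a - 1" 1] p(1) char by simp
  then have "(a - 1) ^ (p ^ k) = 0" using a by simp
  moreover have "a - 1 \<in> F" using F by (auto intro: subring_closed embedded_field_subring)
  ultimately show ?thesis using embedded_field_power_neq_0[OF F(1), of "a - 1" "p ^ k"] by auto
qed

section \<open>Rational function fields and their invariants\<close>

text \<open>
  \<open>FX\<close> is the field of rational functions \<open>F(t)\<close>, embedded in a commutative ring. Fractions are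
  expressed by equations between polynomials, since the ring has no division.
\<close>

locale rational_line =
  fixes F FX :: "'e::comm_ring_1 set" and t :: 'e
  assumes F: "embedded_field F" and FX: "embedded_field FX" and F_FX: "F \<subseteq> FX" and t: "t \<in> FX"
    and transc: "transcendental_over F t"
    and fraction: "\<And>g. g \<in> FX \<Longrightarrow>
      \<exists>P Q. poly_over F P \<and> poly_over F Q \<and> Q \<noteq> 0 \<and> g * poly Q t = poly P t"
begin

lemmas F_ring = embedded_field_subring[OF F] and FX_ring = embedded_field_subring[OF FX]

lemma poly_eqI_transc:
  assumes "poly_over F P" "poly_over F Q" "poly P t = poly Q t"
  shows "P = Q"
proof -
  have "poly (P - Q) t = 0" using assms by simp
  moreover have "poly_over F (P - Q)" using assms F_ring by (intro poly_over_diff)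
  ultimately have "P - Q = 0" using transc by (auto simp: transcendental_over_def)
  then show ?thesis by simp
qed

lemma poly_unit: "poly_over F Q \<Longrightarrow> Q \<noteq> 0 \<Longrightarrow> poly Q t dvd 1"
  using transc poly_in_subring[OF FX_ring poly_over_mono[OF _ F_FX] t] embedded_field_unit[OF FX]
  by (auto simp: transcendental_over_def)

text \<open>
  If \<open>g = P(t)/Q(t)\<close>, then \<open>\<theta>(g) = \<delta> g\<close> says \<open>P(c t) Q(t) = \<delta> P(t) Q(c t)\<close>, and the leading
  coefficients of both sides give \<open>c\<^bsup>deg P\<^esup> = \<delta> c\<^bsup>deg Q\<^esup>\<close>.
\<close>

lemma scaling_eigenvalue:
  assumes \<theta>: "ring_hom_on UNIV \<theta>" "\<And>a. a \<in> F \<Longrightarrow> \<theta> a = a" "\<theta> t = c * t" "c \<in> F" "c \<noteq> 0"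
    and g: "g \<in> FX" "g \<noteq> 0" "\<delta> \<in> F" "\<theta> g = \<delta> * g"
  shows "\<exists>i j. c ^ i = \<delta> * c ^ j"
proof -
  have U: "is_subring (UNIV :: 'e set)" by (simp add: is_subring_def)
  obtain P Q where PQ: "poly_over F P" "poly_over F Q" "Q \<noteq> 0" "g * poly Q t = poly P t"
    using fraction[OF g(1)] by blast
  have "P \<noteq> 0" using PQ(4) g(2) unit_mult_eq_0[OF poly_unit[OF PQ(2,3)], of g] by auto
  have sc: "\<theta> (poly R t) = poly (pcompose R [:0, c:]) t" if "poly_over F R" for R
    using ring_hom_on_poly_fixed[OF U \<theta>(1) F_ring _ \<theta>(2) that]
    by (simp add: \<theta>(3) poly_pcompose mult.commute)
  define Pc Qc where "Pc = pcompose P [:0, c:]" and "Qc = pcompose Q [:0, c:]"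
  have over: "poly_over F Pc" "poly_over F Qc" unfolding Pc_def Qc_def
    using PQ \<theta>(4) F_ring by (auto intro!: poly_over_pcompose poly_over_linear subring_closed)
  have deg: "degree (pcompose R [:0, c:]) = degree R" if "R \<noteq> 0" "poly_over F R" for R
  proof (rule antisym)
    show "degree (pcompose R [:0, c:]) \<le> degree R"
      using degree_pcompose_le[of R "[:0, c:]"] \<theta>(5) by simp
    have "lead_coeff R \<noteq> 0" using that by simp
    then have "c ^ degree R * lead_coeff R \<noteq> 0"
      using embedded_field_mult_eq_0[OF F, of "c ^ degree R"] embedded_field_power_neq_0[OF F \<theta>(4,5)]
        subring_power[OF F_ring \<theta>(4)] by blast
    then show "degree R \<le> degree (pcompose R [:0, c:])"
      by (intro le_degree) (simp add: coeff_pcompose_linear)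
  qed
  have "\<delta> * g * poly Qc t = poly Pc t"
    using arg_cong[OF PQ(4), of \<theta>] ring_hom_on_mult[OF \<theta>(1)] sc[OF PQ(1)] sc[OF PQ(2)] g(4)
    by (simp add: Pc_def Qc_def)
  then have "\<delta> * (g * poly Q t) * poly Qc t = poly Pc t * poly Q t" by (metis mult.assoc mult.commute)
  then have "poly (smult \<delta> (P * Qc)) t = poly (Pc * Q) t" by (simp add: PQ(4) mult_ac)
  then have "smult \<delta> (P * Qc) = Pc * Q"
    using over PQ g(3) F_ring by (intro poly_eqI_transc) (auto intro!: poly_over_closed)
  then have "coeff (smult \<delta> (P * Qc)) (degree P + degree Qc) = coeff (Pc * Q) (degree Pc + degree Q)"
    using deg PQ \<open>P \<noteq> 0\<close> by (simp add: Pc_def Qc_def)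
  then have "\<delta> * (lead_coeff P * lead_coeff Qc) = lead_coeff Pc * lead_coeff Q"
    by (simp add: coeff_mult_degree_sum)
  moreover have "lead_coeff Pc = c ^ degree P * lead_coeff P" "lead_coeff Qc = c ^ degree Q * lead_coeff Q"
    using deg PQ \<open>P \<noteq> 0\<close> by (simp_all add: Pc_def Qc_def coeff_pcompose_linear)
  ultimately have "(lead_coeff P * lead_coeff Q) * (c ^ degree P - \<delta> * c ^ degree Q) = 0"
    by (simp add: algebra_simps)
  moreover have "lead_coeff P * lead_coeff Q \<noteq> 0"
    using embedded_field_mult_eq_0[OF F, of "lead_coeff P" "lead_coeff Q"] PQ \<open>P \<noteq> 0\<close> poly_over_coeff[OF F_ring PQ(1)]
    by auto
  moreover have "lead_coeff P * lead_coeff Q \<in> F" using PQ F_ring by (auto intro!: subring_mult poly_over_coeff)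
  ultimately have "c ^ degree P - \<delta> * c ^ degree Q = 0"
    using embedded_field_mult_eq_0[OF F] by blast
  then show ?thesis by auto
qed

text \<open>
  A fraction that is invariant under a finite group of linear substitutions has an invariant
  denominator, namely the product of the conjugates of any denominator.
\<close>

lemma invariant_fraction:
  assumes G: "finite G" "[:0, 1:] \<in> G" "\<And>l. l \<in> G \<Longrightarrow> poly_over F l"
    and bij: "\<And>l. l \<in> G \<Longrightarrow> bij_betw (\<lambda>k. pcompose k l) G G"
    and \<theta>: "\<And>l. l \<in> G \<Longrightarrow> \<exists>\<theta>. ring_hom_on UNIV \<theta> \<and> (\<forall>a\<in>F. \<theta> a = a) \<and> \<theta> t = poly l t \<and> \<theta> g = g"
    and g: "g \<in> FX"
  shows "\<exists>M N. poly_over F M \<and> poly_over F N \<and> N \<noteq> 0 \<and> g * poly N t = poly M t \<and>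
    (\<forall>l\<in>G. pcompose M l = M \<and> pcompose N l = N)"
proof -
  have U: "is_subring (UNIV :: 'e set)" by (simp add: is_subring_def)
  obtain P Q where PQ: "poly_over F P" "poly_over F Q" "Q \<noteq> 0" "g * poly Q t = poly P t"
    using fraction[OF g] by blast
  define N M where "N = (\<Prod>k\<in>G. pcompose Q k)" and "M = P * (\<Prod>k\<in>G - {[:0, 1:]}. pcompose Q k)"
  have N: "poly_over F N" and M: "poly_over F M" unfolding N_def M_def
    using PQ G F_ring by (auto intro!: poly_over_prod poly_over_mult poly_over_pcompose)
  have sub: "\<theta> (poly R t) = poly (pcompose R l) t"
    if "ring_hom_on UNIV \<theta>" "\<forall>a\<in>F. \<theta> a = a" "\<theta> t = poly l t" "poly_over F R" for \<theta> l R
    using ring_hom_on_poly_fixed[OF U that(1) F_ring _ _ that(4), of t] that(2,3) by (simp add: poly_pcompose)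
  have eq: "N = Q * (\<Prod>k\<in>G - {[:0, 1:]}. pcompose Q k)"
    unfolding N_def using prod.remove[OF G(1,2), of "pcompose Q"] by simp
  have g_eq: "g * poly N t = poly M t" using PQ(4) by (simp add: eq M_def flip: mult.assoc)
  have unit: "poly (pcompose Q l) t dvd 1" if "l \<in> G" for l
  proof -
    obtain \<theta> where *: "ring_hom_on UNIV \<theta>" "\<forall>a\<in>F. \<theta> a = a" "\<theta> t = poly l t" using \<theta>[OF \<open>l \<in> G\<close>] by blast
    obtain b where "poly Q t * b = 1" using poly_unit[OF PQ(2,3)] by (metis dvdE)
    then have "\<theta> (poly Q t) * \<theta> b = 1"
      using ring_hom_on_mult[OF *(1)] ring_hom_on_1[OF *(1)] by (metis UNIV_I)
    then show ?thesis using sub[OF * PQ(2)] by (metis dvd_triv_left)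
  qed
  have "poly N t dvd 1"
    unfolding N_def poly_prod using prod_dvd_prod[of G "\<lambda>k. poly (pcompose Q k) t" "\<lambda>_. 1"] unit by simp
  then have "N \<noteq> 0" by auto
  moreover have inv_N: "pcompose N l = N" if "l \<in> G" for l
    unfolding N_def pcompose_prod pcompose_assoc[symmetric] using prod.reindex_bij_betw[OF bij[OF that]] by blast
  moreover have "pcompose M l = M" if "l \<in> G" for l
  proof -
    obtain \<theta> where *: "ring_hom_on UNIV \<theta>" "\<forall>a\<in>F. \<theta> a = a" "\<theta> t = poly l t" and g: "\<theta> g = g"
      using \<theta>[OF \<open>l \<in> G\<close>] by blast
    have "poly (pcompose M l) t = \<theta> (g * poly N t)" using sub[OF * M] g_eq by simp
    also have "\<dots> = poly M t" using ring_hom_on_mult[OF *(1), of g "poly N t"] g sub[OF * N] inv_N[OF that] g_eq by (metis UNIV_I)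
    finally show ?thesis using M G(3)[OF that] F_ring by (intro poly_eqI_transc poly_over_pcompose)
  qed
  ultimately show ?thesis using M N g_eq by blast
qed

end

lemma prod_translates_invariant:
  fixes B :: "'e::comm_ring_1 set"
  assumes "bij_betw (\<lambda>a. a + b) B B"
  shows "pcompose (\<Prod>a\<in>B. [:a, 1:]) [:b, 1:] = (\<Prod>a\<in>B. [:a, 1:])"
proof -
  have "pcompose (\<Prod>a\<in>B. [:a, 1:]) [:b, 1:] = (\<Prod>a\<in>B. [:a + b, 1:])"
    by (simp add: pcompose_prod pcompose_pCons add.commute)
  also have "\<dots> = (\<Prod>a\<in>B. [:a, 1:])" by (rule prod.reindex_bij_betw[OF assms])
  finally show ?thesis .
qed

text \<open>
  Division by the product \<open>A\<close> of the translates of the variable leaves an invariant remainder of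
  degree less than the number of translations; such a remainder is constant, since it takes the same
  value at all translations.
\<close>

lemma translation_invariant_poly:
  fixes B :: "'e::comm_ring_1 set"
  assumes F: "embedded_field F" and B: "finite B" "B \<subseteq> F" "0 \<in> B" "\<And>b. b \<in> B \<Longrightarrow> bij_betw (\<lambda>a. a + b) B B"
    and P: "poly_over F P" "\<And>b. b \<in> B \<Longrightarrow> pcompose P [:b, 1:] = P"
  shows "\<exists>P1. poly_over F P1 \<and> P = pcompose P1 (\<Prod>b\<in>B. [:b, 1:])"
  using P
proof (induction "degree P" arbitrary: P rule: less_induct)
  case less
  note sub = embedded_field_subring[OF F]
  define A where "A = (\<Prod>b\<in>B. [:b, 1:])"
  have monic: "lead_coeff A = 1" and deg: "degree A = card B"
    using prod_linear_monic[OF B(1), of id] by (auto simp: A_def)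
  have pos: "degree A > 0" using B by (auto simp: deg card_gt_0_iff)
  have A: "poly_over F A" unfolding A_def using B sub by (intro poly_over_prod poly_over_linear subring_1) auto
  have inv_A: "pcompose A [:b, 1:] = A" if "b \<in> B" for b
    unfolding A_def by (rule prod_translates_invariant[OF B(4)[OF that]])
  obtain H R where HR: "poly_over F H" "poly_over F R" "P = A * H + R" "degree R < degree A"
    using monic_division[OF sub less.prems(1) A monic pos] by blast
  have inv: "pcompose H [:b, 1:] = H" "pcompose R [:b, 1:] = R" if "b \<in> B" for b
  proof -
    have "A * pcompose H [:b, 1:] + pcompose R [:b, 1:] = A * H + R"
      using less.prems(2)[OF that] HR(3) by (simp add: pcompose_add pcompose_mult inv_A[OF that])
    moreover have "degree (pcompose R [:b, 1:]) < degree A"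
      using degree_pcompose_le[of R "[:b, 1:]"] HR(4) by simp
    ultimately show "pcompose H [:b, 1:] = H" "pcompose R [:b, 1:] = R"
      using monic_division_unique[OF monic _ _ HR(4)] by blast+
  qed
  have "R - [:poly R 0:] = 0"
  proof (rule ccontr)
    assume nz: "R - [:poly R 0:] \<noteq> 0"
    have zeros: "poly (R - [:poly R 0:]) b = 0" if "b \<in> B" for b
    proof -
      have "poly (pcompose R [:b, 1:]) 0 = poly R 0" by (simp add: inv[OF that])
      then show ?thesis by (simp add: poly_pcompose)
    qed
    have over: "poly_over F (R - [:poly R 0:])"
      using HR sub by (intro poly_over_diff poly_over_const poly_in_subring) (auto intro: subring_0)
    have "card B \<le> degree (R - [:poly R 0:])"
      by (rule card_roots_le_degree[OF F over nz B(1,2) zeros])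
    moreover have "degree (R - [:poly R 0:]) < degree A" using HR(4) pos by (intro degree_diff_less) auto
    ultimately show False using deg by simp
  qed
  then have R: "R = [:poly R 0:]" by simp
  show ?case
  proof (cases "H = 0")
    case True
    then show ?thesis using HR R by (intro exI[of _ R]) (metis A_def mult_zero_right add_0 pcompose_const)
  next
    case False
    have "degree H < degree P"
    proof -
      have "degree P = degree (A * H)"
        using HR(3,4) degree_mult_monic[OF monic False] by (simp add: degree_add_eq_left)
      then show ?thesis using degree_mult_monic[OF monic False] pos by simp
    qed
    from less.hyps[OF this HR(1) inv(1)] obtain H1 where H1: "poly_over F H1" "H = pcompose H1 A"
      unfolding A_def by blast
    have "P = pcompose (pCons (poly R 0) H1) A"
      unfolding pcompose_pCons HR(3) using H1(2) R by (simp add: add.commute)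
    moreover have "poly_over F (pCons (poly R 0) H1)"
      using HR H1 sub by (intro poly_over_pCons poly_in_subring) (auto intro: subring_0)
    ultimately show ?thesis unfolding A_def by blast
  qed
qed

text \<open>
  The coefficients satisfy \<open>c\<^sup>i a\<^sub>i = a\<^sub>i\<close>, so only exponents divisible by the order of \<open>c\<close> occur.
\<close>

lemma scaling_invariant_poly:
  assumes F: "embedded_field F" "c \<in> F" and c: "c ^ r = 1" "r > 0"
    and P: "poly_over F P" "pcompose P [:0, c:] = P"
  shows "\<exists>P1. poly_over F P1 \<and> (\<forall>u. poly P u = poly P1 (u ^ mult_order c))"
proof -
  note sub = embedded_field_subring[OF F(1)]
  define m where "m = mult_order c"
  have m: "m > 0" using mult_order_dvd[OF c] by (simp add: m_def)
  have zero: "coeff P i = 0" if "\<not> m dvd i" for i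
  proof -
    have "c ^ i * coeff P i = coeff P i" using arg_cong[OF P(2), of "\<lambda>p. coeff p i"] by (simp add: coeff_pcompose_linear)
    then have "(c ^ i - 1) * coeff P i = 0" by (simp add: algebra_simps)
    moreover have "c ^ i \<noteq> 1" using that mult_order_dvd(2)[OF c, of i] by (simp add: m_def)
    moreover have "c ^ i - 1 \<in> F" using F sub by (intro subring_closed)
    ultimately show ?thesis using embedded_field_mult_eq_0[OF F(1)] by fastforce
  qed
  define d where "d = degree P"
  define P1 where "P1 = (\<Sum>i\<le>d. monom (coeff P (m * i)) i)"
  have "poly P u = poly P1 (u ^ m)" for u
  proof -
    have "poly P u = (\<Sum>j\<le>d. coeff P j * u ^ j)" by (simp add: poly_altdef d_def)
    also have "\<dots> = (\<Sum>j\<le>m * d. coeff P j * u ^ j)"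
      using m by (intro sum.mono_neutral_left) (auto simp: d_def coeff_eq_0 not_le intro: order_trans[of _ "degree P"])
    also have "\<dots> = (\<Sum>j\<in>(*) m ` {..d}. coeff P j * u ^ j)"
    proof (rule sum.mono_neutral_right)
      show "\<forall>j\<in>{..m * d} - (*) m ` {..d}. coeff P j * u ^ j = 0"
      proof
        fix j assume j: "j \<in> {..m * d} - (*) m ` {..d}"
        have "\<not> m dvd j"
        proof
          assume "m dvd j"
          then obtain k where "j = m * k" ..
          then show False using j m by auto
        qed
        then show "coeff P j * u ^ j = 0" by (simp add: zero)
      qed
    qed auto
    also have "\<dots> = (\<Sum>i\<le>d. coeff P (m * i) * u ^ (m * i))"
      using m by (subst sum.reindex) (auto simp: inj_on_def)
    also have "\<dots> = poly P1 (u ^ m)" by (simp add: P1_def poly_sum poly_monom power_mult)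
    finally show ?thesis .
  qed
  moreover have "poly_over F P1" unfolding P1_def
    using P sub by (intro poly_over_sum poly_over_monom poly_over_coeff)
  ultimately show ?thesis unfolding m_def by blast
qed

section \<open>Quotients of Kummer covers of the line\<close>

lemma UNIV_subring: "is_subring UNIV"
  by (simp add: is_subring_def)

lemma ring_hom_on_unit: "ring_hom_on UNIV h \<Longrightarrow> a dvd 1 \<Longrightarrow> h a dvd 1"
  unfolding dvd_def ring_hom_on_def by (metis UNIV_I)

lemma dvd_one_cancel:
  fixes a :: "'e::comm_ring_1"
  assumes "a dvd 1" "b * a = c * a"
  shows "b = c"
  using unit_mult_eq_0[OF assms(1), of "b - c"] assms(2) by (simp add: algebra_simps)

text \<open>
  The whole ring is the function ring \<open>FX[y]/(y\<^sup>n - g)\<close> of a possibly reducible cover of the line,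
  which is expressed by the basis \<open>1, y, \<dots>, y\<^sup>n\<^sup>-\<^sup>1\<close>.
\<close>

locale kummer_cover = rational_line F FX t for F FX :: "'e::comm_ring_1 set" and t :: 'e +
  fixes y :: 'e and n :: nat
  assumes n: "n > 0" and yn: "y ^ n \<in> FX" "y ^ n \<noteq> 0"
    and span: "\<And>e. \<exists>G. poly_over FX G \<and> degree G < n \<and> e = poly G y"
    and indep: "\<And>G. poly_over FX G \<Longrightarrow> degree G < n \<Longrightarrow> poly G y = 0 \<Longrightarrow> G = 0"
begin

lemma y_unit: "y dvd 1"
proof -
  have "y ^ n dvd 1" using embedded_field_unit[OF FX yn] .
  moreover have "y dvd y ^ n" using n by (intro dvd_power) auto
  ultimately show ?thesis by (rule dvd_trans[rotated])
qed

lemma indep_eq: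
  assumes "poly_over FX G" "degree G < n" "poly_over FX H" "degree H < n" "poly G y = poly H y"
  shows "G = H"
  using indep[of "G - H"] assms FX_ring by (auto simp: poly_over_diff degree_diff_less)

definition coefficient_hom :: "('e \<Rightarrow> 'e) \<Rightarrow> bool" where
  "coefficient_hom \<theta> \<longleftrightarrow> ring_hom_on UNIV \<theta> \<and> (\<forall>a\<in>F. \<theta> a = a)"

lemma hom_poly:
  assumes "coefficient_hom \<theta>" "poly_over F P"
  shows "\<theta> (poly P e) = poly P (\<theta> e)"
  using ring_hom_on_poly_fixed[OF UNIV_subring _ F_ring _ _ assms(2), of \<theta> e] assms(1)
  by (simp add: coefficient_hom_def)

text \<open>
  An endomorphism that maps \<open>t\<close> into \<open>FX\<close> maps denominators to units of the ring that lie in \<open>FX\<close>;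
  these are nonzero, and the field \<open>FX\<close> contains their inverses.
\<close>

lemma hom_FX:
  assumes \<theta>: "coefficient_hom \<theta>" "\<theta> t \<in> FX" and g: "g \<in> FX"
  shows "\<theta> g \<in> FX"
proof -
  have hom: "ring_hom_on UNIV \<theta>" using \<theta>(1) by (simp add: coefficient_hom_def)
  obtain P Q where PQ: "poly_over F P" "poly_over F Q" "Q \<noteq> 0" "g * poly Q t = poly P t"
    using fraction[OF g] by blast
  have eq: "\<theta> g * poly Q (\<theta> t) = poly P (\<theta> t)"
    using arg_cong[OF PQ(4), of \<theta>] ring_hom_on_mult[OF hom] hom_poly[OF \<theta>(1)] PQ(1,2) by simp
  have in_FX: "poly Q (\<theta> t) \<in> FX" "poly P (\<theta> t) \<in> FX"
    using PQ \<theta>(2) FX_ring F_FX by (auto intro!: poly_in_subring elim: poly_over_mono)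
  have "poly Q (\<theta> t) dvd 1"
    using ring_hom_on_unit[OF hom poly_unit[OF PQ(2,3)]] hom_poly[OF \<theta>(1) PQ(2)] by simp
  then have "poly Q (\<theta> t) \<noteq> 0" by auto
  then obtain b where b: "b \<in> FX" "poly Q (\<theta> t) * b = 1"
    using FX in_FX by (auto simp: embedded_field_def)
  have "\<theta> g = poly P (\<theta> t) * b" using eq b(2) by (metis mult.assoc mult.right_neutral)
  then show ?thesis using in_FX b FX_ring by (simp add: subring_mult)
qed

lemma hom_eqI:
  assumes \<theta>: "coefficient_hom \<theta>" and \<theta>': "coefficient_hom \<theta>'" and eq: "\<theta> t = \<theta>' t" "\<theta> y = \<theta>' y"
  shows "\<theta> = \<theta>'"
proof
  fix e
  have hom: "ring_hom_on UNIV \<theta>" "ring_hom_on UNIV \<theta>'" using \<theta> \<theta>' by (simp_all add: coefficient_hom_def)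
  have FX: "\<theta> g = \<theta>' g" if "g \<in> FX" for g
  proof -
    obtain P Q where PQ: "poly_over F P" "poly_over F Q" "Q \<noteq> 0" "g * poly Q t = poly P t"
      using fraction[OF \<open>g \<in> FX\<close>] by blast
    have "\<theta> g * poly Q (\<theta> t) = \<theta>' g * poly Q (\<theta> t)"
      using arg_cong[OF PQ(4), of \<theta>] arg_cong[OF PQ(4), of \<theta>'] ring_hom_on_mult[OF hom(1)]
        ring_hom_on_mult[OF hom(2)] hom_poly[OF \<theta>] hom_poly[OF \<theta>'] PQ(1,2) eq by simp
    moreover have "poly Q (\<theta> t) dvd 1"
      using ring_hom_on_unit[OF hom(1) poly_unit[OF PQ(2,3)]] hom_poly[OF \<theta> PQ(2)] by simp
    ultimately show ?thesis by (rule dvd_one_cancel[rotated])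
  qed
  obtain G where G: "poly_over FX G" "e = poly G y" using span by blast
  have "map_poly \<theta> G = map_poly \<theta>' G"
    by (rule poly_eqI) (simp add: coeff_map_hom[OF UNIV_subring] hom FX poly_over_coeff[OF FX_ring G(1)])
  moreover have "poly_over UNIV G" by (simp add: poly_over_def)
  ultimately show "\<theta> e = \<theta>' e"
    using poly_map_hom[OF UNIV_subring hom(1), of G y] poly_map_hom[OF UNIV_subring hom(2), of G y] G(2) eq(2)
    by (metis UNIV_I)
qed

end

text \<open>
  The wild part \<open>P\<close> is a group of \<open>p\<close>-power exponent acting on the line by affine substitutions,
  the tame part is generated by \<open>S\<close>, which acts diagonally. All of them fix the constants \<open>F\<close>.
\<close>

locale tame_wild_action = kummer_cover F FX t y n
  for F FX :: "'e::comm_ring_1 set" and t y :: 'e and n :: nat +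
  fixes P :: "('e \<Rightarrow> 'e) set" and S :: "'e \<Rightarrow> 'e" and c \<gamma> :: 'e and p q r :: nat
  assumes p: "prime p" "of_nat p = (0 :: 'e)"
    and P: "finite P" "id \<in> P" "\<And>\<rho> \<rho>'. \<rho> \<in> P \<Longrightarrow> \<rho>' \<in> P \<Longrightarrow> \<rho> \<circ> \<rho>' \<in> P"
    and P_hom: "\<And>\<rho>. \<rho> \<in> P \<Longrightarrow> coefficient_hom \<rho>"
    and P_power: "\<And>\<rho>. \<rho> \<in> P \<Longrightarrow> \<rho> ^^ (p ^ q) = id"
    and P_t: "\<And>\<rho>. \<rho> \<in> P \<Longrightarrow> \<exists>a\<in>F. \<exists>b\<in>F. \<rho> t = a * t + b"
    and P_y: "\<And>\<rho>. \<rho> \<in> P \<Longrightarrow> \<exists>\<delta>\<in>F. \<rho> y = \<delta> * y"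
    and S_hom: "coefficient_hom S" and S_power: "S ^^ r = id" "r > 0"
    and c: "c \<in> F" "c \<noteq> 0" and \<gamma>: "\<gamma> \<in> F" "\<gamma> \<noteq> 0"
    and S_t: "S t = c * t" and S_y: "S y = \<gamma> * y"
    and normal: "\<And>\<rho>. \<rho> \<in> P \<Longrightarrow> \<exists>\<rho>'\<in>P. S \<circ> \<rho> = \<rho>' \<circ> S"
begin

lemma hom:
  "\<rho> \<in> P \<Longrightarrow> ring_hom_on UNIV \<rho>" "\<rho> \<in> P \<Longrightarrow> a \<in> F \<Longrightarrow> \<rho> a = a" "ring_hom_on UNIV S" "a \<in> F \<Longrightarrow> S a = a"
  using S_hom by (auto simp: coefficient_hom_def dest: P_hom)

lemma mult_power_eigen:
  assumes "ring_hom_on UNIV \<theta>" "\<theta> a = a" "\<theta> e = a * e"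
  shows "(\<theta> ^^ i) e = a ^ i * e"
proof (induction i)
  case (Suc i)
  have "\<theta> (a ^ i) = a ^ i" using ring_hom_on_power[OF UNIV_subring assms(1), of a] assms(2) by simp
  then have "\<theta> (a ^ i * e) = a ^ i * (a * e)" using ring_hom_on_mult[OF assms(1), of "a ^ i" e] assms(3) by simp
  then show ?case using Suc by (simp add: mult_ac)
qed simp

lemma S_funpow: "(S ^^ i) t = c ^ i * t" "(S ^^ i) y = \<gamma> ^ i * y"
  by (rule mult_power_eigen[OF hom(3) hom(4)[OF c(1)] S_t], rule mult_power_eigen[OF hom(3) hom(4)[OF \<gamma>(1)] S_y])

lemma S_funpow_hom: "coefficient_hom (S ^^ i)"
proof (induction i)
  case 0
  then show ?case by (simp add: coefficient_hom_def ring_hom_on_def)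
next
  case (Suc i)
  then show ?case using S_hom by (simp add: coefficient_hom_def ring_hom_on_def)
qed

lemma mult_t_eq: "a \<in> F \<Longrightarrow> b \<in> F \<Longrightarrow> a' \<in> F \<Longrightarrow> b' \<in> F \<Longrightarrow> a * t + b = a' * t + b' \<Longrightarrow> a = a' \<and> b = b'"
  using poly_eqI_transc[of "[:b, a:]" "[:b', a':]"] F_ring by (auto simp: poly_over_linear algebra_simps)

lemma S_funpow_eq_id: "S ^^ i = id \<longleftrightarrow> c ^ i = 1 \<and> \<gamma> ^ i = 1"
proof
  assume *: "S ^^ i = id"
  have "c ^ i * t + 0 = 1 * t + 0" using S_funpow(1)[of i] * by simp
  then have "c ^ i = 1" using mult_t_eq[of "c ^ i" 0 1 0] c F_ring by (auto simp: subring_closed)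
  moreover have "\<gamma> ^ i * y = 1 * y" using S_funpow(2)[of i] * by simp
  then have "\<gamma> ^ i = 1" by (rule dvd_one_cancel[OF y_unit])
  ultimately show "c ^ i = 1 \<and> \<gamma> ^ i = 1" ..
next
  assume "c ^ i = 1 \<and> \<gamma> ^ i = 1"
  moreover have "coefficient_hom id" using S_funpow_hom[of 0] by simp
  ultimately show "S ^^ i = id" using S_funpow[of i] by (intro hom_eqI S_funpow_hom) auto
qed

lemma c_power: "c ^ r = 1" and \<gamma>_power: "\<gamma> ^ r = 1"
  using S_power(1) S_funpow_eq_id[of r] by simp_all

definition "m = mult_order c"
definition "\<mu> = lcm m (mult_order \<gamma>)"
definition "d = \<mu> div m"

lemma c_power_iff: "c ^ i = 1 \<longleftrightarrow> m dvd i"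
  unfolding m_def by (rule mult_order_dvd(2)[OF c_power S_power(2)])

lemma \<gamma>_power_iff: "\<gamma> ^ i = 1 \<longleftrightarrow> mult_order \<gamma> dvd i"
  by (rule mult_order_dvd(2)[OF \<gamma>_power S_power(2)])

lemma m_pos: "m > 0"
  unfolding m_def by (rule mult_order_dvd(1)[OF c_power S_power(2)])

lemma \<mu>_pos: "\<mu> > 0"
  unfolding \<mu>_def by (rule lcm_pos_nat[OF m_pos mult_order_dvd(1)[OF \<gamma>_power S_power(2)]])

lemma \<mu>_eq: "\<mu> = d * m"
  by (simp add: d_def \<mu>_def)

lemma d_pos: "d > 0"
  using \<mu>_eq \<mu>_pos by (cases d) simp_all

lemma c_unit: "c dvd 1"
  by (rule embedded_field_unit[OF F c])

text \<open>
  A function on the line with \<open>S(g) = \<gamma>\<^sup>\<plusminus>\<^sup>i g\<close> forces \<open>\<gamma>\<^sup>i\<close> to be a power of \<open>c\<close>. Then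
  \<open>\<gamma>\<^bsup>i m\<^esup> = 1\<close>, so \<open>i m\<close> is divisible by the orders of \<open>c\<close> and of \<open>\<gamma>\<close>, that is, by \<open>\<mu> = d m\<close>.
\<close>

lemma semi_invariant_dvd:
  assumes "g \<in> FX" "g \<noteq> 0" "S g * \<gamma> ^ i = g \<or> S g = \<gamma> ^ i * g"
  shows "d dvd i"
proof -
  have "\<exists>a b. c ^ a * \<gamma> ^ i = c ^ b"
  proof -
    have pow: "\<gamma> ^ i \<in> F" using \<gamma> F_ring by (simp add: subring_power)
    from assms(3) show ?thesis
    proof
      assume *: "S g * \<gamma> ^ i = g"
      have "\<gamma> ^ i \<noteq> 0" using embedded_field_power_neq_0[OF F \<gamma>] .
      then obtain \<delta> where \<delta>: "\<delta> \<in> F" "\<gamma> ^ i * \<delta> = 1" using pow F by (auto simp: embedded_field_def)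
      then have "S g = \<delta> * g" using * by (metis mult.assoc mult.commute mult_1)
      then obtain a b where "c ^ a = \<delta> * c ^ b"
        using scaling_eigenvalue[OF hom(3,4) S_t c assms(1,2) \<delta>(1)] by blast
      then have "c ^ a * \<gamma> ^ i = c ^ b" using \<delta> by (metis mult.assoc mult.commute mult_1)
      then show ?thesis by blast
    next
      assume "S g = \<gamma> ^ i * g"
      then obtain a b where "c ^ a = \<gamma> ^ i * c ^ b"
        using scaling_eigenvalue[OF hom(3,4) S_t c assms(1,2) pow] by blast
      then show ?thesis by (metis mult.commute)
    qed
  qed
  then obtain a b where ab: "c ^ a * \<gamma> ^ i = c ^ b" by blast
  have "(c ^ a) ^ m = 1" "(c ^ b) ^ m = 1" using c_power_iff by (simp_all flip: power_mult)
  then have "\<gamma> ^ (i * m) = 1" using arg_cong[OF ab, of "\<lambda>e. e ^ m"] by (simp add: power_mult_distrib power_mult)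
  then have "\<mu> dvd i * m" unfolding \<mu>_def using \<gamma>_power_iff by (intro lcm_least) auto
  then show ?thesis using m_pos by (simp add: \<mu>_eq)
qed

text \<open>
  The function \<open>y\<^sup>n\<close> is a semi-invariant of weight \<open>\<gamma>\<^sup>n\<close> that lies in \<open>FX\<close>.
\<close>

lemma d_dvd_n: "d dvd n"
proof (rule semi_invariant_dvd[OF yn])
  show "S (y ^ n) * \<gamma> ^ n = y ^ n \<or> S (y ^ n) = \<gamma> ^ n * y ^ n"
    using ring_hom_on_power[OF UNIV_subring hom(3)] S_y by (simp add: power_mult_distrib)
qed

text \<open>
  The order of \<open>\<gamma>\<^sup>d\<close> divides \<open>\<mu>/d = m\<close>, so \<open>\<gamma>\<^sup>d\<close> is a power of the primitive \<open>m\<close>-th root of unity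
  \<open>c\<close>.
\<close>

lemma exists_s: "\<exists>s. \<forall>s'. unit_power c s' = \<gamma> ^ d \<longleftrightarrow> [s' = s] (mod int m)"
proof -
  have "(\<gamma> ^ d) ^ m = 1" using \<gamma>_power_iff by (simp add: \<mu>_def flip: power_mult \<mu>_eq)
  then obtain i where i: "\<gamma> ^ d = c ^ i"
    using root_of_unity_power[OF F c(1) _ c_power S_power(2), of "\<gamma> ^ d"] \<gamma> F_ring
    by (auto simp: subring_power m_def)
  have "unit_power c s' = \<gamma> ^ d \<longleftrightarrow> [s' = int i] (mod int m)" for s'
  proof -
    have "unit_power c s' = unit_power c (s' - int i) * c ^ i"
      using unit_power_add[OF c_unit, of "s' - int i" "int i"] by (simp add: unit_power_int)
    then have "unit_power c s' = \<gamma> ^ d \<longleftrightarrow> unit_power c (s' - int i) * c ^ i = 1 * c ^ i" by (simp add: i)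
    also have "\<dots> \<longleftrightarrow> unit_power c (s' - int i) = 1"
      using dvd_one_cancel[of "c ^ i" "unit_power c (s' - int i)" 1] c_unit by (auto simp: is_unit_power_iff) (metis dvd_power_same power_one)
    also have "\<dots> \<longleftrightarrow> [s' = int i] (mod int m)"
      using unit_power_eq_1_iff[OF c_power S_power(2)] by (simp add: m_def cong_iff_dvd_diff)
    finally show ?thesis .
  qed
  then show ?thesis by blast
qed

lemma S_bij: "bij S"
proof -
  obtain r' where r': "r = Suc r'" using S_power(2) by (cases r) auto
  have "S \<circ> (S ^^ r') = id" "(S ^^ r') \<circ> S = id" using S_power(1) unfolding r' by (simp only: funpow.simps(2)[symmetric], simp only: funpow_Suc_right[symmetric])
  then show ?thesis by (intro o_bij)
qed

lemma S_FX: "bij_betw S FX FX"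
proof -
  have "(S ^^ i) t \<in> FX" for i
    unfolding S_funpow(1) using c F_FX t FX_ring by (intro subring_mult subring_power) auto
  then have in_FX: "(S ^^ i) g \<in> FX" if "g \<in> FX" for i g
    by (rule hom_FX[OF S_funpow_hom _ that])
  obtain r' where r': "r = Suc r'" using S_power(2) by (cases r) auto
  have "g = S ((S ^^ r') g)" for g using fun_cong[OF S_power(1), of g] unfolding r' by simp
  then have "FX \<subseteq> S ` FX" using in_FX by blast
  moreover have "S ` FX \<subseteq> FX" using in_FX[of _ 1] by auto
  ultimately show ?thesis using S_bij by (auto simp: bij_betw_def bij_def intro: inj_on_subset)
qed

lemma order_UNIV: "aut_order UNIV S = \<mu>"
proof -
  have "aut_order UNIV S dvd i \<longleftrightarrow> \<mu> dvd i" for i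
  proof -
    have "aut_order UNIV S dvd i \<longleftrightarrow> S ^^ i = id" using aut_order_dvd[OF S_bij] by (auto simp: fun_eq_iff)
    also have "\<dots> \<longleftrightarrow> \<mu> dvd i" unfolding S_funpow_eq_id c_power_iff \<gamma>_power_iff \<mu>_def by simp
    finally show ?thesis .
  qed
  then show ?thesis by (meson dvd_antisym dvd_refl)
qed

lemma order_FX: "aut_order FX S = m"
proof -
  have "aut_order FX S dvd i \<longleftrightarrow> m dvd i" for i
  proof -
    have "aut_order FX S dvd i \<longleftrightarrow> (\<forall>g\<in>FX. (S ^^ i) g = g)" using aut_order_dvd[OF S_FX] .
    also have "\<dots> \<longleftrightarrow> c ^ i = 1"
    proof
      assume "\<forall>g\<in>FX. (S ^^ i) g = g"
      then have "c ^ i * t + 0 = 1 * t + 0" using t S_funpow(1)[of i] by simp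
      then show "c ^ i = 1" using mult_t_eq[of "c ^ i" 0 1 0] c F_ring by (auto simp: subring_closed)
    next
      assume c1: "c ^ i = 1"
      show "\<forall>g\<in>FX. (S ^^ i) g = g"
      proof
        fix g assume "g \<in> FX"
        then obtain P Q where PQ: "poly_over F P" "poly_over F Q" "Q \<noteq> 0" "g * poly Q t = poly P t"
          using fraction by blast
        have "(S ^^ i) t = t" using S_funpow(1)[of i] c1 by simp
        then have fixed: "(S ^^ i) (poly R t) = poly R t" if "poly_over F R" for R
          using hom_poly[OF S_funpow_hom that, of i t] by simp
        have "ring_hom_on UNIV (S ^^ i)" using S_funpow_hom by (simp add: coefficient_hom_def)
        then have "(S ^^ i) g * (S ^^ i) (poly Q t) = (S ^^ i) (poly P t)"
          using ring_hom_on_mult[of UNIV "S ^^ i" g "poly Q t"] PQ(4) by simp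
        then have "(S ^^ i) g * poly Q t = g * poly Q t" using fixed[OF PQ(1)] fixed[OF PQ(2)] PQ(4) by simp
        then show "(S ^^ i) g = g" by (rule dvd_one_cancel[OF poly_unit[OF PQ(2,3)]])
      qed
    qed
    also have "\<dots> \<longleftrightarrow> m dvd i" by (rule c_power_iff)
    finally show ?thesis .
  qed
  then show ?thesis by (meson dvd_antisym dvd_refl)
qed

end

lemma finite_endo_bij: "finite A \<Longrightarrow> f ` A \<subseteq> A \<Longrightarrow> inj_on f A \<Longrightarrow> bij_betw f A A"
  by (simp add: bij_betw_def endo_inj_surj)

context tame_wild_action
begin

text \<open>
  The multiplier of \<open>y\<close> is a root of unity of \<open>p\<close>-power order, hence trivial in characteristic
  \<open>p\<close>. The same argument shows that the affine substitutions of \<open>P\<close> are translations.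
\<close>

lemma P_fixes_y:
  assumes "\<rho> \<in> P"
  shows "\<rho> y = y"
proof -
  obtain \<delta> where \<delta>: "\<delta> \<in> F" "\<rho> y = \<delta> * y" using P_y[OF assms] by blast
  have "\<delta> ^ (p ^ q) * y = 1 * y"
    using mult_power_eigen[OF hom(1)[OF assms] hom(2)[OF assms \<delta>(1)] \<delta>(2), of "p ^ q"] P_power[OF assms] by simp
  then have "\<delta> ^ (p ^ q) = 1" by (rule dvd_one_cancel[OF y_unit])
  then have "\<delta> = 1" by (rule freshman_power_eq_1[OF F \<delta>(1) p])
  then show ?thesis using \<delta> by simp
qed

lemma P_translates:
  assumes "\<rho> \<in> P"
  shows "\<exists>b\<in>F. \<rho> t = t + b"
proof -
  obtain a b where ab: "a \<in> F" "b \<in> F" "\<rho> t = a * t + b" using P_t[OF assms] by blast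
  note h = hom(1)[OF assms]
  have "\<exists>b'\<in>F. (\<rho> ^^ i) t = a ^ i * t + b'" for i
  proof (induction i)
    case 0
    then show ?case using F_ring by (auto intro!: bexI[of _ 0] simp: subring_0)
  next
    case (Suc i)
    then obtain b' where b': "b' \<in> F" "(\<rho> ^^ i) t = a ^ i * t + b'" by blast
    have "\<rho> (a ^ i * t + b') = a ^ i * (a * t + b) + b'"
      using ring_hom_on_add[OF h] ring_hom_on_mult[OF h] hom(2)[OF assms] ab b' subring_power[OF F_ring ab(1)] by simp
    then have "(\<rho> ^^ Suc i) t = a ^ Suc i * t + (a ^ i * b + b')" using b'(2) by (simp add: algebra_simps)
    moreover have "a ^ i * b + b' \<in> F" using ab b' F_ring by (simp add: subring_closed)
    ultimately show ?case by blast
  qed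
  then obtain b' where "b' \<in> F" "1 * t + 0 = a ^ (p ^ q) * t + b'" using P_power[OF assms] by (metis id_apply mult_1 add_0_right)
  then have "a ^ (p ^ q) = 1" using mult_t_eq[of 1 0 "a ^ (p ^ q)" b'] ab F_ring by (auto simp: subring_closed)
  then have "a = 1" by (rule freshman_power_eq_1[OF F ab(1) p])
  then show ?thesis using ab by auto
qed

text \<open>
  The group of translations by which \<open>P\<close> acts on the line.
\<close>

definition "B = (\<lambda>\<rho>. \<rho> t - t) ` P"

lemma B_iff: "b \<in> B \<longleftrightarrow> (\<exists>\<rho>\<in>P. \<rho> t = t + b)"
  unfolding B_def image_iff by (metis add_diff_cancel_left' diff_add_cancel add.commute)

lemma B_F: "B \<subseteq> F"
proof
  fix b assume "b \<in> B"
  then obtain \<rho> where \<rho>: "\<rho> \<in> P" "b = \<rho> t - t" by (auto simp: B_def)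
  then show "b \<in> F" using P_translates[OF \<rho>(1)] by auto
qed

lemma B_finite: "finite B"
  using P(1) by (simp add: B_def)

lemma B_0: "0 \<in> B"
  unfolding B_iff by (rule bexI[OF _ P(2)]) simp

lemma B_add: 
  assumes "a \<in> B" "b \<in> B"
  shows "a + b \<in> B"
proof -
  obtain \<rho> \<rho>' where *: "\<rho> \<in> P" "\<rho> t = t + a" "\<rho>' \<in> P" "\<rho>' t = t + b" using assms unfolding B_iff by blast
  have "\<rho> (t + b) = t + a + b"
    using ring_hom_on_add[OF hom(1)[OF *(1)]] hom(2)[OF *(1)] B_F assms *(2) by auto
  then have "(\<rho> \<circ> \<rho>') t = t + (a + b)" using *(4) by (simp add: add.assoc)
  then show ?thesis unfolding B_iff using P(3)[OF *(1,3)] by blast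
qed

lemma B_translate: "b \<in> B \<Longrightarrow> bij_betw (\<lambda>a. a + b) B B"
  by (rule finite_endo_bij[OF B_finite]) (auto intro: B_add inj_onI)

text \<open>
  If \<open>S \<rho> = \<rho>' S\<close>, then the translation vectors satisfy \<open>b = c b'\<close>.
\<close>

lemma B_scale: "bij_betw ((*) c) B B"
proof -
  have "B \<subseteq> (*) c ` B"
  proof
    fix b assume b: "b \<in> B"
    then obtain \<rho> where \<rho>: "\<rho> \<in> P" "\<rho> t = t + b" unfolding B_iff by blast
    obtain \<rho>' where \<rho>': "\<rho>' \<in> P" "S \<circ> \<rho> = \<rho>' \<circ> S" using normal[OF \<rho>(1)] by blast
    define b' where "b' = \<rho>' t - t"
    have "c * t + b = S (\<rho> t)" using \<rho>(2) ring_hom_on_add[OF hom(3)] S_t hom(4) B_F b by auto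
    also have "\<dots> = \<rho>' (S t)" using fun_cong[OF \<rho>'(2), of t] by simp
    also have "\<dots> = c * t + c * b'"
      using ring_hom_on_mult[OF hom(1)[OF \<rho>'(1)]] hom(2)[OF \<rho>'(1) c(1)] S_t by (simp add: b'_def algebra_simps)
    finally have "b = c * b'" by simp
    moreover have "b' \<in> B" using \<rho>' by (auto simp: B_def b'_def)
    ultimately show "b \<in> (*) c ` B" by blast
  qed
  then have "B = (*) c ` B" using card_image_le[OF B_finite] by (intro card_seteq) (auto simp: B_finite)
  moreover have "inj_on ((*) c) B"
    using dvd_one_cancel[OF c_unit] by (auto intro!: inj_onI simp: mult.commute)
  ultimately show ?thesis by (simp add: bij_betw_def)
qed

text \<open>
  Multiplication by \<open>c\<close> permutes the nonzero elements of \<open>B\<close>; compare the product of these elements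
  with that of their multiples.
\<close>

lemma c_power_card: "c ^ card B = c"
proof -
  have "(*) c ` B = B" "inj_on ((*) c) B" using B_scale by (simp_all add: bij_betw_def)
  then have "(*) c ` (B - {0}) = B - {0}"
    using inj_on_image_set_diff[of "(*) c" B B "{0}"] B_0 by simp
  then have bij: "bij_betw ((*) c) (B - {0}) (B - {0})"
    using \<open>inj_on ((*) c) B\<close> by (auto simp: bij_betw_def intro: inj_on_subset)
  have "\<Prod>(B - {0}) = (\<Prod>b\<in>B - {0}. c * b)"
    using prod.reindex_bij_betw[OF bij, of "\<lambda>b. b"] by simp
  then have "c ^ card (B - {0}) * \<Prod>(B - {0}) = 1 * \<Prod>(B - {0})" by (simp add: prod.distrib)
  moreover have "\<Prod>(B - {0}) dvd 1"
    using prod_dvd_prod[of "B - {0}" "\<lambda>b. b" "\<lambda>_. 1"] embedded_field_unit[OF F] B_F by auto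
  ultimately have "c ^ card (B - {0}) = 1" by (rule dvd_one_cancel[rotated])
  then show ?thesis using card.remove[OF B_finite B_0] by simp
qed

definition "A = (\<Prod>b\<in>B. [:b, 1:])"
definition "u = (\<Prod>\<rho>\<in>P. \<rho> t)"
definition "w = u ^ m"

lemma A_monic: "lead_coeff A = 1" "degree A > 0"
  using prod_linear_monic[OF B_finite, of "\<lambda>b. b"] B_0 B_finite by (auto simp: A_def card_gt_0_iff)

lemma A_over: "poly_over F A"
  unfolding A_def using B_F F_ring by (intro poly_over_prod poly_over_linear subring_1) auto

text \<open>
  An element of \<open>P\<close> is determined by its translation vector because it fixes \<open>y\<close>; hence the
  product over \<open>P\<close> and the product over \<open>B\<close> have the same factors, without repetition.
\<close>

lemma u_eq: "u = poly A t"
proof -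
  have "inj_on (\<lambda>\<rho>. \<rho> t - t) P"
  proof (rule inj_onI)
    fix \<rho> \<rho>' assume *: "\<rho> \<in> P" "\<rho>' \<in> P" "\<rho> t - t = \<rho>' t - t"
    then show "\<rho> = \<rho>'"
      using P_fixes_y[OF *(1)] P_fixes_y[OF *(2)] by (intro hom_eqI[OF P_hom P_hom]) simp_all
  qed
  then have "poly A t = (\<Prod>\<rho>\<in>P. poly [:\<rho> t - t, 1:] t)"
    unfolding A_def poly_prod B_def by (simp add: prod.reindex)
  then show ?thesis by (simp add: u_def)
qed

lemma A_translate: "b \<in> B \<Longrightarrow> pcompose A [:b, 1:] = A"
  unfolding A_def by (rule prod_translates_invariant[OF B_translate])

text \<open>
  The substitution permutes the factors of \<open>A\<close> up to the factor \<open>c\<^sup>|\<^sup>B\<^sup>| = c\<close>.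
\<close>

lemma A_scale: "pcompose A [:0, c:] = smult c A"
proof -
  have "pcompose A [:0, c:] = (\<Prod>b\<in>B. [:b, c:])" by (simp add: A_def pcompose_prod pcompose_pCons)
  also have "\<dots> = (\<Prod>b\<in>B. smult c [:b, 1:])"
    using prod.reindex_bij_betw[OF B_scale, of "\<lambda>b. [:b, c:]", symmetric] by (simp add: mult.commute)
  also have "\<dots> = smult (c ^ card B) A" by (simp only: A_def prod_smult prod_constant)
  finally show ?thesis by (simp add: c_power_card)
qed

lemma S_u: "S u = c * u"
proof -
  have "S u = poly A (c * t)" unfolding u_eq using hom_poly[OF S_hom A_over, of t] S_t by simp
  also have "\<dots> = poly (pcompose A [:0, c:]) t" by (simp add: poly_pcompose mult.commute)
  finally show ?thesis by (simp add: A_scale u_eq)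
qed

lemma P_fixes_u:
  assumes "\<rho> \<in> P"
  shows "\<rho> u = u"
proof -
  define b where "b = \<rho> t - t"
  have b: "b \<in> B" "\<rho> t = t + b" using assms by (auto simp: B_def b_def)
  have "\<rho> u = poly A (t + b)" unfolding u_eq using hom_poly[OF P_hom[OF assms] A_over, of t] b(2) by simp
  also have "\<dots> = poly (pcompose A [:b, 1:]) t" by (simp add: poly_pcompose add.commute)
  finally show ?thesis by (simp add: A_translate[OF b(1)] u_eq)
qed

lemma u_FX: "u \<in> FX"
  unfolding u_eq by (rule poly_in_subring[OF FX_ring poly_over_mono[OF A_over F_FX] t])

lemma u_unit: "u dvd 1"
  unfolding u_eq using A_monic by (intro poly_unit[OF A_over]) auto

lemma S_w: "S w = w"
  using S_u ring_hom_on_power[OF UNIV_subring hom(3), of u m] c_power_iff[of m] by (simp add: w_def power_mult_distrib)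

lemma P_fixes_w: "\<rho> \<in> P \<Longrightarrow> \<rho> w = w"
  using P_fixes_u[of \<rho>] ring_hom_on_power[OF UNIV_subring hom(1), of \<rho> u m] by (simp add: w_def)

text \<open>
  \<open>w\<close> is obtained from \<open>t\<close> by two monic substitutions, \<open>A\<close> and \<open>T\<^sup>m\<close>, neither of which can
  annihilate a nonzero polynomial.
\<close>

lemma transc_w: "transcendental_over F w"
  unfolding transcendental_over_def
proof (intro allI impI, elim conjE)
  fix R assume R: "poly_over F R" "poly R w = 0"
  define R' where "R' = pcompose R (monom 1 m)"
  have "poly (pcompose R' A) t = 0" using R(2) by (simp add: R'_def poly_pcompose poly_monom w_def u_eq)
  moreover have "poly_over F (pcompose R' A)" unfolding R'_def
    using R A_over F_ring by (intro poly_over_pcompose poly_over_monom subring_1)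
  ultimately have "pcompose R' A = 0" using transc by (auto simp: transcendental_over_def)
  then have "pcompose R (monom 1 m) = 0" using pcompose_monic_eq_0[OF A_monic] by (simp add: R'_def)
  then show "R = 0" using pcompose_monic_eq_0[of "monom 1 m" R] m_pos by (simp add: degree_monom_eq)
qed

text \<open>
  The function rings of the quotients of the line and of its cover by the group generated by \<open>P\<close>
  and \<open>S\<close>.
\<close>

definition "W = {g \<in> FX. (\<forall>\<rho>\<in>P. \<rho> g = g) \<and> S g = g}"
definition "Z = {e. (\<forall>\<rho>\<in>P. \<rho> e = e) \<and> S e = e}"

lemma rational_subset_W: "rational_functions F w \<subseteq> W"
proof
  fix g assume "g \<in> rational_functions F w"
  then obtain M N where MN: "poly_over F M" "poly_over F N" "poly N w dvd 1" "g * poly N w = poly M w"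
    by (auto simp: rational_functions_def)
  have w: "w \<in> FX" using u_FX FX_ring by (simp add: w_def subring_power)
  have in_FX: "poly M w \<in> FX" "poly N w \<in> FX"
    using MN F_FX by (auto intro!: poly_in_subring FX_ring w elim: poly_over_mono)
  have "poly N w \<noteq> 0" using MN(3) by auto
  then obtain b where b: "b \<in> FX" "poly N w * b = 1" using FX in_FX by (auto simp: embedded_field_def)
  have "g = poly M w * b" using MN(4) b(2) by (metis mult.assoc mult.right_neutral)
  then have "g \<in> FX" using in_FX b FX_ring by (simp add: subring_mult)
  moreover have "\<theta> g = g" if "coefficient_hom \<theta>" "\<theta> w = w" for \<theta>
  proof (rule dvd_one_cancel[OF MN(3)])
    have h: "ring_hom_on UNIV \<theta>" using that(1) by (simp add: coefficient_hom_def)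
    have "\<theta> g * poly N w = \<theta> (g * poly N w)"
      using ring_hom_on_mult[OF h, of g "poly N w"] hom_poly[OF that(1) MN(2)] that(2) by simp
    also have "\<dots> = g * poly N w" using hom_poly[OF that(1) MN(1)] that(2) MN(4) by simp
    finally show "\<theta> g * poly N w = g * poly N w" .
  qed
  ultimately show "g \<in> W" using P_hom S_hom P_fixes_w S_w by (auto simp: W_def)
qed

text \<open>
  The substitutions \<open>t \<mapsto> c\<^sup>i t + b\<close> by which the whole group acts on the line. A finite group is
  needed to take the product of the conjugates of a denominator.
\<close>

definition "G = (\<lambda>(b, i). [:b, c ^ i:]) ` (B \<times> {..<m})"

lemma G_I: "b \<in> B \<Longrightarrow> [:b, c ^ i:] \<in> G"
proof -
  assume b: "b \<in> B"
  have "c ^ i = (c ^ m) ^ (i div m) * c ^ (i mod m)" by (simp flip: power_mult power_add)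
  then have "c ^ i = c ^ (i mod m)" using c_power_iff[of m] by simp
  moreover have "(b, i mod m) \<in> B \<times> {..<m}" using b m_pos by simp
  ultimately show ?thesis unfolding G_def by (metis (no_types, lifting) case_prod_conv image_eqI)
qed

lemma B_scale_power: "b \<in> B \<Longrightarrow> c ^ i * b \<in> B"
  using B_scale by (induction i) (auto simp: bij_betw_def mult.assoc)

lemma G_bij:
  assumes "l \<in> G"
  shows "bij_betw (\<lambda>k. pcompose k l) G G"
proof (rule finite_endo_bij)
  show "finite G" by (simp add: G_def B_finite)
  obtain b' j where l: "l = [:b', c ^ j:]" "b' \<in> B" using assms by (auto simp: G_def)
  have comp: "pcompose [:b, c ^ i:] l = [:b + c ^ i * b', c ^ (i + j):]" for b i
    by (simp add: l pcompose_pCons power_add mult_ac)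
  show "(\<lambda>k. pcompose k l) ` G \<subseteq> G"
  proof
    fix k' assume "k' \<in> (\<lambda>k. pcompose k l) ` G"
    then obtain b i where "b \<in> B" "k' = pcompose [:b, c ^ i:] l" by (auto simp: G_def)
    then show "k' \<in> G" using G_I[of "b + c ^ i * b'" "i + j"] B_add B_scale_power l(2) by (simp only: comp)
  qed
  show "inj_on (\<lambda>k. pcompose k l) G"
  proof (rule inj_onI)
    fix k k' assume k: "k \<in> G" "k' \<in> G" "pcompose k l = pcompose k' l"
    obtain b i b2 i2 where eq: "k = [:b, c ^ i:]" "k' = [:b2, c ^ i2:]" using k by (auto simp: G_def)
    have e: "b + c ^ i * b' = b2 + c ^ i2 * b'" "c ^ (i + j) = c ^ (i2 + j)"
      using k(3) unfolding eq comp by auto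
    have "c ^ j dvd 1" using c_unit dvd_power_same[of c 1 j] by simp
    then have "c ^ i = c ^ i2" by (rule dvd_one_cancel) (use e(2) in \<open>simp add: power_add\<close>)
    then show "k = k'" using e(1) by (simp add: eq)
  qed
qed

text \<open>
  An invariant fraction has invariant numerator and denominator. Invariance under \<open>B\<close> makes each
  of them a polynomial in \<open>u\<close>; as \<open>S\<close> acts on \<open>u\<close> by the factor \<open>c\<close>, invariance under \<open>S\<close> makes it
  a polynomial in \<open>u\<^sup>m\<close>.
\<close>

lemma W_subset_rational: "W \<subseteq> rational_functions F w"
proof
  fix g assume g: "g \<in> W"
  have G01: "[:0, 1:] \<in> G" using G_I[OF B_0, of 0] by simp
  have G_over: "poly_over F l" if "l \<in> G" for l
    using that B_F c F_ring by (auto simp: G_def intro!: poly_over_linear subring_power)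
  have G_hom: "\<exists>\<theta>. ring_hom_on UNIV \<theta> \<and> (\<forall>a\<in>F. \<theta> a = a) \<and> \<theta> t = poly l t \<and> \<theta> g = g" if "l \<in> G" for l
  proof -
    obtain b i where l: "l = [:b, c ^ i:]" "b \<in> B" using \<open>l \<in> G\<close> by (auto simp: G_def)
    obtain \<rho> where \<rho>: "\<rho> \<in> P" "\<rho> t = t + b" using l(2) unfolding B_iff by blast
    have Si: "ring_hom_on UNIV (S ^^ i)" "\<And>a. a \<in> F \<Longrightarrow> (S ^^ i) a = a"
      using S_funpow_hom by (auto simp: coefficient_hom_def)
    have "(S ^^ i) g = g" using g by (induction i) (auto simp: W_def)
    moreover have "(S ^^ i) (t + b) = c ^ i * t + b"
      using ring_hom_on_add[OF Si(1)] S_funpow(1) Si(2) l(2) B_F by auto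
    moreover have "ring_hom_on UNIV (S ^^ i \<circ> \<rho>)"
      using Si(1) hom(1)[OF \<rho>(1)] by (simp add: ring_hom_on_def)
    ultimately show ?thesis using \<rho> g Si(2) hom(2)[OF \<rho>(1)]
      by (intro exI[of _ "S ^^ i \<circ> \<rho>"]) (auto simp: l W_def algebra_simps)
  qed
  have "finite G" by (simp add: G_def B_finite)
  moreover have "g \<in> FX" using g by (simp add: W_def)
  ultimately obtain M N where MN: "poly_over F M" "poly_over F N" "N \<noteq> 0" "g * poly N t = poly M t"
    and inv: "\<And>l. l \<in> G \<Longrightarrow> pcompose M l = M" "\<And>l. l \<in> G \<Longrightarrow> pcompose N l = N"
    using invariant_fraction[OF _ G01 G_over G_bij G_hom] by blast
  have descend: "\<exists>R2. poly_over F R2 \<and> poly R t = poly R2 w"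
    if R: "poly_over F R" "\<And>l. l \<in> G \<Longrightarrow> pcompose R l = R" for R
  proof -
    have "pcompose R [:b, 1:] = R" if "b \<in> B" for b using R(2)[OF G_I[OF that, of 0]] by simp
    then obtain R1 where R1: "poly_over F R1" "R = pcompose R1 A"
      using translation_invariant_poly[OF F B_finite B_F B_0 B_translate R(1)] unfolding A_def by blast
    have "pcompose (pcompose R1 [:0, c:]) A = pcompose R1 A"
    proof -
      have "pcompose [:0, c:] A = pcompose A [:0, c:]" by (simp add: A_scale pcompose_pCons)
      then have "pcompose (pcompose R1 [:0, c:]) A = pcompose R [:0, c:]"
        by (simp add: R1(2) flip: pcompose_assoc)
      then show ?thesis using R(2)[OF G_I[OF B_0, of 1]] R1(2) by simp
    qed
    then have "pcompose (pcompose R1 [:0, c:] - R1) A = 0" by (simp add: pcompose_diff)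
    then have "pcompose R1 [:0, c:] = R1" using pcompose_monic_eq_0[OF A_monic] by fastforce
    then obtain R2 where "poly_over F R2" "\<And>u. poly R1 u = poly R2 (u ^ m)"
      using scaling_invariant_poly[OF F c(1) c_power S_power(2) R1(1)] unfolding m_def by blast
    then show ?thesis using R1(2) by (auto simp: poly_pcompose w_def u_eq)
  qed
  obtain M2 N2 where "poly_over F M2" "poly M t = poly M2 w" "poly_over F N2" "poly N t = poly N2 w"
    using descend[OF MN(1) inv(1)] descend[OF MN(2) inv(2)] by blast
  then show "g \<in> rational_functions F w"
    using MN(4) poly_unit[OF MN(2,3)] unfolding rational_functions_def by auto
qed

lemma W_eq: "W = rational_functions F w"
  using W_subset_rational rational_subset_W by blast

lemma W_subring: "is_subring W"
  unfolding is_subring_def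
proof (intro conjI ballI)
  have hh: "\<theta> 0 = 0" "\<theta> 1 = 1" "\<theta> (a - b) = \<theta> a - \<theta> b" "\<theta> (a * b) = \<theta> a * \<theta> b"
    if "\<theta> \<in> insert S P" for \<theta> a b
    using that hom(1,3) ring_hom_on_0[OF UNIV_subring] ring_hom_on_1 ring_hom_on_diff[OF UNIV_subring] ring_hom_on_mult
    by (metis UNIV_I insertE)+
  show "0 \<in> W" "1 \<in> W" using hh(1,2) FX_ring by (auto simp: W_def subring_closed)
  fix a b assume ab: "a \<in> W" "b \<in> W"
  have "\<theta> (a - b) = a - b" "\<theta> (a * b) = a * b" if "\<theta> \<in> insert S P" for \<theta>
  proof -
    have "\<theta> a = a" "\<theta> b = b" using ab that by (auto simp: W_def)
    then show "\<theta> (a - b) = a - b" "\<theta> (a * b) = a * b" using hh(3,4)[OF that] by simp_all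
  qed
  then show "a - b \<in> W" "a * b \<in> W" using ab FX_ring by (auto simp: W_def subring_closed)
qed

text \<open>
  An invariant element has coefficients \<open>g\<^sub>i\<close> with respect to the powers of \<open>y\<close> that are fixed by
  \<open>P\<close> and satisfy \<open>S(g\<^sub>i) \<gamma>\<^sup>i = g\<^sub>i\<close>. Hence only exponents \<open>i = d j\<close> occur. Since
  \<open>y\<^bsup>d j\<^esup> = z\<^sup>j u\<^bsup>s j\<^esup>\<close>, the coefficients with respect to the powers of \<open>z\<close> are \<open>g\<^bsub>d j\<^esub> u\<^bsup>s j\<^esup>\<close>,
  and these are invariant. The only relations are the multiples of \<open>T\<^bsup>n/d\<^esup> - z\<^bsup>n/d\<^esup>\<close>, because the
  powers \<open>y\<^bsup>d j\<^esup>\<close>, \<open>j < n/d\<close>, are independent.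
\<close>

theorem kummer_quotient:
  assumes s: "unit_power c s = \<gamma> ^ d"
  defines "z \<equiv> y ^ d * unit_power u (- s)"
  shows "kummer_extension W Z z (n div d) (z ^ (n div d))"
proof -
  define n' where "n' = n div d"
  have n': "n = d * n'" using d_dvd_n by (simp add: n'_def)
  have n'_pos: "n' > 0" using n n' by (cases n') auto
  have u0: "u \<noteq> 0" using u_unit by auto
  have U_FX: "unit_power u k \<in> FX" for k using embedded_field_unit_power[OF FX u_FX u0] .
  have S_U: "S (unit_power u k) = unit_power c k * unit_power u k" for k
    using unit_power_hom[OF hom(3) u_unit] S_u unit_power_mult_distrib[OF c_unit u_unit] by simp
  have P_U: "\<rho> (unit_power u k) = unit_power u k" if "\<rho> \<in> P" for \<rho> k
    using unit_power_hom[OF hom(1)[OF that] u_unit] P_fixes_u[OF that] by simp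
  have S_yi: "S (y ^ i) = \<gamma> ^ i * y ^ i" for i
    using ring_hom_on_power[OF UNIV_subring hom(3)] S_y by (simp add: power_mult_distrib)
  have P_yi: "\<rho> (y ^ i) = y ^ i" if "\<rho> \<in> P" for \<rho> i
    using ring_hom_on_power[OF UNIV_subring hom(1)[OF that]] P_fixes_y[OF that] by simp
  have z_Z: "z \<in> Z"
  proof -
    have "S z = unit_power c s * unit_power c (- s) * z"
      using ring_hom_on_mult[OF hom(3)] by (simp add: z_def S_U S_yi s mult_ac)
    then have "S z = z" using unit_power_minus[OF c_unit] by simp
    moreover have "\<rho> z = z" if "\<rho> \<in> P" for \<rho>
      using ring_hom_on_mult[OF hom(1)[OF that]] P_U[OF that] P_yi[OF that] by (simp add: z_def)
    ultimately show ?thesis by (simp add: Z_def)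
  qed
  have zj: "z ^ j = unit_power u (- s * int j) * y ^ (d * j)" for j
    using unit_power_mult[OF u_unit, of "- s" j] power_mult[of y d j] by (simp add: z_def power_mult_distrib mult.commute)
  have inv_poly: "poly H z \<in> Z" if H: "poly_over W H" for H
  proof -
    have "\<theta> (poly H z) = poly H z" if "\<theta> \<in> insert S P" for \<theta>
    proof -
      have "ring_hom_on UNIV \<theta>" "\<theta> z = z" "\<And>a. a \<in> W \<Longrightarrow> \<theta> a = a"
        using that hom(1,3) z_Z by (auto simp: Z_def W_def)
      then show ?thesis using ring_hom_on_poly_fixed[OF UNIV_subring _ W_subring _ _ H, of \<theta> z] by simp
    qed
    then show ?thesis by (simp add: Z_def)
  qed
  have h_W: "z ^ n' \<in> W"
  proof -
    have "z ^ n' \<in> Z" using inv_poly[of "monom 1 n'"] W_subring by (simp add: poly_monom poly_over_monom subring_1)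
    moreover have "z ^ n' \<in> FX" using zj[of n'] n' U_FX yn(1) FX_ring by (simp add: subring_mult)
    ultimately show ?thesis by (simp add: Z_def W_def)
  qed
  have "e \<in> {poly H z |H. poly_over W H}" if e: "e \<in> Z" for e
  proof -
    obtain R where R: "poly_over FX R" "degree R < n" "e = poly R y" using span by blast
    have R_FX: "coeff R i \<in> FX" for i using poly_over_coeff[OF FX_ring R(1)] .
    have P_coeff: "\<rho> (coeff R i) = coeff R i" if \<rho>: "\<rho> \<in> P" for \<rho> i
    proof -
      have eq: "poly (map_poly \<rho> R) y = poly R y"
        using poly_map_hom[OF UNIV_subring hom(1)[OF \<rho>], of R y] P_fixes_y[OF \<rho>] e \<rho> R(3)
        by (simp add: Z_def poly_over_def)
      have "\<rho> t \<in> FX" using P_translates[OF \<rho>] t F_FX FX_ring by (auto intro!: subring_add)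
      then have over: "poly_over FX (map_poly \<rho> R)"
        using hom_FX[OF P_hom[OF \<rho>]] R_FX FX_ring
        by (auto simp: poly_over_iff subring_0 coeff_map_hom[OF UNIV_subring hom(1)[OF \<rho>]])
      have "degree (map_poly \<rho> R) \<le> degree R"
        using coeff_map_hom[OF UNIV_subring hom(1)[OF \<rho>]] ring_hom_on_0[OF UNIV_subring hom(1)[OF \<rho>]]
        by (intro degree_le) (simp add: coeff_eq_0)
      then have "map_poly \<rho> R = R" using R(2) by (intro indep_eq[OF over _ R(1,2) eq]) simp
      then show ?thesis using coeff_map_hom[OF UNIV_subring hom(1)[OF \<rho>], of R i] by simp
    qed
    have S_coeff: "S (coeff R i) * \<gamma> ^ i = coeff R i" for i
    proof -
      define R' where "R' = pcompose (map_poly S R) [:0, \<gamma>:]"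
      have coeff: "coeff R' i = S (coeff R i) * \<gamma> ^ i" for i
        by (simp add: R'_def coeff_pcompose_linear coeff_map_hom[OF UNIV_subring hom(3)] mult.commute)
      have "poly R' y = S (poly R y)"
        using poly_map_hom[OF UNIV_subring hom(3), of R y] S_y
        by (simp add: R'_def poly_pcompose poly_over_def mult.commute)
      then have eq: "poly R' y = poly R y" using e R(3) by (simp add: Z_def)
      have "S g \<in> FX" if "g \<in> FX" for g using S_FX that by (auto simp: bij_betw_def)
      then have over: "poly_over FX R'"
        using R_FX \<gamma> F_FX FX_ring by (auto simp: poly_over_iff subring_0 coeff intro!: subring_mult subring_power)
      have "degree R' \<le> degree R"
        using coeff ring_hom_on_0[OF UNIV_subring hom(3)] by (intro degree_le) (simp add: coeff_eq_0)
      then have "R' = R" using R(2) by (intro indep_eq[OF over _ R(1,2) eq]) simp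
      then show ?thesis using coeff by simp
    qed
    have zero: "coeff R i = 0" if "\<not> d dvd i" for i
      using semi_invariant_dvd[OF R_FX _ disjI1[OF S_coeff]] that by blast
    define H where "H = (\<Sum>j<n'. monom (coeff R (d * j) * unit_power u (s * int j)) j)"
    have "coeff R (d * j) * unit_power u (s * int j) \<in> W" for j
    proof -
      have "S (coeff R (d * j) * unit_power u (s * int j)) = S (coeff R (d * j)) * (unit_power c (s * int j) * unit_power u (s * int j))"
        using ring_hom_on_mult[OF hom(3)] S_U by simp
      also have "unit_power c (s * int j) = \<gamma> ^ (d * j)" by (simp add: unit_power_mult[OF c_unit] s power_mult)
      finally have "S (coeff R (d * j) * unit_power u (s * int j)) = coeff R (d * j) * unit_power u (s * int j)"
        using S_coeff[of "d * j"] by (metis mult.assoc)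
      moreover have "\<rho> (coeff R (d * j) * unit_power u (s * int j)) = coeff R (d * j) * unit_power u (s * int j)"
        if "\<rho> \<in> P" for \<rho>
        using ring_hom_on_mult[OF hom(1)[OF that]] P_U[OF that] P_coeff[OF that] by simp
      ultimately show ?thesis using R_FX U_FX FX_ring by (simp add: W_def subring_mult)
    qed
    then have "poly_over W H" unfolding H_def using W_subring by (intro poly_over_sum poly_over_monom)
    moreover have "poly H z = e"
    proof -
      have "poly H z = (\<Sum>j<n'. coeff R (d * j) * (unit_power u (s * int j) * unit_power u (- s * int j)) * y ^ (d * j))"
        by (simp add: H_def poly_sum poly_monom zj mult_ac)
      also have "\<dots> = (\<Sum>j<n'. coeff R (d * j) * y ^ (d * j))"
        using unit_power_minus[OF u_unit] by simp
      also have "\<dots> = (\<Sum>i\<in>(*) d ` {..<n'}. coeff R i * y ^ i)"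
        using d_pos by (subst sum.reindex) (auto simp: inj_on_def)
      also have "\<dots> = (\<Sum>i<n. coeff R i * y ^ i)"
      proof (rule sum.mono_neutral_left)
        show "(*) d ` {..<n'} \<subseteq> {..<n}" using d_pos by (auto simp: n')
        show "\<forall>i\<in>{..<n} - (*) d ` {..<n'}. coeff R i * y ^ i = 0"
        proof
          fix i assume i: "i \<in> {..<n} - (*) d ` {..<n'}"
          have "\<not> d dvd i"
          proof
            assume "d dvd i"
            then obtain j where "i = d * j" ..
            then show False using i d_pos by (auto simp: n')
          qed
          then show "coeff R i * y ^ i = 0" by (simp add: zero)
        qed
      qed simp
      also have "\<dots> = e" unfolding R(3) poly_altdef
        using R(2) by (intro sum.mono_neutral_right) (auto simp: coeff_eq_0)
      finally show ?thesis .
    qed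
    ultimately show ?thesis by blast
  qed
  then have Z_eq: "Z = {poly H z |H. poly_over W H}" using inv_poly by blast
  define D where "D = monom 1 n' - [:z ^ n':]"
  have D_coeff: "coeff D n' = 1" using n'_pos by (simp add: D_def coeff_pCons split: nat.splits)
  have D_deg: "degree D = n'"
  proof (rule antisym)
    show "degree D \<le> n'" unfolding D_def by (intro degree_diff_le degree_monom_le) simp
    show "n' \<le> degree D" by (rule le_degree) (simp add: D_coeff)
  qed
  have D_over: "poly_over W D" unfolding D_def
    using W_subring h_W by (intro poly_over_diff poly_over_monom poly_over_const subring_1)
  have D_z: "poly D z = 0" by (simp add: D_def poly_monom)
  have "poly H z = 0 \<longleftrightarrow> (\<exists>H'. poly_over W H' \<and> H = D * H')" if H: "poly_over W H" for H
  proof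
    assume Hz: "poly H z = 0"
    obtain H' R where HR: "poly_over W H'" "poly_over W R" "H = D * H' + R" "degree R < degree D"
      using monic_division[OF W_subring H D_over] D_coeff D_deg n'_pos by auto
    have Rz: "poly R z = 0" using Hz HR(3) D_z by simp
    have R_FX: "coeff R j \<in> FX" for j using poly_over_coeff[OF W_subring HR(2)] by (simp add: W_def)
    define R' where "R' = (\<Sum>j<n'. monom (coeff R j * unit_power u (- s * int j)) (d * j))"
    have R'_FX: "poly_over FX R'" unfolding R'_def
      using FX_ring R_FX U_FX by (intro poly_over_sum poly_over_monom subring_mult)
    have "degree R' < n"
    proof -
      have "degree R' \<le> n - d" unfolding R'_def
      proof (rule degree_sum_le)
        fix j assume "j \<in> {..<n'}"
        then have "d * Suc j \<le> n" unfolding n' by (intro mult_le_mono2) simp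
        then have "d * j \<le> n - d" by simp
        then show "degree (monom (coeff R j * unit_power u (- s * int j)) (d * j)) \<le> n - d"
          using degree_monom_le le_trans by blast
      qed simp
      then show ?thesis using d_pos n by linarith
    qed
    moreover have "poly R' y = poly R z"
    proof -
      have "poly R z = (\<Sum>j<n'. coeff R j * z ^ j)" unfolding poly_altdef
        using HR(4) by (intro sum.mono_neutral_left) (auto simp: coeff_eq_0 D_deg)
      then show ?thesis by (simp add: R'_def poly_sum poly_monom zj mult.assoc)
    qed
    ultimately have "R' = 0" using indep[OF R'_FX] Rz by simp
    have "coeff R j = 0" if "j < n'" for j
    proof -
      have "0 = (\<Sum>i<n'. coeff (monom (coeff R i * unit_power u (- s * int i)) (d * i)) (d * j))"
        using arg_cong[OF \<open>R' = 0\<close>, of "\<lambda>p. coeff p (d * j)"] unfolding R'_def coeff_sum by simp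
      also have "\<dots> = (\<Sum>i<n'. if i = j then coeff R i * unit_power u (- s * int i) else 0)"
        using d_pos by (intro sum.cong) auto
      also have "\<dots> = coeff R j * unit_power u (- s * int j)" using that by simp
      finally have "0 = coeff R j * unit_power u (- s * int j)" .
      moreover have "unit_power u (- s * int j) dvd 1"
        using unit_power_minus[OF u_unit, of "- s * int j"] by (metis dvdI)
      ultimately show ?thesis using unit_mult_eq_0 by metis
    qed
    then have "R = 0" using HR(4) by (intro poly_eqI) (metis D_deg coeff_0 coeff_eq_0 not_less order_less_le_trans)
    then show "\<exists>H'. poly_over W H' \<and> H = D * H'" using HR by auto
  next
    assume "\<exists>H'. poly_over W H' \<and> H = D * H'"
    then show "poly H z = 0" using D_z by auto
  qed
  then show ?thesis unfolding kummer_extension_def n'_def[symmetric] D_def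
    using h_W Z_eq by simp
qed

end

section \<open>Groups with a cyclic quotient\<close>

text \<open>
  The cosets form the set generated by \<open>P\<sigma>\<close>, so the product set \<open>(P\<sigma>)(P\<sigma>)\<close> is a single coset.
  Comparing its elements \<open>\<sigma>\<rho>\<sigma>\<close> and \<open>\<sigma>\<sigma>\<close> shows that \<open>\<sigma>\<close> normalizes \<open>P\<close>. Hence the cosets of the
  powers of \<open>\<sigma>\<close> are closed under the operations of the quotient, and they exhaust it.
\<close>

lemma cyclic_coset_structure:
  fixes G (structure)
  assumes G: "group G" and P: "subgroup P G" and \<sigma>: "\<sigma> \<in> carrier G" "\<sigma> [^] r = \<one>" "(r :: nat) > 0"
    and gen: "generate (G Mod P) {P #> \<sigma>} = carrier (G Mod P)"
  shows "\<rho> \<in> P \<Longrightarrow> \<exists>\<rho>'\<in>P. \<sigma> \<otimes> \<rho> = \<rho>' \<otimes> \<sigma>"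
    and "\<tau> \<in> carrier G \<Longrightarrow> \<exists>\<rho>\<in>P. \<exists>k::nat. \<tau> = \<rho> \<otimes> \<sigma> [^] k"
proof -
  interpret group G by (rule G)
  interpret P: subgroup P G by (rule P)
  have PG: "\<rho> \<in> carrier G" if "\<rho> \<in> P" for \<rho> using P.subset that by blast
  have coset_iff: "x \<in> P #> a \<longleftrightarrow> (\<exists>\<rho>\<in>P. x = \<rho> \<otimes> a)" for x a by (auto simp: r_coset_def)
  have mult: "X \<otimes>\<^bsub>G Mod P\<^esub> Y = X <#> Y" for X Y by (simp add: FactGroup_def)
  have one: "\<one>\<^bsub>G Mod P\<^esub> = P" by (simp add: FactGroup_def)
  have carrier: "carrier (G Mod P) = rcosets P" by (simp add: FactGroup_def)
  have norm: "\<exists>\<rho>'\<in>P. \<sigma> \<otimes> \<rho> = \<rho>' \<otimes> \<sigma>" if \<rho>: "\<rho> \<in> P" for \<rho>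
  proof -
    have "(P #> \<sigma>) <#> (P #> \<sigma>) \<in> rcosets P"
      using generate.eng[OF generate.incl generate.incl, of "P #> \<sigma>" "{P #> \<sigma>}" "P #> \<sigma>" "G Mod P"] gen carrier mult by simp
    then obtain a where a: "a \<in> carrier G" "(P #> \<sigma>) <#> (P #> \<sigma>) = P #> a" by (auto simp: RCOSETS_def)
    have in_coset: "\<rho>' \<otimes> \<sigma> \<in> P #> \<sigma>" if "\<rho>' \<in> P" for \<rho>' using that coset_iff by blast
    have "(\<one> \<otimes> \<sigma>) \<otimes> (\<one> \<otimes> \<sigma>) \<in> P #> a" "(\<one> \<otimes> \<sigma>) \<otimes> (\<rho> \<otimes> \<sigma>) \<in> P #> a"
      using a(2) in_coset[OF \<rho>] in_coset[OF P.one_closed] unfolding set_mult_def by blast+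
    then obtain p1 p2 where p12: "p1 \<in> P" "p2 \<in> P" "\<sigma> \<otimes> \<sigma> = p1 \<otimes> a" "\<sigma> \<otimes> (\<rho> \<otimes> \<sigma>) = p2 \<otimes> a"
      using \<sigma>(1) unfolding coset_iff by auto
    have "a = inv p1 \<otimes> (\<sigma> \<otimes> \<sigma>)" using p12 PG a(1) \<sigma>(1) by (simp add: inv_solve_left)
    then have "(\<sigma> \<otimes> \<rho>) \<otimes> \<sigma> = ((p2 \<otimes> inv p1) \<otimes> \<sigma>) \<otimes> \<sigma>"
      using p12 PG \<sigma>(1) \<rho> by (simp add: m_assoc)
    then have "\<sigma> \<otimes> \<rho> = (p2 \<otimes> inv p1) \<otimes> \<sigma>" using p12 PG \<sigma>(1) \<rho> by (subst (asm) right_cancel) auto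
    moreover have "p2 \<otimes> inv p1 \<in> P" using p12 by simp
    ultimately show ?thesis by blast
  qed
  then show "\<rho> \<in> P \<Longrightarrow> \<exists>\<rho>'\<in>P. \<sigma> \<otimes> \<rho> = \<rho>' \<otimes> \<sigma>" by blast
  have norm_pow: "\<exists>\<rho>'\<in>P. \<sigma> [^] k \<otimes> \<rho> = \<rho>' \<otimes> \<sigma> [^] k" if "\<rho> \<in> P" for \<rho> and k :: nat
    using that
  proof (induction k arbitrary: \<rho>)
    case 0
    then show ?case using PG by auto
  next
    case (Suc k)
    obtain \<rho>1 where 1: "\<rho>1 \<in> P" "\<sigma> \<otimes> \<rho> = \<rho>1 \<otimes> \<sigma>" using norm[OF Suc.prems] by blast
    obtain \<rho>2 where 2: "\<rho>2 \<in> P" "\<sigma> [^] k \<otimes> \<rho>1 = \<rho>2 \<otimes> \<sigma> [^] k" using Suc.IH[OF 1(1)] by blast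
    have "\<sigma> [^] Suc k \<otimes> \<rho> = \<sigma> [^] k \<otimes> (\<sigma> \<otimes> \<rho>)" using \<sigma>(1) PG Suc.prems by (simp add: m_assoc)
    also have "\<dots> = (\<sigma> [^] k \<otimes> \<rho>1) \<otimes> \<sigma>" using 1 \<sigma>(1) PG by (simp add: m_assoc)
    also have "\<dots> = \<rho>2 \<otimes> \<sigma> [^] Suc k" using 2 \<sigma>(1) PG by (simp add: m_assoc)
    finally show ?case using 2 by blast
  qed
  have coset_mult: "(P #> \<sigma> [^] i) <#> (P #> \<sigma> [^] j) = P #> \<sigma> [^] (i + j)" for i j :: nat
  proof
    show "(P #> \<sigma> [^] i) <#> (P #> \<sigma> [^] j) \<subseteq> P #> \<sigma> [^] (i + j)"
    proof
      fix x assume "x \<in> (P #> \<sigma> [^] i) <#> (P #> \<sigma> [^] j)"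
      then obtain \<rho>1 \<rho>2 where x: "\<rho>1 \<in> P" "\<rho>2 \<in> P" "x = (\<rho>1 \<otimes> \<sigma> [^] i) \<otimes> (\<rho>2 \<otimes> \<sigma> [^] j)"
        unfolding set_mult_def coset_iff by (auto simp: coset_iff)
      obtain \<rho>3 where 3: "\<rho>3 \<in> P" "\<sigma> [^] i \<otimes> \<rho>2 = \<rho>3 \<otimes> \<sigma> [^] i" using norm_pow[OF x(2)] by blast
      have "x = \<rho>1 \<otimes> (\<sigma> [^] i \<otimes> \<rho>2) \<otimes> \<sigma> [^] j" using x PG \<sigma>(1) by (simp add: m_assoc)
      also have "\<dots> = (\<rho>1 \<otimes> \<rho>3) \<otimes> \<sigma> [^] (i + j)" unfolding 3(2) using x 3(1) PG \<sigma>(1) by (simp add: m_assoc nat_pow_mult)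
      finally show "x \<in> P #> \<sigma> [^] (i + j)" using x 3(1) coset_iff by blast
    qed
    show "P #> \<sigma> [^] (i + j) \<subseteq> (P #> \<sigma> [^] i) <#> (P #> \<sigma> [^] j)"
    proof
      fix x assume "x \<in> P #> \<sigma> [^] (i + j)"
      then obtain \<rho> where \<rho>: "\<rho> \<in> P" "x = \<rho> \<otimes> \<sigma> [^] (i + j)" unfolding coset_iff by blast
      have "x = (\<rho> \<otimes> \<sigma> [^] i) \<otimes> (\<one> \<otimes> \<sigma> [^] j)" using \<rho> PG \<sigma>(1) by (simp add: m_assoc nat_pow_mult)
      moreover have "\<rho> \<otimes> \<sigma> [^] i \<in> P #> \<sigma> [^] i" "\<one> \<otimes> \<sigma> [^] j \<in> P #> \<sigma> [^] j"
        unfolding coset_iff using \<rho> P.one_closed by blast+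
      ultimately show "x \<in> (P #> \<sigma> [^] i) <#> (P #> \<sigma> [^] j)" unfolding set_mult_def by blast
    qed
  qed
  have P_pow: "P #> \<sigma> [^] (0::nat) = P" "P #> \<sigma> [^] r = P"
    using P.subset by (simp_all add: \<sigma>(2) coset_mult_one)
  have inv: "inv\<^bsub>G Mod P\<^esub> (P #> \<sigma>) = P #> \<sigma> [^] (r - 1)"
    unfolding m_inv_def
  proof (rule the_equality)
    have X: "P #> \<sigma> = P #> \<sigma> [^] (1::nat)" using \<sigma>(1) by simp
    have "(P #> \<sigma>) <#> (P #> \<sigma> [^] (r - 1)) = P" "(P #> \<sigma> [^] (r - 1)) <#> (P #> \<sigma>) = P"
      unfolding X coset_mult using \<sigma>(3) P_pow(2) by simp_all
    then show "P #> \<sigma> [^] (r - 1) \<in> carrier (G Mod P) \<and>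
        (P #> \<sigma>) \<otimes>\<^bsub>G Mod P\<^esub> (P #> \<sigma> [^] (r - 1)) = \<one>\<^bsub>G Mod P\<^esub> \<and>
        (P #> \<sigma> [^] (r - 1)) \<otimes>\<^bsub>G Mod P\<^esub> (P #> \<sigma>) = \<one>\<^bsub>G Mod P\<^esub>"
      using P.subset \<sigma>(1) by (simp add: mult one carrier rcosetsI)
    fix Y assume Y: "Y \<in> carrier (G Mod P) \<and> (P #> \<sigma>) \<otimes>\<^bsub>G Mod P\<^esub> Y = \<one>\<^bsub>G Mod P\<^esub> \<and>
      Y \<otimes>\<^bsub>G Mod P\<^esub> (P #> \<sigma>) = \<one>\<^bsub>G Mod P\<^esub>"
    then obtain b where b: "b \<in> carrier G" "Y = P #> b" unfolding carrier by (auto simp: RCOSETS_def)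
    have "\<one> \<otimes> \<sigma> \<in> P #> \<sigma>" "\<one> \<otimes> b \<in> P #> b" unfolding coset_iff using P.one_closed by blast+
    moreover have "(P #> \<sigma>) <#> (P #> b) = P" using Y b(2) by (simp add: mult one)
    ultimately have "(\<one> \<otimes> \<sigma>) \<otimes> (\<one> \<otimes> b) \<in> P" unfolding set_mult_def by blast
    then have sb: "\<sigma> \<otimes> b \<in> P" using \<sigma>(1) b(1) by simp
    obtain r' where r': "r = Suc r'" using \<sigma>(3) by (cases r) auto
    have "b = \<sigma> [^] (r' + 1) \<otimes> b" using \<sigma>(2) b(1) by (simp add: r' del: nat_pow_Suc)
    also have "\<dots> = \<sigma> [^] r' \<otimes> (\<sigma> \<otimes> b)" using \<sigma>(1) b(1) by (simp add: m_assoc)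
    finally have b_eq: "b = \<sigma> [^] r' \<otimes> (\<sigma> \<otimes> b)" .
    obtain \<rho> where \<rho>: "\<rho> \<in> P" "b = \<rho> \<otimes> \<sigma> [^] r'" using norm_pow[OF sb, of r'] b_eq by metis
    have "P #> b = (P #> \<rho>) #> \<sigma> [^] r'" using \<rho> PG P.subset \<sigma>(1) by (simp add: coset_mult_assoc)
    also have "P #> \<rho> = P" using \<rho>(1) by (simp add: P.rcos_const[OF G])
    finally show "Y = P #> \<sigma> [^] (r - 1)" by (simp add: b(2) r')
  qed
  have cosets: "\<exists>k::nat. X = P #> \<sigma> [^] k" if "X \<in> generate (G Mod P) {P #> \<sigma>}" for X
    using that
  proof (induction X rule: generate.induct)
    case one
    then show ?case using P_pow(1) by (metis \<open>\<one>\<^bsub>G Mod P\<^esub> = P\<close>)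
  next
    case (incl X)
    then show ?case using \<sigma>(1) by (intro exI[of _ 1]) simp
  next
    case (inv X)
    then show ?case using \<open>inv\<^bsub>G Mod P\<^esub> (P #> \<sigma>) = _\<close> by auto
  next
    case (eng X Y)
    then show ?case using coset_mult mult by metis
  qed
  show "\<tau> \<in> carrier G \<Longrightarrow> \<exists>\<rho>\<in>P. \<exists>k::nat. \<tau> = \<rho> \<otimes> \<sigma> [^] k"
  proof -
    assume \<tau>: "\<tau> \<in> carrier G"
    then have "P #> \<tau> \<in> generate (G Mod P) {P #> \<sigma>}" unfolding gen carrier using P.subset by (simp add: rcosetsI)
    then obtain k :: nat where k: "P #> \<tau> = P #> \<sigma> [^] k" using cosets by blast
    have "\<one> \<otimes> \<tau> \<in> P #> \<tau>" unfolding coset_iff using P.one_closed by blast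
    then show ?thesis unfolding k coset_iff using \<tau> by auto
  qed
qed

section \<open>Discrete valuation rings and Gauss extensions\<close>

lemma subfield_subring: "is_subfield k \<Longrightarrow> is_subring k"
  and subfield_inverse: "is_subfield k \<Longrightarrow> a \<in> k \<Longrightarrow> inverse a \<in> k"
  by (auto simp: is_subfield_def)

lemma subfield_divide: "is_subfield k \<Longrightarrow> a \<in> k \<Longrightarrow> b \<in> k \<Longrightarrow> a / b \<in> k"
  by (simp add: divide_inverse subring_mult subfield_subring subfield_inverse)

lemma subfield_powi: "is_subfield k \<Longrightarrow> a \<in> k \<Longrightarrow> a powi i \<in> k"
  by (auto simp: power_int_def subring_power subfield_subring subfield_inverse)

text \<open>
  A discrete valuation ring \<open>R\<close> with field of fractions \<open>E\<close> is described by the normal form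
  \<open>unit \<cdot> \<pi>\<^sup>k\<close> of the nonzero elements of \<open>E\<close>. Membership in the maximal ideal is expressed by
  \<open>a / \<pi> \<in> R\<close>.
\<close>

locale dvr =
  fixes R E :: "'a::field set" and \<pi> :: 'a
  assumes E: "is_subfield E" and R: "is_subring R" and R_E: "R \<subseteq> E"
    and pi: "\<pi> \<in> R" "inverse \<pi> \<notin> R"
    and normal_form: "\<And>a. a \<in> E \<Longrightarrow> a \<noteq> 0 \<Longrightarrow> \<exists>k::int. a * \<pi> powi k \<in> R \<and> inverse (a * \<pi> powi k) \<in> R"
begin

lemma pi_neq_0: "\<pi> \<noteq> 0"
  using pi(2) subring_0[OF R] by auto

lemma pi_E: "\<pi> \<in> E"
  using pi R_E by blast

lemma pi_power_int: "(k::int) \<ge> 0 \<Longrightarrow> \<pi> powi k \<in> R"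
  by (simp add: power_int_def subring_power[OF R pi(1)])

lemma pi_power_int_notin: "(k::int) < 0 \<Longrightarrow> \<pi> powi k \<notin> R"
proof
  assume k: "k < 0" "\<pi> powi k \<in> R"
  have "\<pi> powi k * \<pi> powi (- k - 1) = inverse \<pi>"
    using pi_neq_0 by (simp flip: power_int_add add: power_int_minus)
  then show False using subring_mult[OF R k(2) pi_power_int[of "- k - 1"]] k(1) pi(2) by simp
qed

lemma unit_pi_power: 
  assumes "a \<in> R" "a \<noteq> 0" "a * \<pi> powi k \<in> R" "inverse (a * \<pi> powi k) \<in> R"
  shows "k \<le> 0"
proof (rule ccontr)
  assume k: "\<not> k \<le> 0"
  have "a * inverse (a * \<pi> powi k) = \<pi> powi (- k)"
    using assms(2) pi_neq_0 by (simp add: power_int_minus field_simps)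
  then show False using pi_power_int_notin[of "- k"] k subring_mult[OF R assms(1,4)] by simp
qed

lemma nonunit_divide:
  assumes "a \<in> R" "a = 0 \<or> inverse a \<notin> R"
  shows "a / \<pi> \<in> R"
proof (cases "a = 0")
  case False
  obtain k :: int where k: "a * \<pi> powi k \<in> R" "inverse (a * \<pi> powi k) \<in> R"
    using normal_form[OF _ False] R_E assms(1) by blast
  have "k \<le> 0" by (rule unit_pi_power[OF assms(1) False k])
  moreover have "k \<noteq> 0" using assms(2) k False by auto
  ultimately have "(a * \<pi> powi k) * \<pi> powi (- k - 1) \<in> R" using k(1) by (intro subring_mult[OF R k(1)] pi_power_int) auto
  moreover have "(a * \<pi> powi k) * \<pi> powi (- k - 1) = a / \<pi>"
    using pi_neq_0 by (simp add: mult.assoc divide_inverse power_int_minus flip: power_int_add)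
  ultimately show ?thesis by simp
qed (simp add: subring_0[OF R])

lemma unit_not_divide:
  assumes "a \<noteq> 0" "inverse a \<in> R"
  shows "a / \<pi> \<notin> R"
proof
  assume "a / \<pi> \<in> R"
  then have "inverse a * (a / \<pi>) \<in> R" using assms by (intro subring_mult[OF R])
  then show False using assms pi(2) by (simp add: field_simps)
qed

lemma divide_iff: "a \<in> R \<Longrightarrow> a / \<pi> \<in> R \<longleftrightarrow> a = 0 \<or> inverse a \<notin> R"
  using nonunit_divide unit_not_divide by blast

lemma divide_prime:
  assumes "a \<in> R" "b \<in> R" "a * b / \<pi> \<in> R"
  shows "a / \<pi> \<in> R \<or> b / \<pi> \<in> R"
proof (rule ccontr)
  assume "\<not> ?thesis"
  then have *: "a \<noteq> 0" "inverse a \<in> R" "b \<noteq> 0" "inverse b \<in> R" using assms divide_iff by auto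
  then have "inverse (a * b) \<in> R" by (simp add: subring_mult[OF R])
  then show False using unit_not_divide[of "a * b"] * assms(3) by simp
qed

lemma divide_imp: "a / \<pi> \<in> R \<Longrightarrow> a \<in> R"
  using subring_mult[OF R, of "a / \<pi>" \<pi>] pi pi_neq_0 by simp

lemma valuation_cases: "a \<in> E \<Longrightarrow> a \<in> R \<or> inverse a \<in> R"
proof (cases "a = 0")
  case False
  assume "a \<in> E"
  then obtain k :: int where k: "a * \<pi> powi k \<in> R" "inverse (a * \<pi> powi k) \<in> R"
    using normal_form False by blast
  have "a = (a * \<pi> powi k) * \<pi> powi (- k)" "inverse a = inverse (a * \<pi> powi k) * \<pi> powi k"
    using pi_neq_0 False by (simp_all add: power_int_minus field_simps)
  then show ?thesis using k pi_power_int[of k] pi_power_int[of "- k"] subring_mult[OF R] by (cases "k \<ge> 0") (metis, metis linear neg_0_le_iff_le)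
qed (simp add: subring_0[OF R])

definition primitive :: "'a poly \<Rightarrow> bool" where
  "primitive Q \<longleftrightarrow> poly_over R Q \<and> (\<exists>i. coeff Q i / \<pi> \<notin> R)"

text \<open>
  Gauss's lemma: the coefficient of degree \<open>i + j\<close> is a unit, where \<open>i\<close> and \<open>j\<close> are the least
  degrees in which the factors have a unit coefficient.
\<close>

lemma primitive_mult:
  assumes "primitive P" "primitive Q"
  shows "primitive (P * Q)"
proof -
  define i where "i = (LEAST i. coeff P i / \<pi> \<notin> R)"
  define j where "j = (LEAST i. coeff Q i / \<pi> \<notin> R)"
  have i: "coeff P i / \<pi> \<notin> R" unfolding i_def using assms(1) LeastI_ex[of "\<lambda>i. coeff P i / \<pi> \<notin> R"] by (simp add: primitive_def)
  have j: "coeff Q j / \<pi> \<notin> R" unfolding j_def using assms(2) LeastI_ex[of "\<lambda>i. coeff Q i / \<pi> \<notin> R"] by (simp add: primitive_def)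
  have i': "coeff P k / \<pi> \<in> R" if "k < i" for k using not_less_Least that unfolding i_def by blast
  have j': "coeff Q k / \<pi> \<in> R" if "k < j" for k using not_less_Least that unfolding j_def by blast
  have over: "coeff P k \<in> R" "coeff Q k \<in> R" for k
    using assms poly_over_coeff[OF R] by (auto simp: primitive_def)
  have "coeff (P * Q) (i + j) / \<pi> \<notin> R"
  proof
    assume *: "coeff (P * Q) (i + j) / \<pi> \<in> R"
    have "coeff (P * Q) (i + j) = (\<Sum>k\<le>i + j. coeff P k * coeff Q (i + j - k))" by (simp add: coeff_mult)
    also have "\<dots> = coeff P i * coeff Q j + (\<Sum>k\<in>{..i + j} - {i}. coeff P k * coeff Q (i + j - k))"
      by (subst sum.remove[of _ i]) auto
    finally have "coeff P i * coeff Q j / \<pi> = coeff (P * Q) (i + j) / \<pi> -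
        (\<Sum>k\<in>{..i + j} - {i}. coeff P k * coeff Q (i + j - k) / \<pi>)"
      by (simp add: diff_divide_distrib add_divide_distrib sum_divide_distrib)
    moreover have "coeff P k * coeff Q (i + j - k) / \<pi> \<in> R" if "k \<in> {..i + j} - {i}" for k
    proof (cases "k < i")
      case True
      have "coeff P k / \<pi> * coeff Q (i + j - k) \<in> R" by (intro subring_mult[OF R] i' True over)
      then show ?thesis by simp
    next
      case False
      have "coeff P k * (coeff Q (i + j - k) / \<pi>) \<in> R" using that False by (intro subring_mult[OF R] j' over) auto
      then show ?thesis by simp
    qed
    then have "(\<Sum>k\<in>{..i + j} - {i}. coeff P k * coeff Q (i + j - k) / \<pi>) \<in> R" by (intro subring_sum[OF R])
    ultimately have "coeff P i * coeff Q j / \<pi> \<in> R" using subring_diff[OF R *] by simp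
    then show False using divide_prime[OF over(1) over(2)] i j by blast
  qed
  then show ?thesis unfolding primitive_def using assms R by (auto simp: primitive_def intro: poly_over_mult)
qed

lemma one_div_pi: "1 / \<pi> \<notin> R"
  using pi(2) by (simp add: divide_inverse)

lemma primitive_monom: "primitive (monom 1 k)"
  unfolding primitive_def using R one_div_pi by (auto intro!: poly_over_monom subring_1 exI[of _ k])

lemma primitive_1: "primitive 1"
  using primitive_monom[of 0] by (simp add: monom_0 one_pCons)

lemma primitive_over: "primitive Q \<Longrightarrow> poly_over R Q"
  by (simp add: primitive_def)

lemma primitive_neq_0: "primitive Q \<Longrightarrow> Q \<noteq> 0"
  by (auto simp: primitive_def subring_0[OF R])

lemma primitive_reflect: "primitive Q \<Longrightarrow> primitive (reflect_poly Q)"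
proof -
  assume Q: "primitive Q"
  then obtain i where i: "coeff Q i / \<pi> \<notin> R" by (auto simp: primitive_def)
  then have "coeff Q i \<noteq> 0" using subring_0[OF R] by auto
  then have "i \<le> degree Q" by (rule le_degree)
  then have "coeff (reflect_poly Q) (degree Q - i) = coeff Q i" by (simp add: coeff_reflect_poly)
  moreover have "poly_over R (reflect_poly Q)"
    using Q R by (auto simp: primitive_def poly_over_iff subring_0 coeff_reflect_poly)
  ultimately show ?thesis using i by (auto simp: primitive_def intro!: exI[of _ "degree Q - i"])
qed

text \<open>
  Multiply by the largest of the powers of \<open>\<pi>\<close> that turn the coefficients into units.
\<close>

lemma primitive_multiple:
  assumes P: "poly_over E P" "P \<noteq> 0"
  shows "\<exists>k::int. primitive (smult (\<pi> powi k) P)"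
proof -
  let ?I = "{i. coeff P i \<noteq> 0}"
  have "\<forall>i. \<exists>k::int. coeff P i \<noteq> 0 \<longrightarrow> coeff P i * \<pi> powi k \<in> R \<and> inverse (coeff P i * \<pi> powi k) \<in> R"
    using normal_form poly_over_coeff[OF subfield_subring[OF E] P(1)] by blast
  from choice[OF this] obtain e :: "nat \<Rightarrow> int" where
    e: "\<And>i. coeff P i \<noteq> 0 \<Longrightarrow> coeff P i * \<pi> powi e i \<in> R \<and> inverse (coeff P i * \<pi> powi e i) \<in> R"
    by blast
  have fin: "finite ?I" by (rule finite_subset[of _ "{..degree P}"]) (auto intro: le_degree)
  have ne: "?I \<noteq> {}" using P(2) by (auto simp: poly_eq_iff)
  define k where "k = Max (e ` ?I)"
  have "k \<in> e ` ?I" unfolding k_def using fin ne by (intro Max_in) auto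
  then obtain i0 where i0: "coeff P i0 \<noteq> 0" "e i0 = k" by auto
  have "coeff P i * \<pi> powi k \<in> R" for i
  proof (cases "coeff P i = 0")
    case False
    then have "e i \<le> k" unfolding k_def using fin by (intro Max_ge) auto
    then have "(coeff P i * \<pi> powi e i) * \<pi> powi (k - e i) \<in> R"
      by (intro subring_mult[OF R conjunct1[OF e[OF False]]] pi_power_int) auto
    then show ?thesis using pi_neq_0 by (simp add: mult.assoc flip: power_int_add)
  qed (simp add: subring_0[OF R])
  then have "poly_over R (smult (\<pi> powi k) P)" using R by (simp add: poly_over_iff subring_0 mult.commute)
  moreover have "coeff (smult (\<pi> powi k) P) i0 / \<pi> \<notin> R"
    using unit_not_divide[of "coeff P i0 * \<pi> powi k"] e[OF i0(1)] i0 pi_neq_0 by (simp add: mult.commute)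
  ultimately show ?thesis unfolding primitive_def by blast
qed

text \<open>
  The valuation ring of the Gauss valuation on the rational function field \<open>E(t)\<close>.
\<close>

definition gauss_ring :: "'a \<Rightarrow> 'a set" where
  "gauss_ring t = {poly P t / poly Q t |P Q. poly_over R P \<and> primitive Q}"

lemma gauss_ringI: "poly_over R P \<Longrightarrow> primitive Q \<Longrightarrow> poly P t / poly Q t \<in> gauss_ring t"
  by (auto simp: gauss_ring_def)

lemma gauss_ring_inverse_subset:
  assumes "t \<noteq> 0"
  shows "gauss_ring (inverse t) \<subseteq> gauss_ring t"
proof
  fix g assume "g \<in> gauss_ring (inverse t)"
  then obtain P Q where PQ: "poly_over R P" "primitive Q" "g = poly P (inverse t) / poly Q (inverse t)"
    by (auto simp: gauss_ring_def)
  have "poly_over R (reflect_poly P)"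
    using PQ(1) R by (auto simp: poly_over_iff subring_0 coeff_reflect_poly)
  then have "poly (reflect_poly P * monom 1 (degree Q)) t / poly (reflect_poly Q * monom 1 (degree P)) t \<in> gauss_ring t"
    using PQ R by (intro gauss_ringI primitive_mult primitive_reflect primitive_monom poly_over_mult poly_over_monom subring_1)
  moreover have "poly (reflect_poly P * monom 1 (degree Q)) t / poly (reflect_poly Q * monom 1 (degree P)) t = g"
    unfolding PQ(3) poly_mult poly_reflect_poly_nz[OF assms] using assms by (simp add: poly_monom)
  ultimately show "g \<in> gauss_ring t" by simp
qed

lemma gauss_ring_inverse: "t \<noteq> 0 \<Longrightarrow> gauss_ring (inverse t) = gauss_ring t"
  using gauss_ring_inverse_subset[of t] gauss_ring_inverse_subset[of "inverse t"] by auto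

end

definition ratfun :: "'a::field set \<Rightarrow> 'a \<Rightarrow> 'a set" where
  "ratfun L t = {poly P t / poly Q t |P Q. poly_over L P \<and> poly_over L Q \<and> Q \<noteq> 0}"

lemma ratfunI: "poly_over L P \<Longrightarrow> poly_over L Q \<Longrightarrow> Q \<noteq> 0 \<Longrightarrow> poly P t / poly Q t \<in> ratfun L t"
  by (auto simp: ratfun_def)

lemma transc_poly_neq_0: "transcendental_over L t \<Longrightarrow> poly_over L Q \<Longrightarrow> Q \<noteq> 0 \<Longrightarrow> poly Q t \<noteq> 0"
  by (auto simp: transcendental_over_def)

lemma transc_poly_eqI:
  assumes "is_subring L" "transcendental_over L t" "poly_over L P" "poly_over L Q" "poly P t = poly Q t"
  shows "P = Q"
proof (rule ccontr)
  assume "P \<noteq> Q"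
  then have "P - Q \<noteq> 0" by simp
  then have "poly (P - Q) t \<noteq> 0" by (rule transc_poly_neq_0[OF assms(2) poly_over_diff[OF assms(1,3,4)]])
  then show False using assms(5) by simp
qed

lemma ratfun_base: "is_subfield L \<Longrightarrow> a \<in> L \<Longrightarrow> a \<in> ratfun L t"
  using ratfunI[of L "[:a:]" 1 t] by (simp add: poly_over_const poly_over_1 subfield_subring)

lemma ratfun_gen: "is_subfield L \<Longrightarrow> t \<in> ratfun L t"
  using ratfunI[of L "[:0, 1:]" 1 t] by (simp add: poly_over_linear poly_over_1 subfield_subring subring_0 subring_1)

lemma is_subfield_ratfun:
  assumes L: "is_subfield L" and t: "transcendental_over L t"
  shows "is_subfield (ratfun L t)"
  unfolding is_subfield_def is_subring_def
proof (intro conjI ballI)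
  note sub = subfield_subring[OF L]
  show "0 \<in> ratfun L t" "1 \<in> ratfun L t" using ratfun_base[OF L] sub by (auto simp: subring_closed)
  fix a assume "a \<in> ratfun L t"
  then obtain P Q where PQ: "poly_over L P" "poly_over L Q" "Q \<noteq> 0" "a = poly P t / poly Q t" by (auto simp: ratfun_def)
  show "inverse a \<in> ratfun L t"
  proof (cases "P = 0")
    case True
    then show ?thesis using \<open>0 \<in> ratfun L t\<close> by (simp add: PQ(4))
  next
    case False
    then have "poly Q t / poly P t \<in> ratfun L t" using PQ by (intro ratfunI)
    then show ?thesis by (simp add: PQ(4))
  qed
  fix b assume "b \<in> ratfun L t"
  then obtain P' Q' where PQ': "poly_over L P'" "poly_over L Q'" "Q' \<noteq> 0" "b = poly P' t / poly Q' t"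
    by (auto simp: ratfun_def)
  have nz: "poly Q t \<noteq> 0" "poly Q' t \<noteq> 0" using PQ PQ' transc_poly_neq_0[OF t] by auto
  have "poly (P * Q' - P' * Q) t / poly (Q * Q') t \<in> ratfun L t" "poly (P * P') t / poly (Q * Q') t \<in> ratfun L t"
    by (rule ratfunI; simp add: poly_over_diff[OF sub] poly_over_mult[OF sub] PQ(1-3) PQ'(1-3))+
  then show "a - b \<in> ratfun L t" "a * b \<in> ratfun L t" using nz by (simp_all add: PQ(4) PQ'(4) diff_frac_eq)
qed

lemma field_gen_subset: "is_subfield k \<Longrightarrow> T \<subseteq> k \<Longrightarrow> field_gen T \<subseteq> k"
  by (auto simp: field_gen_def)

lemma field_gen_eq_ratfun:
  assumes L: "is_subfield L" and t: "transcendental_over L t"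
  shows "field_gen (L \<union> {t}) = ratfun L t"
proof
  show "field_gen (L \<union> {t}) \<subseteq> ratfun L t"
    using is_subfield_ratfun[OF L t] ratfun_base[OF L] ratfun_gen[OF L] by (intro field_gen_subset) auto
  have "poly P t / poly Q t \<in> k" if "poly_over L P" "poly_over L Q" "is_subfield k" "L \<union> {t} \<subseteq> k" for P Q k
    using that by (intro subfield_divide poly_in_subring subfield_subring) (auto elim: poly_over_mono)
  then show "ratfun L t \<subseteq> field_gen (L \<union> {t})" by (auto simp: field_gen_def ratfun_def)
qed

lemma transc_inverse:
  fixes L :: "'a::field set"
  assumes "is_subring L" "transcendental_over L t" "t \<noteq> 0"
  shows "transcendental_over L (inverse t)"
  unfolding transcendental_over_def
proof (intro allI impI, elim conjE)
  fix P assume P: "poly_over L P" "poly P (inverse t) = 0"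
  then have "poly (reflect_poly P) t = 0" by (simp add: poly_reflect_poly_nz assms(3))
  moreover have "poly_over L (reflect_poly P)"
    using P assms(1) by (auto simp: poly_over_iff subring_0 coeff_reflect_poly)
  ultimately show "P = 0" using assms(2) by (auto simp: transcendental_over_def)
qed

lemma transc_linear:
  fixes L :: "'a::field set"
  assumes "is_subring L" "transcendental_over L t" "a \<in> L" "a \<noteq> 0" "b \<in> L"
  shows "transcendental_over L (a * t + b)"
  unfolding transcendental_over_def
proof (intro allI impI, elim conjE)
  fix P assume P: "poly_over L P" "poly P (a * t + b) = 0"
  then have "poly (pcompose P [:b, a:]) t = 0" by (simp add: poly_pcompose algebra_simps)
  moreover have "poly_over L (pcompose P [:b, a:])"
    using P assms by (intro poly_over_pcompose poly_over_linear)
  ultimately have "pcompose P [:b, a:] = 0" using assms(2) by (auto simp: transcendental_over_def)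
  then show "P = 0" using assms(4) by (simp add: pcompose_eq_0_iff)
qed

lemma transc_neq: "is_subring L \<Longrightarrow> transcendental_over L t \<Longrightarrow> t \<notin> L"
  using transc_poly_neq_0[of L t "[:- t, 1:]"] by (auto simp: poly_over_linear subring_closed)

context dvr
begin

context
  fixes t assumes t: "transcendental_over E t"
begin

lemma primitive_poly_neq_0: "primitive Q \<Longrightarrow> poly Q t \<noteq> 0"
  using t primitive_neq_0 poly_over_mono[OF primitive_over R_E] by (auto simp: transcendental_over_def)

lemma gauss_ring_subring: "is_subring (gauss_ring t)"
  unfolding is_subring_def
proof (intro conjI ballI)
  show "0 \<in> gauss_ring t" "1 \<in> gauss_ring t"
    using gauss_ringI[OF _ primitive_1, of 0 t] gauss_ringI[OF _ primitive_1, of 1 t] R by (auto simp: poly_over_0 poly_over_1)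
  fix a b assume "a \<in> gauss_ring t" "b \<in> gauss_ring t"
  then obtain P Q P' Q' where *: "poly_over R P" "primitive Q" "a = poly P t / poly Q t"
    "poly_over R P'" "primitive Q'" "b = poly P' t / poly Q' t" by (auto simp: gauss_ring_def)
  have nz: "poly Q t \<noteq> 0" "poly Q' t \<noteq> 0" using * primitive_poly_neq_0 by auto
  have "poly (P * Q' - P' * Q) t / poly (Q * Q') t \<in> gauss_ring t" "poly (P * P') t / poly (Q * Q') t \<in> gauss_ring t"
    by (rule gauss_ringI; simp add: poly_over_diff[OF R] poly_over_mult[OF R] primitive_mult primitive_over *(1,2,4,5))+
  then show "a - b \<in> gauss_ring t" "a * b \<in> gauss_ring t" using nz by (simp_all add: *(3,6) diff_frac_eq)
qed

lemma gauss_ring_poly: "poly_over R P \<Longrightarrow> poly P t \<in> gauss_ring t"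
  using gauss_ringI[OF _ primitive_1, of P t] by simp

lemma gauss_ring_base: "R \<subseteq> gauss_ring t"
  using gauss_ring_poly[OF poly_over_const[OF R]] by auto

lemma gauss_ring_gen: "t \<in> gauss_ring t"
  using gauss_ring_poly[of "[:0, 1:]"] R by (simp add: poly_over_linear subring_closed)

text \<open>
  Multiplying \<open>P\<close> by the power of \<open>\<pi>\<close> that makes it primitive, Gauss's lemma shows that this power
  has a nonpositive exponent.
\<close>

lemma gauss_ring_poly_iff:
  assumes "poly_over E P" "poly P t \<in> gauss_ring t"
  shows "poly_over R P"
proof (cases "P = 0")
  case False
  note sub = subfield_subring[OF E]
  obtain k :: int where k: "primitive (smult (\<pi> powi k) P)" using primitive_multiple[OF assms(1) False] by blast
  obtain M Q where MQ: "poly_over R M" "primitive Q" "poly P t = poly M t / poly Q t"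
    using assms(2) by (auto simp: gauss_ring_def)
  have over: "poly_over E Q" "poly_over E M" 
    by (rule poly_over_mono[OF primitive_over[OF MQ(2)] R_E], rule poly_over_mono[OF MQ(1) R_E])
  have "poly (P * Q) t = poly M t" using MQ(3) primitive_poly_neq_0[OF MQ(2)] by (simp add: field_simps)
  then have PQ: "P * Q = M" using assms over sub by (intro transc_poly_eqI[OF sub t] poly_over_mult)
  have "primitive (smult (\<pi> powi k) M)"
    using primitive_mult[OF k MQ(2)] by (simp add: PQ[symmetric])
  then obtain i where i: "\<pi> powi k * coeff M i / \<pi> \<notin> R" by (auto simp: primitive_def)
  have "k \<le> 0"
  proof (rule ccontr)
    assume "\<not> k \<le> 0"
    then have "\<pi> powi (k - 1) * coeff M i \<in> R" using MQ(1)
      by (intro subring_mult[OF R] pi_power_int poly_over_coeff[OF R]) auto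
    moreover have "\<pi> powi (k - 1) = \<pi> powi k / \<pi>" using pi_neq_0 by (simp add: power_int_diff)
    ultimately show False using i by simp
  qed
  then have "poly_over R (smult (\<pi> powi (- k)) (smult (\<pi> powi k) P))"
    by (intro poly_over_smult[OF R _ primitive_over[OF k]] pi_power_int) simp
  moreover have "\<pi> powi (- k) * \<pi> powi k = 1" using pi_neq_0 by (simp flip: power_int_add)
  ultimately show ?thesis by simp
qed (simp add: poly_over_0[OF R])

text \<open>
  Numerator and denominator of a fraction are powers of \<open>\<pi>\<close> times primitive polynomials, and a
  quotient of primitive polynomials is a unit of the Gauss ring.
\<close>

lemma dvr_gauss: "dvr (gauss_ring t) (ratfun E t) \<pi>"
proof
  note sub = subfield_subring[OF E]
  show "is_subfield (ratfun E t)" by (rule is_subfield_ratfun[OF E t])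
  show "is_subring (gauss_ring t)" by (rule gauss_ring_subring)
  show "gauss_ring t \<subseteq> ratfun E t"
    using primitive_over primitive_neq_0 poly_over_mono[OF _ R_E] by (auto simp: gauss_ring_def intro!: ratfunI)
  show "\<pi> \<in> gauss_ring t" using gauss_ring_base pi by blast
  show "inverse \<pi> \<notin> gauss_ring t"
  proof
    assume "inverse \<pi> \<in> gauss_ring t"
    then have "poly_over R [:inverse \<pi>:]"
      using pi_E E sub by (intro gauss_ring_poly_iff poly_over_const) (auto simp: subfield_inverse)
    then show False using poly_over_coeff[OF R, of "[:inverse \<pi>:]" 0] pi(2) by simp
  qed
  fix a assume a: "a \<in> ratfun E t" "a \<noteq> 0"
  then obtain P Q where PQ: "poly_over E P" "poly_over E Q" "Q \<noteq> 0" "a = poly P t / poly Q t" by (auto simp: ratfun_def)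
  then have "P \<noteq> 0" using a(2) by auto
  obtain i j :: int where ij: "primitive (smult (\<pi> powi i) P)" "primitive (smult (\<pi> powi j) Q)"
    using primitive_multiple PQ \<open>P \<noteq> 0\<close> by meson
  have eq: "a * \<pi> powi (i - j) = poly (smult (\<pi> powi i) P) t / poly (smult (\<pi> powi j) Q) t"
    using pi_neq_0 by (simp add: PQ(4) power_int_diff mult.commute)
  have "poly (smult (\<pi> powi i) P) t / poly (smult (\<pi> powi j) Q) t \<in> gauss_ring t"
    "poly (smult (\<pi> powi j) Q) t / poly (smult (\<pi> powi i) P) t \<in> gauss_ring t"
    using ij primitive_over by (blast intro: gauss_ringI)+
  then show "\<exists>k::int. a * \<pi> powi k \<in> gauss_ring t \<and> inverse (a * \<pi> powi k) \<in> gauss_ring t"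
    using eq by (intro exI[of _ "i - j"]) simp
qed

end

end

section \<open>Models of the projective line\<close>

lemma ring_gen_insert:
  assumes "is_subring A"
  shows "ring_gen (insert t A) = {poly P t |P. poly_over A P}"
proof
  have "is_subring {poly P t |P. poly_over A P}"
    unfolding is_subring_def
  proof (intro conjI ballI)
    show "0 \<in> {poly P t |P. poly_over A P}" using poly_over_0[OF assms] by (auto intro!: exI[of _ 0])
    show "1 \<in> {poly P t |P. poly_over A P}" using poly_over_1[OF assms] by (auto intro!: exI[of _ 1])
    fix a b assume "a \<in> {poly P t |P. poly_over A P}" "b \<in> {poly P t |P. poly_over A P}"
    then obtain P Q where "poly_over A P" "a = poly P t" "poly_over A Q" "b = poly Q t" by blast
    then show "a - b \<in> {poly P t |P. poly_over A P}" "a * b \<in> {poly P t |P. poly_over A P}"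
      using poly_over_diff[OF assms, of P Q] poly_over_mult[OF assms, of P Q] by (metis (mono_tags, lifting) mem_Collect_eq poly_diff, metis (mono_tags, lifting) mem_Collect_eq poly_mult)
  qed
  moreover have "t \<in> {poly P t |P. poly_over A P}"
    using assms by (auto intro!: exI[of _ "[:0, 1:]"] poly_over_linear subring_0 subring_1)
  moreover have "A \<subseteq> {poly P t |P. poly_over A P}"
    using poly_over_const[OF assms] by (auto intro!: exI[of _ "[:_:]"])
  ultimately show "ring_gen (insert t A) \<subseteq> {poly P t |P. poly_over A P}" unfolding ring_gen_def by blast
  have "poly P t \<in> B" if "is_subring B" "insert t A \<subseteq> B" "poly_over A P" for B P
    using that by (intro poly_in_subring) (auto elim: poly_over_mono)
  then show "{poly P t |P. poly_over A P} \<subseteq> ring_gen (insert t A)" unfolding ring_gen_def by blast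
qed

lemma ring_gen_subring: "is_subring (ring_gen T)"
  unfolding ring_gen_def is_subring_def by blast

lemma ring_gen_superset: "T \<subseteq> ring_gen T"
  unfolding ring_gen_def by blast

lemma ring_gen_least: "is_subring B \<Longrightarrow> T \<subseteq> B \<Longrightarrow> ring_gen T \<subseteq> B"
  unfolding ring_gen_def by blast

locale localization =
  fixes A P R :: "'a::field set"
  assumes A: "is_subring A" and P: "prime_ideal A P" and R_def: "R = {a / b |a b. a \<in> A \<and> b \<in> A - P}"
begin

lemma prime_rules:
  "P \<subseteq> A" "0 \<in> P" "1 \<notin> P" "a \<in> P \<Longrightarrow> b \<in> P \<Longrightarrow> a + b \<in> P" "a \<in> A \<Longrightarrow> b \<in> P \<Longrightarrow> a * b \<in> P"
  "a \<in> A \<Longrightarrow> b \<in> A \<Longrightarrow> a * b \<in> P \<Longrightarrow> a \<in> P \<or> b \<in> P"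
  using P unfolding prime_ideal_def by blast+

lemma A_R: "A \<subseteq> R"
proof
  fix a assume "a \<in> A"
  then have "a / 1 \<in> R" unfolding R_def using prime_rules(3) subring_1[OF A] by blast
  then show "a \<in> R" by simp
qed

lemma inverse_in: "b \<in> A \<Longrightarrow> b \<notin> P \<Longrightarrow> inverse b \<in> R"
proof -
  assume "b \<in> A" "b \<notin> P"
  then have "1 / b \<in> R" unfolding R_def using subring_1[OF A] by blast
  then show "inverse b \<in> R" by (simp add: divide_inverse)
qed

lemma fraction_cases: 
  assumes "x \<in> R"
  obtains a b where "a \<in> A" "b \<in> A" "b \<notin> P" "b \<noteq> 0" "x = a / b"
proof -
  obtain a b where *: "a \<in> A" "b \<in> A - P" "x = a / b" using assms unfolding R_def by blast
  then have "b \<noteq> 0" using prime_rules(2) by auto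
  with * show thesis using that by blast
qed

lemma R_subring: "is_subring R"
  unfolding is_subring_def
proof (intro conjI ballI)
  show "0 \<in> R" "1 \<in> R" using A_R A by (auto simp: subring_closed)
  fix x y assume "x \<in> R" "y \<in> R"
  obtain a b where ab: "a \<in> A" "b \<in> A" "b \<notin> P" "b \<noteq> 0" "x = a / b" by (rule fraction_cases[OF \<open>x \<in> R\<close>])
  obtain c d where cd: "c \<in> A" "d \<in> A" "d \<notin> P" "d \<noteq> 0" "y = c / d" by (rule fraction_cases[OF \<open>y \<in> R\<close>])
  have "b * d \<in> A - P" using ab cd prime_rules(6) A by (auto intro: subring_mult)
  moreover have "a * d - c * b \<in> A" "a * c \<in> A" using ab cd A by (auto intro!: subring_closed)
  ultimately have "(a * d - c * b) / (b * d) \<in> R" "a * c / (b * d) \<in> R" unfolding R_def by blast+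
  then show "x - y \<in> R" "x * y \<in> R" using ab cd by (simp_all add: diff_frac_eq)
qed

definition "maximal = {a / b |a b. a \<in> P \<and> b \<in> A - P}"

lemma unit_or_maximal: "x \<in> R \<Longrightarrow> x \<in> maximal \<or> (x \<noteq> 0 \<and> inverse x \<in> R)"
proof -
  assume "x \<in> R"
  then obtain a b where ab: "a \<in> A" "b \<in> A" "b \<notin> P" "b \<noteq> 0" "x = a / b" by (rule fraction_cases)
  show ?thesis
  proof (cases "a \<in> P")
    case True
    then show ?thesis using ab unfolding maximal_def by blast
  next
    case False
    then have "a \<noteq> 0" using prime_rules(2) by auto
    moreover have "b / a \<in> R" using ab False unfolding R_def by blast
    ultimately show ?thesis using ab by simp
  qed
qed

lemma not_unit_and_maximal: "x \<in> maximal \<Longrightarrow> inverse x \<in> R \<Longrightarrow> x = 0"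
proof (rule ccontr)
  assume x: "x \<in> maximal" "inverse x \<in> R" "x \<noteq> 0"
  obtain a b where ab: "a \<in> P" "b \<in> A" "b \<notin> P" "x = a / b" using x(1) unfolding maximal_def by blast
  obtain c d where cd: "c \<in> A" "d \<in> A" "d \<notin> P" "d \<noteq> 0" "inverse x = c / d" by (rule fraction_cases[OF x(2)])
  have nz: "a \<noteq> 0" "b \<noteq> 0" using x ab prime_rules(2) by auto
  then have "b / a = c / d" using ab(4) cd(5) by simp
  then have "b * d = c * a" using nz(1) cd(4) by (simp add: frac_eq_eq)
  then have "b * d \<in> P" using prime_rules(5)[OF cd(1) ab(1)] by simp
  then show False using prime_rules(6)[OF ab(2) cd(2)] ab cd by blast
qed

lemma maximal_add: "x \<in> maximal \<Longrightarrow> y \<in> maximal \<Longrightarrow> x + y \<in> maximal"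
proof -
  assume "x \<in> maximal" "y \<in> maximal"
  then obtain a b c d where *: "a \<in> P" "b \<in> A" "b \<notin> P" "x = a / b" "c \<in> P" "d \<in> A" "d \<notin> P" "y = c / d"
    unfolding maximal_def by blast
  then have nz: "b \<noteq> 0" "d \<noteq> 0" using prime_rules(2) by auto
  have "d * a + b * c \<in> P" "b * d \<in> A - P" using * prime_rules(6) A by (auto intro!: prime_rules(4,5) subring_mult)
  then have "(d * a + b * c) / (b * d) \<in> maximal" unfolding maximal_def by blast
  moreover have "x + y = (d * a + b * c) / (b * d)" using nz by (simp add: *(4,8) field_simps)
  ultimately show ?thesis by simp
qed

lemma maximal_mult: "x \<in> R \<Longrightarrow> y \<in> maximal \<Longrightarrow> x * y \<in> maximal"
proof -
  assume "x \<in> R" and y: "y \<in> maximal"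
  obtain a b where ab: "a \<in> A" "b \<in> A" "b \<notin> P" "b \<noteq> 0" "x = a / b" by (rule fraction_cases[OF \<open>x \<in> R\<close>])
  obtain c d where *: "c \<in> P" "d \<in> A" "d \<notin> P" "y = c / d" using y unfolding maximal_def by blast
  have "a * c \<in> P" "b * d \<in> A - P" using ab * prime_rules(6) A by (auto intro!: prime_rules(5) subring_mult)
  then have "a * c / (b * d) \<in> maximal" unfolding maximal_def by blast
  then show ?thesis using ab * by simp
qed

text \<open>
  The charts of a model overlap: \<open>R\<close> is a local ring of \<open>B \<subseteq> R\<close> as well, namely at the contraction
  of its maximal ideal, as soon as the elements of \<open>A\<close> are fractions of \<open>B\<close> whose denominators are
  units of \<open>R\<close>.
\<close>

lemma transfer:
  assumes B: "is_subring B" "B \<subseteq> R"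
    and fraction: "\<And>a. a \<in> A \<Longrightarrow> \<exists>b\<in>B. \<exists>d\<in>B. d \<noteq> 0 \<and> inverse d \<in> R \<and> a = b / d"
  shows "R \<in> spec_model B"
proof -
  define P' where "P' = B \<inter> maximal"
  have "1 \<notin> maximal" using not_unit_and_maximal[of 1] subring_1[OF R_subring] by auto
  moreover have "0 / 1 \<in> maximal" using prime_rules(2,3) subring_1[OF A] unfolding maximal_def by blast
  then have "0 \<in> maximal" by simp
  moreover have "a \<in> maximal \<or> b \<in> maximal" if "a \<in> B" "b \<in> B" "a * b \<in> maximal" for a b
  proof (rule ccontr)
    assume "\<not> ?thesis"
    then have "a \<noteq> 0" "inverse a \<in> R" "b \<noteq> 0" "inverse b \<in> R" using unit_or_maximal that B by blast+
    then have "inverse (a * b) \<in> R" "a * b \<noteq> 0" using subring_mult[OF R_subring] by auto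
    then show False using not_unit_and_maximal[OF that(3)] by simp
  qed
  ultimately have "prime_ideal B P'"
    unfolding prime_ideal_def P'_def using B maximal_add maximal_mult by (auto intro: subring_0 subring_add subring_mult)
  moreover have "R = {a / b |a b. a \<in> B \<and> b \<in> B - P'}"
  proof
    show "{a / b |a b. a \<in> B \<and> b \<in> B - P'} \<subseteq> R"
    proof clarify
      fix a b assume "a \<in> B" "b \<in> B" "b \<notin> P'"
      then have "inverse b \<in> R" using unit_or_maximal[of b] B by (auto simp: P'_def)
      then show "a / b \<in> R" using \<open>a \<in> B\<close> B subring_mult[OF R_subring] by (auto simp: divide_inverse)
    qed
    show "R \<subseteq> {a / b |a b. a \<in> B \<and> b \<in> B - P'}"
    proof
      fix x assume "x \<in> R"
      then obtain a b where ab: "a \<in> A" "b \<in> A" "b \<notin> P" "b \<noteq> 0" "x = a / b" by (rule fraction_cases)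
      obtain a1 a2 where a: "a1 \<in> B" "a2 \<in> B" "a2 \<noteq> 0" "inverse a2 \<in> R" "a = a1 / a2" using fraction[OF ab(1)] by blast
      obtain b1 b2 where b: "b1 \<in> B" "b2 \<in> B" "b2 \<noteq> 0" "inverse b2 \<in> R" "b = b1 / b2" using fraction[OF ab(2)] by blast
      have "b1 \<noteq> 0" using ab b by auto
      have "inverse b1 = inverse b * inverse b2" using b ab(4) by (simp add: field_simps)
      then have "inverse b1 \<in> R" using subring_mult[OF R_subring inverse_in[OF ab(2,3)] b(4)] by simp
      then have "inverse (a2 * b1) \<in> R" using a(4) subring_mult[OF R_subring] by (simp add: mult.commute)
      then have "a2 * b1 \<notin> maximal" using not_unit_and_maximal[of "a2 * b1"] a(3) \<open>b1 \<noteq> 0\<close> by auto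
      moreover have "a1 * b2 \<in> B" "a2 * b1 \<in> B" using a b B by (auto intro: subring_mult)
      moreover have "x = (a1 * b2) / (a2 * b1)" using a(3) b(3) \<open>b1 \<noteq> 0\<close> ab(4) by (simp add: ab(5) a(5) b(5))
      ultimately show "x \<in> {a / b |a b. a \<in> B \<and> b \<in> B - P'}" unfolding P'_def by blast
    qed
  qed
  ultimately show ?thesis unfolding spec_model_def by blast
qed

text \<open>
  It therefore suffices to verify the hypothesis of \<open>transfer\<close> on generators of \<open>A\<close>.
\<close>

lemma fractions_subring:
  assumes B: "is_subring B" "B \<subseteq> R"
  shows "is_subring {b / d |b d. b \<in> B \<and> d \<in> B \<and> d \<noteq> 0 \<and> inverse d \<in> R}" (is "is_subring ?F")
  unfolding is_subring_def
proof (intro conjI ballI)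
  have "inverse 1 \<in> R" using subring_1[OF R_subring] by simp
  then have F_I: "b / 1 \<in> ?F" if "b \<in> B" for b using that subring_1[OF B(1)] one_neq_zero[where ?'a = 'a] by blast
  show "0 \<in> ?F" "1 \<in> ?F" using F_I[OF subring_0[OF B(1)]] F_I[OF subring_1[OF B(1)]] by simp_all
  fix x y assume "x \<in> ?F" "y \<in> ?F"
  then obtain a b c d where *: "a \<in> B" "b \<in> B" "b \<noteq> 0" "inverse b \<in> R" "x = a / b"
    "c \<in> B" "d \<in> B" "d \<noteq> 0" "inverse d \<in> R" "y = c / d" by blast
  have "a * d - c * b \<in> B" "a * c \<in> B" "b * d \<in> B" "b * d \<noteq> 0" "inverse (b * d) \<in> R"
    using * B subring_mult[OF R_subring *(4,9)] by (auto intro!: subring_closed simp: mult.commute)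
  then have "(a * d - c * b) / (b * d) \<in> ?F" "(a * c) / (b * d) \<in> ?F" by blast+
  then show "x - y \<in> ?F" "x * y \<in> ?F" using * by (simp_all add: diff_frac_eq)
qed

end

lemma spec_model_localization:
  assumes "is_subring A" "R \<in> spec_model A"
  obtains P where "localization A P R"
proof -
  obtain P where "prime_ideal A P" "R = {a / b |a b. a \<in> A \<and> b \<in> A - P}"
    using assms(2) unfolding spec_model_def by blast
  then have "localization A P R" using assms(1) by unfold_locales
  then show thesis by (rule that)
qed

lemma P1_model_inverse: "P1_model \<O> (inverse t) = P1_model \<O> t"
  by (auto simp: P1_model_def)

text \<open>
  The rings of the affine chart around \<open>0\<close> coincide. In the chart around infinity two cases occur.
  If \<open>1/(t - e)\<close> is a unit at the point, then the point lies in the chart around \<open>0\<close>. Otherwise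
  \<open>t / (t - e) = 1 + e/(t - e)\<close> is a unit there, so \<open>1/t\<close> is defined at the point, which therefore
  lies in the chart of \<open>t\<close> around infinity.
\<close>

lemma P1_model_translate_subset:
  assumes O: "is_subring \<O>" and e: "e \<in> \<O>" and nz: "t \<noteq> 0" "t \<noteq> e"
  shows "P1_model \<O> (t - e) \<subseteq> P1_model \<O> t"
proof
  define t' where "t' = t - e"
  have t': "t' \<noteq> 0" "t = t' + e" using nz by (auto simp: t'_def)
  have e': "- e \<in> \<O>" using O e by (simp add: subring_uminus)
  have gens: "is_subring (ring_gen (insert s \<O>))" "s \<in> ring_gen (insert s \<O>)" "\<O> \<subseteq> ring_gen (insert s \<O>)" for s
    using ring_gen_subring ring_gen_superset[of "insert s \<O>"] by auto
  have ring_eq: "ring_gen (insert (t - e) \<O>) \<subseteq> ring_gen (insert t \<O>)" "ring_gen (insert t \<O>) \<subseteq> ring_gen (insert (t - e) \<O>)"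
  proof -
    show "ring_gen (insert (t - e) \<O>) \<subseteq> ring_gen (insert t \<O>)"
      using gens[of t] e by (intro ring_gen_least) (auto intro!: subring_diff)
    have "t \<in> ring_gen (insert (t - e) \<O>)"
      using gens[of "t - e"] e subring_add[of "ring_gen (insert (t - e) \<O>)" "t - e" e] by auto
    then show "ring_gen (insert t \<O>) \<subseteq> ring_gen (insert (t - e) \<O>)"
      using gens[of "t - e"] by (intro ring_gen_least) auto
  qed
  fix R assume "R \<in> P1_model \<O> (t - e)"
  then consider "R \<in> spec_model (ring_gen (insert t \<O>))" | "R \<in> spec_model (ring_gen (insert (inverse t') \<O>))"
    using ring_eq by (auto simp: P1_model_def t'_def)
  then show "R \<in> P1_model \<O> t"
  proof cases
    case 1
    then show ?thesis by (simp add: P1_model_def)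
  next
    case 2
    let ?A = "ring_gen (insert (inverse t') \<O>)"
    obtain P where "localization ?A P R" by (rule spec_model_localization[OF gens(1) 2])
    then interpret localization ?A P R .
    have O_R: "\<O> \<subseteq> R" using gens(3) A_R by blast
    have it: "inverse t' \<in> R" using gens(2) A_R by blast
    show ?thesis
    proof (cases "inverse t' \<in> P")
      case False
      then have "t' \<in> R" using inverse_in[of "inverse t'"] gens(2) by simp
      then have "t \<in> R" using t'(2) e O_R subring_add[OF R_subring] by auto
      let ?B = "ring_gen (insert t \<O>)"
      have B: "?B \<subseteq> R" using O_R \<open>t \<in> R\<close> R_subring by (intro ring_gen_least) auto
      let ?F = "{b / d |b d. b \<in> ?B \<and> d \<in> ?B \<and> d \<noteq> 0 \<and> inverse d \<in> R}"
      have "t' \<in> ?B" using gens[of t] e by (auto simp: t'_def intro!: subring_diff)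
      then have "1 / t' \<in> ?F" using subring_1[OF gens(1)] it t'(1) by blast
      moreover have "a / 1 \<in> ?F" if "a \<in> \<O>" for a
        using that gens[of t] subring_1[OF gens(1)[of t]] subring_1[OF R_subring] by (intro CollectI exI[of _ a] exI[of _ 1]) auto
      ultimately have "?A \<subseteq> ?F" using fractions_subring[OF gens(1) B] by (intro ring_gen_least) (auto simp: divide_inverse)
      then have "R \<in> spec_model ?B" using B gens(1) by (intro transfer) blast+
      then show ?thesis by (simp add: P1_model_def)
    next
      case True
      let ?q = "1 + e * inverse t'"
      have q_A: "?q \<in> ?A" using gens[of "inverse t'"] e by (auto intro!: subring_closed)
      have "?q \<notin> P"
      proof
        assume "?q \<in> P"
        moreover have "(- e) * inverse t' \<in> P" using True e' gens(3) by (intro prime_rules(5)) auto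
        ultimately have "?q + (- e) * inverse t' \<in> P" by (rule prime_rules(4))
        then show False using prime_rules(3) by simp
      qed
      then have iq: "inverse ?q \<in> R" using q_A by (rule inverse_in[rotated])
      have q: "?q = t / t'" using t' by (simp add: field_simps)
      have "inverse t = inverse t' * inverse ?q" unfolding q using t'(1) nz(1) by (simp add: field_simps)
      then have itR: "inverse t \<in> R" using subring_mult[OF R_subring it iq] by simp
      let ?B = "ring_gen (insert (inverse t) \<O>)"
      have B: "?B \<subseteq> R" using O_R itR R_subring by (intro ring_gen_least) auto
      let ?F = "{b / d |b d. b \<in> ?B \<and> d \<in> ?B \<and> d \<noteq> 0 \<and> inverse d \<in> R}"
      define d where "d = 1 - e * inverse t"
      have d: "d = t' / t" using nz t'_def by (simp add: d_def field_simps)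
      have "d \<in> ?B" unfolding d_def using gens[of "inverse t"] e by (auto intro!: subring_closed)
      moreover have "d \<noteq> 0" using d t'(1) nz by simp
      moreover have "inverse d \<in> R" using q_A A_R by (auto simp: d q)
      ultimately have "inverse t / d \<in> ?F" using gens(2) by blast
      moreover have "inverse t / d = inverse t'" using d nz t'(1) by (simp add: field_simps)
      moreover have "a / 1 \<in> ?F" if "a \<in> \<O>" for a
        using that gens[of "inverse t"] subring_1[OF gens(1)[of "inverse t"]] subring_1[OF R_subring]
        by (intro CollectI exI[of _ a] exI[of _ 1]) auto
      ultimately have "?A \<subseteq> ?F" using fractions_subring[OF gens(1) B] by (intro ring_gen_least) auto
      then have "R \<in> spec_model ?B" using B gens(1) by (intro transfer) blast+
      then show ?thesis by (simp add: P1_model_def)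
    qed
  qed
qed

lemma P1_model_translate:
  assumes "is_subring \<O>" "e \<in> \<O>" "t \<noteq> 0" "t \<noteq> e"
  shows "P1_model \<O> (t - e) = P1_model \<O> t"
proof
  show "P1_model \<O> (t - e) \<subseteq> P1_model \<O> t" by (rule P1_model_translate_subset[OF assms])
  have "P1_model \<O> (t - e - - e) \<subseteq> P1_model \<O> (t - e)"
    using assms by (intro P1_model_translate_subset subring_uminus) auto
  then show "P1_model \<O> t \<subseteq> P1_model \<O> (t - e)" by simp
qed

context dvr
begin

text \<open>
  \<open>\<pi>\<close> is a non-unit of a local ring of the special fibre. A polynomial that is not primitive is
  divisible by \<open>\<pi>\<close>, so the denominators of the local ring are primitive.
\<close>

lemma special_point_subset_gauss_ring:
  assumes "R' \<in> spec_model (ring_gen (insert t R))" "\<not> E \<subseteq> R'"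
  shows "R' \<subseteq> gauss_ring t"
proof -
  let ?A = "ring_gen (insert t R)"
  have A: "is_subring ?A" "?A = {poly P t |P. poly_over R P}" 
    by (rule ring_gen_subring, rule ring_gen_insert[OF R])
  have R_A: "R \<subseteq> ?A" using ring_gen_superset[of "insert t R"] by auto
  obtain P where "localization ?A P R'" by (rule spec_model_localization[OF A(1) assms(1)])
  then interpret loc: localization ?A P R' .
  have "\<pi> \<in> P"
  proof (rule ccontr)
    assume pi_P: "\<pi> \<notin> P"
    have "inverse \<pi> \<in> R'" using loc.inverse_in[of \<pi>] pi pi_P R_A by blast
    then have ip: "inverse \<pi> ^ k \<in> R'" for k by (rule subring_power[OF loc.R_subring])
    have "a \<in> R'" if a: "a \<in> E" for a
    proof (cases "a = 0")
      case False
      obtain k :: int where k: "a * \<pi> powi k \<in> R" using normal_form[OF a False] by blast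
      have "a = (a * \<pi> powi k) * \<pi> powi (- k)" using pi_neq_0 by (simp add: power_int_minus field_simps)
      moreover have "\<pi> powi (- k) \<in> R'"
        using ip pi R_A loc.A_R subring_power[OF loc.R_subring, of \<pi>] by (auto simp: power_int_def)
      moreover have "a * \<pi> powi k \<in> R'" using k R_A loc.A_R by blast
      ultimately show ?thesis using subring_mult[OF loc.R_subring] by metis
    qed (simp add: subring_0[OF loc.R_subring])
    then show False using assms(2) by blast
  qed
  show ?thesis
  proof
    fix g assume "g \<in> R'"
    then obtain a b where ab: "a \<in> ?A" "b \<in> ?A" "b \<notin> P" "g = a / b" by (rule loc.fraction_cases)
    then obtain M Q where MQ: "poly_over R M" "a = poly M t" "poly_over R Q" "b = poly Q t" unfolding A(2) by blast
    have "primitive Q"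
    proof (rule ccontr)
      assume "\<not> primitive Q"
      then have "coeff Q i / \<pi> \<in> R" for i using MQ(3) by (auto simp: primitive_def)
      then have "poly_over R (smult (inverse \<pi>) Q)" using R by (simp add: poly_over_iff subring_0 divide_inverse mult.commute)
      then have "poly (smult (inverse \<pi>) Q) t \<in> ?A" unfolding A(2) by blast
      then have "poly (smult (inverse \<pi>) Q) t * \<pi> \<in> P" using \<open>\<pi> \<in> P\<close> by (rule loc.prime_rules(5))
      moreover have "poly (smult (inverse \<pi>) Q) t * \<pi> = b" using MQ(4) pi_neq_0 by simp
      ultimately show False using ab(3) by simp
    qed
    then show "g \<in> gauss_ring t" using MQ ab(4) by (auto intro: gauss_ringI)
  qed
qed

text \<open>
  The Gauss ring is the localization of \<open>R[t]\<close> at the prime ideal \<open>\<pi>R[t]\<close>, whose complement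
  consists of the primitive polynomials.
\<close>

lemma gauss_ring_in_spec_model:
  assumes t: "transcendental_over E t"
  shows "gauss_ring t \<in> spec_model (ring_gen (insert t R))"
proof -
  interpret G: dvr "gauss_ring t" "ratfun E t" \<pi> by (rule dvr_gauss[OF t])
  let ?A = "ring_gen (insert t R)"
  have A: "is_subring ?A" "?A = {poly P t |P. poly_over R P}" 
    by (rule ring_gen_subring, rule ring_gen_insert[OF R])
  define P where "P = {a \<in> ?A. a / \<pi> \<in> gauss_ring t}"
  have A_G: "?A \<subseteq> gauss_ring t" unfolding A(2) using gauss_ring_poly[OF t] by blast
  have "prime_ideal ?A P"
    unfolding prime_ideal_def
  proof (intro conjI ballI impI)
    show "P \<subseteq> ?A" "0 \<in> P" using subring_0[OF A(1)] subring_0[OF G.R] by (auto simp: P_def)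
    show "1 \<notin> P" using G.one_div_pi by (simp add: P_def)
  next
    fix a b assume "a \<in> P" "b \<in> P"
    then show "a + b \<in> P" using A(1) subring_add[OF G.R, of "a / \<pi>" "b / \<pi>"]
      by (auto simp: P_def add_divide_distrib intro: subring_add)
  next
    fix a b assume "a \<in> ?A" "b \<in> P"
    then show "a * b \<in> P" using A_G subring_mult[OF G.R, of a "b / \<pi>"] A(1) by (auto simp: P_def intro: subring_mult)
  next
    fix a b assume "a \<in> ?A" "b \<in> ?A" "a * b \<in> P"
    moreover from this have "a * b / \<pi> \<in> gauss_ring t" unfolding P_def by blast
    moreover have "a \<in> gauss_ring t" "b \<in> gauss_ring t" using calculation A_G by blast+
    ultimately show "a \<in> P \<or> b \<in> P" using G.divide_prime[of a b] unfolding P_def by blast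
  qed
  moreover have "gauss_ring t = {a / b |a b. a \<in> ?A \<and> b \<in> ?A - P}"
  proof -
    have "primitive Q \<longleftrightarrow> poly Q t \<notin> P" if Q: "poly_over R Q" for Q
    proof -
      have "poly Q t / \<pi> \<in> gauss_ring t \<longleftrightarrow> \<not> primitive Q"
      proof
        assume "poly Q t / \<pi> \<in> gauss_ring t"
        then have "poly (smult (inverse \<pi>) Q) t \<in> gauss_ring t" by (simp add: divide_inverse mult.commute)
        moreover have "poly_over E (smult (inverse \<pi>) Q)"
          using poly_over_mono[OF Q R_E] pi_E E by (intro poly_over_smult subfield_subring subfield_inverse)
        ultimately have "poly_over R (smult (inverse \<pi>) Q)" by (rule gauss_ring_poly_iff[OF t, rotated])
        then show "\<not> primitive Q" using poly_over_coeff[OF R, of "smult (inverse \<pi>) Q"]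
          by (auto simp: primitive_def divide_inverse mult.commute)
      next
        assume "\<not> primitive Q"
        then have "coeff Q i / \<pi> \<in> R" for i using Q by (auto simp: primitive_def)
        then have "poly_over R (smult (inverse \<pi>) Q)" using R by (simp add: poly_over_iff subring_0 divide_inverse mult.commute)
        then have "poly (smult (inverse \<pi>) Q) t \<in> gauss_ring t" by (rule gauss_ring_poly[OF t])
        then show "poly Q t / \<pi> \<in> gauss_ring t" by (simp add: divide_inverse mult.commute)
      qed
      then show ?thesis using Q by (auto simp: P_def A(2))
    qed
    then show ?thesis unfolding gauss_ring_def A(2) using primitive_over by blast
  qed
  ultimately show ?thesis unfolding spec_model_def by blast
qed

text \<open>
  Every special point is a specialization of the Gauss point, which is the generic point of the
  special fibre; the charts \<open>t\<close> and \<open>1/t\<close> have the same Gauss ring.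
\<close>

lemma component_P1_model:
  assumes t: "transcendental_over E t" and v: "v \<in> components E (P1_model R t)"
  shows "v = gauss_ring t"
proof -
  have t0: "t \<noteq> 0" using transc_neq[OF subfield_subring[OF E] t] subring_0[OF subfield_subring[OF E]] by auto
  have v': "v \<in> P1_model R t" "\<not> E \<subseteq> v" using v by (auto simp: components_def special_points_def)
  have "v \<subseteq> gauss_ring t"
    using v' special_point_subset_gauss_ring[of v t] special_point_subset_gauss_ring[of v "inverse t"] gauss_ring_inverse[OF t0]
    by (auto simp: P1_model_def)
  moreover have "gauss_ring t \<in> special_points E (P1_model R t)"
  proof -
    interpret G: dvr "gauss_ring t" "ratfun E t" \<pi> by (rule dvr_gauss[OF t])
    have "\<not> E \<subseteq> gauss_ring t" using G.pi(2) pi_E subfield_inverse[OF E] by blast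
    then show ?thesis using gauss_ring_in_spec_model[OF t] by (simp add: special_points_def P1_model_def)
  qed
  ultimately show ?thesis using v by (auto simp: components_def)
qed

end

section \<open>Kummer extensions of fields\<close>

text \<open>
  Unique factorization for products of linear polynomials, indexed so that repeated roots are
  allowed.
\<close>

lemma monic_dvd_prod_linear:
  fixes a :: "'i \<Rightarrow> 'a::field"
  assumes "finite I" "lead_coeff G = 1" "G dvd (\<Prod>i\<in>I. [:- a i, 1:])"
  shows "\<exists>J\<subseteq>I. G = (\<Prod>i\<in>J. [:- a i, 1:])"
  using assms
proof (induction I arbitrary: G)
  case empty
  moreover have "G \<noteq> 0" using empty.prems(1) by auto
  ultimately have "degree G = 0" by (simp add: is_unit_iff_degree)
  then have "G = [:1:]" using empty.prems(1) by (metis degree_eq_zeroE coeff_pCons_0)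
  then show ?case by (intro exI[of _ "{}"]) (simp add: one_pCons)
next
  case (insert j I)
  obtain H where "(\<Prod>i\<in>insert j I. [:- a i, 1:]) = G * H" using insert.prems(2) by (rule dvdE)
  then have H: "[:- a j, 1:] * (\<Prod>i\<in>I. [:- a i, 1:]) = G * H" using insert.hyps by simp
  show ?case
  proof (cases "poly G (a j) = 0")
    case True
    then obtain G' where G': "G = [:- a j, 1:] * G'" unfolding poly_eq_0_iff_dvd by (rule dvdE)
    have "[:- a j, 1:] * (\<Prod>i\<in>I. [:- a i, 1:]) = [:- a j, 1:] * (G' * H)" using H unfolding G' mult.assoc .
    then have "(\<Prod>i\<in>I. [:- a i, 1:]) = G' * H" by (subst (asm) mult_cancel_left) simp
    moreover have "lead_coeff G' = 1" using insert.prems(1) unfolding G' lead_coeff_mult by simp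
    ultimately obtain J where J: "J \<subseteq> I" "G' = (\<Prod>i\<in>J. [:- a i, 1:])" using insert.IH[of G'] by auto
    then have "G = (\<Prod>i\<in>insert j J. [:- a i, 1:])"
      using insert.hyps finite_subset[OF J(1)] unfolding G' by (subst prod.insert) auto
    then show ?thesis using J(1) by (intro exI[of _ "insert j J"]) auto
  next
    case False
    have "poly (G * H) (a j) = 0" by (simp flip: H)
    then have "poly H (a j) = 0" using False by simp
    then obtain H' where H': "H = [:- a j, 1:] * H'" unfolding poly_eq_0_iff_dvd by (rule dvdE)
    have "[:- a j, 1:] * (\<Prod>i\<in>I. [:- a i, 1:]) = [:- a j, 1:] * (G * H')" using H unfolding H' by (simp only: mult_ac)
    then have "(\<Prod>i\<in>I. [:- a i, 1:]) = G * H'" by (subst (asm) mult_cancel_left) simp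
    then obtain J where "J \<subseteq> I" "G = (\<Prod>i\<in>J. [:- a i, 1:])" using insert.IH[OF insert.prems(1)] by auto
    then show ?thesis by blast
  qed
qed

lemma primitive_root_power_eq:
  fixes \<zeta> :: "'a::field"
  assumes "\<zeta> ^ n = 1" "\<And>k. 0 < k \<Longrightarrow> k < n \<Longrightarrow> \<zeta> ^ k \<noteq> 1" "i < n" "j < n" "\<zeta> ^ i = \<zeta> ^ j"
  shows "i = j"
proof -
  have nz: "\<zeta> \<noteq> 0" using assms(1,3) by (metis less_nat_zero_code neq0_conv power_0_left zero_neq_one)
  have "i = j" if "i \<le> j" "j < n" "\<zeta> ^ i = \<zeta> ^ j" for i j
  proof (rule ccontr)
    assume "i \<noteq> j"
    have "\<zeta> ^ j = \<zeta> ^ i * \<zeta> ^ (j - i)" using that(1) by (simp flip: power_add)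
    then have "\<zeta> ^ (j - i) = 1" using that(3) nz by simp
    then show False using assms(2)[of "j - i"] that \<open>i \<noteq> j\<close> by simp
  qed
  then show ?thesis using assms by (metis nle_le)
qed

text \<open>
  The difference of the two sides has degree less than \<open>n\<close> and vanishes at the \<open>n\<close> conjugates of
  \<open>y\<close>.
\<close>

lemma prod_conjugates:
  fixes \<zeta> y :: "'a::field"
  assumes n: "n > 0" and \<zeta>: "\<zeta> ^ n = 1" "\<And>k. 0 < k \<Longrightarrow> k < n \<Longrightarrow> \<zeta> ^ k \<noteq> 1" and y: "y \<noteq> 0"
  shows "(\<Prod>i<n. [:- (\<zeta> ^ i * y), 1:]) = monom 1 n - [:y ^ n:]"
proof (rule ccontr)
  let ?D = "monom 1 n - [:y ^ n:]" and ?Q = "\<Prod>i<n. [:- (\<zeta> ^ i * y), 1:]"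
  assume "\<not> ?thesis"
  then have nz: "?D - ?Q \<noteq> 0" by simp
  have Q: "lead_coeff ?Q = 1" "degree ?Q = n" using prod_linear_monic[of "{..<n}" "\<lambda>i. - (\<zeta> ^ i * y)"] by auto
  have "degree ?D \<le> n" by (intro degree_diff_le degree_monom_le) simp
  then have le: "degree (?D - ?Q) \<le> n" using Q(2) by (intro degree_diff_le[OF \<open>degree ?D \<le> n\<close>]) simp
  have "coeff (?D - ?Q) n = 0" using Q n by (simp add: coeff_pCons split: nat.splits)
  then have lt: "degree (?D - ?Q) < n" using le nz by (metis le_neq_implies_less leading_coeff_0_iff)
  have "inj_on (\<lambda>i. \<zeta> ^ i * y) {..<n}"
    using primitive_root_power_eq[OF \<zeta>] y by (auto intro!: inj_onI)
  then have card: "card ((\<lambda>i. \<zeta> ^ i * y) ` {..<n}) = n" by (simp add: card_image)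
  have "(\<zeta> ^ i) ^ n = 1" for i using \<zeta>(1) by (metis mult.commute power_mult power_one)
  then have "poly (?D - ?Q) b = 0" if "b \<in> (\<lambda>i. \<zeta> ^ i * y) ` {..<n}" for b
    using that by (auto simp: poly_monom poly_prod power_mult_distrib)
  moreover have "embedded_field (UNIV :: 'a set)"
    unfolding embedded_field_def using UNIV_subring right_inverse by blast
  ultimately have "n \<le> degree (?D - ?Q)"
    using card card_roots_le_degree[OF _ _ nz, of UNIV "(\<lambda>i. \<zeta> ^ i * y) ` {..<n}"] by (simp add: poly_over_def)
  then show False using lt by simp
qed

text \<open>
  The minimal polynomial of \<open>y\<close> divides \<open>T\<^sup>n - y\<^sup>n\<close>, so it is the product of \<open>T - \<zeta>\<^sup>i y\<close> over some
  of the conjugates, and its constant term is a root of unity, up to sign, times \<open>y\<^sup>d\<close>. Hence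
  \<open>y\<^sup>d \<in> E\<close>. If \<open>d < n\<close>, the least exponent \<open>e\<close> with \<open>y\<^sup>e \<in> E\<close> is a proper divisor of \<open>n\<close>, and
  \<open>y\<^sup>n\<close> is a proper power in \<open>E\<close>.
\<close>

lemma kummer_irreducible:
  fixes \<zeta> y :: "'a::field"
  assumes E: "is_subfield E" and n: "n > 0"
    and \<zeta>: "\<zeta> \<in> E" "\<zeta> ^ n = 1" "\<And>k. 0 < k \<Longrightarrow> k < n \<Longrightarrow> \<zeta> ^ k \<noteq> 1"
    and y: "y ^ n \<in> E" "y \<noteq> 0"
    and no_power: "\<And>q g. q dvd n \<Longrightarrow> q > 1 \<Longrightarrow> g \<in> E \<Longrightarrow> g ^ q \<noteq> y ^ n"
    and G: "poly_over E G" "degree G < n" "poly G y = 0"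
  shows "G = 0"
proof (rule ccontr)
  assume "G \<noteq> 0"
  note sub = subfield_subring[OF E]
  define Pr where "Pr k \<longleftrightarrow> (\<exists>G. poly_over E G \<and> G \<noteq> 0 \<and> poly G y = 0 \<and> degree G = k)" for k
  define d where "d = (LEAST k. Pr k)"
  have "Pr (degree G)" using G \<open>G \<noteq> 0\<close> by (auto simp: Pr_def)
  then have "Pr d" "d < n" unfolding d_def using G(2) by (auto intro: LeastI dest: Least_le order.strict_trans1)
  then obtain M where M: "poly_over E M" "M \<noteq> 0" "poly M y = 0" "degree M = d" by (auto simp: Pr_def)
  define M1 where "M1 = smult (inverse (lead_coeff M)) M"
  have M1: "poly_over E M1" "poly M1 y = 0" "degree M1 = d" "lead_coeff M1 = 1"
    unfolding M1_def using M sub E by (auto intro!: poly_over_smult subfield_inverse poly_over_coeff)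
  have "d > 0"
  proof (rule ccontr)
    assume "\<not> d > 0"
    then obtain a where "M1 = [:a:]" using M1(3) by (metis degree_eq_zeroE neq0_conv)
    then show False using M1(2,4) by simp
  qed
  have over: "poly_over E (monom 1 n - [:y ^ n:])"
    using sub y by (intro poly_over_diff poly_over_monom poly_over_const subring_1)
  have "\<exists>H R. poly_over E H \<and> poly_over E R \<and> monom 1 n - [:y ^ n:] = M1 * H + R \<and> degree R < degree M1"
    using \<open>d > 0\<close> M1 by (intro monic_division[OF sub over M1(1,4)]) simp
  then obtain H R where HR: "poly_over E H" "poly_over E R" "monom 1 n - [:y ^ n:] = M1 * H + R" "degree R < d"
    using M1(3) by auto
  have "poly R y = 0" using arg_cong[OF HR(3), of "\<lambda>p. poly p y"] M1(2) by (simp add: poly_monom)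
  then have "R = 0" using not_less_Least[of "degree R" Pr] HR unfolding d_def[symmetric] by (auto simp: Pr_def)
  then have "M1 dvd (\<Prod>i<n. [:- (\<zeta> ^ i * y), 1:])" using HR(3) prod_conjugates[OF n \<zeta>(2,3) y(2)] by simp
  from monic_dvd_prod_linear[OF finite_lessThan M1(4) this]
  obtain J where J: "J \<subseteq> {..<n}" "M1 = (\<Prod>i\<in>J. [:- (\<zeta> ^ i * y), 1:])" by blast
  have fin: "finite J" using J(1) finite_subset by blast
  have "card J = d" using M1(3) prod_linear_monic[OF fin, of "\<lambda>i. - (\<zeta> ^ i * y)"] J(2) by simp
  moreover have "poly M1 0 = (\<Prod>i\<in>J. - (\<zeta> ^ i)) * y ^ card J"
    unfolding J(2) poly_prod by (simp add: prod.distrib flip: mult_minus_left)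
  moreover have "\<zeta> \<noteq> 0" using \<zeta>(2) n by (auto simp: power_0_left)
  then have "(\<Prod>i\<in>J. - (\<zeta> ^ i)) \<noteq> 0" using fin by simp
  ultimately have "y ^ d = poly M1 0 / (\<Prod>i\<in>J. - (\<zeta> ^ i))" by simp
  moreover have "poly M1 0 \<in> E" using M1(1) sub by (intro poly_in_subring subring_0)
  moreover have "(\<Prod>i\<in>J. - (\<zeta> ^ i)) \<in> E" using \<zeta>(1) sub by (intro subring_prod subring_uminus subring_power)
  ultimately have "y ^ d \<in> E" using E by (simp add: subfield_divide)
  define e where "e = (LEAST k. 0 < k \<and> y ^ k \<in> E)"
  have "0 < e \<and> y ^ e \<in> E" unfolding e_def using \<open>y ^ d \<in> E\<close> \<open>d > 0\<close> LeastI[of "\<lambda>k. 0 < k \<and> y ^ k \<in> E" d] by simp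
  then have e: "0 < e" "y ^ e \<in> E" by auto
  have "e \<le> d" unfolding e_def using \<open>y ^ d \<in> E\<close> \<open>d > 0\<close> by (intro Least_le) simp
  have "y ^ n = (y ^ e) ^ (n div e) * y ^ (n mod e)" by (simp flip: power_mult power_add)
  then have "y ^ (n mod e) = y ^ n / (y ^ e) ^ (n div e)" using y(2) by simp
  then have "y ^ (n mod e) \<in> E" using e y E by (simp add: subfield_divide subring_power[OF sub])
  moreover have "n mod e < e" using e by simp
  ultimately have "n mod e = 0" using not_less_Least[of "n mod e" "\<lambda>k. 0 < k \<and> y ^ k \<in> E"] unfolding e_def[symmetric] by auto
  then have ne: "n = e * (n div e)" by auto
  have "(y ^ e) ^ (n div e) = y ^ n" using ne by (simp flip: power_mult)
  moreover have "n div e dvd n" using ne by (metis dvd_triv_right)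
  moreover have "n div e > 1"
  proof (rule ccontr)
    assume "\<not> n div e > 1"
    then have "e * (n div e) \<le> e * 1" by (intro mult_le_mono2) simp
    then show False using ne \<open>e \<le> d\<close> \<open>d < n\<close> by simp
  qed
  ultimately show False using no_power e(2) by blast
qed

lemma order_power: "(P :: 'a::idom poly) \<noteq> 0 \<Longrightarrow> Polynomial.order a (P ^ k) = k * Polynomial.order a P"
  by (induction k) (auto simp: order_mult)

text \<open>
  If \<open>f = (P/Q)\<^sup>q\<close>, then \<open>q\<close> divides the order of \<open>f\<close> at every point, hence the greatest common
  divisor of \<open>n\<close> and the orders.
\<close>

lemma not_power_in_ratfun:
  fixes f :: "'a::field poly"
  assumes L: "is_subfield L" and x: "transcendental_over L x" and f: "poly_over L f" "f \<noteq> 0"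
    and gcd: "Gcd (insert n ((\<lambda>\<alpha>. Polynomial.order \<alpha> f) ` {\<alpha>. poly f \<alpha> = 0})) = 1"
    and q: "q dvd n" "q > 1" and g: "g \<in> ratfun L x"
  shows "g ^ q \<noteq> poly f x"
proof
  note sub = subfield_subring[OF L]
  assume eq: "g ^ q = poly f x"
  obtain P Q where PQ: "poly_over L P" "poly_over L Q" "Q \<noteq> 0" "g = poly P x / poly Q x" using g by (auto simp: ratfun_def)
  have "poly Q x \<noteq> 0" using transc_poly_neq_0[OF x PQ(2,3)] .
  then have "poly (f * Q ^ q) x = poly (P ^ q) x" using eq by (simp add: PQ(4) power_divide field_simps)
  then have id: "f * Q ^ q = P ^ q" using PQ f sub by (intro transc_poly_eqI[OF sub x] poly_over_mult poly_over_power)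
  have "P \<noteq> 0" using id f(2) PQ(3) q(2) by (auto simp: power_0_left)
  have "q dvd Polynomial.order \<alpha> f" for \<alpha>
  proof -
    have "Polynomial.order \<alpha> f + q * Polynomial.order \<alpha> Q = q * Polynomial.order \<alpha> P"
      using arg_cong[OF id, of "Polynomial.order \<alpha>"] f(2) PQ(3) \<open>P \<noteq> 0\<close> by (simp add: order_mult order_power)
    then show ?thesis by (metis dvd_add_left_iff dvd_triv_left)
  qed
  then have "q dvd Gcd (insert n ((\<lambda>\<alpha>. Polynomial.order \<alpha> f) ` {\<alpha>. poly f \<alpha> = 0}))"
    using q(1) by (intro Gcd_greatest) auto
  then have "q dvd 1" unfolding gcd .
  then show False using q(2) by simp
qed

text \<open>
  The ambient field is the extension of \<open>E\<close> of degree \<open>n\<close> generated by an \<open>n\<close>-th root; the last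
  assumption is the irreducibility of \<open>T\<^sup>n - y\<^sup>n\<close> over \<open>E\<close>.
\<close>

locale kummer_field =
  fixes E :: "'a::field set" and y :: 'a and n :: nat
  assumes E: "is_subfield E" and n: "n > 0" and yn: "y ^ n \<in> E"
    and gen: "field_gen (E \<union> {y}) = UNIV"
    and indep: "\<And>G. poly_over E G \<Longrightarrow> degree G < n \<Longrightarrow> poly G y = 0 \<Longrightarrow> G = 0"
begin

lemmas E_ring = subfield_subring[OF E]

definition minpoly where "minpoly = monom 1 n - [:y ^ n:]"

lemma minpoly: "poly_over E minpoly" "lead_coeff minpoly = 1" "degree minpoly = n" "poly minpoly y = 0"
proof -
  show "poly_over E minpoly" unfolding minpoly_def
    using E_ring yn by (intro poly_over_diff poly_over_monom poly_over_const subring_1)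
  have "coeff minpoly n = 1" using n by (simp add: minpoly_def coeff_pCons split: nat.splits)
  moreover have "degree minpoly \<le> n" unfolding minpoly_def by (intro degree_diff_le degree_monom_le) simp
  ultimately show "degree minpoly = n" "lead_coeff minpoly = 1" using le_degree[of minpoly n] by auto
  show "poly minpoly y = 0" by (simp add: minpoly_def poly_monom)
qed

lemma reduce: "poly_over E G \<Longrightarrow> \<exists>H R. poly_over E H \<and> poly_over E R \<and> G = minpoly * H + R \<and> degree R < n"
  using monic_division[OF E_ring _ minpoly(1,2), of G] minpoly(3) n by auto

lemma kernel: "poly_over E G \<Longrightarrow> poly G y = 0 \<Longrightarrow> \<exists>H. poly_over E H \<and> G = minpoly * H"
proof -
  assume G: "poly_over E G" "poly G y = 0"
  obtain H R where HR: "poly_over E H" "poly_over E R" "G = minpoly * H + R" "degree R < n" using reduce[OF G(1)] by blast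
  then have "poly R y = 0" using G(2) minpoly(4) by simp
  then have "R = 0" using indep HR by blast
  then show ?thesis using HR by auto
qed

lemma poly_y_subring: "is_subring {poly G y |G. poly_over E G}"
  using ring_gen_subring[of "insert y E"] ring_gen_insert[OF E_ring, of y] by simp

text \<open>
  The polynomials with value at \<open>y\<close> in the ideal generated by \<open>e = G(y) \<noteq> 0\<close> form an ideal of
  \<open>E[T]\<close> that contains \<open>minpoly\<close> and \<open>G\<close>. A nonconstant generator \<open>M\<close> of it would be a factor of
  the irreducible \<open>minpoly\<close>, so \<open>M(y) = 0\<close>; but then \<open>e = 0\<close>, since \<open>M\<close> divides \<open>G\<close>.
\<close>

lemma poly_y_inverse:
  assumes G: "poly_over E G" "poly G y \<noteq> 0"
  shows "\<exists>H. poly_over E H \<and> poly G y * poly H y = 1"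
proof -
  define I where "I = {M. poly_over E M \<and> (\<exists>H. poly_over E H \<and> poly M y = poly G y * poly H y)}"
  have G_I: "G \<in> I" using G poly_over_1[OF E_ring] by (auto simp: I_def intro!: exI[of _ 1])
  have minpoly_I: "minpoly \<in> I" using minpoly poly_over_0 by (auto simp: I_def intro!: exI[of _ 0] poly_over_0[OF E_ring])
  have I_closed: "P - M * Q \<in> I" if "P \<in> I" "M \<in> I" "poly_over E Q" for P M Q
  proof -
    obtain H1 H2 where *: "poly_over E H1" "poly P y = poly G y * poly H1 y" "poly_over E H2" "poly M y = poly G y * poly H2 y"
      using \<open>P \<in> I\<close> \<open>M \<in> I\<close> by (auto simp: I_def)
    have "poly (P - M * Q) y = poly G y * poly (H1 - H2 * Q) y" using * by (simp add: algebra_simps)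
    moreover have "poly_over E (H1 - H2 * Q)" "poly_over E (P - M * Q)"
      using * that E_ring by (auto simp: I_def intro!: poly_over_diff poly_over_mult)
    ultimately show ?thesis by (auto simp: I_def)
  qed
  define Pr where "Pr k \<longleftrightarrow> (\<exists>M\<in>I. M \<noteq> 0 \<and> degree M = k)" for k
  define d where "d = (LEAST k. Pr k)"
  have "minpoly \<noteq> 0" using minpoly(2) by auto
  then have "Pr n" using minpoly_I minpoly(3) by (auto simp: Pr_def)
  then have "Pr d" unfolding d_def by (rule LeastI)
  then obtain M0 where M0: "M0 \<in> I" "M0 \<noteq> 0" "degree M0 = d" by (auto simp: Pr_def)
  define M where "M = smult (inverse (lead_coeff M0)) M0"
  have lc: "inverse (lead_coeff M0) \<in> E" using M0 E E_ring by (auto simp: I_def intro!: subfield_inverse poly_over_coeff)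
  have "0 \<in> I" using poly_over_0[OF E_ring] by (auto simp: I_def intro!: exI[of _ 0])
  then have "0 - M0 * [:- inverse (lead_coeff M0):] \<in> I"
    using lc M0 E_ring by (intro I_closed poly_over_const subring_uminus)
  moreover have "coeff M0 d \<noteq> 0" using M0 by auto
  ultimately have M: "M \<in> I" "lead_coeff M = 1" "degree M = d" using M0 by (simp_all add: M_def)
  have M_over: "poly_over E M" using M by (simp add: I_def)
  have dvd: "\<exists>H. poly_over E H \<and> P = M * H" if P: "P \<in> I" and d: "d > 0" for P
  proof -
    have "poly_over E P" using P by (simp add: I_def)
    then obtain H R where HR: "poly_over E H" "poly_over E R" "P = M * H + R" "degree R < d"
      using monic_division[OF E_ring _ M_over M(2)] d M(3) by blast
    have "R \<in> I" using I_closed[OF P M(1) HR(1)] HR(3) by simp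
    then have "R = 0" using not_less_Least[of "degree R" Pr] HR(4) unfolding d_def[symmetric] by (auto simp: Pr_def)
    then show ?thesis using HR by auto
  qed
  have "d = 0"
  proof (rule ccontr)
    assume "d \<noteq> 0"
    obtain H where H: "poly_over E H" "minpoly = M * H" using dvd[OF minpoly_I] \<open>d \<noteq> 0\<close> by blast
    have nz: "M \<noteq> 0" "H \<noteq> 0" using H \<open>minpoly \<noteq> 0\<close> by auto
    have deg: "n = d + degree H" using minpoly(3) H nz M(3) by (simp add: degree_mult_eq)
    have "poly M y = 0 \<or> poly H y = 0" using minpoly(4) H(2) by simp
    then have "poly M y = 0" using indep[OF H(1)] deg \<open>d \<noteq> 0\<close> nz by auto
    obtain H' where "poly_over E H'" "G = M * H'" using dvd[OF G_I] \<open>d \<noteq> 0\<close> by blast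
    then show False using \<open>poly M y = 0\<close> G(2) by simp
  qed
  then have "M = [:1:]" using M by (metis degree_eq_zeroE coeff_pCons_0)
  then show ?thesis using M(1) by (auto simp: I_def)
qed

lemma span: "\<exists>G. poly_over E G \<and> degree G < n \<and> e = poly G y"
proof -
  let ?A = "{poly G y |G. poly_over E G}"
  have "is_subfield ?A"
    unfolding is_subfield_def
  proof (intro conjI ballI poly_y_subring)
    fix a assume "a \<in> ?A"
    then obtain G where G: "poly_over E G" "a = poly G y" by blast
    show "inverse a \<in> ?A"
    proof (cases "a = 0")
      case True
      then show ?thesis using subring_0[OF poly_y_subring] by simp
    next
      case False
      then obtain H where "poly_over E H" "a * poly H y = 1" using poly_y_inverse[OF G(1)] G(2) by auto
      then show ?thesis using inverse_unique[of a "poly H y"] by blast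
    qed
  qed
  moreover have "E \<union> {y} \<subseteq> ?A"
    using poly_over_const[OF E_ring] poly_over_linear[OF E_ring subring_0[OF E_ring] subring_1[OF E_ring]]
    by (auto intro: exI[of _ "[:_:]"] exI[of _ "[:0, 1:]"])
  ultimately have "e \<in> ?A" using field_gen_subset gen by blast
  then obtain G where G: "poly_over E G" "e = poly G y" by blast
  obtain H R where "poly_over E H" "poly_over E R" "G = minpoly * H + R" "degree R < n" using reduce[OF G(1)] by blast
  then show ?thesis using G(2) minpoly(4) by auto
qed

lemma indep_eq:
  assumes "poly_over E G" "degree G < n" "poly_over E H" "degree H < n" "poly G y = poly H y"
  shows "G = H"
proof -
  have "poly (G - H) y = 0" using assms(5) by simp
  then have "G - H = 0"
    by (rule indep[OF poly_over_diff[OF E_ring assms(1,3)] degree_diff_less[OF assms(2,4)]])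
  then show ?thesis by simp
qed

text \<open>
  \<open>E(y)\<close> is \<open>E[T]/(T\<^sup>n - y\<^sup>n)\<close>, and \<open>z\<close> satisfies the transformed equation.
\<close>

lemma extend_hom:
  assumes \<theta>: "ring_hom_on E \<theta>" and z: "z ^ n = \<theta> (y ^ n)"
  shows "\<exists>\<tau>. ring_hom_on UNIV \<tau> \<and> (\<forall>a\<in>E. \<tau> a = \<theta> a) \<and> \<tau> y = (z :: 'a)"
proof -
  have kern: "poly (map_poly \<theta> G) z = 0" if G: "poly_over E G" "poly G y = 0" for G
  proof -
    obtain H where H: "poly_over E H" "G = minpoly * H" using kernel[OF G] by blast
    have "map_poly \<theta> minpoly = monom 1 n - [:\<theta> (y ^ n):]"
    proof -
      have "map_poly \<theta> minpoly = map_poly \<theta> (monom 1 n) - map_poly \<theta> [:y ^ n:]"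
        unfolding minpoly_def using E_ring yn by (intro map_hom_diff[OF E_ring \<theta>] poly_over_monom poly_over_const subring_1)
      then show ?thesis using ring_hom_on_0[OF E_ring \<theta>] ring_hom_on_1[OF \<theta>]
        by (simp add: map_poly_monom map_hom_pCons[OF E_ring \<theta>])
    qed
    then show ?thesis using map_hom_mult[OF E_ring \<theta> minpoly(1) H(1)] H(2) z by (simp add: poly_monom)
  qed
  have wd: "poly (map_poly \<theta> G) z = poly (map_poly \<theta> H) z"
    if "poly_over E G" "poly_over E H" "poly G y = poly H y" for G H
  proof -
    have "poly (G - H) y = 0" using that(3) by simp
    then have "poly (map_poly \<theta> (G - H)) z = 0" by (rule kern[OF poly_over_diff[OF E_ring that(1,2)]])
    then show ?thesis unfolding map_hom_diff[OF E_ring \<theta> that(1,2)] by simp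
  qed
  define rep where "rep e = (SOME G. poly_over E G \<and> e = poly G y)" for e
  have rep: "poly_over E (rep e)" "e = poly (rep e) y" for e
    using someI_ex[of "\<lambda>G. poly_over E G \<and> e = poly G y"] span[of e] unfolding rep_def by blast+
  define \<tau> where "\<tau> e = poly (map_poly \<theta> (rep e)) z" for e
  have \<tau>: "\<tau> (poly G y) = poly (map_poly \<theta> G) z" if "poly_over E G" for G
    unfolding \<tau>_def using wd[OF rep(1) that] rep(2)[of "poly G y"] by simp
  have "\<tau> a = \<theta> a" if "a \<in> E" for a
    using \<tau>[OF poly_over_const[OF E_ring that]] ring_hom_on_0[OF E_ring \<theta>] by (simp add: map_hom_pCons[OF E_ring \<theta>])
  moreover have "\<tau> y = z"
    using \<tau>[of "[:0, 1:]"] ring_hom_on_0[OF E_ring \<theta>] ring_hom_on_1[OF \<theta>] E_ring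
    by (simp add: map_hom_pCons[OF E_ring \<theta>] poly_over_linear subring_0 subring_1)
  moreover have "ring_hom_on UNIV \<tau>"
    unfolding ring_hom_on_def
  proof (intro conjI ballI)
    show "\<tau> 1 = 1" using \<tau>[OF poly_over_1[OF E_ring]] ring_hom_on_0[OF E_ring \<theta>] ring_hom_on_1[OF \<theta>]
      by (simp add: map_poly_1')
    fix a b
    have "\<tau> (poly (rep a + rep b) y) = \<tau> a + \<tau> b"
      using \<tau>[OF poly_over_add[OF E_ring rep(1) rep(1)]] map_hom_add[OF E_ring \<theta> rep(1) rep(1)] by (simp add: \<tau>_def)
    then show "\<tau> (a + b) = \<tau> a + \<tau> b" using rep(2) by simp
    have "\<tau> (poly (rep a * rep b) y) = \<tau> a * \<tau> b"
      using \<tau>[OF poly_over_mult[OF E_ring rep(1) rep(1)]] map_hom_mult[OF E_ring \<theta> rep(1) rep(1)] by (simp add: \<tau>_def)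
    then show "\<tau> (a * b) = \<tau> a * \<tau> b" using rep(2) by simp
  qed
  ultimately show ?thesis by blast
qed

end

lemma ring_hom_on_inverse:
  fixes A :: "'a::field set" and h :: "'a \<Rightarrow> 'b::field"
  assumes A: "is_subfield A" and h: "ring_hom_on A h" and a: "a \<in> A"
  shows "h (inverse a) = inverse (h a)"
proof (cases "a = 0")
  case True
  then show ?thesis using ring_hom_on_0[OF subfield_subring[OF A] h] by simp
next
  case False
  have "h a * h (inverse a) = h 1"
    using ring_hom_on_mult[OF h a subfield_inverse[OF A a]] False by simp
  then show ?thesis using ring_hom_on_1[OF h] by (simp add: inverse_unique)
qed

lemma ring_hom_on_inj:
  fixes A :: "'a::field set" and h :: "'a \<Rightarrow> 'b::field"
  assumes A: "is_subfield A" and h: "ring_hom_on A h" and a: "a \<in> A" "a \<noteq> 0"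
  shows "h a \<noteq> 0"
proof
  assume "h a = 0"
  then have "h (a * inverse a) = 0" using ring_hom_on_mult[OF h a(1) subfield_inverse[OF A a(1)]] by simp
  then show False using a(2) ring_hom_on_1[OF h] by simp
qed

text \<open>
  An endomorphism of the coefficients is injective and so preserves nonzero denominators; the
  value does not depend on the fraction, because an identity of values at the transcendental \<open>x\<close>
  is an identity of polynomials.
\<close>

lemma ratfun_hom:
  fixes L :: "'a::field set"
  assumes L: "is_subfield L" and x: "transcendental_over L x"
    and \<sigma>: "ring_hom_on L \<sigma>" "\<sigma> ` L \<subseteq> L"
  shows "\<exists>\<theta>. ring_hom_on (ratfun L x) \<theta> \<and> (\<forall>a\<in>L. \<theta> a = \<sigma> a) \<and> \<theta> x = x"
proof -
  note sub = subfield_subring[OF L]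
  have over: "poly_over L (map_poly \<sigma> P)" if "poly_over L P" for P
    using \<sigma>(2) poly_over_coeff[OF sub that] by (auto simp: poly_over_iff subring_0[OF sub] coeff_map_hom[OF sub \<sigma>(1)])
  have nz: "poly (map_poly \<sigma> Q) x \<noteq> 0" if Q: "poly_over L Q" "Q \<noteq> 0" for Q
  proof (rule transc_poly_neq_0[OF x over[OF Q(1)]])
    have "\<sigma> (lead_coeff Q) \<noteq> 0" using Q by (intro ring_hom_on_inj[OF L \<sigma>(1)] poly_over_coeff[OF sub]) auto
    then have "coeff (map_poly \<sigma> Q) (degree Q) \<noteq> 0" by (simp add: coeff_map_hom[OF sub \<sigma>(1)])
    then show "map_poly \<sigma> Q \<noteq> 0" by auto
  qed
  define good where "good g PQ \<longleftrightarrow> (case PQ of (P, Q) \<Rightarrow> poly_over L P \<and> poly_over L Q \<and> Q \<noteq> 0 \<and> g = poly P x / poly Q x)" for g PQ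
  define \<theta> where "\<theta> g = (case (SOME PQ. good g PQ) of (P, Q) \<Rightarrow> poly (map_poly \<sigma> P) x / poly (map_poly \<sigma> Q) x)" for g
  have \<theta>: "\<theta> g = poly (map_poly \<sigma> P) x / poly (map_poly \<sigma> Q) x"
    if g: "poly_over L P" "poly_over L Q" "Q \<noteq> 0" "g = poly P x / poly Q x" for g P Q
  proof -
    obtain P' Q' where PQ': "(SOME PQ. good g PQ) = (P', Q')" by fastforce
    have "good g (P, Q)" using g by (simp add: good_def)
    then have "good g (P', Q')" unfolding PQ'[symmetric] by (rule someI)
    then have *: "poly_over L P'" "poly_over L Q'" "Q' \<noteq> 0" "g = poly P' x / poly Q' x" by (auto simp: good_def)
    have "poly (P * Q') x = poly (P' * Q) x"
      using g(4) *(4) transc_poly_neq_0[OF x g(2,3)] transc_poly_neq_0[OF x *(2,3)] by (simp add: frac_eq_eq)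
    then have "P * Q' = P' * Q" using g * sub by (intro transc_poly_eqI[OF sub x] poly_over_mult)
    then have "map_poly \<sigma> P * map_poly \<sigma> Q' = map_poly \<sigma> P' * map_poly \<sigma> Q"
      using map_hom_mult[OF sub \<sigma>(1)] g * by metis
    then have "poly (map_poly \<sigma> P) x * poly (map_poly \<sigma> Q') x = poly (map_poly \<sigma> P') x * poly (map_poly \<sigma> Q) x"
      by (metis poly_mult)
    then show ?thesis unfolding \<theta>_def PQ' using nz[OF g(2,3)] nz[OF *(2,3)] by (simp add: frac_eq_eq)
  qed
  have map1: "map_poly \<sigma> 1 = 1" using ring_hom_on_0[OF sub \<sigma>(1)] ring_hom_on_1[OF \<sigma>(1)] by (simp add: map_poly_1')
  have "\<theta> a = \<sigma> a" if "a \<in> L" for a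
    using \<theta>[of "[:a:]" 1 a] that sub map1 ring_hom_on_0[OF sub \<sigma>(1)]
    by (simp add: poly_over_const poly_over_1 map_hom_pCons[OF sub \<sigma>(1)])
  moreover have "\<theta> x = x"
    using \<theta>[of "[:0, 1:]" 1 x] sub map1 ring_hom_on_0[OF sub \<sigma>(1)] ring_hom_on_1[OF \<sigma>(1)]
    by (simp add: poly_over_linear poly_over_1 map_hom_pCons[OF sub \<sigma>(1)] subring_0 subring_1)
  moreover have "ring_hom_on (ratfun L x) \<theta>"
    unfolding ring_hom_on_def
  proof (intro conjI ballI)
    show "\<theta> 1 = 1" using \<theta>[of 1 1 1] sub map1 by (simp add: poly_over_1)
    fix a b assume "a \<in> ratfun L x" "b \<in> ratfun L x"
    then obtain P Q P' Q' where *: "poly_over L P" "poly_over L Q" "Q \<noteq> 0" "a = poly P x / poly Q x"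
      "poly_over L P'" "poly_over L Q'" "Q' \<noteq> 0" "b = poly P' x / poly Q' x" by (auto simp: ratfun_def)
    note q = transc_poly_neq_0[OF x *(2,3)] transc_poly_neq_0[OF x *(6,7)]
    have "a + b = poly (P * Q' + P' * Q) x / poly (Q * Q') x" "a * b = poly (P * P') x / poly (Q * Q') x"
      using q by (simp_all add: *(4,8) add_frac_eq)
    then have "\<theta> (a + b) = poly (map_poly \<sigma> (P * Q' + P' * Q)) x / poly (map_poly \<sigma> (Q * Q')) x"
      "\<theta> (a * b) = poly (map_poly \<sigma> (P * P')) x / poly (map_poly \<sigma> (Q * Q')) x"
      by (intro \<theta>; simp add: poly_over_mult[OF sub] poly_over_add[OF sub] *(1-3,5-7))+
    moreover have "\<theta> a = poly (map_poly \<sigma> P) x / poly (map_poly \<sigma> Q) x" "\<theta> b = poly (map_poly \<sigma> P') x / poly (map_poly \<sigma> Q') x"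
      using \<theta> * by blast+
    ultimately show "\<theta> (a + b) = \<theta> a + \<theta> b" "\<theta> (a * b) = \<theta> a * \<theta> b"
      using nz[OF *(2,3)] nz[OF *(6,7)]
      by (simp_all add: map_hom_mult[OF sub \<sigma>(1)] map_hom_add[OF sub \<sigma>(1)] poly_over_mult[OF sub] *(1,2,5,6) add_frac_eq)
  qed
  ultimately show ?thesis by blast
qed

lemma ring_hom_on_eq_UNIV:
  fixes h h' :: "'a::field \<Rightarrow> 'b::field"
  assumes h: "ring_hom_on UNIV h" "ring_hom_on UNIV h'" and eq: "\<And>a. a \<in> T \<Longrightarrow> h a = h' a" and T: "field_gen T = UNIV"
  shows "h = h'"
proof -
  have U: "is_subfield (UNIV :: 'a set)" by (simp add: is_subfield_def is_subring_def)
  have "is_subfield {a. h a = h' a}"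
    unfolding is_subfield_def is_subring_def
    using ring_hom_on_0[OF UNIV_subring h(1)] ring_hom_on_0[OF UNIV_subring h(2)] ring_hom_on_1[OF h(1)] ring_hom_on_1[OF h(2)]
      ring_hom_on_diff[OF UNIV_subring h(1)] ring_hom_on_diff[OF UNIV_subring h(2)]
      ring_hom_on_mult[OF h(1)] ring_hom_on_mult[OF h(2)] ring_hom_on_inverse[OF U h(1)] ring_hom_on_inverse[OF U h(2)]
    by simp
  then have "field_gen T \<subseteq> {a. h a = h' a}" using eq by (intro field_gen_subset) auto
  then show ?thesis using T by auto
qed

text \<open>
  An automorphism of \<open>L\<close> and its inverse extend to endomorphisms of \<open>L(x, y)\<close> that are inverse to each
  other, because both compositions fix the generators.
\<close>

lemma coeff_act:
  fixes L :: "'a::field set"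
  assumes L: "is_subfield L" and x: "transcendental_over L x" and kummer: "kummer_field (ratfun L x) y n"
    and f: "y ^ n = poly f x" "poly_over L f"
    and \<sigma>: "ring_hom_on L \<sigma>" "bij_betw \<sigma> L L" "\<And>i. \<sigma> (coeff f i) = coeff f i"
    and gen_xy: "field_gen (L \<union> {x, y}) = UNIV"
  shows "bij (coeff_act L x y \<sigma>) \<and> ring_hom_on UNIV (coeff_act L x y \<sigma>) \<and>
    (\<forall>a\<in>L. coeff_act L x y \<sigma> a = \<sigma> a) \<and> coeff_act L x y \<sigma> x = x \<and> coeff_act L x y \<sigma> y = y"
proof -
  interpret kummer_field "ratfun L x" y n by (rule kummer)
  note sub = subfield_subring[OF L]
  have ext: "\<exists>\<tau>. ring_hom_on UNIV \<tau> \<and> (\<forall>a\<in>L. \<tau> a = s a) \<and> \<tau> x = x \<and> \<tau> y = y"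
    if s: "ring_hom_on L s" "s ` L \<subseteq> L" "\<And>i. s (coeff f i) = coeff f i" for s
  proof -
    obtain \<theta> where \<theta>: "ring_hom_on (ratfun L x) \<theta>" "\<forall>a\<in>L. \<theta> a = s a" "\<theta> x = x"
      using ratfun_hom[OF L x s(1,2)] by blast
    have L_sub: "L \<subseteq> ratfun L x" using ratfun_base[OF L] by blast
    have "map_poly \<theta> f = f"
      using \<theta>(2) s(3) poly_over_coeff[OF sub f(2)] by (intro poly_eqI) (simp add: coeff_map_hom[OF E_ring \<theta>(1)])
    then have "y ^ n = \<theta> (y ^ n)"
      using poly_map_hom[OF E_ring \<theta>(1) poly_over_mono[OF f(2) L_sub] ratfun_gen[OF L]] f(1) \<theta>(3) by simp
    then obtain \<tau> where "ring_hom_on UNIV \<tau>" "\<forall>a\<in>ratfun L x. \<tau> a = \<theta> a" "\<tau> y = y"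
      using extend_hom[OF \<theta>(1)] by blast
    then show ?thesis using \<theta> L_sub ratfun_gen[OF L, of x] by (intro exI[of _ \<tau>]) auto
  qed
  define s' where "s' = inv_into L \<sigma>"
  have s': "s' a \<in> L" "\<sigma> (s' a) = a" "s' (\<sigma> a) = a" if "a \<in> L" for a
    using that \<sigma>(2) by (auto simp: s'_def bij_betw_def intro: inv_into_into f_inv_into_f)
  have \<sigma>_L: "\<sigma> a \<in> L" if "a \<in> L" for a using that \<sigma>(2) by (auto simp: bij_betw_def)
  have s'_hom: "ring_hom_on L s'"
    unfolding ring_hom_on_def
  proof (intro conjI ballI)
    show "s' 1 = 1" using s'(3)[OF subring_1[OF sub]] ring_hom_on_1[OF \<sigma>(1)] by simp
    fix a b assume "a \<in> L" "b \<in> L"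
    then show "s' (a + b) = s' a + s' b" "s' (a * b) = s' a * s' b"
      using s'(3)[of "s' a + s' b"] s'(3)[of "s' a * s' b"] s' ring_hom_on_add[OF \<sigma>(1)] ring_hom_on_mult[OF \<sigma>(1)]
        subring_add[OF sub] subring_mult[OF sub] by auto
  qed
  have "s' (coeff f i) = coeff f i" for i using s'(3)[OF poly_over_coeff[OF sub f(2)], of i] \<sigma>(3) by simp
  then obtain \<tau>' where \<tau>': "ring_hom_on UNIV \<tau>'" "\<forall>a\<in>L. \<tau>' a = s' a" "\<tau>' x = x" "\<tau>' y = y"
    using ext[OF s'_hom] s'(1) by blast
  obtain \<tau> where \<tau>: "ring_hom_on UNIV \<tau>" "\<forall>a\<in>L. \<tau> a = \<sigma> a" "\<tau> x = x" "\<tau> y = y"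
    using ext[OF \<sigma>(1) _ \<sigma>(3)] \<sigma>_L by blast
  have comp: "ring_hom_on UNIV (\<tau> \<circ> \<tau>')" "ring_hom_on UNIV (\<tau>' \<circ> \<tau>)" "ring_hom_on UNIV (id :: 'a \<Rightarrow> 'a)"
    using \<tau>(1) \<tau>'(1) by (simp_all add: ring_hom_on_def)
  have "\<tau> \<circ> \<tau>' = id" "\<tau>' \<circ> \<tau> = id"
    using \<tau> \<tau>' s' \<sigma>_L by (auto intro!: ring_hom_on_eq_UNIV[OF comp(1,3) _ gen_xy] ring_hom_on_eq_UNIV[OF comp(2,3) _ gen_xy])
  then have bij: "bij \<tau>" by (intro o_bij)
  have "coeff_act L x y \<sigma> = \<tau>"
    unfolding coeff_act_def
  proof (rule the_equality)
    show "bij \<tau> \<and> ring_hom_on UNIV \<tau> \<and> (\<forall>a\<in>L. \<tau> a = \<sigma> a) \<and> \<tau> x = x \<and> \<tau> y = y" using bij \<tau> by blast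
    fix \<tau>2 assume *: "bij \<tau>2 \<and> ring_hom_on UNIV \<tau>2 \<and> (\<forall>a\<in>L. \<tau>2 a = \<sigma> a) \<and> \<tau>2 x = x \<and> \<tau>2 y = y"
    then show "\<tau>2 = \<tau>" using \<tau> by (intro ring_hom_on_eq_UNIV[OF _ \<tau>(1) _ gen_xy]) auto
  qed
  then show ?thesis using bij \<tau> by simp
qed

section \<open>Integral closure of a valuation ring in an unramified Kummer extension\<close>

text \<open>
  The extension given by \<open>y\<^sup>n\<close> is unramified over \<open>R\<close> because both \<open>n\<close> and \<open>y\<^sup>n\<close> are units.
\<close>

locale kummer_dvr = dvr R E \<pi> + kummer_field E y n
  for R E :: "'a::field set" and \<pi> y :: 'a and n :: nat +
  fixes \<zeta> :: 'a
  assumes \<zeta>: "\<zeta> \<in> R" "\<zeta> ^ n = 1" "\<And>k. 0 < k \<Longrightarrow> k < n \<Longrightarrow> \<zeta> ^ k \<noteq> 1"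
    and n_unit: "of_nat n \<noteq> (0 :: 'a)" "inverse (of_nat n) \<in> R"
    and y_power: "y ^ n \<in> R" "y \<noteq> 0" "inverse (y ^ n) \<in> R"
begin

definition "A = {poly G y |G. poly_over R G}"

lemma A_subring: "is_subring A"
  using ring_gen_subring[of "insert y R"] ring_gen_insert[OF R, of y] by (simp add: A_def)

lemma R_A: "R \<subseteq> A"
  using ring_gen_superset[of "insert y R"] ring_gen_insert[OF R, of y] by (simp add: A_def)

lemma y_A: "y \<in> A"
  using ring_gen_superset[of "insert y R"] ring_gen_insert[OF R, of y] by (simp add: A_def)

lemma A_reduced_form:
  assumes "a \<in> A"
  shows "\<exists>G. poly_over R G \<and> degree G < n \<and> a = poly G y"
proof -
  obtain P where P: "poly_over R P" "a = poly P y" using assms by (auto simp: A_def)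
  have "poly_over R minpoly" unfolding minpoly_def
    using R y_power(1) by (intro poly_over_diff poly_over_monom poly_over_const subring_1)
  then obtain H G where "poly_over R H" "poly_over R G" "P = minpoly * H + G" "degree G < n"
    using monic_division[OF R P(1), of minpoly] minpoly(2,3) n by auto
  then show ?thesis using P(2) minpoly(4) by auto
qed

lemma A_coefficients:
  assumes "poly_over E G" "degree G < n" "poly G y \<in> A"
  shows "poly_over R G"
proof -
  obtain H where H: "poly_over R H" "degree H < n" "poly G y = poly H y" using A_reduced_form[OF assms(3)] by blast
  have "G = H" by (rule indep_eq[OF assms(1,2) poly_over_mono[OF H(1) R_E] H(2,3)])
  then show ?thesis using H by simp
qed

lemma A_E: "a \<in> A \<Longrightarrow> a \<in> E \<Longrightarrow> a \<in> R"
  using A_coefficients[of "[:a:]"] n poly_over_coeff[OF R, of "[:a:]" 0] by (simp add: poly_over_const E_ring)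

lemma exists_rotation: "\<exists>\<tau>. ring_hom_on UNIV \<tau> \<and> (\<forall>a\<in>E. \<tau> a = a) \<and> \<tau> y = \<zeta> * y"
proof -
  have "ring_hom_on E (\<lambda>a. a)" by (simp add: ring_hom_on_def)
  then show ?thesis using extend_hom[of "\<lambda>a. a" "\<zeta> * y"] \<zeta>(2) by (simp add: power_mult_distrib)
qed

text \<open>
  A generator of the Galois group of the extension.
\<close>

definition \<tau> :: "'a \<Rightarrow> 'a" where
  "\<tau> = (SOME \<tau>. ring_hom_on UNIV \<tau> \<and> (\<forall>a\<in>E. \<tau> a = a) \<and> \<tau> y = \<zeta> * y)"

lemma \<tau>: "ring_hom_on UNIV \<tau>" "a \<in> E \<Longrightarrow> \<tau> a = a" "\<tau> y = \<zeta> * y"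
  using someI_ex[OF exists_rotation] unfolding \<tau>_def[symmetric] by auto

lemma \<tau>_poly: "poly_over E G \<Longrightarrow> \<tau> (poly G e) = poly G (\<tau> e)"
  by (rule ring_hom_on_poly_fixed[OF UNIV_subring \<tau>(1) E_ring _ \<tau>(2)]) auto

lemma \<zeta>_E: "\<zeta> \<in> E"
  using \<zeta>(1) R_E by blast

lemma \<tau>_power_y: "(\<tau> ^^ j) y = \<zeta> ^ j * y"
proof (induction j)
  case (Suc j)
  have "\<tau> (\<zeta> ^ j * y) = \<zeta> ^ j * (\<zeta> * y)"
    using ring_hom_on_mult[OF \<tau>(1), of "\<zeta> ^ j" y] \<tau>(2)[OF subring_power[OF E_ring \<zeta>_E]] \<tau>(3) by simp
  then show ?case using Suc by (simp add: mult_ac)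
qed simp

lemma \<tau>_power_poly: "poly_over E G \<Longrightarrow> (\<tau> ^^ j) (poly G y) = poly G (\<zeta> ^ j * y)"
proof -
  assume G: "poly_over E G"
  have "(\<tau> ^^ j) (poly G y) = poly G ((\<tau> ^^ j) y)" by (induction j) (simp_all add: \<tau>_poly[OF G])
  then show ?thesis by (simp add: \<tau>_power_y)
qed

lemma \<tau>_A: "a \<in> A \<Longrightarrow> \<tau> a \<in> A"
proof -
  assume "a \<in> A"
  then obtain G where G: "poly_over R G" "a = poly G y" by (auto simp: A_def)
  have "\<tau> a = poly G (\<zeta> * y)" using \<tau>_poly[OF poly_over_mono[OF G(1) R_E], of y] G(2) \<tau>(3) by simp
  moreover have "\<zeta> * y \<in> A" using \<zeta>(1) R_A y_A A_subring by (auto intro: subring_mult)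
  ultimately show ?thesis using poly_in_subring[OF A_subring poly_over_mono[OF G(1) R_A]] by simp
qed

text \<open>
  Fourier inversion on the group of \<open>n\<close>-th roots of unity recovers the coefficients with respect
  to the powers of \<open>y\<close> from the conjugates; the factor \<open>\<zeta>\<^bsup>n - i\<^esup>\<close> is \<open>\<zeta>\<^bsup>-i\<^esup>\<close>.
\<close>

lemma coefficient_formula:
  assumes G: "poly_over E G" "degree G < n" and i: "i < n"
  shows "(\<Sum>j<n. (\<zeta> ^ (n - i)) ^ j * (\<tau> ^^ j) (poly G y)) = of_nat n * coeff G i * y ^ i"
proof -
  have G_sum: "poly G z = (\<Sum>k<n. coeff G k * z ^ k)" for z
    unfolding poly_altdef using G(2) by (intro sum.mono_neutral_left) (auto simp: coeff_eq_0)
  have inner: "(\<Sum>j<n. (\<zeta> ^ (n - i + k)) ^ j) = (if k = i then of_nat n else 0)" if "k < n" for k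
  proof (cases "k = i")
    case True
    then show ?thesis using i \<zeta>(2) by simp
  next
    case False
    have "\<zeta> ^ (n - i + k) \<noteq> 1"
    proof
      assume *: "\<zeta> ^ (n - i + k) = 1"
      have "\<zeta> ^ k = \<zeta> ^ i * \<zeta> ^ (n - i + k)"
        using i \<zeta>(2) by (simp flip: power_add) (simp add: power_add)
      then have "\<zeta> ^ k = \<zeta> ^ i" using * by simp
      then show False using primitive_root_power_eq[OF \<zeta>(2,3) that i] False by blast
    qed
    moreover have "(\<zeta> ^ (n - i + k)) ^ n = 1" using \<zeta>(2) by (metis mult.commute power_mult power_one)
    ultimately show ?thesis using False by (simp add: geometric_sum)
  qed
  have "(\<Sum>j<n. (\<zeta> ^ (n - i)) ^ j * (\<tau> ^^ j) (poly G y)) =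
      (\<Sum>j<n. \<Sum>k<n. coeff G k * y ^ k * (\<zeta> ^ (n - i + k)) ^ j)"
  proof (rule sum.cong)
    fix j
    have "(\<tau> ^^ j) (poly G y) = (\<Sum>k<n. coeff G k * (\<zeta> ^ j * y) ^ k)"
      unfolding \<tau>_power_poly[OF G(1)] by (rule G_sum)
    moreover have "(\<zeta> ^ (n - i)) ^ j * (coeff G k * (\<zeta> ^ j * y) ^ k) = coeff G k * y ^ k * (\<zeta> ^ (n - i + k)) ^ j" for k
      by (simp add: power_add power_mult_distrib mult_ac flip: power_mult)
    ultimately show "(\<zeta> ^ (n - i)) ^ j * (\<tau> ^^ j) (poly G y) = (\<Sum>k<n. coeff G k * y ^ k * (\<zeta> ^ (n - i + k)) ^ j)"
      by (simp only: sum_distrib_left)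
  qed simp
  also have "\<dots> = (\<Sum>k<n. coeff G k * y ^ k * (\<Sum>j<n. (\<zeta> ^ (n - i + k)) ^ j))"
    by (subst sum.swap) (simp add: sum_distrib_left)
  also have "\<dots> = (\<Sum>k<n. if k = i then coeff G i * y ^ i * of_nat n else 0)"
    by (intro sum.cong refl) (simp add: inner)
  also have "\<dots> = of_nat n * coeff G i * y ^ i" using i by (simp add: mult_ac)
  finally show ?thesis .
qed

text \<open>
  The preimage in \<open>A\<close> of the nilradical of \<open>A/\<pi>A\<close>.
\<close>

definition "nil = {a \<in> A. \<exists>N. a ^ N / \<pi> \<in> A}"

lemma pi_A: "a / \<pi> \<in> A \<Longrightarrow> b \<in> A \<Longrightarrow> a * b / \<pi> \<in> A"
  using subring_mult[OF A_subring, of "a / \<pi>" b] by simp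

lemma nil_mult: "c \<in> A \<Longrightarrow> a \<in> nil \<Longrightarrow> c * a \<in> nil"
proof -
  assume c: "c \<in> A" and "a \<in> nil"
  then obtain N where N: "a \<in> A" "a ^ N / \<pi> \<in> A" by (auto simp: nil_def)
  have "(c * a) ^ N / \<pi> \<in> A"
    using pi_A[OF N(2) subring_power[OF A_subring c, of N]] by (simp add: power_mult_distrib mult.commute)
  then show ?thesis using c N(1) by (auto simp: nil_def intro: subring_mult[OF A_subring])
qed

lemma nil_add: "a \<in> nil \<Longrightarrow> b \<in> nil \<Longrightarrow> a + b \<in> nil"
proof -
  assume "a \<in> nil" "b \<in> nil"
  then obtain N M where *: "a \<in> A" "a ^ N / \<pi> \<in> A" "b \<in> A" "b ^ M / \<pi> \<in> A" by (auto simp: nil_def)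
  have "of_nat (N + M choose k) * a ^ k * b ^ (N + M - k) / \<pi> \<in> A" if "k \<le> N + M" for k
  proof (cases "k \<ge> N")
    case True
    then have "a ^ k = a ^ N * a ^ (k - N)" by (simp flip: power_add)
    then have "of_nat (N + M choose k) * a ^ k * b ^ (N + M - k) / \<pi> =
        a ^ N * (of_nat (N + M choose k) * a ^ (k - N) * b ^ (N + M - k)) / \<pi>" by simp
    moreover have "of_nat (N + M choose k) * a ^ (k - N) * b ^ (N + M - k) \<in> A"
      by (intro subring_mult[OF A_subring] subring_power[OF A_subring] subring_of_nat[OF A_subring] *(1,3))
    ultimately show ?thesis using pi_A[OF *(2)] by metis
  next
    case False
    then have "N + M - k = M + (N - k)" by simp
    then have "b ^ (N + M - k) = b ^ M * b ^ (N - k)" by (simp add: power_add)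
    then have "of_nat (N + M choose k) * a ^ k * b ^ (N + M - k) / \<pi> =
        b ^ M * (of_nat (N + M choose k) * a ^ k * b ^ (N - k)) / \<pi>" by simp
    moreover have "of_nat (N + M choose k) * a ^ k * b ^ (N - k) \<in> A"
      by (intro subring_mult[OF A_subring] subring_power[OF A_subring] subring_of_nat[OF A_subring] *(1,3))
    ultimately show ?thesis using pi_A[OF *(4)] by metis
  qed
  then have "(\<Sum>k\<le>N + M. of_nat (N + M choose k) * a ^ k * b ^ (N + M - k) / \<pi>) \<in> A"
    by (intro subring_sum[OF A_subring]) simp
  then have "(a + b) ^ (N + M) / \<pi> \<in> A" by (simp add: binomial_ring sum_divide_distrib)
  then show ?thesis using * A_subring by (auto simp: nil_def intro: subring_add)
qed

lemma nil_\<tau>: "a \<in> nil \<Longrightarrow> \<tau> a \<in> nil"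
proof -
  assume "a \<in> nil"
  then obtain N where N: "a \<in> A" "a ^ N / \<pi> \<in> A" by (auto simp: nil_def)
  have U: "is_subfield (UNIV :: 'a set)" by (simp add: is_subfield_def is_subring_def)
  have "\<tau> (a ^ N / \<pi>) = \<tau> a ^ N / \<pi>"
    unfolding divide_inverse
    using ring_hom_on_mult[OF \<tau>(1), of "a ^ N" "inverse \<pi>"] ring_hom_on_power[OF UNIV_subring \<tau>(1), of a N]
      ring_hom_on_inverse[OF U \<tau>(1), of \<pi>] \<tau>(2)[OF pi_E] by simp
  then show ?thesis using \<tau>_A[OF N(1)] \<tau>_A[OF N(2)] by (auto simp: nil_def)
qed

lemma nil_sum: "(\<And>i. i \<in> I \<Longrightarrow> g i \<in> nil) \<Longrightarrow> sum g I \<in> nil"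
proof (induction I rule: infinite_finite_induct)
  case (insert i I)
  then show ?case by (simp add: nil_add)
qed (use subring_0[OF A_subring] in \<open>auto simp: nil_def intro!: exI[of _ 1]\<close>)

lemma prime_power: "a \<in> R \<Longrightarrow> a ^ N / \<pi> \<in> R \<Longrightarrow> a / \<pi> \<in> R"
proof (induction N)
  case 0
  then show ?case using one_div_pi by simp
next
  case (Suc N)
  then show ?case using divide_prime[of a "a ^ N"] subring_power[OF R] by auto
qed

text \<open>
  \<open>A/\<pi>A\<close> is reduced: its nilradical is stable under the rotations \<open>y \<mapsto> \<zeta>\<^sup>j y\<close>, so with an element
  it contains \<open>n y\<^sup>i\<close> times each coefficient. Since \<open>n\<close> and \<open>y\<close> are units, the coefficients are
  nilpotent; but they lie in the residue field of \<open>R\<close>.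
\<close>

lemma reduced:
  assumes "a \<in> nil"
  shows "a / \<pi> \<in> A"
proof -
  have "a \<in> A" using assms by (simp add: nil_def)
  then obtain G where G: "poly_over R G" "degree G < n" "a = poly G y" using A_reduced_form by blast
  have GE: "poly_over E G" using poly_over_mono[OF G(1) R_E] .
  have "coeff G i / \<pi> \<in> R" for i
  proof (cases "i < n")
    case i: True
    have "(\<tau> ^^ j) a \<in> nil" for j using assms nil_\<tau> by (induction j) auto
    then have "(\<Sum>j<n. (\<zeta> ^ (n - i)) ^ j * (\<tau> ^^ j) a) \<in> nil"
      using \<zeta>(1) R_A A_subring by (intro nil_sum nil_mult subring_power) auto
    then have "of_nat n * coeff G i * y ^ i \<in> nil" using coefficient_formula[OF GE G(2) i] G(3) by simp
    moreover have "inverse (of_nat n) * inverse (y ^ n) * y ^ (n - i) \<in> A"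
      using n_unit y_power R_A y_A A_subring by (auto intro!: subring_mult subring_power)
    ultimately have "(inverse (of_nat n) * inverse (y ^ n) * y ^ (n - i)) * (of_nat n * coeff G i * y ^ i) \<in> nil"
      by (rule nil_mult[rotated])
    moreover have "(inverse (of_nat n) * inverse (y ^ n) * y ^ (n - i)) * (of_nat n * coeff G i * y ^ i) = coeff G i"
    proof -
      have "y ^ n = y ^ (n - i) * y ^ i" using i by (simp flip: power_add)
      then show ?thesis using n_unit(1) y_power(2) by (simp add: field_simps)
    qed
    ultimately obtain N where "coeff G i ^ N / \<pi> \<in> A" by (auto simp: nil_def)
    moreover have "coeff G i \<in> R" using poly_over_coeff[OF R G(1)] .
    moreover have "coeff G i ^ N / \<pi> \<in> E"
      using \<open>coeff G i \<in> R\<close> R_E pi_E by (intro subfield_divide[OF E] subring_power[OF E_ring]) auto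
    ultimately show ?thesis using A_E prime_power by blast
  next
    case False
    then show ?thesis using G(2) subring_0[OF R] by (simp add: coeff_eq_0)
  qed
  then have "poly_over R (smult (inverse \<pi>) G)" by (simp add: poly_over_iff subring_0[OF R] divide_inverse mult.commute)
  then have "poly (smult (inverse \<pi>) G) y \<in> A" unfolding A_def by blast
  then show ?thesis using G(3) by (simp add: divide_inverse mult.commute)
qed

text \<open>
  Let \<open>k\<close> be minimal with \<open>a = \<pi>\<^sup>k b \<in> A\<close>. If \<open>k > 0\<close>, an integral equation of \<open>b\<close> of degree \<open>d\<close>,
  multiplied by \<open>\<pi>\<^bsup>k d\<^esup>\<close>, shows that \<open>a\<^sup>d\<close> is divisible by \<open>\<pi>\<close>. Since \<open>A/\<pi>A\<close> is reduced, \<open>a\<close> is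
  divisible by \<open>\<pi>\<close>, against the choice of \<open>k\<close>.
\<close>

lemma integral_subset_A: "integral_closure R \<subseteq> A"
proof
  fix b assume "b \<in> integral_closure R"
  then obtain P where P: "poly_over R P" "lead_coeff P = 1" "poly P b = 0" by (auto simp: integral_closure_def)
  define d where "d = degree P"
  have "\<exists>k. \<pi> ^ k * b \<in> A"
  proof -
    obtain G where G: "poly_over E G" "degree G < n" "b = poly G y" using span by blast
    show ?thesis
    proof (cases "G = 0")
      case True
      then show ?thesis using G(3) subring_0[OF A_subring] by auto
    next
      case False
      obtain k :: int where k: "primitive (smult (\<pi> powi k) G)" using primitive_multiple[OF G(1) False] by blast
      have "poly (smult (\<pi> powi k) G) y \<in> A" using primitive_over[OF k] unfolding A_def by blast
      then have kb: "\<pi> powi k * b \<in> A" using G(3) by simp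
      show ?thesis
      proof (cases "k \<ge> 0")
        case True
        then show ?thesis using kb by (auto simp: power_int_def)
      next
        case False
        have "\<pi> ^ nat (- k) * (\<pi> powi k * b) \<in> A"
          using pi(1) R_A by (intro subring_mult[OF A_subring _ kb] subring_power[OF A_subring]) auto
        moreover have "\<pi> ^ nat (- k) * (\<pi> powi k * b) = \<pi> ^ 0 * b"
          using False pi_neq_0 by (simp add: power_int_def field_simps)
        ultimately show ?thesis by metis
      qed
    qed
  qed
  then obtain k0 where k0: "\<pi> ^ k0 * b \<in> A" ..
  define k where "k = (LEAST k. \<pi> ^ k * b \<in> A)"
  have k: "\<pi> ^ k * b \<in> A" unfolding k_def using k0 by (rule LeastI)
  have "k = 0"
  proof (rule ccontr)
    assume "k \<noteq> 0"
    define a where "a = \<pi> ^ k * b"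
    have a: "a \<in> A" using k by (simp add: a_def)
    have "P \<noteq> 0" using P(2) by auto
    have "b ^ d = - (\<Sum>j<d. coeff P j * b ^ j)"
    proof -
      have "0 = (\<Sum>j\<le>d. coeff P j * b ^ j)" using P(3) by (simp add: poly_altdef d_def)
      also have "\<dots> = (\<Sum>j<d. coeff P j * b ^ j) + b ^ d" using P(2) by (simp add: d_def flip: lessThan_Suc_atMost)
      finally show ?thesis by (simp add: eq_neg_iff_add_eq_0 add.commute)
    qed
    then have "a ^ d = - (\<Sum>j<d. \<pi> ^ (k * d) * (coeff P j * b ^ j))"
      by (simp add: a_def power_mult_distrib sum_distrib_left flip: power_mult)
    also have "\<dots> = - (\<Sum>j<d. \<pi> ^ (k * (d - j)) * (coeff P j * a ^ j))"
    proof -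
      have "\<pi> ^ (k * d) * (coeff P j * b ^ j) = \<pi> ^ (k * (d - j)) * (coeff P j * a ^ j)" if "j < d" for j
      proof -
        have "k * ((d - j) + j) = k * (d - j) + k * j" by (rule distrib_left)
        then have "k * d = k * (d - j) + k * j" using that by simp
        then show ?thesis by (simp add: a_def power_add power_mult_distrib mult_ac flip: power_mult)
      qed
      then show ?thesis by (intro arg_cong[of _ _ uminus] sum.cong) (simp_all only: lessThan_iff)
    qed
    finally have "a ^ d / \<pi> = - (\<Sum>j<d. \<pi> ^ (k * (d - j)) * (coeff P j * a ^ j) / \<pi>)"
      by (simp add: sum_divide_distrib)
    moreover have "\<pi> ^ (k * (d - j)) * (coeff P j * a ^ j) / \<pi> \<in> A" if "j < d" for j
    proof (rule pi_A)
      have "k * (d - j) > 0" using \<open>k \<noteq> 0\<close> that by simp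
      then obtain l where "k * (d - j) = Suc l" using gr0_implies_Suc by blast
      then show "\<pi> ^ (k * (d - j)) / \<pi> \<in> A"
        using pi R_A pi_neq_0 subring_power[OF A_subring, of \<pi> l] by auto
      show "coeff P j * a ^ j \<in> A" using poly_over_coeff[OF R P(1)] R_A a A_subring
        by (intro subring_mult subring_power) auto
    qed
    ultimately have "a ^ d / \<pi> \<in> A" by (auto intro!: subring_uminus[OF A_subring] subring_sum[OF A_subring])
    then have "a / \<pi> \<in> A" using a by (intro reduced) (auto simp: nil_def)
    moreover obtain k' where "k = Suc k'" using \<open>k \<noteq> 0\<close> not0_implies_Suc by blast
    ultimately have "\<pi> ^ k' * b \<in> A" "k' < k" using pi_neq_0 by (simp_all add: a_def)
    then show False using not_less_Least[of k' "\<lambda>k. \<pi> ^ k * b \<in> A"] unfolding k_def[symmetric] by blast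
  qed
  then show "b \<in> A" using k by simp
qed

lemma \<tau>_fixed: "a \<in> A \<Longrightarrow> \<tau> a = a \<Longrightarrow> a \<in> R"
proof -
  assume "a \<in> A" and fixed: "\<tau> a = a"
  then obtain G where G: "poly_over R G" "degree G < n" "a = poly G y" using A_reduced_form by blast
  have GE: "poly_over E G" using poly_over_mono[OF G(1) R_E] .
  define G' where "G' = pcompose G [:0, \<zeta>:]"
  have "poly G' y = poly G y" using fixed \<tau>_poly[OF GE, of y] \<tau>(3) G(3) by (simp add: G'_def poly_pcompose mult.commute)
  moreover have "poly_over E G'" unfolding G'_def
    using GE \<zeta>_E by (intro poly_over_pcompose[OF E_ring] poly_over_linear[OF E_ring] subring_0[OF E_ring])
  moreover have "degree G' < n"
    using degree_pcompose_le[of G "[:0, \<zeta>:]"] G(2) by (auto simp: G'_def split: if_splits)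
  ultimately have eq: "G' = G" using indep_eq[OF _ _ GE G(2)] by blast
  have "coeff G i = 0" if "i > 0" for i
  proof (cases "i < n")
    case True
    have "\<zeta> ^ i * coeff G i = coeff G i" using arg_cong[OF eq, of "\<lambda>p. coeff p i"] by (simp add: G'_def coeff_pcompose_linear)
    then have "(\<zeta> ^ i - 1) * coeff G i = 0" by (simp add: algebra_simps)
    then show ?thesis using \<zeta>(3)[OF that True] by simp
  qed (use G(2) in \<open>simp add: coeff_eq_0\<close>)
  then have "degree G = 0" by (metis leading_coeff_0_iff degree_0 gr0I)
  then obtain r where "G = [:r:]" by (metis degree_eq_zeroE)
  then show "a \<in> R" using G(1,3) poly_over_coeff[OF R G(1), of 0] by simp
qed

text \<open>
  The polynomial with the conjugates of \<open>a\<close> as roots is invariant under \<open>\<tau>\<close>, so its coefficients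
  lie in \<open>R\<close>.
\<close>

lemma A_subset_integral: "A \<subseteq> integral_closure R"
proof
  fix a assume a: "a \<in> A"
  obtain G where G: "poly_over R G" "a = poly G y" using a unfolding A_def by blast
  have GE: "poly_over E G" using poly_over_mono[OF G(1) R_E] .
  have \<tau>j: "(\<tau> ^^ j) a \<in> A" for j using a \<tau>_A by (induction j) auto
  define Q where "Q = (\<Prod>j<n. [:- (\<tau> ^^ j) a, 1:])"
  have Q_A: "poly_over A Q" unfolding Q_def
    using \<tau>j A_subring by (intro poly_over_prod poly_over_linear subring_uminus subring_1)
  have map_prod: "map_poly \<tau> (\<Prod>j<k. [:- (\<tau> ^^ j) a, 1:]) = (\<Prod>j<k. [:- (\<tau> ^^ Suc j) a, 1:])" for k
  proof (induction k)
    case 0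
    then show ?case using ring_hom_on_0[OF UNIV_subring \<tau>(1)] ring_hom_on_1[OF \<tau>(1)] by (simp add: map_poly_1')
  next
    case (Suc k)
    have "map_poly \<tau> ((\<Prod>j<k. [:- (\<tau> ^^ j) a, 1:]) * [:- (\<tau> ^^ k) a, 1:]) =
        map_poly \<tau> (\<Prod>j<k. [:- (\<tau> ^^ j) a, 1:]) * map_poly \<tau> [:- (\<tau> ^^ k) a, 1:]"
      by (intro map_hom_mult[OF UNIV_subring \<tau>(1)]) (simp_all add: poly_over_def)
    moreover have "map_poly \<tau> [:- (\<tau> ^^ k) a, 1:] = [:- (\<tau> ^^ Suc k) a, 1:]"
      using ring_hom_on_0[OF UNIV_subring \<tau>(1)] ring_hom_on_1[OF \<tau>(1)] ring_hom_on_uminus[OF UNIV_subring \<tau>(1)]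
      by (simp add: map_hom_pCons[OF UNIV_subring \<tau>(1)])
    ultimately show ?case using Suc by (simp only: prod.lessThan_Suc)
  qed
  have "(\<tau> ^^ n) a = a" using \<tau>_power_poly[OF GE, of n] \<zeta>(2) G(2) by simp
  then have "map_poly \<tau> Q = Q"
  proof -
    obtain k where k: "n = Suc k" using n gr0_implies_Suc by blast
    have "map_poly \<tau> Q = (\<Prod>j<k. [:- (\<tau> ^^ Suc j) a, 1:]) * [:- (\<tau> ^^ Suc k) a, 1:]"
      unfolding Q_def map_prod k by (rule prod.lessThan_Suc)
    also have "\<dots> = (\<Prod>j<k. [:- (\<tau> ^^ Suc j) a, 1:]) * [:- (\<tau> ^^ 0) a, 1:]"
      using \<open>(\<tau> ^^ n) a = a\<close> unfolding k by simp
    also have "\<dots> = Q" unfolding Q_def k by (subst prod.lessThan_Suc_shift) (simp only: mult.commute)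
    finally show ?thesis .
  qed
  then have "\<tau> (coeff Q i) = coeff Q i" for i
    using coeff_map_hom[OF UNIV_subring \<tau>(1), of Q i] by simp
  then have "coeff Q i \<in> R" for i using poly_over_coeff[OF A_subring Q_A] \<tau>_fixed by blast
  then have "poly_over R Q" by (simp add: poly_over_iff subring_0[OF R])
  moreover have "lead_coeff Q = 1" 
    using prod_linear_monic[of "{..<n}" "\<lambda>j. - (\<tau> ^^ j) a"] unfolding Q_def by blast
  moreover have "poly Q a = 0" unfolding Q_def poly_prod
    using n by (intro prod_zero) (auto intro!: bexI[of _ 0])
  ultimately show "a \<in> integral_closure R" unfolding integral_closure_def by blast
qed

theorem integral_closure_eq: "integral_closure R = A"
  using integral_subset_A A_subset_integral by blast

end

section \<open>Discretely valued fields\<close>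

context
  fixes L :: "'a::field set" and val :: "'a \<Rightarrow> real" and \<pi> :: 'a
  assumes L: "is_subfield L" and val: "is_valuation L val" and pi: "prime_element L val \<pi>"
begin

lemma val_mult: "a \<in> L \<Longrightarrow> b \<in> L \<Longrightarrow> a \<noteq> 0 \<Longrightarrow> b \<noteq> 0 \<Longrightarrow> val (a * b) = val a + val b"
  using val by (simp add: is_valuation_def)

lemma val_add: "a \<in> L \<Longrightarrow> b \<in> L \<Longrightarrow> a \<noteq> 0 \<Longrightarrow> b \<noteq> 0 \<Longrightarrow> a + b \<noteq> 0 \<Longrightarrow> val (a + b) \<ge> min (val a) (val b)"
  using val by (simp add: is_valuation_def)

lemma val_1: "val 1 = 0"
  using val_mult[of 1 1] subring_1[OF subfield_subring[OF L]] by simp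

lemma val_power: "a \<in> L \<Longrightarrow> a \<noteq> 0 \<Longrightarrow> val (a ^ k) = real k * val a"
  by (induction k) (auto simp: val_1 val_mult subring_power[OF subfield_subring[OF L]] algebra_simps)

lemma val_inverse: "a \<in> L \<Longrightarrow> a \<noteq> 0 \<Longrightarrow> val (inverse a) = - val a"
  using val_mult[of a "inverse a"] subfield_inverse[OF L, of a] val_1 by simp

lemma val_power_int: "a \<in> L \<Longrightarrow> a \<noteq> 0 \<Longrightarrow> val (a powi k) = real_of_int k * val a"
  by (auto simp: power_int_def val_power val_inverse subfield_inverse[OF L])

lemma val_minus: "a \<in> L \<Longrightarrow> a \<noteq> 0 \<Longrightarrow> val (- a) = val a"
proof -
  have m1: "- 1 \<in> L" using subring_uminus subring_1 subfield_subring[OF L] by blast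
  have "val ((- 1) * (- 1)) = val (- 1) + val (- 1)" using m1 by (intro val_mult) auto
  then have "val (- 1) = 0" using val_1 by simp
  then show "a \<in> L \<Longrightarrow> a \<noteq> 0 \<Longrightarrow> val (- a) = val a" using val_mult[OF m1, of a] by simp
qed

lemma pi_facts: "\<pi> \<in> L" "\<pi> \<noteq> 0" "val \<pi> > 0" "\<And>a. a \<in> L \<Longrightarrow> a \<noteq> 0 \<Longrightarrow> val a > 0 \<Longrightarrow> val a \<ge> val \<pi>"
  using pi by (auto simp: prime_element_def)

lemma in_val_ring: "a \<in> val_ring L val \<longleftrightarrow> a \<in> L \<and> (a = 0 \<or> val a \<ge> 0)"
  by (simp add: val_ring_def)

text \<open>
  An element of minimal positive valuation generates the value group: subtract from \<open>val a\<close> the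
  largest integral multiple of \<open>val \<pi>\<close> that does not exceed it.
\<close>

lemma dvr_of_valuation: "dvr (val_ring L val) L \<pi>"
proof
  note sub = subfield_subring[OF L]
  show "is_subfield L" by (rule L)
  show "is_subring (val_ring L val)"
    unfolding is_subring_def
  proof (intro conjI ballI)
    show "0 \<in> val_ring L val" "1 \<in> val_ring L val" using sub by (auto simp: in_val_ring val_1 subring_closed)
    fix a b assume ab: "a \<in> val_ring L val" "b \<in> val_ring L val"
    show "a * b \<in> val_ring L val"
      using ab sub by (cases "a = 0 \<or> b = 0") (auto simp: in_val_ring val_mult subring_closed)
    have mb: "- b \<in> L" "b \<noteq> 0 \<Longrightarrow> val (- b) = val b" using ab sub by (auto simp: in_val_ring subring_uminus val_minus)
    show "a - b \<in> val_ring L val"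
    proof (cases "b = 0 \<or> a - b = 0")
      case True
      then show ?thesis using ab sub by (auto simp: in_val_ring subring_0)
    next
      case False
      then have b': "val (- b) \<ge> 0" "- b \<noteq> 0" using mb(2) ab by (auto simp: in_val_ring)
      show ?thesis
      proof (cases "a = 0")
        case True
        then show ?thesis using mb(1) b' by (simp add: in_val_ring)
      next
        case a: False
        then have "val (a + - b) \<ge> min (val a) (val (- b))"
          using ab mb(1) b' False by (intro val_add) (auto simp: in_val_ring)
        then show ?thesis using ab a b' sub by (auto simp: in_val_ring subring_diff)
      qed
    qed
  qed
  show "val_ring L val \<subseteq> L" by (auto simp: in_val_ring)
  show "\<pi> \<in> val_ring L val" using pi_facts by (simp add: in_val_ring)
  show "inverse \<pi> \<notin> val_ring L val" using pi_facts by (simp add: in_val_ring val_inverse)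
  fix a assume a: "a \<in> L" "a \<noteq> 0"
  define k where "k = \<lfloor>val a / val \<pi>\<rfloor>"
  define b where "b = a * \<pi> powi (- k)"
  have b: "b \<in> L" "b \<noteq> 0" using a pi_facts L sub by (auto simp: b_def intro: subring_mult subfield_powi)
  have val_b: "val b = val a - real_of_int k * val \<pi>"
    using a pi_facts L by (simp add: b_def val_mult val_power_int subfield_powi)
  have "real_of_int k \<le> val a / val \<pi>" "val a / val \<pi> < real_of_int k + 1" unfolding k_def by linarith+
  then have "val b \<ge> 0" "val b < val \<pi>" using pi_facts(3) by (auto simp: val_b field_simps)
  then have "val b = 0" using pi_facts(4)[OF b] by force
  then have "b \<in> val_ring L val" "inverse b \<in> val_ring L val"
    using b subfield_inverse[OF L] by (auto simp: in_val_ring val_inverse)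
  then show "\<exists>k::int. a * \<pi> powi k \<in> val_ring L val \<and> inverse (a * \<pi> powi k) \<in> val_ring L val"
    unfolding b_def by blast
qed

text \<open>
  The minimum of the valuations of the coefficients is read off from the power of \<open>\<pi>\<close> that makes
  the polynomial primitive; this translates between real valuations and the ring-theoretic
  language.
\<close>

lemma Min_val_coeffs:
  assumes P: "poly_over L P" and prim: "dvr.primitive (val_ring L val) \<pi> (smult (\<pi> powi k) P)"
  shows "Min (val ` (set (coeffs P) - {0})) = - real_of_int k * val \<pi>"
proof -
  interpret dvr "val_ring L val" L \<pi> by (rule dvr_of_valuation)
  have coeffs: "set (coeffs P) - {0} = {coeff P i |i. coeff P i \<noteq> 0}" using range_coeff[of P] by auto
  have val_coeff: "val (\<pi> powi k * coeff P i) = real_of_int k * val \<pi> + val (coeff P i)" if "coeff P i \<noteq> 0" for i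
    using that pi_facts poly_over_coeff[OF subfield_subring[OF L] P] L by (simp add: val_mult val_power_int subfield_powi)
  have lower: "val (coeff P i) \<ge> - real_of_int k * val \<pi>" if "coeff P i \<noteq> 0" for i
  proof -
    have "\<pi> powi k * coeff P i \<in> val_ring L val" using poly_over_coeff[OF R primitive_over[OF prim], of i] by simp
    then show ?thesis using val_coeff[OF that] that pi_facts by (simp add: in_val_ring)
  qed
  obtain i where i: "\<pi> powi k * coeff P i / \<pi> \<notin> val_ring L val" using prim by (auto simp: primitive_def)
  then have nz: "coeff P i \<noteq> 0" using subring_0[OF R] by auto
  have in_R: "\<pi> powi k * coeff P i \<in> val_ring L val" using poly_over_coeff[OF R primitive_over[OF prim], of i] by simp
  then have "inverse (\<pi> powi k * coeff P i) \<in> val_ring L val" using i divide_iff by blast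
  then have "val (\<pi> powi k * coeff P i) = 0"
    using in_R nz pi_facts val_inverse[of "\<pi> powi k * coeff P i"] by (auto simp: in_val_ring)
  then have "val (coeff P i) = - real_of_int k * val \<pi>" using val_coeff[OF nz] by simp
  moreover have "finite (val ` (set (coeffs P) - {0}))" by simp
  ultimately show ?thesis using lower nz unfolding coeffs by (intro Min_eqI) (auto intro!: image_eqI)
qed

text \<open>
  By Gauss's lemma the exponents add up in the two products of a cross-multiplied identity of
  fractions, so the value does not depend on the fraction.
\<close>

lemma gauss_val_eq:
  assumes t: "transcendental_over L t" and PQ: "poly_over L P" "poly_over L Q" "P \<noteq> 0" "Q \<noteq> 0"
    and prim: "dvr.primitive (val_ring L val) \<pi> (smult (\<pi> powi i) P)" "dvr.primitive (val_ring L val) \<pi> (smult (\<pi> powi j) Q)"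
  shows "gauss_val L val t (poly P t / poly Q t) = real_of_int (j - i) * val \<pi>"
  unfolding gauss_val_def
proof (rule the_equality)
  interpret dvr "val_ring L val" L \<pi> by (rule dvr_of_valuation)
  note sub = subfield_subring[OF L]
  show "\<exists>P' Q'. poly_over L P' \<and> poly_over L Q' \<and> P' \<noteq> 0 \<and> Q' \<noteq> 0 \<and> poly P t / poly Q t = poly P' t / poly Q' t \<and>
      real_of_int (j - i) * val \<pi> = Min (val ` (set (coeffs P') - {0})) - Min (val ` (set (coeffs Q') - {0}))"
    using PQ Min_val_coeffs[OF PQ(1) prim(1)] Min_val_coeffs[OF PQ(2) prim(2)]
    by (intro exI[of _ P] exI[of _ Q]) (simp add: algebra_simps)
  fix r assume "\<exists>P' Q'. poly_over L P' \<and> poly_over L Q' \<and> P' \<noteq> 0 \<and> Q' \<noteq> 0 \<and> poly P t / poly Q t = poly P' t / poly Q' t \<and>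
      r = Min (val ` (set (coeffs P') - {0})) - Min (val ` (set (coeffs Q') - {0}))"
  then obtain P' Q' where *: "poly_over L P'" "poly_over L Q'" "P' \<noteq> 0" "Q' \<noteq> 0" "poly P t / poly Q t = poly P' t / poly Q' t"
    "r = Min (val ` (set (coeffs P') - {0})) - Min (val ` (set (coeffs Q') - {0}))" by blast
  obtain i' j' :: int where ij: "primitive (smult (\<pi> powi i') P')" "primitive (smult (\<pi> powi j') Q')"
    using primitive_multiple * by meson
  have "poly (P * Q') t = poly (P' * Q) t"
    using *(5) transc_poly_neq_0[OF t PQ(2,4)] transc_poly_neq_0[OF t *(2,4)] by (simp add: frac_eq_eq)
  then have eq: "P * Q' = P' * Q" using PQ * sub by (intro transc_poly_eqI[OF sub t] poly_over_mult)
  have "primitive (smult (\<pi> powi (i + j')) (P * Q'))" "primitive (smult (\<pi> powi (i' + j)) (P' * Q))"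
    using primitive_mult[OF prim(1) ij(2)] primitive_mult[OF ij(1) prim(2)] pi_neq_0 by (simp_all add: power_int_add mult_ac)
  then have "- real_of_int (i + j') * val \<pi> = - real_of_int (i' + j) * val \<pi>"
    using Min_val_coeffs[of "P * Q'"] eq PQ * sub by (metis poly_over_mult)
  then have "real_of_int (i + j') * val \<pi> = real_of_int (i' + j) * val \<pi>"
    by (metis minus_mult_left neg_equal_iff_equal)
  moreover have "r = - real_of_int i' * val \<pi> - - real_of_int j' * val \<pi>"
    unfolding *(6) using Min_val_coeffs[OF *(1) ij(1)] Min_val_coeffs[OF *(2) ij(2)] by simp
  ultimately show "r = real_of_int (j - i) * val \<pi>" by (simp add: algebra_simps)
qed

text \<open>
  \<open>\<pi>\<^sup>-\<^sup>N g\<close> is a quotient of two primitive polynomials, because \<open>N\<close> is the difference of the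
  exponents of denominator and numerator.
\<close>

lemma gauss_val_unit:
  assumes t: "transcendental_over L t" and g: "g \<in> ratfun L t" "g \<noteq> 0"
    and N: "gauss_val L val t g = of_int N * gauss_val L val t \<pi>"
  shows "\<pi> powi (- N) * g \<in> dvr.gauss_ring (val_ring L val) \<pi> t"
    and "inverse (\<pi> powi (- N) * g) \<in> dvr.gauss_ring (val_ring L val) \<pi> t"
proof -
  interpret dvr "val_ring L val" L \<pi> by (rule dvr_of_valuation)
  note sub = subfield_subring[OF L]
  obtain P Q where PQ: "poly_over L P" "poly_over L Q" "Q \<noteq> 0" "g = poly P t / poly Q t" using g(1) by (auto simp: ratfun_def)
  have "P \<noteq> 0" using g(2) PQ(4) by auto
  obtain i j :: int where ij: "primitive (smult (\<pi> powi i) P)" "primitive (smult (\<pi> powi j) Q)"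
    using primitive_multiple PQ \<open>P \<noteq> 0\<close> by meson
  have "primitive (smult (\<pi> powi (- 1)) [:\<pi>:])" "primitive (smult (\<pi> powi 0) 1)"
    using pi_neq_0 primitive_1 by (simp_all add: power_int_minus one_pCons)
  then have "gauss_val L val t (poly [:\<pi>:] t / poly 1 t) = real_of_int (0 - - 1) * val \<pi>"
    using pi_facts(1) pi_neq_0 sub by (intro gauss_val_eq[OF t] poly_over_const poly_over_1) auto
  then have "real_of_int (j - i) * val \<pi> = of_int N * val \<pi>"
    using N gauss_val_eq[OF t PQ(1,2) \<open>P \<noteq> 0\<close> PQ(3) ij] by (simp add: PQ(4))
  then have "j - i = N" using pi_facts(3) by (metis mult_right_cancel of_int_eq_iff less_irrefl)
  then have "\<pi> powi (- N) = \<pi> powi i / \<pi> powi j" using pi_neq_0 power_int_diff[of \<pi> i j] by auto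
  then have eq: "\<pi> powi (- N) * g = poly (smult (\<pi> powi i) P) t / poly (smult (\<pi> powi j) Q) t" by (simp add: PQ(4))
  show "\<pi> powi (- N) * g \<in> gauss_ring t" unfolding eq by (rule gauss_ringI[OF primitive_over[OF ij(1)] ij(2)])
  have "inverse (\<pi> powi (- N) * g) = poly (smult (\<pi> powi j) Q) t / poly (smult (\<pi> powi i) P) t" unfolding eq by simp
  also have "\<dots> \<in> gauss_ring t" by (rule gauss_ringI[OF primitive_over[OF ij(2)] ij(1)])
  finally show "inverse (\<pi> powi (- N) * g) \<in> gauss_ring t" .
qed

lemma root_in_val_ring:
  assumes "a \<in> L" "a ^ n = u" "n > 0" "u \<in> L" "val u = 0" "u \<noteq> 0"
  shows "a \<in> val_ring L val"
  using val_power[of a n] assms by (auto simp: in_val_ring)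

end

text \<open>
  These two values decide which natural numbers are units at a place above \<open>p\<close>.
\<close>

lemma padic_val_of_nat:
  assumes "prime p"
  shows "\<not> p dvd k \<Longrightarrow> padic_val p (of_nat k) = 0" and "padic_val p (of_nat p) = 1"
proof -
  have q: "quotient_of (of_nat k) = (int k, 1)" for k using quotient_of_int[of "int k"] by (simp add: of_int_of_nat_eq)
  have pp: "prime (int p)" using assms by simp
  have one: "multiplicity (int p) 1 = 0" by (rule multiplicity_unit_right) simp
  show "\<not> p dvd k \<Longrightarrow> padic_val p (of_nat k) = 0"
    by (simp add: padic_val_def q one not_dvd_imp_multiplicity_0)
  have "multiplicity (int p) (int p) = 1" using pp by (intro multiplicity_self) (auto simp: prime_elem_not_unit)
  then show "padic_val p (of_nat p) = 1" by (simp add: padic_val_def q one)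
qed

section \<open>Charts\<close>

lemma field_gen_mono: "T \<subseteq> T' \<Longrightarrow> field_gen T \<subseteq> field_gen T'"
  unfolding field_gen_def by blast

lemma ratfun_eqI:
  assumes L: "is_subfield L" and t: "transcendental_over L t" "transcendental_over L s"
    and mem: "t \<in> ratfun L s" "s \<in> ratfun L t"
  shows "ratfun L t = ratfun L s"
proof -
  have "ratfun L t \<subseteq> ratfun L s" if "transcendental_over L t" "transcendental_over L s" "t \<in> ratfun L s" for t s
    unfolding field_gen_eq_ratfun[OF L that(1), symmetric]
    using is_subfield_ratfun[OF L that(2)] ratfun_base[OF L] that(3) by (intro field_gen_subset) auto
  then show ?thesis using t mem by blast
qed

definition is_coordinate :: "'a::field set \<Rightarrow> 'a \<Rightarrow> 'a \<Rightarrow> bool" where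
  "is_coordinate L x t \<longleftrightarrow> transcendental_over L t \<and> ratfun L t = ratfun L x"

lemma coordinate_neq_0: "is_subfield L \<Longrightarrow> is_coordinate L x t \<Longrightarrow> t \<noteq> 0"
  unfolding is_coordinate_def using transc_neq[OF subfield_subring] subring_0[OF subfield_subring] by metis

lemma coordinate_linear:
  assumes L: "is_subfield L" and t: "is_coordinate L x t" and ab: "a \<in> L" "a \<noteq> 0" "b \<in> L"
  shows "is_coordinate L x (a * t + b)"
proof -
  note sub = subfield_subring[OF L]
  have t': "transcendental_over L t" using t by (simp add: is_coordinate_def)
  have s: "transcendental_over L (a * t + b)" by (rule transc_linear[OF sub t' ab])
  have k: "is_subring (ratfun L r)" "r \<in> ratfun L r" "L \<subseteq> ratfun L r" if "transcendental_over L r" for r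
    using is_subfield_ratfun[OF L that] ratfun_gen[OF L] ratfun_base[OF L] by (auto simp: subfield_subring)
  have "a * t + b \<in> ratfun L t" using k[OF t'] ab by (intro subring_add subring_mult) auto
  moreover have "inverse a * ((a * t + b) - b) \<in> ratfun L (a * t + b)"
    using k[OF s] ab subfield_inverse[OF L] by (intro subring_diff subring_mult) auto
  then have "t \<in> ratfun L (a * t + b)" using ab(2) by (simp flip: mult.assoc)
  ultimately show ?thesis using ratfun_eqI[OF L s t'] s t by (simp add: is_coordinate_def)
qed

lemma coordinate_inverse:
  assumes L: "is_subfield L" and t: "is_coordinate L x t"
  shows "is_coordinate L x (inverse t)"
proof -
  have t': "transcendental_over L t" using t by (simp add: is_coordinate_def)
  have s: "transcendental_over L (inverse t)"
    by (rule transc_inverse[OF subfield_subring[OF L] t' coordinate_neq_0[OF L t]])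
  have "inverse t \<in> ratfun L t" "inverse (inverse t) \<in> ratfun L (inverse t)"
    using subfield_inverse is_subfield_ratfun[OF L] ratfun_gen[OF L] t' s by blast+
  then show ?thesis using ratfun_eqI[OF L s t'] s t by (simp add: is_coordinate_def)
qed

lemma coordinate_translate: "is_subfield L \<Longrightarrow> is_coordinate L x t \<Longrightarrow> b \<in> L \<Longrightarrow> is_coordinate L x (t - b)"
  using coordinate_linear[of L x t 1 "- b"] subring_1[OF subfield_subring] subring_uminus[OF subfield_subring] by auto

lemma is_chart_cong:
  assumes "is_chart \<O> L x M v t" "P1_model \<O> t' = P1_model \<O> t"
    "\<exists>a\<in>L. \<exists>b\<in>L. \<exists>c\<in>L. \<exists>d\<in>L. a * d - b * c \<noteq> 0 \<and> t' = (a * x + b) / (c * x + d)"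
  shows "is_chart \<O> L x M v t'"
  using assms unfolding is_chart_def by simp

text \<open>
  Iwasawa decomposition: an invertible matrix is the product of an integral one and an upper
  triangular one. A chart with matrix \<open>(a b; c d)\<close> has \<open>a/c\<close> or \<open>c/a\<close> integral, and subtracting
  this constant \<open>e\<close> from \<open>t\<close> or from \<open>1/t\<close> makes the numerator constant; the inverse of the result
  is affine linear in \<open>x\<close>. Translation by an integral constant and inversion do not change the
  model.
\<close>

lemma affine_chart_exists:
  assumes dvr: "dvr \<O> L \<pi>" and x: "transcendental_over L x" and t: "is_chart \<O> L x M v t"
  shows "is_coordinate L x t" and "v = dvr.gauss_ring \<O> \<pi> t"
    and "\<exists>a\<in>L. \<exists>b\<in>L. a \<noteq> 0 \<and> is_chart \<O> L x M v (a * x + b)"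
proof -
  interpret dvr \<O> L \<pi> by (rule dvr)
  note sub = subfield_subring[OF E]
  obtain a b c d where abcd: "a \<in> L" "b \<in> L" "c \<in> L" "d \<in> L" "a * d - b * c \<noteq> 0" "t = (a * x + b) / (c * x + d)"
    using t by (auto simp: is_chart_def)
  have cx: "is_coordinate L x x" using x by (simp add: is_coordinate_def)
  have affine_nz: "a' * x + b' \<noteq> 0" if "a' \<in> L" "b' \<in> L" "a' \<noteq> 0" for a' b'
    using coordinate_neq_0[OF E coordinate_linear[OF E cx that(1,3,2)]] .
  have main: "is_coordinate L x t \<and> (\<exists>a\<in>L. \<exists>b\<in>L. a \<noteq> 0 \<and> P1_model \<O> (a * x + b) = P1_model \<O> t)"
  proof (cases "c \<noteq> 0 \<and> a / c \<in> \<O>")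
    case True
    define e t' where "e = a / c" and "t' = c / (b - e * d) * x + d / (b - e * d)"
    have e: "e \<in> \<O>" "e \<in> L" using True R_E by (auto simp: e_def)
    have det: "b - e * d \<noteq> 0" using abcd(5) True by (auto simp: e_def field_simps)
    have co: "c / (b - e * d) \<in> L" "c / (b - e * d) \<noteq> 0" "d / (b - e * d) \<in> L"
      using abcd e det True E sub by (auto intro!: subfield_divide subring_diff subring_mult)
    have t': "is_coordinate L x t'" unfolding t'_def by (rule coordinate_linear[OF E cx co])
    have nz: "c * x + d \<noteq> 0" using affine_nz[of c d] abcd True by simp
    have "a = e * c" using True by (simp add: e_def)
    then have num: "a * x + b - e * (c * x + d) = b - e * d" by (simp add: algebra_simps)
    have "(a * x + b) / (c * x + d) - e = (a * x + b - e * (c * x + d)) / (c * x + d)"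
      using nz by (simp add: diff_divide_distrib)
    then have "t - e = (b - e * d) / (c * x + d)" unfolding num abcd(6) .
    moreover have "t' = (c * x + d) / (b - e * d)" by (simp add: t'_def add_divide_distrib)
    ultimately have eq: "t - e = inverse t'" by simp
    have "t = inverse t' - - e" using eq by (simp add: algebra_simps)
    then have t: "is_coordinate L x t"
      using coordinate_translate[OF E coordinate_inverse[OF E t'], of "- e"] e sub by (simp add: subring_uminus)
    have "t \<noteq> e" using transc_neq[OF sub] t e(2) unfolding is_coordinate_def by blast
    then have "P1_model \<O> (t - e) = P1_model \<O> t" using P1_model_translate[OF R e(1) coordinate_neq_0[OF E t]] by simp
    then have "P1_model \<O> t' = P1_model \<O> t" unfolding eq P1_model_inverse .
    then show ?thesis using t co unfolding t'_def by blast
  next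
    case False
    have a: "a \<noteq> 0 \<and> c / a \<in> \<O>"
    proof (cases "c = 0")
      case True
      then show ?thesis using abcd(5) subring_0[OF R] by auto
    next
      case c: False
      then have "a / c \<notin> \<O>" using False by simp
      moreover have "a / c \<in> L" using abcd E by (simp add: subfield_divide)
      ultimately have "inverse (a / c) \<in> \<O>" using valuation_cases by blast
      moreover have "a \<noteq> 0" using \<open>a / c \<notin> \<O>\<close> subring_0[OF R] by auto
      ultimately show ?thesis by simp
    qed
    define e t' where "e = c / a" and "t' = a / (d - e * b) * x + b / (d - e * b)"
    have e: "e \<in> \<O>" "e \<in> L" using a R_E by (auto simp: e_def)
    have det: "d - e * b \<noteq> 0" using abcd(5) a by (auto simp: e_def field_simps)
    have co: "a / (d - e * b) \<in> L" "a / (d - e * b) \<noteq> 0" "b / (d - e * b) \<in> L"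
      using abcd e det a E sub by (auto intro!: subfield_divide subring_diff subring_mult)
    have t': "is_coordinate L x t'" unfolding t'_def by (rule coordinate_linear[OF E cx co])
    have nz: "a * x + b \<noteq> 0" using affine_nz[of a b] abcd a by simp
    have "c = e * a" using a by (simp add: e_def)
    then have num: "c * x + d - e * (a * x + b) = d - e * b" by (simp add: algebra_simps)
    have "(c * x + d) / (a * x + b) - e = (c * x + d - e * (a * x + b)) / (a * x + b)"
      using nz by (simp add: diff_divide_distrib)
    moreover have "inverse t = (c * x + d) / (a * x + b)" by (simp add: abcd(6))
    ultimately have "inverse t - e = (d - e * b) / (a * x + b)" unfolding num by simp
    moreover have "t' = (a * x + b) / (d - e * b)" by (simp add: t'_def add_divide_distrib)
    ultimately have eq: "inverse t - e = inverse t'" by simp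
    have "inverse t = inverse t' - - e" using eq by (simp add: algebra_simps)
    then have it: "is_coordinate L x (inverse t)"
      using coordinate_translate[OF E coordinate_inverse[OF E t'], of "- e"] e sub by (simp add: subring_uminus)
    then have t: "is_coordinate L x t" using coordinate_inverse[OF E it] by simp
    have "inverse t \<noteq> e" using transc_neq[OF sub] it e(2) unfolding is_coordinate_def by blast
    then have "P1_model \<O> (inverse t - e) = P1_model \<O> (inverse t)"
      using P1_model_translate[OF R e(1) coordinate_neq_0[OF E it]] by simp
    then have "P1_model \<O> t' = P1_model \<O> t" unfolding eq P1_model_inverse .
    then show ?thesis using t co unfolding t'_def by blast
  qed
  then show co: "is_coordinate L x t" by blast
  show "v = gauss_ring t" using t co by (intro component_P1_model) (auto simp: is_chart_def is_coordinate_def)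
  obtain a b where ab: "a \<in> L" "b \<in> L" "a \<noteq> 0" "P1_model \<O> (a * x + b) = P1_model \<O> t" using main by blast
  have "is_chart \<O> L x M v (a * x + b)"
    using ab sub by (intro is_chart_cong[OF t ab(4)] bexI[of _ a] bexI[of _ b] bexI[of _ 0] bexI[of _ 1])
      (auto simp: subring_0 subring_1)
  then show "\<exists>a\<in>L. \<exists>b\<in>L. a \<noteq> 0 \<and> is_chart \<O> L x M v (a * x + b)" using ab by blast
qed

lemma chart_translate:
  assumes dvr: "dvr \<O> L \<pi>" and x: "transcendental_over L x" and t: "is_chart \<O> L x M v (a * x + b)"
    and ab: "a \<in> L" "b \<in> L" "a \<noteq> 0" and e: "e \<in> \<O>"
  shows "is_chart \<O> L x M v (a * x + b - e)"
proof -
  interpret dvr \<O> L \<pi> by (rule dvr)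
  note sub = subfield_subring[OF E]
  have co: "is_coordinate L x (a * x + b)" using x ab by (intro coordinate_linear[OF E]) (auto simp: is_coordinate_def)
  have eL: "e \<in> L" using e R_E by blast
  have "a * x + b \<noteq> e" using transc_neq[OF sub] co eL unfolding is_coordinate_def by blast
  then have "P1_model \<O> (a * x + b - e) = P1_model \<O> (a * x + b)"
    by (rule P1_model_translate[OF R e coordinate_neq_0[OF E co]])
  then show ?thesis
    using ab eL sub
    by (intro is_chart_cong[OF t] bexI[of _ a] bexI[of _ "b - e"] bexI[of _ 0] bexI[of _ 1])
      (auto simp: subring_0 subring_1 subring_diff)
qed

section \<open>Reduction of the integral closure\<close>

lemma lift_poly:
  assumes "poly_over (red ` S) G" "0 \<in> S" "red 0 = 0"
  shows "\<exists>G0. poly_over S G0 \<and> map_poly red G0 = G \<and> degree G0 \<le> degree G"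
proof -
  define sel where "sel c = (if c = 0 then 0 else (SOME b. b \<in> S \<and> red b = c))" for c
  have sel: "sel c \<in> S \<and> red (sel c) = c" if "c \<in> red ` S" for c
    using that assms(2,3) someI_ex[of "\<lambda>b. b \<in> S \<and> red b = c"] by (auto simp: sel_def)
  have G: "coeff G i \<in> red ` S" for i
  proof -
    have "0 \<in> red ` S" using assms(2,3) by force
    then show ?thesis using assms(1) by (simp add: poly_over_iff)
  qed
  have coeff: "coeff (map_poly sel G) i = sel (coeff G i)" for i by (simp add: coeff_map_poly sel_def)
  have "poly_over S (map_poly sel G)" using sel[OF G] assms(2) by (simp add: poly_over_iff coeff)
  moreover have "map_poly red (map_poly sel G) = G"
    using sel[OF G] assms(3) by (intro poly_eqI) (simp add: coeff_map_poly coeff)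
  moreover have "degree (map_poly sel G) \<le> degree G"
    by (intro degree_le) (simp add: coeff coeff_eq_0 sel_def)
  ultimately show ?thesis by blast
qed

text \<open>
  The reduction \<open>A/\<pi>A\<close> is an abstract ring, known only through the quotient map.
\<close>

locale reduction = kummer_dvr R E \<pi> y n \<zeta>
  for R E :: "'a::field set" and \<pi> y :: 'a and n :: nat and \<zeta> :: 'a +
  fixes red :: "'a \<Rightarrow> 'e::comm_ring_1"
  assumes red: "quotient_map A ((\<lambda>b. \<pi> * b) ` A) red"
begin

lemma red_hom: "ring_hom_on A red"
  using red by (simp add: quotient_map_def)

lemma red_surj: "\<exists>b\<in>A. red b = e"
  using red unfolding quotient_map_def by (metis UNIV_I imageE)

lemma red_0_iff: "b \<in> A \<Longrightarrow> red b = 0 \<longleftrightarrow> b / \<pi> \<in> A"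
proof -
  assume "b \<in> A"
  then have "red b = 0 \<longleftrightarrow> b \<in> (\<lambda>b. \<pi> * b) ` A" using red by (simp add: quotient_map_def)
  also have "\<dots> \<longleftrightarrow> b / \<pi> \<in> A" using pi_neq_0 by (auto simp: image_iff intro!: bexI[of _ "b / \<pi>"])
  finally show ?thesis .
qed

lemmas red_add = ring_hom_on_add[OF red_hom] and red_mult = ring_hom_on_mult[OF red_hom]
  and red_1 = ring_hom_on_1[OF red_hom] and red_0 = ring_hom_on_0[OF A_subring red_hom]
  and red_diff = ring_hom_on_diff[OF A_subring red_hom] and red_power = ring_hom_on_power[OF A_subring red_hom]
  and red_poly = poly_map_hom[OF A_subring red_hom]

lemma red_image_subring: "is_subring B \<Longrightarrow> B \<subseteq> A \<Longrightarrow> is_subring (red ` B)"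
  unfolding is_subring_def[of "red ` B"]
proof (intro conjI ballI)
  assume B: "is_subring B" "B \<subseteq> A"
  show "0 \<in> red ` B" "1 \<in> red ` B" using red_0 red_1 subring_0[OF B(1)] subring_1[OF B(1)] by (metis image_eqI)+
  fix a b assume "a \<in> red ` B" "b \<in> red ` B"
  then obtain a' b' where ab: "a' \<in> B" "b' \<in> B" "a = red a'" "b = red b'" by blast
  moreover from this have "a' \<in> A" "b' \<in> A" using B(2) by blast+
  ultimately have "a - b = red (a' - b')" "a * b = red (a' * b')" by (simp_all add: red_diff red_mult)
  then show "a - b \<in> red ` B" "a * b \<in> red ` B" using ab B(1) subring_diff subring_mult by blast+
qed

text \<open>
  An element of \<open>B\<close> with nonzero reduction is a unit of \<open>B\<close>; so the image is the residue field of
  a local ring.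
\<close>

lemma embedded_field_red:
  assumes B: "is_subring B" "B \<subseteq> A" and unit: "\<And>b. b \<in> B \<Longrightarrow> b / \<pi> \<notin> A \<Longrightarrow> inverse b \<in> B"
  shows "embedded_field (red ` B)"
  unfolding embedded_field_def
proof (intro conjI ballI impI red_image_subring B)
  fix a assume "a \<in> red ` B" "a \<noteq> 0"
  then obtain b where b: "b \<in> B" "a = red b" "red b \<noteq> 0" by blast
  have b0: "b \<noteq> 0" using b(3) red_0 by auto
  have "b / \<pi> \<notin> A" using b red_0_iff[of b] B by auto
  then have "inverse b \<in> B" by (rule unit[OF b(1)])
  moreover from this have "a * red (inverse b) = 1"
    using red_mult[of b "inverse b"] b B(2) b0 red_1 by auto
  ultimately show "\<exists>b\<in>red ` B. a * b = 1" by blast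
qed

text \<open>
  Everything is lifted: a polynomial relation between the reductions lifts to an element of \<open>R\<close>,
  or of \<open>R[y]\<close>, that is divisible by \<open>\<pi>\<close>. By Gauss's lemma, or by the uniqueness of coordinates
  with respect to the powers of \<open>y\<close>, all its coefficients are then divisible by \<open>\<pi>\<close>.
\<close>

lemma kummer_cover_red:
  assumes dvr: "dvr \<O> L \<pi>" and t: "transcendental_over L t" and R_eq: "R = dvr.gauss_ring \<O> \<pi> t" and E_eq: "E = ratfun L t"
  shows "kummer_cover (red ` \<O>) (red ` R) (red t) (red y) n"
proof -
  interpret O: dvr \<O> L \<pi> by (rule dvr)
  have O_R: "\<O> \<subseteq> R" using O.gauss_ring_base[OF t] R_eq by simp
  have t_R: "t \<in> R" using O.gauss_ring_gen[OF t] R_eq by simp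
  have L_E: "L \<subseteq> E" using ratfun_base[OF O.E] E_eq by blast
  have A_R: "a \<in> R" if "a \<in> A" "a \<in> E" for a using A_E that by blast
  have div_E: "a / \<pi> \<in> E" if "a \<in> E" for a using that pi_E E by (simp add: subfield_divide)
  have A_O: "a \<in> \<O>" if "a \<in> A" "a \<in> L" for a
  proof -
    have "poly [:a:] t \<in> O.gauss_ring t" using A_R that L_E R_eq by auto
    then have "poly_over \<O> [:a:]" using that(2) by (intro O.gauss_ring_poly_iff[OF t] poly_over_const subfield_subring O.E)
    then show ?thesis using poly_over_coeff[OF O.R, of "[:a:]" 0] by simp
  qed
  have R_A': "R \<subseteq> A" using R_A .
  have O_A: "\<O> \<subseteq> A" using O_R R_A by blast
  have F: "embedded_field (red ` \<O>)"
  proof (rule embedded_field_red[OF O.R O_A])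
    fix b assume "b \<in> \<O>" "b / \<pi> \<notin> A"
    then show "inverse b \<in> \<O>" using O.nonunit_divide O_A by blast
  qed
  have FX: "embedded_field (red ` R)"
  proof (rule embedded_field_red[OF R R_A])
    fix b assume "b \<in> R" "b / \<pi> \<notin> A"
    then show "inverse b \<in> R" using nonunit_divide R_A by blast
  qed
  have transc: "transcendental_over (red ` \<O>) (red t)"
    unfolding transcendental_over_def
  proof (intro allI impI, elim conjE)
    fix P assume P: "poly_over (red ` \<O>) P" "poly P (red t) = 0"
    obtain P0 where P0: "poly_over \<O> P0" "map_poly red P0 = P"
      using lift_poly[OF P(1) subring_0[OF O.R] red_0] by blast
    have val_A: "poly P0 t \<in> A" using poly_in_subring[OF A_subring poly_over_mono[OF P0(1) O_A]] t_R R_A by blast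
    have "red (poly P0 t) = 0"
      using red_poly[OF poly_over_mono[OF P0(1) O_A], of t] P0(2) P(2) t_R R_A by auto
    then have "poly P0 t / \<pi> \<in> A" using red_0_iff[OF val_A] by simp
    moreover have "poly P0 t \<in> E"
      using poly_in_subring[OF E_ring poly_over_mono[OF P0(1)], of t] O_R R_E t_R by blast
    ultimately have "poly P0 t / \<pi> \<in> O.gauss_ring t" using A_R div_E R_eq by blast
    then have "poly (smult (inverse \<pi>) P0) t \<in> O.gauss_ring t" by (simp add: divide_inverse mult.commute)
    moreover have "poly_over L (smult (inverse \<pi>) P0)"
      using poly_over_mono[OF P0(1) O.R_E] O.pi_E O.E by (intro poly_over_smult subfield_subring subfield_inverse)
    ultimately have over: "poly_over \<O> (smult (inverse \<pi>) P0)" by (intro O.gauss_ring_poly_iff[OF t])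
    have "coeff P0 i / \<pi> \<in> A" for i
      using poly_over_coeff[OF O.R over, of i] O_A by (auto simp: divide_inverse mult.commute)
    then have "red (coeff P0 i) = 0" for i using red_0_iff poly_over_coeff[OF O.R P0(1)] O_A by blast
    then show "P = 0" using P0(2) red_0 by (intro poly_eqI) (auto simp: coeff_map_poly)
  qed
  show ?thesis
  proof
    show "embedded_field (red ` \<O>)" "embedded_field (red ` R)" "red ` \<O> \<subseteq> red ` R" "red t \<in> red ` R"
      using F FX O_R t_R by auto
    show "transcendental_over (red ` \<O>) (red t)" by (rule transc)
    show "0 < n" by (rule n)
    show "\<exists>P Q. poly_over (red ` \<O>) P \<and> poly_over (red ` \<O>) Q \<and> Q \<noteq> 0 \<and> g * poly Q (red t) = poly P (red t)"
      if "g \<in> red ` R" for g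
    proof -
      obtain b where b: "b \<in> R" "g = red b" using \<open>g \<in> red ` R\<close> by blast
      then obtain P Q where PQ: "poly_over \<O> P" "O.primitive Q" "b = poly P t / poly Q t"
        unfolding R_eq O.gauss_ring_def by blast
      note Q = O.primitive_over[OF PQ(2)]
      have "b * poly Q t = poly P t" using O.primitive_poly_neq_0[OF t PQ(2)] PQ(3) by simp
      moreover have "poly Q t \<in> A" using poly_in_subring[OF A_subring poly_over_mono[OF Q O_A]] t_R R_A by blast
      ultimately have "red b * red (poly Q t) = red (poly P t)" using red_mult[of b "poly Q t"] b R_A by auto
      then have "g * poly (map_poly red Q) (red t) = poly (map_poly red P) (red t)"
        using red_poly[OF poly_over_mono[OF Q O_A], of t] red_poly[OF poly_over_mono[OF PQ(1) O_A], of t] t_R R_A b(2) by auto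
      moreover have over: "poly_over (red ` \<O>) (map_poly red G)" if "poly_over \<O> G" for G
        using poly_over_coeff[OF O.R that] red_0 subring_0[OF O.R]
        by (subst poly_over_iff) (auto simp: coeff_map_poly intro: rev_image_eqI)
      moreover have "map_poly red Q \<noteq> 0"
      proof
        assume "map_poly red Q = 0"
        then have "red (coeff Q i) = 0" for i using red_0 coeff_map_poly[of red Q i] by simp
        then have "coeff Q i / \<pi> \<in> A" for i using red_0_iff poly_over_coeff[OF O.R Q] O_A by blast
        moreover have "coeff Q i / \<pi> \<in> L" for i
          using poly_over_coeff[OF O.R Q] O.R_E O.pi_E O.E by (auto intro!: subfield_divide)
        ultimately have "coeff Q i / \<pi> \<in> \<O>" for i using A_O by blast
        then show False using PQ(2) by (simp add: O.primitive_def)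
      qed
      ultimately show ?thesis using PQ(1) Q by blast
    qed
    have yn: "red y ^ n = red (y ^ n)" using red_power[OF y_A] by simp
    then show "red y ^ n \<in> red ` R" using y_power(1) by blast
    show "red y ^ n \<noteq> 0"
    proof
      assume "red y ^ n = 0"
      then have "y ^ n / \<pi> \<in> A" using yn red_0_iff y_power(1) R_A by auto
      then have "y ^ n / \<pi> \<in> R" using A_R div_E y_power(1) R_E by blast
      then show False using unit_not_divide[of "y ^ n"] y_power by simp
    qed
    show "\<exists>G. poly_over (red ` R) G \<and> degree G < n \<and> e = poly G (red y)" for e
    proof -
      obtain b where b: "b \<in> A" "red b = e" using red_surj by blast
      obtain G where G: "poly_over R G" "degree G < n" "b = poly G y" using A_reduced_form[OF b(1)] by blast
      have "poly (map_poly red G) (red y) = e" using red_poly[OF poly_over_mono[OF G(1) R_A] y_A] G(3) b(2) by simp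
      moreover have "poly_over (red ` R) (map_poly red G)"
        using poly_over_coeff[OF R G(1)] red_0 subring_0[OF R]
        by (subst poly_over_iff) (auto simp: coeff_map_poly intro: rev_image_eqI)
      moreover have "degree (map_poly red G) \<le> degree G"
        using red_0 by (intro degree_le) (simp add: coeff_map_poly coeff_eq_0)
      ultimately show ?thesis using G(2) by (intro exI[of _ "map_poly red G"]) auto
    qed
    show "G = 0" if G: "poly_over (red ` R) G" "degree G < n" "poly G (red y) = 0" for G
    proof -
      obtain G0 where G0: "poly_over R G0" "map_poly red G0 = G" "degree G0 \<le> degree G"
        using lift_poly[OF G(1) subring_0[OF R] red_0] by blast
      have "red (poly G0 y) = 0" using red_poly[OF poly_over_mono[OF G0(1) R_A] y_A] G0(2) G(3) by simp
      moreover have "poly G0 y \<in> A" using poly_in_subring[OF A_subring poly_over_mono[OF G0(1) R_A] y_A] .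
      ultimately have "poly G0 y / \<pi> \<in> A" using red_0_iff by simp
      then have "poly (smult (inverse \<pi>) G0) y \<in> A" by (simp add: divide_inverse mult.commute)
      moreover have "poly_over E (smult (inverse \<pi>) G0)"
        using poly_over_mono[OF G0(1) R_E] pi_E E by (intro poly_over_smult subfield_subring subfield_inverse)
      moreover have "degree (smult (inverse \<pi>) G0) < n" using G0(3) G(2) by simp
      ultimately have over: "poly_over R (smult (inverse \<pi>) G0)" by (intro A_coefficients)
      have "coeff G0 i / \<pi> \<in> A" for i
        using poly_over_coeff[OF R over, of i] R_A by (auto simp: divide_inverse mult.commute)
      then have "red (coeff G0 i) = 0" for i using red_0_iff poly_over_coeff[OF R G0(1)] R_A by blast
      then show "G = 0" using G0(2) red_0 by (intro poly_eqI) (auto simp: coeff_map_poly)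
    qed
  qed
qed

text \<open>
  What is needed to act on \<open>A/\<pi>A\<close>: integral elements over \<open>R\<close> are mapped to such elements, and
  \<open>\<pi>A\<close> into itself.
\<close>

definition reducible_hom :: "('a \<Rightarrow> 'a) \<Rightarrow> bool" where
  "reducible_hom T \<longleftrightarrow> ring_hom_on UNIV T \<and> T ` R \<subseteq> R \<and> T \<pi> / \<pi> \<in> R"

lemma reducible_hom_A:
  assumes T: "reducible_hom T" and b: "b \<in> A"
  shows "T b \<in> A"
proof -
  have hom: "ring_hom_on UNIV T" using T by (simp add: reducible_hom_def)
  have "b \<in> integral_closure R" using b integral_closure_eq by simp
  then obtain P where P: "poly_over R P" "lead_coeff P = 1" "poly P b = 0" by (auto simp: integral_closure_def)
  have coeff: "coeff (map_poly T P) i = T (coeff P i)" for i by (rule coeff_map_hom[OF UNIV_subring hom])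
  have "poly_over R (map_poly T P)"
    using poly_over_coeff[OF R P(1)] T by (auto simp: poly_over_iff subring_0[OF R] coeff reducible_hom_def)
  moreover have "lead_coeff (map_poly T P) = 1"
  proof -
    have "coeff (map_poly T P) (degree P) = 1" using P(2) coeff ring_hom_on_1[OF hom] by simp
    moreover have "degree (map_poly T P) \<le> degree P"
      by (intro degree_le) (simp add: coeff coeff_eq_0 ring_hom_on_0[OF UNIV_subring hom])
    ultimately show ?thesis using le_degree[of "map_poly T P" "degree P"] by simp
  qed
  moreover have "poly (map_poly T P) (T b) = 0"
    using poly_map_hom[OF UNIV_subring hom, of P b] P(3) ring_hom_on_0[OF UNIV_subring hom] by (simp add: poly_over_def)
  ultimately have "T b \<in> integral_closure R" unfolding integral_closure_def by blast
  then show ?thesis using integral_closure_eq by simp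
qed

text \<open>
  The operator \<open>induced\<close> is a definite description; it denotes the induced map because the latter
  is well defined and the quotient map is surjective.
\<close>

lemma induced_red:
  assumes T: "reducible_hom T" and b: "b \<in> A"
  shows "induced A red T (red b) = red (T b)"
proof -
  have hom: "ring_hom_on UNIV T" using T by (simp add: reducible_hom_def)
  have wd: "red (T a) = red (T b)" if "a \<in> A" "b \<in> A" "red a = red b" for a b
  proof -
    have "a - b \<in> A" using that A_subring by (simp add: subring_diff)
    moreover have "red (a - b) = 0" using red_diff that by simp
    ultimately have "(a - b) / \<pi> \<in> A" using red_0_iff by simp
    then have "T ((a - b) / \<pi>) * (T \<pi> / \<pi>) \<in> A"
      using reducible_hom_A[OF T] T R_A A_subring by (intro subring_mult) (auto simp: reducible_hom_def)
    moreover have "T ((a - b) / \<pi>) * T \<pi> = T (a - b)"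
      using ring_hom_on_mult[OF hom, of "(a - b) / \<pi>" \<pi>] pi_neq_0 by simp
    ultimately have "T (a - b) / \<pi> \<in> A" by simp
    moreover have "T (a - b) = T a - T b" using ring_hom_on_diff[OF UNIV_subring hom] by simp
    moreover have "T a - T b \<in> A" using reducible_hom_A[OF T] that A_subring by (simp add: subring_diff)
    ultimately have "red (T a - T b) = 0" using red_0_iff by simp
    then show ?thesis using red_diff[of "T a" "T b"] reducible_hom_A[OF T] that by simp
  qed
  define g where "g e = red (T (SOME a. a \<in> A \<and> red a = e))" for e
  have g: "\<forall>b\<in>A. g (red b) = red (T b)"
  proof
    fix b assume b: "b \<in> A"
    then have "(SOME a. a \<in> A \<and> red a = red b) \<in> A \<and> red (SOME a. a \<in> A \<and> red a = red b) = red b"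
      by (intro someI[of "\<lambda>a. a \<in> A \<and> red a = red b"]) simp
    then show "g (red b) = red (T b)" unfolding g_def using wd b by blast
  qed
  have "induced A red T = g"
    unfolding induced_def
  proof (rule the_equality)
    show "\<forall>b\<in>A. g (red b) = red (T b)" by (rule g)
    fix h assume "\<forall>b\<in>A. h (red b) = red (T b)"
    then show "h = g" using g red_surj by (metis ext)
  qed
  then show ?thesis using g b by simp
qed

lemma induced_hom: "reducible_hom T \<Longrightarrow> ring_hom_on UNIV (induced A red T)"
  unfolding ring_hom_on_def[of UNIV]
proof (intro conjI ballI)
  assume T: "reducible_hom T"
  then have hom: "ring_hom_on UNIV T" by (simp add: reducible_hom_def)
  show "induced A red T 1 = 1"
    using induced_red[OF T subring_1[OF A_subring]] red_1 ring_hom_on_1[OF hom] by simp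
  fix e e'
  obtain a b where ab: "a \<in> A" "red a = e" "b \<in> A" "red b = e'" using red_surj by blast
  note A = subring_add[OF A_subring] subring_mult[OF A_subring] reducible_hom_A[OF T]
  show "induced A red T (e + e') = induced A red T e + induced A red T e'"
    using induced_red[OF T] ab A red_add ring_hom_on_add[OF hom] by (metis UNIV_I)
  show "induced A red T (e * e') = induced A red T e * induced A red T e'"
    using induced_red[OF T] ab A red_mult ring_hom_on_mult[OF hom] by (metis UNIV_I)
qed

lemma induced_comp:
  assumes T: "reducible_hom T" and T': "reducible_hom T'" and c: "reducible_hom (T \<circ> T')"
  shows "induced A red (T \<circ> T') = induced A red T \<circ> induced A red T'"
proof
  fix e
  obtain b where b: "b \<in> A" "red b = e" using red_surj by blast
  have "induced A red (T \<circ> T') (red b) = red (T (T' b))" using induced_red[OF c b(1)] by simp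
  also have "\<dots> = induced A red T (induced A red T' (red b))"
    using induced_red[OF T reducible_hom_A[OF T' b(1)]] induced_red[OF T' b(1)] by simp
  finally show "induced A red (T \<circ> T') e = (induced A red T \<circ> induced A red T') e" using b(2) by simp
qed

lemma induced_id:
  assumes "reducible_hom id"
  shows "induced A red id = id"
proof
  fix e
  obtain b where b: "b \<in> A" "red b = e" using red_surj by blast
  then show "induced A red id e = id e" using induced_red[OF assms b(1)] by simp
qed

end

section \<open>The inertia group and its action\<close>

lemma dvr_max_ideal: "dvr R E \<pi> \<Longrightarrow> max_ideal R = {a \<in> R. a / \<pi> \<in> R}"
  unfolding max_ideal_def using dvr.divide_iff by blast

locale inertia_action =
  fixes L K :: "'a::field set" and val :: "'a \<Rightarrow> real" and \<pi> x y :: 'a and n :: nat and f :: "'a poly" and v :: "'a set"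
  assumes L: "is_subfield L" and dvr_O: "dvr (val_ring L val) L \<pi>"
    and x: "transcendental_over L x" and kummer: "kummer_field (ratfun L x) y n"
    and f: "y ^ n = poly f x" "poly_over K f" and K: "0 \<in> K" "K \<subseteq> L"
    and gen_xy: "field_gen (L \<union> {x, y}) = UNIV"
begin

abbreviation "\<O> \<equiv> val_ring L val"
abbreviation "act \<equiv> coeff_act L x y"

definition "I = {\<tau> \<in> inertia L K val. act \<tau> ` v = v}"

sublocale O: dvr \<O> L \<pi> by (rule dvr_O)

lemmas L_ring = subfield_subring[OF L]

lemma Gal: "\<tau> \<in> Gal L K \<Longrightarrow> \<tau> \<in> Bij L" "\<tau> \<in> Gal L K \<Longrightarrow> ring_hom_on L \<tau>" "\<tau> \<in> Gal L K \<Longrightarrow> a \<in> K \<Longrightarrow> \<tau> a = a"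
  "\<tau> \<in> Gal L K \<Longrightarrow> bij_betw \<tau> L L" "\<tau> \<in> Gal L K \<Longrightarrow> a \<in> L \<Longrightarrow> \<tau> a \<in> L"
  by (auto simp: Gal_def Bij_def bij_betw_def)

lemma act:
  assumes "\<tau> \<in> Gal L K"
  shows "bij (act \<tau>)" "ring_hom_on UNIV (act \<tau>)" "a \<in> L \<Longrightarrow> act \<tau> a = \<tau> a" "act \<tau> x = x" "act \<tau> y = y"
proof -
  have "coeff f i \<in> K" for i using f(2) K(1) by (simp add: poly_over_iff)
  then have "\<tau> (coeff f i) = coeff f i" for i using Gal(3)[OF assms] by blast
  then show "bij (act \<tau>)" "ring_hom_on UNIV (act \<tau>)" "a \<in> L \<Longrightarrow> act \<tau> a = \<tau> a" "act \<tau> x = x" "act \<tau> y = y"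
    using coeff_act[OF L x kummer f(1) poly_over_mono[OF f(2) K(2)] Gal(2)[OF assms] Gal(4)[OF assms] _ gen_xy] by blast+
qed

lemma act_eqI:
  assumes "\<tau> \<in> Gal L K" "ring_hom_on UNIV T" "\<And>a. a \<in> L \<Longrightarrow> T a = \<tau> a" "T x = x" "T y = y"
  shows "act \<tau> = T"
  using act[OF assms(1)] assms by (intro ring_hom_on_eq_UNIV[OF _ assms(2) _ gen_xy]) auto

lemma inertia_Gal: "\<tau> \<in> inertia L K val \<Longrightarrow> \<tau> \<in> Gal L K"
  by (simp add: inertia_def)

lemma inertia_diff:
  assumes "\<tau> \<in> inertia L K val" "a \<in> \<O>"
  shows "(\<tau> a - a) / \<pi> \<in> \<O>" "\<tau> a \<in> \<O>"
proof -
  have *: "\<tau> a - a \<in> \<O>" "(\<tau> a - a) / \<pi> \<in> \<O>"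
    using assms dvr_max_ideal[OF dvr_O] by (auto simp: inertia_def)
  show "(\<tau> a - a) / \<pi> \<in> \<O>" by (rule *(2))
  show "\<tau> a \<in> \<O>" using subring_add[OF O.R *(1) assms(2)] by simp
qed

lemma inertia_pi: "\<tau> \<in> inertia L K val \<Longrightarrow> \<tau> \<pi> / \<pi> \<in> \<O>"
proof -
  assume "\<tau> \<in> inertia L K val"
  then have "(\<tau> \<pi> - \<pi>) / \<pi> + 1 \<in> \<O>"
    using inertia_diff(1)[of \<tau> \<pi>] O.pi(1) subring_1[OF O.R] by (intro subring_add[OF O.R]) auto
  then show ?thesis using O.pi_neq_0 by (simp add: diff_divide_distrib)
qed

lemma GalI:
  assumes "\<tau> \<in> Bij L" "\<And>a. a \<in> L \<Longrightarrow> \<tau> a = h a" "ring_hom_on L h" "\<And>a. a \<in> K \<Longrightarrow> h a = a"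
  shows "\<tau> \<in> Gal L K"
  using assms ring_hom_on_cong[OF _ L_ring assms(3), of \<tau>] K by (auto simp: Gal_def)

lemma one_I: "(\<lambda>a\<in>L. a) \<in> I" and act_one: "act (\<lambda>a\<in>L. a) = id"
proof -
  have gal: "(\<lambda>a\<in>L. a) \<in> Gal L K" by (rule GalI[of _ "\<lambda>a. a"]) (auto simp: id_Bij ring_hom_on_def)
  show act1: "act (\<lambda>a\<in>L. a) = id" by (rule act_eqI[OF gal]) (auto simp: ring_hom_on_def)
  have "0 \<in> max_ideal \<O>" using subring_0[OF O.R] by (simp add: max_ideal_def)
  then show "(\<lambda>a\<in>L. a) \<in> I" using gal act1 O.R_E by (auto simp: I_def inertia_def)
qed

lemma compose_I:
  assumes "\<tau> \<in> I" "\<tau>' \<in> I"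
  shows "compose L \<tau> \<tau>' \<in> I" "act (compose L \<tau> \<tau>') = act \<tau> \<circ> act \<tau>'"
proof -
  have in_i: "\<tau> \<in> inertia L K val" "\<tau>' \<in> inertia L K val" using assms by (auto simp: I_def)
  note g = inertia_Gal[OF in_i(1)] inertia_Gal[OF in_i(2)]
  have comp: "compose L \<tau> \<tau>' a = \<tau> (\<tau>' a)" if "a \<in> L" for a using that by (simp add: compose_def)
  have gal: "compose L \<tau> \<tau>' \<in> Gal L K"
  proof (rule GalI[of _ "\<tau> \<circ> \<tau>'"])
    show "compose L \<tau> \<tau>' \<in> Bij L" using Gal(1) g by (intro compose_Bij)
    show "ring_hom_on L (\<tau> \<circ> \<tau>')"
      using Gal(2)[OF g(1)] Gal(2,5)[OF g(2)] by (simp add: ring_hom_on_def)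
    show "(\<tau> \<circ> \<tau>') a = a" if "a \<in> K" for a
      using Gal(3)[OF g(1) that] Gal(3)[OF g(2) that] by simp
  qed (simp add: comp)
  show *: "act (compose L \<tau> \<tau>') = act \<tau> \<circ> act \<tau>'"
    using act[OF g(1)] act[OF g(2)] Gal(5)[OF g(2)]
    by (intro act_eqI[OF gal]) (auto simp: comp ring_hom_on_def)
  have "compose L \<tau> \<tau>' a - a \<in> max_ideal \<O>" if a: "a \<in> \<O>" for a
  proof -
    have "(\<tau> (\<tau>' a) - \<tau>' a) / \<pi> + (\<tau>' a - a) / \<pi> \<in> \<O>"
      using inertia_diff[OF in_i(2) a] inertia_diff(1)[OF in_i(1)] by (intro subring_add[OF O.R])
    then have "(compose L \<tau> \<tau>' a - a) / \<pi> \<in> \<O>" using comp O.R_E a by (auto simp flip: add_divide_distrib)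
    then show ?thesis using dvr_max_ideal[OF dvr_O] O.divide_imp by blast
  qed
  moreover have "act (compose L \<tau> \<tau>') ` v = v" using assms unfolding * image_comp[symmetric] by (simp add: I_def)
  ultimately show "compose L \<tau> \<tau>' \<in> I" using gal by (simp add: I_def inertia_def)
qed

text \<open>
  Why the inverse \<open>s\<close> preserves integrality: if \<open>s(a)\<close> were not integral, its inverse would be
  divisible by \<open>\<pi>\<close>; applying the element of inertia, which maps \<open>\<pi>\<close> to a multiple of \<open>\<pi>\<close>, the
  inverse of \<open>a\<close> would be divisible by \<open>\<pi>\<close>.
\<close>

lemma inverse_I:
  assumes "\<tau> \<in> I"
  shows "(\<lambda>a\<in>L. inv_into L \<tau> a) \<in> I"
proof -
  have in_i: "\<tau> \<in> inertia L K val" using assms by (auto simp: I_def)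
  note g = inertia_Gal[OF in_i]
  define s where "s = (\<lambda>a\<in>L. inv_into L \<tau> a)"
  have bij: "bij_betw \<tau> L L" using Gal(4)[OF g] .
  have s: "s a \<in> L" "\<tau> (s a) = a" "s (\<tau> a) = a" if "a \<in> L" for a
    using that bij by (auto simp: s_def bij_betw_def intro: inv_into_into f_inv_into_f)
  have hom: "ring_hom_on L s"
    unfolding ring_hom_on_def
  proof (intro conjI ballI)
    show "s 1 = 1" using s(3)[OF subring_1[OF L_ring]] ring_hom_on_1[OF Gal(2)[OF g]] by simp
    fix a b assume "a \<in> L" "b \<in> L"
    then show "s (a + b) = s a + s b" "s (a * b) = s a * s b"
      using s(3)[of "s a + s b"] s(3)[of "s a * s b"] s ring_hom_on_add[OF Gal(2)[OF g]] ring_hom_on_mult[OF Gal(2)[OF g]]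
        subring_add[OF L_ring] subring_mult[OF L_ring] by auto
  qed
  have gal: "s \<in> Gal L K"
  proof (rule GalI[of _ s])
    show "s \<in> Bij L" unfolding s_def using Gal(1)[OF g] by (rule restrict_inv_into_Bij)
    show "s a = a" if "a \<in> K" for a using s(3)[of a] Gal(3)[OF g that] that K by auto
  qed (use hom in auto)
  have comp: "act s \<circ> act \<tau> = id"
  proof -
    have "ring_hom_on UNIV (act s \<circ> act \<tau>)" using act(2)[OF gal] act(2)[OF g] by (simp add: ring_hom_on_def)
    moreover have "(\<lambda>a\<in>L. a) \<in> Gal L K" using one_I by (simp add: I_def inertia_def)
    ultimately have "act (\<lambda>a\<in>L. a) = act s \<circ> act \<tau>"
      using act[OF gal] act[OF g] s Gal(5)[OF g] by (intro act_eqI) auto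
    then show ?thesis using act_one by simp
  qed
  have s_O: "s a \<in> \<O>" if a: "a \<in> \<O>" for a
  proof (rule ccontr)
    assume not: "s a \<notin> \<O>"
    have aL: "a \<in> L" using a O.R_E by blast
    have nz: "s a \<noteq> 0" using not subring_0[OF O.R] by auto
    then have a0: "a \<noteq> 0" using s(2)[OF aL] ring_hom_on_inj[OF L Gal(2)[OF g] s(1)[OF aL]] by metis
    have "inverse (s a) \<in> \<O>" using O.valuation_cases[OF s(1)[OF aL]] not by blast
    then have d: "inverse (s a) / \<pi> \<in> \<O>" using O.nonunit_divide not by simp
    have "\<tau> (inverse (s a) / \<pi> * \<pi>) = \<tau> (inverse (s a) / \<pi>) * \<tau> \<pi>"
      using d O.R_E O.pi_E by (intro ring_hom_on_mult[OF Gal(2)[OF g]]) auto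
    moreover have "\<tau> (inverse (s a)) = inverse a" using ring_hom_on_inverse[OF L Gal(2)[OF g] s(1)[OF aL]] s(2)[OF aL] by simp
    ultimately have "inverse a / \<pi> = \<tau> (inverse (s a) / \<pi>) * (\<tau> \<pi> / \<pi>)" using O.pi_neq_0 by simp
    then have "inverse a / \<pi> \<in> \<O>" 
      using subring_mult[OF O.R inertia_diff(2)[OF in_i d] inertia_pi[OF in_i]] by metis
    then have "a * (inverse a / \<pi>) \<in> \<O>" using a by (intro subring_mult[OF O.R])
    then show False using a0 O.one_div_pi by simp
  qed
  have "s a - a \<in> max_ideal \<O>" if a: "a \<in> \<O>" for a
  proof -
    have "\<tau> (s a) = a" using s(2) a O.R_E by blast
    then have "(a - s a) / \<pi> \<in> \<O>" using inertia_diff(1)[OF in_i s_O[OF a]] by simp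
    then have "- ((a - s a) / \<pi>) \<in> \<O>" by (rule subring_uminus[OF O.R])
    moreover have "- ((a - s a) / \<pi>) = (s a - a) / \<pi>" by (simp add: diff_divide_distrib)
    ultimately show ?thesis using dvr_max_ideal[OF dvr_O] O.divide_imp by auto
  qed
  moreover have "act s ` v = v"
  proof -
    have "act s ` (act \<tau> ` v) = v" unfolding image_comp comp by simp
    then show ?thesis using assms by (simp add: I_def)
  qed
  ultimately show "s \<in> I" using gal by (simp add: I_def inertia_def)
qed

lemma subgroup_I: "subgroup I (BijGroup L)"
proof
  have Bij: "\<tau> \<in> Bij L" if "\<tau> \<in> I" for \<tau> using that Gal(1) inertia_Gal by (auto simp: I_def)
  then show "I \<subseteq> carrier (BijGroup L)" by (auto simp: BijGroup_def)
  show "\<one>\<^bsub>BijGroup L\<^esub> \<in> I" using one_I by (simp add: BijGroup_def)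
  show "\<tau> \<otimes>\<^bsub>BijGroup L\<^esub> \<tau>' \<in> I" if "\<tau> \<in> I" "\<tau>' \<in> I" for \<tau> \<tau>'
    using compose_I(1)[OF that] Bij that by (simp add: BijGroup_def)
  show "inv\<^bsub>BijGroup L\<^esub> \<tau> \<in> I" if "\<tau> \<in> I" for \<tau>
    using inverse_I[OF that] inv_BijGroup[OF Bij[OF that]] by simp
qed

definition "G = (BijGroup L)\<lparr>carrier := I\<rparr>"

lemma group_G: "group G"
  unfolding G_def by (rule subgroup.subgroup_is_group[OF subgroup_I group_BijGroup])

lemma carrier_G: "carrier G = I"
  by (simp add: G_def)

lemma one_G: "\<one>\<^bsub>G\<^esub> = (\<lambda>a\<in>L. a)"
  by (simp add: G_def BijGroup_def)

lemma mult_G: "\<tau> \<in> I \<Longrightarrow> \<tau>' \<in> I \<Longrightarrow> \<tau> \<otimes>\<^bsub>G\<^esub> \<tau>' = compose L \<tau> \<tau>'"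
  using subgroup.subset[OF subgroup_I] by (auto simp: G_def BijGroup_def subset_iff)

lemma act_mult: "\<tau> \<in> I \<Longrightarrow> \<tau>' \<in> I \<Longrightarrow> act (\<tau> \<otimes>\<^bsub>G\<^esub> \<tau>') = act \<tau> \<circ> act \<tau>'"
  by (simp add: mult_G compose_I(2))

text \<open>
  Both \<open>\<tau>\<close> and its inverse map \<open>\<pi>\<close> to a multiple of \<open>\<pi>\<close>.
\<close>

lemma I_pi_unit:
  assumes "\<tau> \<in> I"
  shows "\<tau> \<pi> / \<pi> \<in> \<O>" "inverse (\<tau> \<pi> / \<pi>) \<in> \<O>" "\<tau> \<pi> \<in> L" "\<tau> \<pi> \<noteq> 0"
proof -
  have in_i: "\<tau> \<in> inertia L K val" using assms by (auto simp: I_def)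
  note g = inertia_Gal[OF in_i]
  show "\<tau> \<pi> / \<pi> \<in> \<O>" by (rule inertia_pi[OF in_i])
  show L\<pi>: "\<tau> \<pi> \<in> L" using Gal(5)[OF g O.pi_E] .
  show nz: "\<tau> \<pi> \<noteq> 0" by (rule ring_hom_on_inj[OF L Gal(2)[OF g] O.pi_E O.pi_neq_0])
  define s where "s = (\<lambda>a\<in>L. inv_into L \<tau> a)"
  have sI: "s \<in> inertia L K val" using inverse_I[OF assms] by (simp add: I_def s_def)
  have "\<tau> (s \<pi>) = \<pi>" using Gal(4)[OF g] O.pi_E by (auto simp: s_def bij_betw_def intro: f_inv_into_f)
  moreover have d: "s \<pi> / \<pi> \<in> \<O>" by (rule inertia_pi[OF sI])
  have "\<tau> (s \<pi> / \<pi> * \<pi>) = \<tau> (s \<pi> / \<pi>) * \<tau> \<pi>"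
    using d O.R_E O.pi_E by (intro ring_hom_on_mult[OF Gal(2)[OF g]]) auto
  ultimately have "\<pi> = \<tau> (s \<pi> / \<pi>) * \<tau> \<pi>" using O.pi_neq_0 by simp
  then have "inverse (\<tau> \<pi> / \<pi>) = \<tau> (s \<pi> / \<pi>)" using nz O.pi_neq_0 by (simp add: field_simps)
  then show "inverse (\<tau> \<pi> / \<pi>) \<in> \<O>" using inertia_diff(2)[OF in_i d] by simp
qed

end

text \<open>
  Irreducibility of \<open>T\<^sup>n - f(x)\<close>: by the condition on the greatest common divisor, \<open>f(x)\<close> is not a
  \<open>q\<close>-th power for any divisor \<open>q > 1\<close> of \<open>n\<close>.
\<close>

lemma kummer_field_ratfun:
  fixes L :: "'a::field set"
  assumes L: "is_subfield L" and x: "transcendental_over L x" and n: "n > 0"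
    and f: "poly_over L f" "f \<noteq> 0" and y: "y ^ n = poly f x"
    and gcd: "Gcd (insert n ((\<lambda>\<alpha>. Polynomial.order \<alpha> f) ` {\<alpha>. poly f \<alpha> = 0})) = 1"
    and gen: "field_gen (L \<union> {x, y}) = UNIV"
    and \<zeta>: "\<zeta> \<in> L" "\<zeta> ^ n = 1" "\<And>k. 0 < k \<Longrightarrow> k < n \<Longrightarrow> \<zeta> ^ k \<noteq> 1"
  shows "kummer_field (ratfun L x) y n" "y \<noteq> 0"
proof -
  have k: "is_subfield (ratfun L x)" by (rule is_subfield_ratfun[OF L x])
  have sub: "L \<subseteq> ratfun L x" "x \<in> ratfun L x" using ratfun_base[OF L] ratfun_gen[OF L] by auto
  have yn: "y ^ n \<in> ratfun L x"
    unfolding y using poly_in_subring[OF subfield_subring[OF k] poly_over_mono[OF f(1) sub(1)] sub(2)] .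
  show y0: "y \<noteq> 0" using transc_poly_neq_0[OF x f] y n by (auto simp: power_0_left)
  show "kummer_field (ratfun L x) y n"
  proof
    show "is_subfield (ratfun L x)" "0 < n" "y ^ n \<in> ratfun L x" using k n yn by auto
    have "field_gen (L \<union> {x, y}) \<subseteq> field_gen (ratfun L x \<union> {y})" using sub by (intro field_gen_mono) auto
    then show "field_gen (ratfun L x \<union> {y}) = UNIV" using gen by auto
    fix G assume G: "poly_over (ratfun L x) G" "degree G < n" "poly G y = 0"
    have "g ^ q \<noteq> y ^ n" if "q dvd n" "q > 1" "g \<in> ratfun L x" for q g
      unfolding y by (rule not_power_in_ratfun[OF L x f gcd that])
    then show "G = 0" using kummer_irreducible[OF k n _ \<zeta>(2,3) yn y0 _ G] \<zeta>(1) sub(1) by blast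
  qed
qed

lemma kummer_field_scale:
  assumes "kummer_field E y n" and a: "a \<in> E" "a \<noteq> 0"
  shows "kummer_field E (a * y) n"
proof -
  interpret kummer_field E y n by fact
  show ?thesis
  proof
    show "is_subfield E" "0 < n" by (rule E, rule n)
    show "(a * y) ^ n \<in> E" using a yn E_ring by (simp add: power_mult_distrib subring_mult subring_power)
    have "y \<in> k" if "is_subfield k" "E \<union> {a * y} \<subseteq> k" for k
    proof -
      have "(a * y) / a \<in> k" using that a by (intro subfield_divide) auto
      then show ?thesis using a by simp
    qed
    then have "field_gen (E \<union> {y}) \<subseteq> field_gen (E \<union> {a * y})" by (auto simp: field_gen_def)
    then show "field_gen (E \<union> {a * y}) = UNIV" using gen by auto
    fix G assume G: "poly_over E G" "degree G < n" "poly G (a * y) = 0"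
    have "poly (pcompose G [:0, a:]) y = 0" using G(3) by (simp add: poly_pcompose mult.commute)
    moreover have "poly_over E (pcompose G [:0, a:])"
      using G a E_ring by (intro poly_over_pcompose poly_over_linear subring_0)
    moreover have "degree (pcompose G [:0, a:]) < n" using G(2) a by (simp add: degree_pcompose)
    ultimately have "pcompose G [:0, a:] = 0" by (intro indep)
    then show "G = 0" using a by (simp add: pcompose_eq_0_iff)
  qed
qed

section \<open>Quotients of the components of the stable reduction by inertia\<close>

theorem proposition5p6:
  fixes p n m \<mu> :: nat
    and Q K L :: "'a::field_char_0 set" and val :: "'a \<Rightarrow> real" and \<pi> x y :: 'a and f :: "'a poly"
    and \<O> v O\<^sub>Y :: "'a set" and \<X> :: "'a set set" and lam :: 'a and N :: int
    and I\<^sub>v P\<^sub>v :: "('a \<Rightarrow> 'a) set" and \<sigma> :: "'a \<Rightarrow> 'a"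
    and red :: "'a \<Rightarrow> 'e::comm_ring_1" and \<psi> :: "('a \<Rightarrow> 'a) \<Rightarrow> 'e \<Rightarrow> 'e"
    and FL FX Z W :: "'e set" and ybar :: 'e
    and act :: "('a \<Rightarrow> 'a) \<Rightarrow> 'a \<Rightarrow> 'a" and affine_chart :: "'a \<Rightarrow> bool"
    and diagonal :: "'a \<Rightarrow> 'e \<Rightarrow> 'e \<Rightarrow> bool" and Gv :: "('a \<Rightarrow> 'a) monoid"
    \<comment> \<open>the fields \<open>\<rat>\<^sub>p = Q \<subseteq> K \<subseteq> L\<close>\<close>
  assumes p: "prime p" and n: "n \<ge> 2" "coprime n p"
    and Q: "is_Qp p Q val"
    and K: "is_subfield K" "Q \<subseteq> K" "\<exists>d. has_dim Q K {0} d"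
    and L: "is_subfield L" "finite_galois L K" "is_valuation L val"
    and pi: "prime_element L val \<pi>"
    and O: "\<O> = val_ring L val"
    \<comment> \<open>the polynomial \<open>f\<close> and the function field \<open>UNIV = L(x,y)\<close> of \<open>Y\<^sub>L\<close>\<close>
    and f: "poly_over K f" "degree f > 0"
      "\<forall>g. poly_over K g \<and> g ^ n dvd f \<longrightarrow> degree g = 0"
      "{\<alpha>. poly f \<alpha> = 0} \<subseteq> L"
      "f = Polynomial.smult (lead_coeff f) (\<Prod>\<alpha> | poly f \<alpha> = 0. [:- \<alpha>, 1:] ^ Polynomial.order \<alpha> f)"
      "Gcd (insert n ((\<lambda>\<alpha>. Polynomial.order \<alpha> f) ` {\<alpha>. poly f \<alpha> = 0})) = 1"
    and xy: "transcendental_over L x" "y ^ n = poly f x" "field_gen (L \<union> {x, y}) = UNIV"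
    and genus: "genus K (field_gen (K \<union> {x, y})) \<ge> 2"
    and L_large: "\<exists>\<zeta>\<in>L. \<zeta> ^ n = 1 \<and> (\<forall>k. 0 < k \<and> k < n \<longrightarrow> \<zeta> ^ k \<noteq> 1)"
      "\<exists>r\<in>L. r ^ n = of_nat p"
      "n dvd ramification_index val L (field_gen (K \<union> {\<alpha>. poly f \<alpha> = 0}))"
    and act: "act = coeff_act L x y"
    \<comment> \<open>the stable marked model of \<open>X\<^sub>L\<close>, a component \<open>v\<close>, and a chart for it\<close>
    and X: "stable_marked_model \<O> L \<pi> (field_gen (L \<union> {x})) (branch_points L x n f) \<X>"
    and v: "v \<in> components L \<X>"
    and lam: "is_chart \<O> L x \<X> v lam"
    and N: "gauss_val L val lam (poly f x) = of_int N * gauss_val L val lam \<pi>" "int n dvd N"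
    \<comment> \<open>the function ring \<open>'e\<close> of \<open>Y\<^sub>v\<close>, containing the function field \<open>FX\<close> of \<open>X\<^sub>v\<close> and the residue field \<open>FL\<close>\<close>
    and OY: "O\<^sub>Y = integral_closure v"
    and red: "quotient_map O\<^sub>Y ((\<lambda>b. \<pi> * b) ` O\<^sub>Y) red"
    and FL: "FL = red ` \<O>" and FX: "FX = red ` v"
    and ybar: "ybar = red (\<pi> powi (- (N div int n)) * y)"
    and psi: "\<psi> = (\<lambda>\<tau>. induced O\<^sub>Y red (act \<tau>))"
    \<comment> \<open>the groups \<open>I\<^sub>v\<close> and \<open>P\<^sub>v\<close>, and \<open>\<sigma>\<close>\<close>
    and Iv: "I\<^sub>v = {\<tau> \<in> inertia L K val. act \<tau> ` v = v}"
    and Gv: "Gv = (BijGroup L)\<lparr>carrier := I\<^sub>v\<rparr>"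
    and Pv: "subgroup P\<^sub>v Gv" "card P\<^sub>v = p ^ multiplicity p (card I\<^sub>v)"
    and sigma: "\<sigma> \<in> I\<^sub>v" "coprime (group.ord Gv \<sigma>) p"
      "generate (Gv Mod P\<^sub>v) {P\<^sub>v #>\<^bsub>Gv\<^esub> \<sigma>} = carrier (Gv Mod P\<^sub>v)"
    and mu: "\<mu> = aut_order UNIV (\<psi> \<sigma>)"
    and m: "m = aut_order FX (\<psi> \<sigma>)"
    \<comment> \<open>the function rings of \<open>Z\<^sub>v = Y\<^sub>v/I\<^sub>v\<close> and \<open>W\<^sub>v = X\<^sub>v/I\<^sub>v\<close>\<close>
    and Z: "Z = {e. \<forall>\<tau>\<in>I\<^sub>v. \<psi> \<tau> e = e}"
    and W: "W = {e \<in> FX. \<forall>\<tau>\<in>I\<^sub>v. \<psi> \<tau> e = e}"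
    and affine_chart: "\<And>t. affine_chart t \<longleftrightarrow> is_chart \<O> L x \<X> v t \<and>
      (\<forall>\<tau>\<in>I\<^sub>v. \<exists>a\<in>FL. \<exists>b\<in>FL. \<psi> \<tau> (red t) = a * red t + b)"
    and diagonal: "\<And>t c \<gamma>. diagonal t c \<gamma> \<longleftrightarrow> c \<in> FL - {0} \<and> \<gamma> \<in> FL - {0} \<and>
      \<psi> \<sigma> (red t) = c * red t \<and> \<psi> \<sigma> ybar = \<gamma> * ybar"
  shows "(\<exists>t c \<gamma>. affine_chart t \<and> diagonal t c \<gamma>) \<and>
    (\<forall>t c \<gamma>. affine_chart t \<and> diagonal t c \<gamma> \<longrightarrow>
      (let u = (\<Prod>\<rho>\<in>\<psi> ` P\<^sub>v. \<rho> (red t)); w = u ^ m in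
        m = mult_order c \<and> \<mu> = lcm m (mult_order \<gamma>) \<and> m dvd \<mu> \<and> (\<mu> div m) dvd n \<and>
        (\<exists>s. \<forall>s'. unit_power c s' = \<gamma> ^ (\<mu> div m) \<longleftrightarrow> [s' = s] (mod int m)) \<and>
        transcendental_over FL w \<and> W = rational_functions FL w \<and>
        (\<forall>s. unit_power c s = \<gamma> ^ (\<mu> div m) \<longrightarrow>
          (\<exists>h\<in>rational_functions FL w.
            kummer_extension W Z (ybar ^ (\<mu> div m) * unit_power u (- s)) (n div (\<mu> div m)) h))))"
proof -
  note L_ring = subfield_subring[OF L(1)]
  have dvr_O: "dvr \<O> L \<pi>" unfolding O by (rule dvr_of_valuation[OF L(1,3) pi])
  interpret O: dvr \<O> L \<pi> by (rule dvr_O)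
  have KL: "K \<subseteq> L" using L(2) by (simp add: finite_galois_def)
  have K0: "0 \<in> K" using subring_0[OF subfield_subring[OF K(1)]] .
  have f0: "f \<noteq> 0" using f(2) by auto
  have f_L: "poly_over L f" by (rule poly_over_mono[OF f(1) KL])
  have n0: "n > 0" using n(1) by simp
  obtain \<zeta> where \<zeta>: "\<zeta> \<in> L" "\<zeta> ^ n = 1" "\<And>k. 0 < k \<Longrightarrow> k < n \<Longrightarrow> \<zeta> ^ k \<noteq> 1"
    using L_large(1) by blast
  have kf: "kummer_field (ratfun L x) y n" and y0: "y \<noteq> 0"
    using kummer_field_ratfun[OF L(1) xy(1) n0 f_L f0 xy(2) f(6) xy(3) \<zeta>] by blast+
  interpret I: inertia_action L K val \<pi> x y n f v
    by (rule inertia_action.intro[OF L(1) dvr_O[unfolded O] xy(1) kf xy(2) f(1) K0 KL xy(3)])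
  have Iv': "I\<^sub>v = I.I" unfolding Iv I.I_def act ..
  have Gv': "Gv = I.G" unfolding Gv I.G_def Iv' ..

  \<comment> \<open>on the rational numbers \<open>val\<close> is the \<open>p\<close>-adic valuation; hence \<open>n\<close> is a unit of \<open>\<O>\<close>, and the
    residue field has characteristic \<open>p\<close>\<close>
  have val_nat: "val (of_nat k) = of_int (padic_val p (of_nat k))" if "k > 0" for k
  proof -
    have "of_nat k \<noteq> (0 :: rat)" using that by simp
    then have "val (of_rat (of_nat k)) = of_int (padic_val p (of_nat k))" using Q unfolding is_Qp_def by blast
    then show ?thesis by simp
  qed
  have "\<not> p dvd n" using n(2) p by (metis coprime_absorb_right not_prime_unit)
  then have val_n: "val (of_nat n) = 0" using val_nat[OF n0] padic_val_of_nat(1)[OF p] by simp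
  have val_p: "val (of_nat p) = 1" using val_nat[of p] padic_val_of_nat(2)[OF p] p by (simp add: prime_gt_0_nat)
  have nat_L: "of_nat k \<in> L" for k by (rule subring_of_nat[OF L_ring])
  have n_unit: "of_nat n \<noteq> (0 :: 'a)" "inverse (of_nat n) \<in> \<O>"
    using val_inverse[OF L(1,3) pi nat_L, of n] val_n n0 nat_L subfield_inverse[OF L(1)]
    by (auto simp: O in_val_ring[OF L(1,3) pi])
  have p_pi: "of_nat p / \<pi> \<in> \<O>"
  proof (rule O.nonunit_divide)
    show "of_nat p \<in> \<O>" using nat_L val_p by (simp add: O in_val_ring[OF L(1,3) pi])
    have "of_nat p \<noteq> (0 :: 'a)" using p by (simp add: prime_gt_0_nat)
    then show "of_nat p = (0 :: 'a) \<or> inverse (of_nat p) \<notin> \<O>"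
      using val_inverse[OF L(1,3) pi nat_L, of p] val_p by (simp add: O in_val_ring[OF L(1,3) pi])
  qed
  have \<zeta>_O: "\<zeta> \<in> \<O>"
    unfolding O using val_1[OF L(1,3) pi] subring_1[OF L_ring]
    by (intro root_in_val_ring[OF L(1,3) pi \<zeta>(1,2) n0]) auto

  \<comment> \<open>the local ring \<open>v\<close> is a Gauss ring over \<open>\<O>\<close>; the power of \<open>\<pi>\<close> in \<open>Y\<close> turns \<open>Y\<^sup>n\<close> into a unit
    of it\<close>
  define E where "E = ratfun L x"
  have lam_facts: "transcendental_over L lam" "ratfun L lam = E" "v = O.gauss_ring lam"
    using affine_chart_exists(1,2)[OF dvr_O xy(1) lam] by (auto simp: is_coordinate_def E_def)
  have dvr_v: "dvr v E \<pi>" using O.dvr_gauss[OF lam_facts(1)] lam_facts(2,3) by simp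
  interpret v: dvr v E \<pi> by (rule dvr_v)
  have O_v: "\<O> \<subseteq> v" using O.gauss_ring_base[OF lam_facts(1)] lam_facts(3) by simp
  define M where "M = N div int n"
  define Y where "Y = \<pi> powi (- M) * y"
  have pi_M: "\<pi> powi i \<in> E" "\<pi> powi i \<noteq> 0" for i :: int
    using subfield_powi[OF v.E v.pi_E] O.pi_neq_0 by auto
  have kf_Y: "kummer_field E Y n"
    unfolding Y_def using kf pi_M by (intro kummer_field_scale) (auto simp: E_def)
  have N_eq: "N = M * int n" using N(2) by (simp add: M_def)
  have "\<pi> powi (- N) = (\<pi> powi (- M)) ^ n"
    using power_int_mult[of \<pi> "- M" "int n"] by (simp add: N_eq)
  then have Y_n: "Y ^ n = \<pi> powi (- N) * poly f x" by (simp add: Y_def power_mult_distrib xy(2))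
  have fx: "poly f x \<in> E" "poly f x \<noteq> 0"
    using poly_in_subring[OF subfield_subring[OF v.E] poly_over_mono[OF f_L], of x] ratfun_base[OF L(1)] ratfun_gen[OF L(1)]
      transc_poly_neq_0[OF xy(1) f_L f0] by (auto simp: E_def)
  have Y_unit: "Y ^ n \<in> v" "inverse (Y ^ n) \<in> v"
    using gauss_val_unit[OF L(1,3) pi lam_facts(1) _ fx(2) N(1)] fx(1) lam_facts(2,3) unfolding Y_n O by auto
  have kd: "kummer_dvr v E \<pi> Y n \<zeta>"
  proof (intro kummer_dvr.intro dvr_v kf_Y kummer_dvr_axioms.intro)
    show "\<zeta> \<in> v" "inverse (of_nat n) \<in> v" using \<zeta>_O n_unit O_v by auto
    show "Y \<noteq> 0" using y0 pi_M by (simp add: Y_def)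
  qed (use \<zeta> n_unit Y_unit in auto)
  have OY': "O\<^sub>Y = kummer_dvr.A v Y" unfolding OY by (rule kummer_dvr.integral_closure_eq[OF kd])
  interpret V: reduction v E \<pi> Y n \<zeta> red
    using red unfolding OY' by (intro reduction.intro kd reduction_axioms.intro)
  have ybar': "ybar = red Y" by (simp add: ybar Y_def M_def)
  have O_A: "\<O> \<subseteq> V.A" using O_v V.R_A by blast

  have I_inertia: "\<tau> \<in> inertia L K val" "\<tau> \<in> Gal L K" if "\<tau> \<in> I\<^sub>v" for \<tau>
    using that I.inertia_Gal by (auto simp: Iv)
  note acts = I.act[folded act]
  have rh: "V.reducible_hom (act \<tau>)" if \<tau>: "\<tau> \<in> I\<^sub>v" for \<tau>
  proof -
    have "act \<tau> \<pi> / \<pi> \<in> v"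
      using acts(3)[OF I_inertia(2)[OF \<tau>] O.pi_E] I.inertia_pi[OF I_inertia(1)[OF \<tau>]] O_v unfolding O by auto
    then show ?thesis using acts(2)[OF I_inertia(2)[OF \<tau>]] \<tau> by (simp add: V.reducible_hom_def Iv)
  qed
  have psi_red: "\<psi> \<tau> (red b) = red (act \<tau> b)" if "\<tau> \<in> I\<^sub>v" "b \<in> V.A" for \<tau> b
    unfolding psi OY' by (rule V.induced_red[OF rh[OF that(1)] that(2)])
  have psi_hom: "ring_hom_on UNIV (\<psi> \<tau>)" if "\<tau> \<in> I\<^sub>v" for \<tau>
    unfolding psi OY' by (rule V.induced_hom[OF rh[OF that]])
  \<comment> \<open>the defining property of inertia: \<open>\<tau>(b) - b\<close> is divisible by \<open>\<pi>\<close> for integral \<open>b\<close>\<close>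
  have psi_FL: "\<psi> \<tau> a = a" if \<tau>: "\<tau> \<in> I\<^sub>v" and a: "a \<in> FL" for \<tau> a
  proof -
    obtain b where b: "b \<in> \<O>" "a = red b" using a unfolding FL by blast
    have bA: "b \<in> V.A" "\<tau> b \<in> V.A" "(\<tau> b - b) / \<pi> \<in> V.A"
      using b O_A I.inertia_diff[OF I_inertia(1)[OF \<tau>], of b] unfolding O by auto
    have "red (\<tau> b - b) = 0" using V.red_0_iff[of "\<tau> b - b"] bA subring_diff[OF V.A_subring] by blast
    then have "red (\<tau> b) = red b" using V.red_diff bA by simp
    moreover have "act \<tau> b = \<tau> b" using acts(3)[OF I_inertia(2)[OF \<tau>]] b O.R_E by blast
    ultimately show ?thesis using psi_red[OF \<tau> bA(1)] b(2) by simp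
  qed
  have FL_field: "embedded_field FL"
    unfolding FL using O_A O.nonunit_divide by (intro V.embedded_field_red O.R) auto
  note FL_ring = embedded_field_subring[OF FL_field]
  interpret G: group Gv unfolding Gv' by (rule I.group_G)
  have carrier_G: "carrier Gv = I\<^sub>v" by (simp add: Gv)
  have psi_mult: "\<psi> (\<tau> \<otimes>\<^bsub>Gv\<^esub> \<tau>') = \<psi> \<tau> \<circ> \<psi> \<tau>'" if "\<tau> \<in> I\<^sub>v" "\<tau>' \<in> I\<^sub>v" for \<tau> \<tau>'
  proof -
    have "\<tau> \<otimes>\<^bsub>Gv\<^esub> \<tau>' \<in> I\<^sub>v" using G.m_closed that carrier_G by simp
    moreover have comp: "act (\<tau> \<otimes>\<^bsub>Gv\<^esub> \<tau>') = act \<tau> \<circ> act \<tau>'" using that unfolding Iv' Gv' act by (rule I.act_mult)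
    ultimately have "V.reducible_hom (act \<tau> \<circ> act \<tau>')" using rh by metis
    then show ?thesis using V.induced_comp[OF rh[OF that(1)] rh[OF that(2)]] by (simp only: psi OY' comp)
  qed
  have psi_one: "\<psi> \<one>\<^bsub>Gv\<^esub> = id"
  proof -
    have "act \<one>\<^bsub>Gv\<^esub> = id" unfolding Gv' I.one_G act by (rule I.act_one)
    moreover from this have "V.reducible_hom id" using rh[of "\<one>\<^bsub>Gv\<^esub>"] G.one_closed carrier_G by simp
    ultimately show ?thesis using V.induced_id by (simp add: psi OY')
  qed
  have psi_pow: "\<psi> (\<tau> [^]\<^bsub>Gv\<^esub> k) = \<psi> \<tau> ^^ k" if \<tau>: "\<tau> \<in> I\<^sub>v" for \<tau> and k :: nat
  proof (induction k)
    case 0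
    then show ?case by (simp add: psi_one)
  next
    case (Suc k)
    have "\<tau> [^]\<^bsub>Gv\<^esub> k \<in> I\<^sub>v" using G.nat_pow_closed \<tau> carrier_G by blast
    then show ?case using psi_mult[OF _ \<tau>, of "\<tau> [^]\<^bsub>Gv\<^esub> k"] Suc by (simp add: funpow_Suc_right del: funpow.simps)
  qed
  have psi_inj: "e = 0" if \<tau>: "\<tau> \<in> I\<^sub>v" and e: "\<psi> \<tau> e = 0" for \<tau> e
  proof -
    have i: "inv\<^bsub>Gv\<^esub> \<tau> \<in> I\<^sub>v" using G.inv_closed \<tau> carrier_G by blast
    have "\<psi> (inv\<^bsub>Gv\<^esub> \<tau>) \<circ> \<psi> \<tau> = id" using psi_mult[OF i \<tau>] G.l_inv[of \<tau>] \<tau> carrier_G psi_one by simp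
    then have "e = \<psi> (inv\<^bsub>Gv\<^esub> \<tau>) 0" using e by (metis comp_apply id_apply)
    then show ?thesis using ring_hom_on_0[OF UNIV_subring psi_hom[OF i]] by simp
  qed
  \<comment> \<open>\<open>\<tau>\<close> fixes \<open>y\<close>, so it multiplies \<open>Y = \<pi>\<^sup>-\<^sup>M y\<close> by a power of the unit \<open>\<tau>(\<pi>)/\<pi>\<close>\<close>
  have psi_y: "\<exists>\<delta>\<in>FL - {0}. \<psi> \<tau> ybar = \<delta> * ybar" if \<tau>: "\<tau> \<in> I\<^sub>v" for \<tau>
  proof -
    note g = I_inertia(2)[OF \<tau>]
    define d where "d = \<tau> \<pi> / \<pi>"
    have "\<tau> \<in> I.I" using \<tau> Iv' by simp
    note u = I.I_pi_unit[OF this, folded O]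
    have d: "d powi (- M) \<in> \<O>" "inverse (d powi (- M)) \<in> \<O>"
      using u(1,2) unfolding d_def
      by (auto simp: power_int_def subring_power[OF O.R] simp flip: power_inverse)
    have "act \<tau> (\<pi> powi (- M)) = \<tau> \<pi> powi (- M)"
    proof -
      have U: "is_subfield (UNIV :: 'a set)" by (simp add: is_subfield_def is_subring_def)
      have "act \<tau> (\<pi> ^ k) = \<tau> \<pi> ^ k" "act \<tau> (inverse \<pi> ^ k) = inverse (\<tau> \<pi>) ^ k" for k
        using ring_hom_on_power[OF UNIV_subring acts(2)[OF g]] ring_hom_on_inverse[OF U acts(2)[OF g], of \<pi>] acts(3)[OF g O.pi_E] by auto
      then show ?thesis by (simp add: power_int_def)
    qed
    moreover have "\<tau> \<pi> powi (- M) = d powi (- M) * \<pi> powi (- M)"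
      using O.pi_neq_0 by (simp add: d_def flip: power_int_mult_distrib)
    ultimately have "act \<tau> Y = d powi (- M) * Y"
      using ring_hom_on_mult[OF acts(2)[OF g], of "\<pi> powi (- M)" y] acts(5)[OF g] by (simp add: Y_def)
    then have "\<psi> \<tau> ybar = red (d powi (- M)) * ybar"
      using psi_red[OF \<tau> V.y_A] V.red_mult[OF _ V.y_A, of "d powi (- M)"] d O_A by (auto simp: ybar')
    moreover have "red (d powi (- M)) * red (inverse (d powi (- M))) = 1"
      using V.red_mult[of "d powi (- M)" "inverse (d powi (- M))"] d O_A V.red_1 u(4) O.pi_neq_0
      by (auto simp: d_def power_int_not_zero)
    then have "red (d powi (- M)) \<noteq> 0" by auto
    moreover have "red (d powi (- M)) \<in> FL" using d unfolding FL by blast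
    ultimately show ?thesis by blast
  qed

  define r where "r = G.ord \<sigma>"
  have \<sigma>_G: "\<sigma> \<in> carrier Gv" using sigma(1) carrier_G by simp
  have r: "r > 0" "\<sigma> [^]\<^bsub>Gv\<^esub> r = \<one>\<^bsub>Gv\<^esub>" "coprime r p"
  proof -
    show "\<sigma> [^]\<^bsub>Gv\<^esub> r = \<one>\<^bsub>Gv\<^esub>" unfolding r_def by (rule G.pow_ord_eq_1[OF \<sigma>_G])
    show "coprime r p" using sigma(2) by (simp add: r_def)
    \<comment> \<open>the order of an element of infinite order is \<open>0\<close>, which is not coprime to \<open>p\<close>\<close>
    then show "r > 0" using p by (metis coprime_0_left_iff neq0_conv not_prime_unit)
  qed
  have PI: "\<rho> \<in> I\<^sub>v" if "\<rho> \<in> P\<^sub>v" for \<rho> using subgroup.subset[OF Pv(1)] that carrier_G by blast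
  note normal = cyclic_coset_structure(1)[OF G.is_group Pv(1) \<sigma>_G r(2,1) sigma(3)]
  note decomposition = cyclic_coset_structure(2)[OF G.is_group Pv(1) \<sigma>_G r(2,1) sigma(3)]
  define q where "q = multiplicity p (card I\<^sub>v)"
  have "card P\<^sub>v > 0" using Pv(2) p by (simp add: prime_gt_0_nat)
  then have fin_P: "finite P\<^sub>v" using card_ge_0_finite by blast
  have P_pow: "\<psi> \<rho> ^^ (p ^ q) = id" if \<rho>: "\<rho> \<in> P\<^sub>v" for \<rho>
  proof -
    interpret H: group "Gv\<lparr>carrier := P\<^sub>v\<rparr>" by (rule subgroup.subgroup_is_group[OF Pv(1) G.is_group])
    have "\<rho> [^]\<^bsub>Gv\<lparr>carrier := P\<^sub>v\<rparr>\<^esub> card P\<^sub>v = \<one>\<^bsub>Gv\<^esub>"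
      using H.pow_order_eq_1[of \<rho>] \<rho> by (simp add: order_def)
    then have "\<rho> [^]\<^bsub>Gv\<^esub> (p ^ q) = \<one>\<^bsub>Gv\<^esub>" using G.nat_pow_consistent[of \<rho> _ P\<^sub>v] Pv(2) by (simp add: q_def)
    then show ?thesis using psi_pow[OF PI[OF \<rho>], of "p ^ q"] psi_one by simp
  qed
  have S_pow: "\<psi> \<sigma> ^^ r = id" using psi_pow[OF sigma(1), of r] r(2) psi_one by simp
  have p_e: "of_nat p = (0 :: 'e)"
  proof -
    have "of_nat p \<in> V.A" by (rule subring_of_nat[OF V.A_subring])
    then have "red (of_nat p) = 0" using V.red_0_iff p_pi O_A by blast
    then show ?thesis using ring_hom_on_of_nat[OF V.A_subring V.red_hom, of p] by simp
  qed
  \<comment> \<open>since \<open>I\<^sub>v\<close> is the product of \<open>P\<^sub>v\<close> and the powers of \<open>\<sigma>\<close>, only these have to be considered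
    for invariance\<close>
  have fixed_iff: "(\<forall>\<tau>\<in>I\<^sub>v. \<psi> \<tau> e = e) \<longleftrightarrow> (\<forall>\<rho>\<in>\<psi> ` P\<^sub>v. \<rho> e = e) \<and> \<psi> \<sigma> e = e" for e
  proof
    assume "\<forall>\<tau>\<in>I\<^sub>v. \<psi> \<tau> e = e"
    then show "(\<forall>\<rho>\<in>\<psi> ` P\<^sub>v. \<rho> e = e) \<and> \<psi> \<sigma> e = e" using PI sigma(1) by blast
  next
    assume *: "(\<forall>\<rho>\<in>\<psi> ` P\<^sub>v. \<rho> e = e) \<and> \<psi> \<sigma> e = e"
    show "\<forall>\<tau>\<in>I\<^sub>v. \<psi> \<tau> e = e"
    proof
      fix \<tau> assume "\<tau> \<in> I\<^sub>v"
      then obtain \<rho> and k :: nat where \<tau>: "\<rho> \<in> P\<^sub>v" "\<tau> = \<rho> \<otimes>\<^bsub>Gv\<^esub> \<sigma> [^]\<^bsub>Gv\<^esub> k"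
        using decomposition[of \<tau>] carrier_G by blast
      have "\<sigma> [^]\<^bsub>Gv\<^esub> k \<in> I\<^sub>v" using G.nat_pow_closed[OF \<sigma>_G] carrier_G by blast
      then have "\<psi> \<tau> e = \<psi> \<rho> ((\<psi> \<sigma> ^^ k) e)"
        unfolding \<tau>(2) using psi_mult[OF PI[OF \<tau>(1)]] psi_pow[OF sigma(1)] by simp
      also have "(\<psi> \<sigma> ^^ k) e = e" using * by (induction k) auto
      finally show "\<psi> \<tau> e = e" using * \<tau>(1) by simp
    qed
  qed

  have chart: "transcendental_over L t" "v = O.gauss_ring t" "ratfun L t = E" "t \<in> v" if "is_chart \<O> L x \<X> v t" for t
  proof -
    show *: "transcendental_over L t" "v = O.gauss_ring t" "ratfun L t = E"
      using affine_chart_exists(1,2)[OF dvr_O xy(1) that] by (auto simp: is_coordinate_def E_def)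
    show "t \<in> v" using O.gauss_ring_gen[OF *(1)] *(2) by simp
  qed
  have cover: "kummer_cover FL FX (red t) ybar n" if "is_chart \<O> L x \<X> v t" for t
    unfolding FL FX ybar' using chart(1,2)[OF that] chart(3)[OF that, symmetric] by (rule V.kummer_cover_red[OF dvr_O])

  have "\<exists>t c \<gamma>. affine_chart t \<and> diagonal t c \<gamma>"
  proof -
    obtain a b where ab: "a \<in> L" "b \<in> L" "a \<noteq> 0" and chart0: "is_chart \<O> L x \<X> v (a * x + b)"
      using affine_chart_exists(3)[OF dvr_O xy(1) lam] by blast
    define t0 where "t0 = a * x + b"
    note t0 = chart[OF chart0, folded t0_def]
    have t0_A: "t0 \<in> V.A" using t0(4) V.R_A by blast
    \<comment> \<open>\<open>\<tau>\<close> fixes \<open>x\<close> and hence maps \<open>t0\<close> to an affine linear expression \<open>e t0 + d\<close> over \<open>L\<close>; the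
      coefficients are integral because \<open>\<tau>\<close> maps \<open>v\<close> to itself\<close>
    have affine0: "\<exists>a'\<in>FL. \<exists>b'\<in>FL. \<psi> \<tau> (red t0) = a' * red t0 + b'" if \<tau>: "\<tau> \<in> I\<^sub>v" for \<tau>
    proof -
      note g = I_inertia(2)[OF \<tau>]
      define e d where "e = \<tau> a / a" and "d = \<tau> b - e * b"
      have ed: "e \<in> L" "d \<in> L"
        using I.Gal(5)[OF g] ab L(1) L_ring by (auto simp: e_def d_def intro!: subfield_divide subring_diff subring_mult)
      have "act \<tau> t0 = \<tau> a * x + \<tau> b"
        using ring_hom_on_add[OF acts(2)[OF g]] ring_hom_on_mult[OF acts(2)[OF g]] acts(3,4)[OF g] ab by (simp add: t0_def)
      also have "\<dots> = e * t0 + d" using ab(3) by (simp add: e_def d_def t0_def field_simps)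
      finally have act_t0: "act \<tau> t0 = e * t0 + d" .
      have "act \<tau> t0 \<in> v" using \<tau> t0(4) by (auto simp: Iv)
      then have "poly [:d, e:] t0 \<in> O.gauss_ring t0" using act_t0 t0(2) by (simp add: algebra_simps)
      then have over: "poly_over \<O> [:d, e:]"
        using ed by (intro O.gauss_ring_poly_iff[OF t0(1)] poly_over_linear[OF L_ring])
      have ed_O: "e \<in> \<O>" "d \<in> \<O>"
        using poly_over_coeff[OF O.R over, of 0] poly_over_coeff[OF O.R over, of 1] by auto
      then have ed_A: "e \<in> V.A" "d \<in> V.A" using O_A by blast+
      have "\<psi> \<tau> (red t0) = red (e * t0 + d)" using psi_red[OF \<tau> t0_A] act_t0 by simp
      also have "\<dots> = red e * red t0 + red d"
        using V.red_add[OF subring_mult[OF V.A_subring ed_A(1) t0_A] ed_A(2)] V.red_mult[OF ed_A(1) t0_A] by simp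
      finally have "\<psi> \<tau> (red t0) = red e * red t0 + red d" .
      then show ?thesis using ed_O unfolding FL by blast
    qed
    obtain a' b' where ab': "a' \<in> FL" "b' \<in> FL" "\<psi> \<sigma> (red t0) = a' * red t0 + b'" using affine0[OF sigma(1)] by blast
    \<comment> \<open>a fixed point of \<open>\<sigma>\<close> on the affine line over the residue field: if the multiplier is \<open>1\<close>,
      then \<open>\<sigma>\<close> acts by a translation, whose order divides both \<open>p\<close> and \<open>r\<close>; otherwise
      \<open>b'/(1 - a')\<close> is fixed\<close>
    have "\<exists>e\<in>\<O>. a' * red e + b' = red e"
    proof (cases "a' = 1")
      case True
      have "(\<psi> \<sigma> ^^ j) (red t0) = red t0 + of_nat j * b'" for j
      proof (induction j)
        case (Suc j)
        have nat: "of_nat j * b' \<in> FL" using ab'(2) FL_ring by (simp add: subring_mult subring_of_nat)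
        show ?case using Suc ring_hom_on_add[OF psi_hom[OF sigma(1)], of "red t0" "of_nat j * b'"] psi_FL[OF sigma(1) nat] ab'(3) True
          by (simp add: algebra_simps)
      qed simp
      then have rb: "of_nat r * b' = 0" using S_pow by (metis add_cancel_right_right id_apply)
      obtain i j :: int where "i * int r + j * int p = 1" using bezout_int[of "int r" "int p"] r(3) by auto
      then have "(1 :: 'e) = of_int i * of_nat r + of_int j * of_nat p" by (metis of_int_1 of_int_add of_int_mult of_int_of_nat_eq)
      then have "b' = of_int i * (of_nat r * b') + of_int j * (of_nat p * b')" by (metis distrib_right mult.assoc mult_1)
      then have "b' = 0" by (simp add: rb p_e)
      then show ?thesis using True subring_0[OF O.R] V.red_0 by (intro bexI[of _ 0]) auto
    next
      case False
      have "1 - a' \<in> FL" "1 - a' \<noteq> 0" using False ab' FL_ring by (auto intro: subring_diff subring_1)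
      then obtain i where i: "i \<in> FL" "(1 - a') * i = 1" using FL_field by (auto simp: embedded_field_def)
      have "b' * i \<in> FL" using ab' i FL_ring by (simp add: subring_mult)
      then obtain e where e: "e \<in> \<O>" "red e = b' * i" unfolding FL by force
      have "b' = (1 - a') * red e" using i(2) by (simp add: e(2)) (metis mult.commute mult.left_commute mult_1_right)
      then have "a' * red e + b' = red e" by (simp add: algebra_simps)
      then show ?thesis using e(1) by blast
    qed
    then obtain e where e: "e \<in> \<O>" "a' * red e + b' = red e" by blast
    define t where "t = t0 - e"
    have chart_t: "is_chart \<O> L x \<X> v t"
      unfolding t_def t0_def by (rule chart_translate[OF dvr_O xy(1) chart0 ab e(1)])
    have e_FL: "red e \<in> FL" using e(1) unfolding FL by blast
    have red_t: "red t = red t0 - red e" unfolding t_def using t0_A e(1) O_A by (intro V.red_diff) auto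
    have psi_t: "\<psi> \<tau> (red t) = \<psi> \<tau> (red t0) - red e" if \<tau>: "\<tau> \<in> I\<^sub>v" for \<tau>
      unfolding red_t using ring_hom_on_diff[OF UNIV_subring psi_hom[OF \<tau>]] psi_FL[OF \<tau> e_FL] by simp
    have "\<psi> \<sigma> (red t) = a' * red t0 + b' - red e" by (simp only: psi_t[OF sigma(1)] ab'(3))
    also have "\<dots> = a' * red t" unfolding red_t using e(2) by (simp add: algebra_simps)
    finally have diag: "\<psi> \<sigma> (red t) = a' * red t" .
    have "affine_chart t"
      unfolding affine_chart
    proof (intro conjI chart_t ballI)
      fix \<tau> assume \<tau>: "\<tau> \<in> I\<^sub>v"
      obtain a1 b1 where 1: "a1 \<in> FL" "b1 \<in> FL" "\<psi> \<tau> (red t0) = a1 * red t0 + b1" using affine0[OF \<tau>] by blast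
      have "\<psi> \<tau> (red t) = a1 * red t0 + b1 - red e" by (simp only: psi_t[OF \<tau>] 1(3))
      also have "\<dots> = a1 * red t + (a1 * red e + b1 - red e)" unfolding red_t by (simp add: algebra_simps)
      finally have "\<psi> \<tau> (red t) = a1 * red t + (a1 * red e + b1 - red e)" .
      moreover have "a1 * red e + b1 - red e \<in> FL" using 1 e_FL FL_ring by (auto intro!: subring_closed)
      ultimately show "\<exists>a\<in>FL. \<exists>b\<in>FL. \<psi> \<tau> (red t) = a * red t + b" using 1(1) by blast
    qed
    moreover have "a' \<noteq> 0"
    proof
      assume "a' = 0"
      then have "red t = 0" using psi_inj[OF sigma(1), of "red t"] diag by simp
      moreover have "red t \<noteq> 0"
      proof -
        interpret kummer_cover FL FX "red t" ybar n by (rule cover[OF chart_t])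
        have "poly_over FL [:0, 1:]" using FL_ring by (intro poly_over_linear subring_0 subring_1)
        then show ?thesis using poly_unit[of "[:0, 1:]"] by auto
      qed
      ultimately show False by simp
    qed
    moreover obtain \<gamma> where "\<gamma> \<in> FL - {0}" "\<psi> \<sigma> ybar = \<gamma> * ybar" using psi_y[OF sigma(1)] by blast
    ultimately show ?thesis using ab'(1) diag unfolding diagonal by blast
  qed
  moreover have "let u = (\<Prod>\<rho>\<in>\<psi> ` P\<^sub>v. \<rho> (red t)); w = u ^ m in
        m = mult_order c \<and> \<mu> = lcm m (mult_order \<gamma>) \<and> m dvd \<mu> \<and> (\<mu> div m) dvd n \<and>
        (\<exists>s. \<forall>s'. unit_power c s' = \<gamma> ^ (\<mu> div m) \<longleftrightarrow> [s' = s] (mod int m)) \<and>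
        transcendental_over FL w \<and> W = rational_functions FL w \<and>
        (\<forall>s. unit_power c s = \<gamma> ^ (\<mu> div m) \<longrightarrow>
          (\<exists>h\<in>rational_functions FL w.
            kummer_extension W Z (ybar ^ (\<mu> div m) * unit_power u (- s)) (n div (\<mu> div m)) h))"
    if ac: "affine_chart t" and dg: "diagonal t c \<gamma>" for t c \<gamma>
  proof -
    have ct: "is_chart \<O> L x \<X> v t" and aff: "\<And>\<tau>. \<tau> \<in> I\<^sub>v \<Longrightarrow> \<exists>a\<in>FL. \<exists>b\<in>FL. \<psi> \<tau> (red t) = a * red t + b"
      using ac unfolding affine_chart by blast+
    have d: "c \<in> FL" "c \<noteq> 0" "\<gamma> \<in> FL" "\<gamma> \<noteq> 0" "\<psi> \<sigma> (red t) = c * red t" "\<psi> \<sigma> ybar = \<gamma> * ybar"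
      using dg unfolding diagonal by auto
    note kc = cover[OF ct]
    have coeff_hom: "kummer_cover.coefficient_hom FL (\<psi> \<tau>)" if "\<tau> \<in> I\<^sub>v" for \<tau>
      unfolding kummer_cover.coefficient_hom_def[OF kc] using psi_hom[OF that] psi_FL[OF that] by blast
    \<comment> \<open>any diagonal chart, not only the one constructed above, satisfies the hypotheses of the
      abstract quotient theorem\<close>
    interpret T: tame_wild_action FL FX "red t" ybar n "\<psi> ` P\<^sub>v" "\<psi> \<sigma>" c \<gamma> p q r
    proof (intro tame_wild_action.intro kc tame_wild_action_axioms.intro)
      show "prime p" "of_nat p = (0 :: 'e)" by (rule p, rule p_e)
      show "finite (\<psi> ` P\<^sub>v)" using fin_P by simp
      show "id \<in> \<psi> ` P\<^sub>v" using psi_one subgroup.one_closed[OF Pv(1)] by (metis image_eqI)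
      show "\<rho> \<circ> \<rho>' \<in> \<psi> ` P\<^sub>v" if "\<rho> \<in> \<psi> ` P\<^sub>v" "\<rho>' \<in> \<psi> ` P\<^sub>v" for \<rho> \<rho>'
      proof -
        obtain r1 r2 where "r1 \<in> P\<^sub>v" "r2 \<in> P\<^sub>v" "\<rho> = \<psi> r1" "\<rho>' = \<psi> r2"
          using \<open>\<rho> \<in> \<psi> ` P\<^sub>v\<close> \<open>\<rho>' \<in> \<psi> ` P\<^sub>v\<close> by blast
        then show ?thesis using psi_mult[OF PI PI] subgroup.m_closed[OF Pv(1)] by (metis image_eqI)
      qed
      show "kummer_cover.coefficient_hom FL \<rho>" if "\<rho> \<in> \<psi> ` P\<^sub>v" for \<rho> using that coeff_hom PI by blast
      show "\<rho> ^^ p ^ q = id" if "\<rho> \<in> \<psi> ` P\<^sub>v" for \<rho> using that P_pow by blast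
      show "\<exists>a\<in>FL. \<exists>b\<in>FL. \<rho> (red t) = a * red t + b" if "\<rho> \<in> \<psi> ` P\<^sub>v" for \<rho> using that aff PI by blast
      show "\<exists>\<delta>\<in>FL. \<rho> ybar = \<delta> * ybar" if "\<rho> \<in> \<psi> ` P\<^sub>v" for \<rho> using that psi_y PI by blast
      show "kummer_cover.coefficient_hom FL (\<psi> \<sigma>)" by (rule coeff_hom[OF sigma(1)])
      show "\<psi> \<sigma> ^^ r = id" "0 < r" by (rule S_pow, rule r(1))
      show "\<exists>\<rho>'\<in>\<psi> ` P\<^sub>v. \<psi> \<sigma> \<circ> \<rho> = \<rho>' \<circ> \<psi> \<sigma>" if "\<rho> \<in> \<psi> ` P\<^sub>v" for \<rho>
      proof -
        obtain r1 where r1: "r1 \<in> P\<^sub>v" "\<rho> = \<psi> r1" using \<open>\<rho> \<in> \<psi> ` P\<^sub>v\<close> by blast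
        obtain r2 where "r2 \<in> P\<^sub>v" "\<sigma> \<otimes>\<^bsub>Gv\<^esub> r1 = r2 \<otimes>\<^bsub>Gv\<^esub> \<sigma>" using normal[OF r1(1)] by blast
        then show ?thesis
          using psi_mult[OF sigma(1) PI[OF r1(1)]] psi_mult[OF PI sigma(1)] r1(2) by (metis image_eqI)
      qed
    qed (use d in auto)
    have m_eq: "m = T.m" unfolding m by (rule T.order_FX)
    have \<mu>_eq: "\<mu> = T.\<mu>" unfolding mu by (rule T.order_UNIV)
    have d_eq: "\<mu> div m = T.d" by (simp add: m_eq \<mu>_eq T.d_def)
    have u_eq: "(\<Prod>\<rho>\<in>\<psi> ` P\<^sub>v. \<rho> (red t)) = T.u" by (simp add: T.u_def)
    have w_eq: "T.u ^ m = T.w" by (simp add: T.w_def m_eq)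
    have W_eq: "W = T.W" unfolding W T.W_def fixed_iff ..
    have Z_eq: "Z = T.Z" unfolding Z T.Z_def fixed_iff ..
    show ?thesis
      unfolding Let_def u_eq w_eq d_eq
    proof (intro conjI allI impI)
      show "m = mult_order c" "\<mu> = lcm m (mult_order \<gamma>)" "m dvd \<mu>" by (simp_all add: m_eq \<mu>_eq T.m_def T.\<mu>_def)
      show "T.d dvd n" by (rule T.d_dvd_n)
      show "\<exists>s. \<forall>s'. unit_power c s' = \<gamma> ^ T.d \<longleftrightarrow> [s' = s] (mod int m)" unfolding m_eq by (rule T.exists_s)
      show "transcendental_over FL T.w" by (rule T.transc_w)
      show "W = rational_functions FL T.w" unfolding W_eq by (rule T.W_eq)
      fix s assume "unit_power c s = \<gamma> ^ T.d"
      note k = T.kummer_quotient[OF this]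
      then have "(ybar ^ T.d * unit_power T.u (- s)) ^ (n div T.d) \<in> rational_functions FL T.w"
        unfolding T.W_eq[symmetric] by (simp add: kummer_extension_def)
      then show "\<exists>h\<in>rational_functions FL T.w.
          kummer_extension W Z (ybar ^ T.d * unit_power T.u (- s)) (n div T.d) h"
        using k unfolding W_eq Z_eq by blast
    qed
  qed
  ultimately show ?thesis by blast
qed

end
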